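(* Let $(\mathfrak{F}_{T,F})_{T\in\mathcal{T}_h,\,F\in\mathcal{F}_T}$ be a family of linear numerical fluxes $\mathfrak{F}_{T,F}:X_h\to\mathbb{R}$ satisfying the following coercivity property for some $\gamma>0$: for all $v_h\in X_h$, $$\sum_{T\in\mathcal{T}_h}\sum_{F\in\mathcal{F}_T}\mathfrak{F}_{T,F}(v_h)(v_T-v_F)\ge\gamma\|v_h\|_{1,\mathcal{T}_h}^2.$$ If the solution $u\in H^1_0(\Omega)$ of $(\boldsymbol{K}\nabla u,\nabla v)=(f,v)$ for all $v\in H^1_0(\Omega)$ belongs to $C(\overline\Omega)\cap H^2(\mathcal{T}_h)$, then, denoting by $u_h\in X_h$ the solution of the Finite Volume scheme $$\mathfrak{F}_{T,F}(u_h)+\mathfrak{F}_{T',F}(u_h)=0\quad\forall F\in\mathcal{F}_h^{\rm i}\text{ with }\mathcal{T}_F=\{T,T'\},\qquad\sum_{F\in\mathcal{F}_T}\mathfrak{F}_{T,F}(u_h)=\int_Tf\quad\forall T\in\mathcal{T}_h,$$ it holds $$\|u_h-I_hu\|_{1,\mathcal{T}_h}\le\gamma^{-1}\Big(\sum_{T\in\mathcal{T}_h}\underline{\lambda}_T^{-1}\sum_{F\in\mathcal{F}_T}\frac{d_{TF}}{|F|}\Big[\int_F\boldsymbol{K}_T\nabla u_{|T}\cdot\boldsymbol{n}_{TF}+\mathfrak{F}_{T,F}(I_hu)\Big]^2\Big)^{1/2}.$$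
   Context: $\Omega\subset\mathbb{R}^d$ ($d\ge1$) is an open bounded connected polytopal domain, $f\in L^2(\Omega)$, $(\cdot,\cdot)$ is the $L^2(\Omega)$ (scalar or vector) inner product. $\boldsymbol{K}:\Omega\to\mathbb{R}^{d\times d}$ is symmetric, uniformly elliptic, and piecewise constant on a finite partition of $\Omega$ into polytopes. $\mathcal{M}_h=(\mathcal{T}_h,\mathcal{F}_h)$ is a polytopal mesh of $\Omega$: $\mathcal{T}_h$ is the set of elements (cells), $\mathcal{F}_h=\mathcal{F}_h^{\rm i}\cup\mathcal{F}_h^{\rm b}$ the set of hyperplanar internal and boundary faces, $\mathcal{F}_T$ the set of faces lying on $\partial T$, $\mathcal{T}_F$ the set of the one or two cells sharing $F$, $\boldsymbol{n}_{TF}$ the unit normal to $F$ pointing out of $T$. Each cell lies in one polytope of the partition, and $\boldsymbol{K}_T=\boldsymbol{K}_{|T}$ is constant, with smallest eigenvalue $\underline{\lambda}_T$. $H^2(\mathcal{T}_h)=\{v\in L^2(\Omega):v_{|T}\in H^2(T)\ \forall T\}$. (The mesh is also taken in a regular family, but no hidden constant appears in the estimate.) One point $\boldsymbol{x}_T$ is chosen in each cell $T$ and one point $\boldsymbol{x}_F$ on each face $F$. $|F|$ is the $(d-1)$-dimensional measure of $F$ and, for $T\in\mathcal{T}_F$, $d_{TF}>0$ is the orthogonal distance between $\boldsymbol{x}_T$ and $F$. The space of unknowns is $$X_h=\{v_h=((v_T)_{T\in\mathcal{T}_h},(v_F)_{F\in\mathcal{F}_h}):v_T\in\mathbb{R},\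 v_F\in\mathbb{R}\ \forall F\in\mathcal{F}_h^{\rm i},\ v_F=0\ \forall F\in\mathcal{F}_h^{\rm b}\},$$ with norm $$\|v_h\|_{1,\mathcal{T}_h}=\Big(\sum_{T}\underline{\lambda}_T|v_h|_{1,T}^2\Big)^{1/2},\qquad|v_h|_{1,T}^2=\sum_{F\in\mathcal{F}_T}|F|d_{TF}\Big(\frac{v_T-v_F}{d_{TF}}\Big)^2.$$ For $u\in C(\overline\Omega)$ with $u_{|\partial\Omega}=0$, $I_hu=\big((u(\boldsymbol{x}_T))_{T\in\mathcal{T}_h},(u(\boldsymbol{x}_F))_{F\in\mathcal{F}_h}\big)\in X_h$. *)

theory Defs
  imports "HOL-Analysis.Analysis"
begin

section \<open>Sobolev spaces\<close>

definition partial_deriv :: "'n \<Rightarrow> (real^'n \<Rightarrow> real) \<Rightarrow> real^'n \<Rightarrow> real" where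
  "partial_deriv i f x = frechet_derivative f (at x) (axis i 1)"

definition smooth :: "(real^'n \<Rightarrow> real) \<Rightarrow> bool" where
  "smooth f \<longleftrightarrow> (\<forall>is. foldr partial_deriv is f differentiable_on UNIV)"

definition test_function :: "(real^'n) set \<Rightarrow> (real^'n \<Rightarrow> real) \<Rightarrow> bool" where
  "test_function S \<phi> \<longleftrightarrow>
     smooth \<phi> \<and> compact (closure {x. \<phi> x \<noteq> 0}) \<and> closure {x. \<phi> x \<noteq> 0} \<subseteq> S"

definition L2 :: "(real^'n) set \<Rightarrow> (real^'n \<Rightarrow> real) \<Rightarrow> bool" where
  "L2 S f \<longleftrightarrow> f \<in> borel_measurable (lebesgue_on S) \<and> integrable (lebesgue_on S) (\<lambda>x. (f x)\<^sup>2)"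

text \<open>In all uses below, \<open>f\<close> and \<open>g\<close> are square integrable on the open set \<open>S\<close>.\<close>

definition weak_partial :: "(real^'n) set \<Rightarrow> 'n \<Rightarrow> (real^'n \<Rightarrow> real) \<Rightarrow> (real^'n \<Rightarrow> real) \<Rightarrow> bool" where
  "weak_partial S i f g \<longleftrightarrow>
     (\<forall>\<phi>. test_function S \<phi> \<longrightarrow>
        (LINT x|lebesgue_on S. f x * partial_deriv i \<phi> x) = - (LINT x|lebesgue_on S. g x * \<phi> x))"

definition H1 :: "(real^'n) set \<Rightarrow> (real^'n \<Rightarrow> real) \<Rightarrow> bool" where
  "H1 S f \<longleftrightarrow> L2 S f \<and> (\<forall>i. \<exists>g. L2 S g \<and> weak_partial S i f g)"

definition H2 :: "(real^'n) set \<Rightarrow> (real^'n \<Rightarrow> real) \<Rightarrow> bool" where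
  "H2 S f \<longleftrightarrow> L2 S f \<and> (\<forall>i. \<exists>g. H1 S g \<and> weak_partial S i f g)"

text \<open>A representative of the weak gradient of \<open>f\<close> on \<open>S\<close>; it is determined almost everywhere
  on \<open>S\<close> and meaningful when \<open>H1 S f\<close>.\<close>

definition wgrad :: "(real^'n) set \<Rightarrow> (real^'n \<Rightarrow> real) \<Rightarrow> real^'n \<Rightarrow> real^'n" where
  "wgrad S f x = (\<chi> i. (SOME g. L2 S g \<and> weak_partial S i f g) x)"

definition H1_norm :: "(real^'n) set \<Rightarrow> (real^'n \<Rightarrow> real) \<Rightarrow> real" where
  "H1_norm S f =
     sqrt ((LINT x|lebesgue_on S. (f x)\<^sup>2) + (LINT x|lebesgue_on S. (norm (wgrad S f x))\<^sup>2))"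

definition H10 :: "(real^'n) set \<Rightarrow> (real^'n \<Rightarrow> real) \<Rightarrow> bool" where
  "H10 S f \<longleftrightarrow> H1 S f \<and>
     (\<exists>\<phi>. (\<forall>k::nat. test_function S (\<phi> k)) \<and> (\<lambda>k. H1_norm S (\<lambda>x. \<phi> k x - f x)) \<longlonglongrightarrow> 0)"

definition broken_H2 :: "(real^'n) set \<Rightarrow> (real^'n) set set \<Rightarrow> (real^'n \<Rightarrow> real) \<Rightarrow> bool" where
  "broken_H2 \<Omega> Th v \<longleftrightarrow> L2 \<Omega> v \<and> (\<forall>T\<in>Th. H2 T v)"

definition weak_solution ::
  "(real^'n) set \<Rightarrow> (real^'n \<Rightarrow> real^'n^'n) \<Rightarrow> (real^'n \<Rightarrow> real) \<Rightarrow> (real^'n \<Rightarrow> real) \<Rightarrow> bool" where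
  "weak_solution \<Omega> K f u \<longleftrightarrow> H10 \<Omega> u \<and>
     (\<forall>v. H10 \<Omega> v \<longrightarrow>
        (LINT x|lebesgue_on \<Omega>. (K x *v wgrad \<Omega> u x) \<bullet> wgrad \<Omega> v x)
          = (LINT x|lebesgue_on \<Omega>. f x * v x))"


section \<open>Surface measure on faces\<close>

text \<open>The \<open>(d-1)\<close>-dimensional Lebesgue measure on the hyperplane \<open>n \<bullet> x = c\<close>, for a unit vector
  \<open>n\<close>, as a measure on the whole space: the measure of \<open>A\<close> is the \<open>d\<close>-dimensional measure of the
  right cylinder of height one over the part of \<open>A\<close> in the hyperplane. In dimension one this is
  the unit point mass.\<close>

definition hyperplane_measure :: "real^'n \<Rightarrow> real \<Rightarrow> (real^'n) measure" where
  "hyperplane_measure n c =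
     completion (distr (restrict_space lborel {y. c \<le> n \<bullet> y \<and> n \<bullet> y \<le> c + 1}) borel
       (\<lambda>y. y - (n \<bullet> y - c) *\<^sub>R n))"

text \<open>For a nonempty relatively open subset \<open>F\<close> of a hyperplane, that hyperplane is unique and the
  measure does not depend on the sign chosen for the normal.\<close>

definition surf :: "(real^'n) set \<Rightarrow> (real^'n) measure" where
  "surf F = (let p = (SOME p. norm (fst p) = 1 \<and> F \<subseteq> {x. fst p \<bullet> x = snd p})
             in hyperplane_measure (fst p) (snd p))"

definition area :: "(real^'n) set \<Rightarrow> real" where
  "area F = measure (surf F) F"

definition is_outward_normal :: "(real^'n) set \<Rightarrow> (real^'n) set \<Rightarrow> real^'n \<Rightarrow> bool" where
  "is_outward_normal T F n \<longleftrightarrow>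
     norm n = 1 \<and> (\<forall>x\<in>F. \<forall>y\<in>F. n \<bullet> (x - y) = 0) \<and>
     (AE x in surf F. x \<in> F \<longrightarrow>
        (\<exists>\<epsilon>>0. \<forall>t. 0 < t \<and> t < \<epsilon> \<longrightarrow> x - t *\<^sub>R n \<in> T \<and> x + t *\<^sub>R n \<notin> T))"

definition outward_normal :: "(real^'n) set \<Rightarrow> (real^'n) set \<Rightarrow> real^'n" where
  "outward_normal T F = (THE n. is_outward_normal T F n)"

text \<open>The trace on \<open>F\<close> of a Sobolev function \<open>w\<close> defined in \<open>T\<close>, as the limit of the means of \<open>w\<close>
  over short segments entering \<open>T\<close> along the normal. By Fubini, changing \<open>w\<close> on a null set changes
  the trace only on a null set of \<open>F\<close>. For \<open>w\<close> in \<open>H1\<close> the limit exists almost everywhere on \<open>F\<close>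
  (\<open>w\<close> has a representative that is absolutely continuous along almost every normal line) and is
  the usual trace; where \<open>w\<close> extends continuously up to \<open>F\<close> it is that extension
  (see \<open>face_trace_continuous\<close>).\<close>

definition face_trace ::
  "(real^'n) set \<Rightarrow> (real^'n) set \<Rightarrow> (real^'n \<Rightarrow> 'b::euclidean_space) \<Rightarrow> real^'n \<Rightarrow> 'b" where
  "face_trace T F w x =
     Lim (at_right 0) (\<lambda>\<epsilon>. (1 / \<epsilon>) *\<^sub>R
       (LINT t|lebesgue_on {0<..<\<epsilon>}. w (x - t *\<^sub>R outward_normal T F)))"

lemma face_trace_continuous:
  fixes w :: "real^'n \<Rightarrow> 'b::euclidean_space"
  assumes "0 < r"
    and meas: "(\<lambda>t. w (x - t *\<^sub>R outward_normal T F)) \<in> borel_measurable (lebesgue_on {0<..<r})"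
    and lim: "((\<lambda>t. w (x - t *\<^sub>R outward_normal T F)) \<longlongrightarrow> l) (at_right 0)"
  shows "face_trace T F w x = l"
proof -
  define h where "h = (\<lambda>t. w (x - t *\<^sub>R outward_normal T F))"
  have "((\<lambda>\<epsilon>. (1 / \<epsilon>) *\<^sub>R (LINT t|lebesgue_on {0<..<\<epsilon>}. h t)) \<longlongrightarrow> l) (at_right 0)"
  proof (rule tendstoI)
    fix e :: real assume "e > 0"
    then have "\<forall>\<^sub>F t in at_right 0. dist (h t) l < e / 2"
      using tendstoD[OF lim, of "e / 2"] by (simp add: h_def)
    then obtain b where b: "b > 0" "\<And>t. 0 < t \<Longrightarrow> t < b \<Longrightarrow> dist (h t) l < e / 2"
      unfolding eventually_at_right_field by auto
    have "dist ((1 / \<epsilon>) *\<^sub>R (LINT t|lebesgue_on {0<..<\<epsilon>}. h t)) l < e"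
      if \<epsilon>: "0 < \<epsilon>" "\<epsilon> < min b r" for \<epsilon>
    proof -
      let ?M = "lebesgue_on {0<..<\<epsilon>}"
      have fin: "finite_measure ?M"
        by (intro finite_measure_lebesgue_on lmeasurable_interval)
      then interpret finite_measure ?M .
      have Mm: "measure ?M (space ?M) = \<epsilon>"
        using \<epsilon> by (simp add: measure_restrict_space)
      have sub: "{0<..<\<epsilon>} \<subseteq> {0<..<r}"
        using \<epsilon> by auto
      have "h \<in> borel_measurable ?M"
        by (rule measurable_restrict_mono[OF meas[folded h_def] sub])
      moreover have bd: "norm (h t - l) \<le> e / 2" if "t \<in> {0<..<\<epsilon>}" for t
        using b(2)[of t] that \<epsilon> by (simp add: dist_norm)
      ultimately have int: "integrable ?M (\<lambda>t. h t - l)"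
        by (intro integrable_const_bound[where B = "e / 2"] AE_I2) auto
      then have inth: "integrable ?M h"
        using Bochner_Integration.integrable_add[OF int integrable_const[of l]] by simp
      have "(LINT t|?M. h t - l) = (LINT t|?M. h t) - \<epsilon> *\<^sub>R l"
        using inth Mm by (simp add: Bochner_Integration.integral_diff)
      then have "(1 / \<epsilon>) *\<^sub>R (LINT t|?M. h t) - l = (1 / \<epsilon>) *\<^sub>R (LINT t|?M. h t - l)"
        using \<epsilon> by (simp add: scaleR_diff_right)
      moreover have "norm (LINT t|?M. h t - l) \<le> (LINT t|?M. e / 2)"
        by (rule Bochner_Integration.integral_norm_bound_integral[OF int]) (use bd in auto)
      moreover have "(LINT t|?M. e / 2) = \<epsilon> * (e / 2)"
        using Mm by simp
      ultimately have "norm ((1 / \<epsilon>) *\<^sub>R (LINT t|?M. h t) - l) = (1 / \<epsilon>) * norm (LINT t|?M. h t - l)"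
        and le: "norm (LINT t|?M. h t - l) \<le> \<epsilon> * (e / 2)"
        using \<epsilon> by (simp, argo)
      note this(1)
      also have "(1 / \<epsilon>) * norm (LINT t|?M. h t - l) \<le> (1 / \<epsilon>) * (\<epsilon> * (e / 2))"
        using le \<epsilon> by (intro mult_left_mono) auto
      also have "\<dots> < e"
        using \<epsilon> \<open>e > 0\<close> by simp
      finally show ?thesis
        by (simp add: dist_norm)
    qed
    then show "\<forall>\<^sub>F \<epsilon> in at_right 0. dist ((1 / \<epsilon>) *\<^sub>R (LINT t|lebesgue_on {0<..<\<epsilon>}. h t)) l < e"
      unfolding eventually_at_right_field using b(1) \<open>0 < r\<close>
      by (intro exI[of _ "min b r"]) auto
  qed
  then show ?thesis
    unfolding face_trace_def h_def by (intro tendsto_Lim) auto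
qed


section \<open>Polytopal meshes\<close>

text \<open>\<open>polytope\<close> is the library's convex polytope. A polytopal set is open and bounded, but
  need be neither convex nor connected.\<close>

definition polytopal :: "(real^'n) set \<Rightarrow> bool" where
  "polytopal P \<longleftrightarrow> P \<noteq> {} \<and> (\<exists>S. finite S \<and> (\<forall>C\<in>S. polytope C) \<and> P = interior (\<Union>S))"

definition polytopal_partition :: "(real^'n) set \<Rightarrow> (real^'n) set set \<Rightarrow> bool" where
  "polytopal_partition \<Omega> Ps \<longleftrightarrow>
     finite Ps \<and> (\<forall>P\<in>Ps. polytopal P) \<and> disjoint Ps \<and> closure \<Omega> = (\<Union>P\<in>Ps. closure P)"

definition faces_of :: "(real^'n) set set \<Rightarrow> (real^'n) set \<Rightarrow> (real^'n) set set" where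
  "faces_of Fh T = {F\<in>Fh. F \<subseteq> frontier T}"

definition cells_of :: "(real^'n) set set \<Rightarrow> (real^'n) set \<Rightarrow> (real^'n) set set" where
  "cells_of Th F = {T\<in>Th. F \<subseteq> frontier T}"

definition internal_faces :: "(real^'n) set \<Rightarrow> (real^'n) set set \<Rightarrow> (real^'n) set set" where
  "internal_faces \<Omega> Fh = {F\<in>Fh. F \<subseteq> \<Omega>}"

definition boundary_faces :: "(real^'n) set \<Rightarrow> (real^'n) set set \<Rightarrow> (real^'n) set set" where
  "boundary_faces \<Omega> Fh = {F\<in>Fh. F \<subseteq> frontier \<Omega>}"

text \<open>Cells are open and faces are relatively open in their hyperplanes. A cell may have several
  faces in one hyperplane (hanging nodes).\<close>

definition polytopal_mesh :: "(real^'n) set \<Rightarrow> (real^'n) set set \<Rightarrow> (real^'n) set set \<Rightarrow> bool" where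
  "polytopal_mesh \<Omega> Th Fh \<longleftrightarrow>
     polytopal_partition \<Omega> Th \<and> finite Fh \<and> disjoint Fh \<and>
     (\<forall>F\<in>Fh. F \<noteq> {} \<and>
        (\<exists>n c. norm n = 1 \<and> openin (top_of_set {x. n \<bullet> x = c}) F) \<and>
        closure F - F \<in> null_sets (surf F)) \<and>
     (\<forall>F\<in>Fh. F \<subseteq> \<Omega> \<and> card (cells_of Th F) = 2 \<or>
              F \<subseteq> frontier \<Omega> \<and> card (cells_of Th F) = 1) \<and>
     (\<forall>T\<in>Th. frontier T = (\<Union>F\<in>faces_of Fh T. closure F)) \<and>
     (\<forall>T\<in>Th. \<forall>F\<in>faces_of Fh T. \<exists>n. is_outward_normal T F n)"

text \<open>The distance from \<open>x\<close> to the hyperplane spanned by \<open>F\<close>.\<close>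

definition orth_dist :: "real^'n \<Rightarrow> (real^'n) set \<Rightarrow> real" where
  "orth_dist x F = infdist x (affine hull F)"


section \<open>Diffusion tensor\<close>

definition uniformly_elliptic :: "(real^'n) set \<Rightarrow> (real^'n \<Rightarrow> real^'n^'n) \<Rightarrow> bool" where
  "uniformly_elliptic \<Omega> K \<longleftrightarrow>
     (\<exists>a>0. \<exists>b. \<forall>x\<in>\<Omega>. \<forall>\<xi>. a * (norm \<xi>)\<^sup>2 \<le> (K x *v \<xi>) \<bullet> \<xi> \<and> (K x *v \<xi>) \<bullet> \<xi> \<le> b * (norm \<xi>)\<^sup>2)"

definition cell_value :: "(real^'n \<Rightarrow> real^'n^'n) \<Rightarrow> (real^'n) set \<Rightarrow> real^'n^'n" where
  "cell_value K T = (THE A. \<forall>x\<in>T. K x = A)"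

definition min_eigenvalue :: "real^'n^'n \<Rightarrow> real" where
  "min_eigenvalue A = Min {l. \<exists>v. v \<noteq> 0 \<and> A *v v = l *\<^sub>R v}"


section \<open>Discrete unknowns and numerical fluxes\<close>

type_synonym 'n dofs = "((real^'n) set \<Rightarrow> real) \<times> ((real^'n) set \<Rightarrow> real)"

text \<open>The components of a vector of unknowns are indexed by all sets and vanish off the mesh, so
  that two vectors with the same cell and face values are equal.\<close>

definition Xh :: "(real^'n) set \<Rightarrow> (real^'n) set set \<Rightarrow> (real^'n) set set \<Rightarrow> 'n dofs set" where
  "Xh \<Omega> Th Fh =
     {(vT, vF). (\<forall>T. T \<notin> Th \<longrightarrow> vT T = 0) \<and> (\<forall>F. F \<notin> Fh \<longrightarrow> vF F = 0) \<and>
                (\<forall>F\<in>boundary_faces \<Omega> Fh. vF F = 0)}"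

definition lincomb :: "real \<Rightarrow> 'n dofs \<Rightarrow> real \<Rightarrow> 'n dofs \<Rightarrow> 'n dofs" where
  "lincomb a v b w =
     ((\<lambda>T. a * fst v T + b * fst w T), (\<lambda>F. a * snd v F + b * snd w F))"

definition linear_on_dofs :: "'n dofs set \<Rightarrow> ('n dofs \<Rightarrow> real) \<Rightarrow> bool" where
  "linear_on_dofs X G \<longleftrightarrow>
     (\<forall>v\<in>X. \<forall>w\<in>X. \<forall>a b. G (lincomb a v b w) = a * G v + b * G w)"

definition interpolate ::
  "(real^'n) set set \<Rightarrow> (real^'n) set set \<Rightarrow> ((real^'n) set \<Rightarrow> real^'n) \<Rightarrow> ((real^'n) set \<Rightarrow> real^'n)
   \<Rightarrow> (real^'n \<Rightarrow> real) \<Rightarrow> 'n dofs" where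
  "interpolate Th Fh xT xF u =
     ((\<lambda>T. if T \<in> Th then u (xT T) else 0), (\<lambda>F. if F \<in> Fh then u (xF F) else 0))"

definition local_seminorm ::
  "(real^'n) set set \<Rightarrow> ((real^'n) set \<Rightarrow> real^'n) \<Rightarrow> (real^'n) set \<Rightarrow> 'n dofs \<Rightarrow> real" where
  "local_seminorm Fh xT T v =
     sqrt (\<Sum>F\<in>faces_of Fh T.
       area F * orth_dist (xT T) F * ((fst v T - snd v F) / orth_dist (xT T) F)\<^sup>2)"

definition dofs_norm ::
  "(real^'n) set set \<Rightarrow> (real^'n) set set \<Rightarrow> (real^'n \<Rightarrow> real^'n^'n) \<Rightarrow> ((real^'n) set \<Rightarrow> real^'n)
   \<Rightarrow> 'n dofs \<Rightarrow> real" where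
  "dofs_norm Th Fh K xT v =
     sqrt (\<Sum>T\<in>Th. min_eigenvalue (cell_value K T) * (local_seminorm Fh xT T v)\<^sup>2)"

definition coercive_fluxes ::
  "(real^'n) set \<Rightarrow> (real^'n) set set \<Rightarrow> (real^'n) set set \<Rightarrow> (real^'n \<Rightarrow> real^'n^'n)
   \<Rightarrow> ((real^'n) set \<Rightarrow> real^'n) \<Rightarrow> ((real^'n) set \<Rightarrow> (real^'n) set \<Rightarrow> 'n dofs \<Rightarrow> real) \<Rightarrow> real \<Rightarrow> bool" where
  "coercive_fluxes \<Omega> Th Fh K xT flux \<gamma> \<longleftrightarrow>
     (\<forall>v\<in>Xh \<Omega> Th Fh.
        (\<Sum>T\<in>Th. \<Sum>F\<in>faces_of Fh T. flux T F v * (fst v T - snd v F))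
          \<ge> \<gamma> * (dofs_norm Th Fh K xT v)\<^sup>2)"

definition fv_solution ::
  "(real^'n) set \<Rightarrow> (real^'n) set set \<Rightarrow> (real^'n) set set \<Rightarrow> (real^'n \<Rightarrow> real)
   \<Rightarrow> ((real^'n) set \<Rightarrow> (real^'n) set \<Rightarrow> 'n dofs \<Rightarrow> real) \<Rightarrow> 'n dofs \<Rightarrow> bool" where
  "fv_solution \<Omega> Th Fh f flux uh \<longleftrightarrow> uh \<in> Xh \<Omega> Th Fh \<and>
     (\<forall>F\<in>internal_faces \<Omega> Fh. \<forall>T T'. T \<noteq> T' \<and> cells_of Th F = {T, T'} \<longrightarrow>
        flux T F uh + flux T' F uh = 0) \<and>
     (\<forall>T\<in>Th. (\<Sum>F\<in>faces_of Fh T. flux T F uh) = (LINT x|lebesgue_on T. f x))"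

definition exact_flux ::
  "(real^'n \<Rightarrow> real^'n^'n) \<Rightarrow> (real^'n \<Rightarrow> real) \<Rightarrow> (real^'n) set \<Rightarrow> (real^'n) set \<Rightarrow> real" where
  "exact_flux K u T F =
     (LINT x:F|surf F. (cell_value K T *v face_trace T F (wgrad T u) x) \<bullet> outward_normal T F)"

end

theory Submission
  imports Defs
begin

text \<open>The scheme and the exact fluxes \<open>- exact_flux K u T F\<close> satisfy the same balance in each cell and
  the same conservation across internal faces. Paired with \<open>v = uh - I\<close>, where \<open>I\<close> is the interpolate
  of \<open>u\<close>, they give the same sum, so coercivity bounds \<open>\<gamma> * (norm of v)\<^sup>2\<close> by the sum of the consistency
  errors against \<open>fst v T - snd v F\<close>, and the Cauchy--Schwarz inequality concludes. That \<open>I\<close> belongs to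
  \<open>Xh\<close> is the vanishing of a continuous \<open>H10\<close> function on the boundary.

  Balance and conservation of the exact fluxes are a Gauss--Green formula for a field whose components
  are only in \<open>H1\<close>, on cells that need not be convex or even Lipschitz. Such a field is absolutely
  continuous on almost every line, in particular on the normals of the faces, and this gives its
  boundary values. Near a point of a face off the skeleton, the union of the intersections of distinct
  face hyperplanes, a cell is locally a half-ball, and testing the divergence with
  cut-off functions of the distance to the face gives the formula for test functions supported off the
  skeleton. The skeleton has codimension two: a cut-off at scale \<open>\<delta>\<close> has a gradient of size \<open>1 / \<delta>\<close>
  on a set of volume of order \<open>\<delta>\<^sup>2\<close>, hence of bounded \<open>L2\<close> norm, and since the field is square
  integrable its contribution tends to \<open>0\<close>.\<close>

section \<open>Smooth functions\<close>

text \<open>The obstacle is that the exact flux is defined through \<open>face_trace\<close>, a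
  pointwise limit of means of one representative of the gradient: neither measurability nor
  integrability on a face comes with it, and a finite union of convex pieces offers no Lipschitz
  chart for a trace theorem. Hence a second boundary value, \<open>btrace\<close>, the limit of
  means against kernels that are also the normal derivatives of the cut-offs. It is Borel by
  construction, agrees with \<open>face_trace\<close> almost everywhere on a face, and its defining
  averages are those that appear when the divergence is tested. Its integrability comes from the
  mass of the field in thin layers: inside a convex piece a layer is moved along an oblique
  direction towards an interior point, so that only the derivative in that direction enters. This
  controls the traces in L1 only, which is enough because the cut-offs near the skeleton are bounded
  on the faces; square integrability serves the volume term. Arguments on lines use Borel
  representatives with \<open>lborel\<close> and \<open>hyp\<close>, where Fubini applies without
  completions.\<close>

definition grad :: "(real^'n \<Rightarrow> real) \<Rightarrow> real^'n \<Rightarrow> real^'n" where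
  "grad f x = (\<chi> i. partial_deriv i f x)"

lemma grad_nth [simp]: "grad f x $ i = partial_deriv i f x"
  by (simp add: grad_def)

lemma partial_derivI:
  "(f has_derivative f') (at x) \<Longrightarrow> partial_deriv i f x = f' (axis i 1)"
  unfolding partial_deriv_def using frechet_derivative_at by metis

lemma grad_has_derivative:
  assumes "f differentiable (at x)"
  shows "(f has_derivative (\<lambda>v. v \<bullet> grad f x)) (at x)"
proof -
  let ?D = "frechet_derivative f (at x)"
  have D: "(f has_derivative ?D) (at x)"
    using assms frechet_derivative_works by blast
  then interpret bounded_linear ?D
    by (rule has_derivative_bounded_linear)
  have "?D v = v \<bullet> grad f x" for v :: "real^'a"
  proof -
    have "?D v = ?D (\<Sum>i\<in>UNIV. (v $ i) *\<^sub>R axis i 1)"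
      by (metis basis_expansion scalar_mult_eq_scaleR)
    also have "\<dots> = (\<Sum>i\<in>UNIV. v $ i * partial_deriv i f x)"
      by (simp add: sum scaleR partial_deriv_def)
    finally show ?thesis
      by (simp add: inner_vec_def)
  qed
  then show ?thesis
    using D by (metis (no_types, lifting) ext)
qed

lemma gradI: "(f has_derivative (\<lambda>v. v \<bullet> g)) (at x) \<Longrightarrow> grad f x = g"
  by (simp add: vec_eq_iff partial_derivI inner_axis inner_commute[of "axis _ _"])

section \<open>Functions differentiable up to a finite order\<close>

text \<open>\<open>smooth\<close> speaks about iterated derivatives along all index lists at once,
  which gives no induction for products or quotients. The recursion on the order does: it peels off
  the derivative that acts on \<open>f\<close> directly, so the rules below go by induction on
  \<open>k\<close>, most of them with the functions left arbitrary.\<close>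

fun times_differentiable :: "nat \<Rightarrow> (real^'n \<Rightarrow> real) \<Rightarrow> bool" where
  "times_differentiable 0 f \<longleftrightarrow> f differentiable_on UNIV"
| "times_differentiable (Suc k) f \<longleftrightarrow>
     f differentiable_on UNIV \<and> (\<forall>i. times_differentiable k (partial_deriv i f))"

lemma times_differentiable_iff:
  "times_differentiable k f \<longleftrightarrow>
     (\<forall>is. length is \<le> k \<longrightarrow> foldr partial_deriv is f differentiable_on UNIV)"
proof (induction k arbitrary: f)
  case (Suc k)
  show ?case
  proof
    assume L: "times_differentiable (Suc k) f"
    show "\<forall>is. length is \<le> Suc k \<longrightarrow> foldr partial_deriv is f differentiable_on UNIV"
    proof (intro allI impI)
      fix "is" :: "'a list" assume "length is \<le> Suc k"
      then show "foldr partial_deriv is f differentiable_on UNIV"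
        \<comment> \<open>\<open>foldr\<close> applies the last index of the list first, so the list
          is split at its end.\<close>
        using L Suc by (cases "is" rule: rev_cases) auto
    qed
  next
    assume R: "\<forall>is. length is \<le> Suc k \<longrightarrow> foldr partial_deriv is f differentiable_on UNIV"
    have "foldr partial_deriv is (partial_deriv i f) differentiable_on UNIV" if "length is \<le> k" for "is" i
      using R[rule_format, of "is @ [i]"] that by simp
    then show "times_differentiable (Suc k) f"
      using R[rule_format, of "[]"] Suc by simp
  qed
qed simp

lemma smooth_iff: "smooth f \<longleftrightarrow> (\<forall>k. times_differentiable k f)"
  unfolding smooth_def times_differentiable_iff by blast

lemma times_differentiable_differentiable:
  "times_differentiable k f \<Longrightarrow> f differentiable (at x)"
  by (cases k) (auto simp: differentiable_on_def)

lemma times_differentiable_Suc_D: "times_differentiable (Suc k) f \<Longrightarrow> times_differentiable k f"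
  by (auto simp: times_differentiable_iff)

lemma times_differentiable_const: "times_differentiable k (\<lambda>x. c)"
proof (induction k arbitrary: c)
  case (Suc k)
  have "partial_deriv i (\<lambda>x. c) = (\<lambda>x::real^'a. 0)" for i
    by (rule ext) (auto intro!: partial_derivI derivative_eq_intros)
  then show ?case using Suc by simp
qed simp

lemma times_differentiable_add:
  "times_differentiable k f \<Longrightarrow> times_differentiable k g \<Longrightarrow> times_differentiable k (\<lambda>x. f x + g x)"
proof (induction k arbitrary: f g)
  case (Suc k)
  have "partial_deriv i (\<lambda>x. f x + g x) = (\<lambda>x. partial_deriv i f x + partial_deriv i g x)" for i
  proof
    fix x
    have "((\<lambda>x. f x + g x) has_derivative (\<lambda>v. v \<bullet> grad f x + v \<bullet> grad g x)) (at x)"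
      by (intro has_derivative_add grad_has_derivative times_differentiable_differentiable[OF Suc.prems(1)]
          times_differentiable_differentiable[OF Suc.prems(2)])
    from partial_derivI[OF this, of i]
    show "partial_deriv i (\<lambda>x. f x + g x) x = partial_deriv i f x + partial_deriv i g x"
      by (simp add: inner_axis')
  qed
  then show ?case using Suc by simp
qed simp

lemma partial_deriv_mult:
  assumes "f differentiable (at x)" "g differentiable (at x)"
  shows "partial_deriv i (\<lambda>x. f x * g x) x = partial_deriv i f x * g x + f x * partial_deriv i g x"
proof -
  have "((\<lambda>x. f x * g x) has_derivative (\<lambda>v. f x * (v \<bullet> grad g x) + (v \<bullet> grad f x) * g x)) (at x)"
    using assms by (intro has_derivative_mult grad_has_derivative)
  from partial_derivI[OF this, of i] show ?thesis
    by (simp add: inner_axis')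
qed

lemma times_differentiable_mult:
  "times_differentiable k f \<Longrightarrow> times_differentiable k g \<Longrightarrow> times_differentiable k (\<lambda>x. f x * g x)"
proof (induction k arbitrary: f g)
  case (Suc k)
  have "partial_deriv i (\<lambda>x. f x * g x) = (\<lambda>x. partial_deriv i f x * g x + f x * partial_deriv i g x)" for i
    by (rule ext, intro partial_deriv_mult times_differentiable_differentiable[OF Suc.prems(1)]
        times_differentiable_differentiable[OF Suc.prems(2)])
  moreover have "times_differentiable k f" "times_differentiable k g"
    using Suc.prems times_differentiable_Suc_D by blast+
  ultimately show ?case
    using Suc by (auto intro!: times_differentiable_add simp del: times_differentiable.simps(1))
qed simp

text \<open>The derivative of \<open>1 / f\<close> is a product of \<open>1 / f\<close>, twice, and
  a derivative of \<open>f\<close>, up to sign; so one induction hypothesis, for the same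
  \<open>f\<close> at the order below, covers every factor that is not already known.\<close>

lemma times_differentiable_inverse:
  "times_differentiable k f \<Longrightarrow> (\<And>x. f x \<noteq> 0) \<Longrightarrow> times_differentiable k (\<lambda>x. inverse (f x))"
proof (induction k)
  case 0
  then show ?case
    by (auto simp: differentiable_on_def intro!: differentiable_inverse)
next
  case (Suc k)
  have "partial_deriv i (\<lambda>x. inverse (f x)) =
      (\<lambda>x. (-1) * (inverse (f x) * partial_deriv i f x * inverse (f x)))" (is "_ = ?D i") for i
  proof
    fix x
    have "((\<lambda>x. inverse (f x)) has_derivative (\<lambda>v. - (inverse (f x) * (v \<bullet> grad f x) * inverse (f x)))) (at x)"
      using Deriv.has_derivative_inverse[OF Suc.prems(2)
          grad_has_derivative[OF times_differentiable_differentiable[OF Suc.prems(1)]]] by simp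
    from partial_derivI[OF this, of i]
    show "partial_deriv i (\<lambda>x. inverse (f x)) x = (-1) * (inverse (f x) * partial_deriv i f x * inverse (f x))"
      by (simp add: inner_axis')
  qed
  moreover have "times_differentiable k (\<lambda>x. inverse (f x))"
    using Suc times_differentiable_Suc_D by blast
  moreover have "(\<lambda>x. inverse (f x)) differentiable_on UNIV"
    using Suc.prems by (auto simp: differentiable_on_def intro!: differentiable_inverse)
  moreover have "times_differentiable k (?D i)" for i
    using Suc.prems \<open>times_differentiable k (\<lambda>x. inverse (f x))\<close>
    by (intro times_differentiable_mult times_differentiable_const) auto
  ultimately show ?case
    by (simp only: times_differentiable.simps) simp
qed

lemma has_derivative_translate:
  assumes "(f has_derivative f') (at (x + c))"
  shows "((\<lambda>x. f (x + c)) has_derivative f') (at x)"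
proof -
  have "((\<lambda>x. x + c) has_derivative (\<lambda>v. v)) (at x)"
    by (auto intro!: derivative_eq_intros)
  from has_derivative_compose[OF this assms] show ?thesis .
qed

lemma times_differentiable_translate:
  "times_differentiable k f \<Longrightarrow> times_differentiable k (\<lambda>x. f (x + c))"
proof (induction k arbitrary: f)
  case 0
  then have "(\<lambda>x. f (x + c)) differentiable (at x)" for x
    unfolding differentiable_def times_differentiable.simps differentiable_on_def
    using has_derivative_translate by blast
  then show ?case by (simp add: differentiable_on_def)
next
  case (Suc k)
  have D: "((\<lambda>x. f (x + c)) has_derivative (\<lambda>v. v \<bullet> grad f (x + c))) (at x)" for x
    by (intro has_derivative_translate grad_has_derivative
        times_differentiable_differentiable[OF Suc.prems])
  have "partial_deriv i (\<lambda>x. f (x + c)) = (\<lambda>x. partial_deriv i f (x + c))" for i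
    by (rule ext) (simp add: partial_derivI[OF D] inner_axis')
  moreover have "(\<lambda>x. f (x + c)) differentiable_on UNIV"
    using D by (auto simp: differentiable_on_def differentiable_def)
  ultimately show ?case using Suc by simp
qed

text \<open>The derivatives of \<open>exp (-1/t)\<close> are linear combinations of these functions.\<close>

definition flat :: "nat \<Rightarrow> real \<Rightarrow> real" where
  "flat m t = (if t > 0 then exp (- (1 / t)) / t ^ m else 0)"

lemma flat_nonneg: "flat m t \<ge> 0"
  by (simp add: flat_def)

text \<open>From the right, substituting \<open>inverse t\<close> turns this into the decay of
  \<open>x ^ m / exp x\<close> at infinity; from the left the function is constantly zero.\<close>

lemma flat_tendsto_0: "(flat m \<longlongrightarrow> 0) (at 0)"
proof -
  have "((\<lambda>x::real. x ^ m / exp x) \<longlongrightarrow> 0) at_top"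
    by (rule tendsto_power_div_exp_0)
  then have "((\<lambda>t. inverse t ^ m / exp (inverse t)) \<longlongrightarrow> 0) (at_right (0::real))"
    by (rule filterlim_compose) (rule filterlim_inverse_at_top_right)
  then have "(flat m \<longlongrightarrow> 0) (at_right 0)"
    by (rule Lim_transform_eventually)
      (auto simp: flat_def eventually_at_right_field exp_minus field_simps intro!: exI[of _ 1])
  moreover have "(flat m \<longlongrightarrow> 0) (at_left 0)"
    by (rule tendsto_eventually) (auto simp: flat_def eventually_at_left_field intro!: exI[of _ "-1"])
  ultimately show ?thesis
    by (simp add: filterlim_split_at)
qed

lemma flat_deriv:
  "(flat m has_real_derivative flat (m + 2) t - real m * flat (m + 1) t) (at t)"
proof (cases t "0::real" rule: linorder_cases)
  case less
  have "((\<lambda>t. 0) has_real_derivative 0) (at t)" by simp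
  moreover have "\<forall>\<^sub>F s in nhds t. flat m s = 0"
    using eventually_nhds_in_open[of "{..<0}" t] less
    by (auto simp: flat_def elim!: eventually_mono)
  ultimately have "(flat m has_real_derivative 0) (at t)"
    by (subst DERIV_cong_ev) auto
  then show ?thesis using less by (simp add: flat_def)
next
  case equal
  \<comment> \<open>The difference quotient at zero of \<open>flat m\<close> is
    \<open>flat (m + 1)\<close>, whose limit is zero by the previous lemma.\<close>
  have "((\<lambda>h. (flat m (0 + h) - flat m 0) / h) \<longlongrightarrow> 0) (at 0)"
    by (rule Lim_transform_eventually[OF flat_tendsto_0[of "m + 1"]])
      (auto simp: flat_def field_simps intro!: always_eventually)
  then show ?thesis
    using equal by (simp add: DERIV_def flat_def)
next
  case greater
  have "((\<lambda>t. exp (- (1 / t)) / t ^ m) has_real_derivative flat (m + 2) t - real m * flat (m + 1) t) (at t)"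
    using greater
    by (auto intro!: derivative_eq_intros simp: flat_def divide_simps)
      (cases m; simp add: algebra_simps power2_eq_square power_add)
  moreover have "\<forall>\<^sub>F s in nhds t. flat m s = exp (- (1 / s)) / s ^ m"
    using eventually_nhds_in_open[of "{0<..}" t] greater
    by (auto simp: flat_def elim!: eventually_mono)
  ultimately show ?thesis
    by (subst DERIV_cong_ev) auto
qed

text \<open>Along an affine function each partial derivative is a combination of
  \<open>flat (m + 2)\<close> and \<open>flat (m + 1)\<close> with constant coefficients, hence the
  induction over the order with \<open>m\<close> arbitrary.\<close>

lemma times_differentiable_flat: "times_differentiable k (\<lambda>x. flat m (a \<bullet> x + b))"
proof (induction k arbitrary: m)
  case 0
  have "(\<lambda>x. flat m (a \<bullet> x + b)) differentiable (at x)" for x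
  proof -
    have "((\<lambda>x. flat m (a \<bullet> x + b)) has_derivative
        (\<lambda>v. (a \<bullet> v) * (flat (m + 2) (a \<bullet> x + b) - real m * flat (m + 1) (a \<bullet> x + b)))) (at x)"
      by (rule derivative_eq_intros flat_deriv[THEN DERIV_compose_FDERIV] refl ext | simp)+
    then show ?thesis
      by (auto simp: differentiable_def)
  qed
  then show ?case by (simp add: differentiable_on_def)
next
  case (Suc k)
  have D: "((\<lambda>x. flat m (a \<bullet> x + b)) has_derivative
        (\<lambda>v. (a \<bullet> v) * (flat (m + 2) (a \<bullet> x + b) - real m * flat (m + 1) (a \<bullet> x + b)))) (at x)" for x
      by (rule derivative_eq_intros flat_deriv[THEN DERIV_compose_FDERIV] refl ext | simp)+
  have "partial_deriv i (\<lambda>x. flat m (a \<bullet> x + b)) =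
      (\<lambda>x. a $ i * (flat (m + 2) (a \<bullet> x + b) + (- real m) * flat (m + 1) (a \<bullet> x + b)))" (is "_ = ?D i") for i
    by (rule ext) (use partial_derivI[OF D, of i] in \<open>simp add: inner_axis\<close>)
  moreover have "times_differentiable k (?D i)" for i
    by (intro times_differentiable_mult times_differentiable_const times_differentiable_add Suc)
  moreover have "(\<lambda>x. flat m (a \<bullet> x + b)) differentiable_on UNIV"
    using D by (auto simp: differentiable_on_def differentiable_def)
  ultimately show ?case
    by (simp only: times_differentiable.simps) simp
qed

lemma smooth_differentiable: "smooth f \<Longrightarrow> f differentiable (at x)"
  using smooth_iff times_differentiable_differentiable by blast

lemma smooth_has_derivative: "smooth f \<Longrightarrow> (f has_derivative (\<lambda>v. v \<bullet> grad f x)) (at x)"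
  by (simp add: grad_has_derivative smooth_differentiable)

lemma smooth_continuous_on: "smooth f \<Longrightarrow> continuous_on S f"
  by (meson differentiable_imp_continuous_within continuous_at_imp_continuous_on smooth_differentiable)

lemma smooth_partial_deriv: "smooth f \<Longrightarrow> smooth (partial_deriv i f)"
  unfolding smooth_iff by (meson times_differentiable.simps(2))

lemma smooth_grad_continuous_on: "smooth f \<Longrightarrow> continuous_on S (grad f)"
  unfolding grad_def by (intro continuous_on_vec_lambda smooth_continuous_on smooth_partial_deriv)

lemma smooth_const: "smooth (\<lambda>x. c)"
  by (simp add: smooth_iff times_differentiable_const)

lemma smooth_add: "smooth f \<Longrightarrow> smooth g \<Longrightarrow> smooth (\<lambda>x. f x + g x)"
  by (simp add: smooth_iff times_differentiable_add)

lemma smooth_mult: "smooth f \<Longrightarrow> smooth g \<Longrightarrow> smooth (\<lambda>x. f x * g x)"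
  by (simp add: smooth_iff times_differentiable_mult)

lemma smooth_diff:
  assumes "smooth f" "smooth g" shows "smooth (\<lambda>x. f x - g x)"
  using smooth_add[OF assms(1) smooth_mult[OF smooth_const[of "-1"] assms(2)]] by simp

lemma smooth_inverse: "smooth f \<Longrightarrow> (\<And>x. f x \<noteq> 0) \<Longrightarrow> smooth (\<lambda>x. inverse (f x))"
  by (simp add: smooth_iff times_differentiable_inverse)

lemma smooth_prod: "(\<And>i. i \<in> I \<Longrightarrow> smooth (f i)) \<Longrightarrow> smooth (\<lambda>x. \<Prod>i\<in>I. f i x)"
  by (induction I rule: infinite_finite_induct) (auto intro: smooth_const smooth_mult)

lemma smooth_translate: "smooth f \<Longrightarrow> smooth (\<lambda>x. f (x + c))"
  by (simp add: smooth_iff times_differentiable_translate)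

lemma grad_mult: "smooth f \<Longrightarrow> smooth g \<Longrightarrow> grad (\<lambda>x. f x * g x) x = g x *\<^sub>R grad f x + f x *\<^sub>R grad g x"
  by (simp add: vec_eq_iff partial_deriv_mult smooth_differentiable)

lemma grad_translate: "smooth f \<Longrightarrow> grad (\<lambda>x. f (x + c)) x = grad f (x + c)"
proof (rule gradI)
  assume "smooth f"
  then show "((\<lambda>x. f (x + c)) has_derivative (\<lambda>v. v \<bullet> grad f (x + c))) (at x)"
    by (intro has_derivative_translate smooth_has_derivative)
qed

lemma grad_eq_0_outside:
  assumes "closed C" "\<And>x. x \<notin> C \<Longrightarrow> f x = 0" "x \<notin> C"
  shows "grad f x = 0"
proof (rule gradI)
  have "\<forall>\<^sub>F y in nhds x. f y = 0"
    using eventually_nhds_in_open[of "- C" x] assms by (auto elim!: eventually_mono simp: open_Compl)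
  then have "(f has_derivative (\<lambda>v. 0)) (at x)"
    using assms has_derivative_transform_eventually[OF has_derivative_const[of 0 "at x"], of f]
    by (auto simp: eventually_nhds_conv_at elim: eventually_mono)
  then show "(f has_derivative (\<lambda>v. v \<bullet> 0)) (at x)" by simp
qed


section \<open>Test functions\<close>

text \<open>The usual smooth transition from 0 to 1 over the unit interval. The denominator never
  vanishes because \<open>t\<close> and \<open>1 - t\<close> are not both nonpositive.\<close>

definition step :: "real \<Rightarrow> real" where
  "step t = flat 0 t * inverse (flat 0 t + flat 0 (1 - t))"

text \<open>The quotient rule for \<open>step\<close>, with \<open>flat 2\<close> as the derivative
  of \<open>flat 0\<close>.\<close>

definition step' :: "real \<Rightarrow> real" where
  "step' t = (flat 2 t * (flat 0 t + flat 0 (1 - t)) - flat 0 t * (flat 2 t - flat 2 (1 - t)))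
     / (flat 0 t + flat 0 (1 - t))\<^sup>2"

lemma flat_sum_pos: "flat 0 t + flat 0 (1 - t) > 0"
  by (auto simp: flat_def add_nonneg_pos)

lemma step_deriv: "(step has_real_derivative step' t) (at t)"
proof -
  have *: "flat 0 t + flat 0 (1 - t) \<noteq> 0"
    using flat_sum_pos[of t] by simp
  have d: "(flat 0 has_real_derivative flat 2 t) (at t)" for t
    using flat_deriv[of 0 t] by (simp add: numeral_2_eq_2)
  have "((\<lambda>t. 1 - t) has_real_derivative -1) (at t)"
    by (auto intro!: derivative_eq_intros)
  then have "((\<lambda>t. flat 0 (1 - t)) has_real_derivative - flat 2 (1 - t)) (at t)"
    using DERIV_chain2[where f = "flat 0" and g = "\<lambda>t. 1 - t" and s = UNIV and x = t, OF d, of "-1"]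
    by simp
  then have "((\<lambda>t. flat 0 t / (flat 0 t + flat 0 (1 - t))) has_real_derivative
      ((flat 2 t) * (flat 0 t + flat 0 (1 - t)) - flat 0 t * (flat 2 t + - flat 2 (1 - t)))
        / ((flat 0 t + flat 0 (1 - t)) * (flat 0 t + flat 0 (1 - t)))) (at t)"
    using * by (intro DERIV_quotient[unfolded numeral_2_eq_2] DERIV_divide DERIV_add d)
  then show ?thesis
    unfolding step_def[abs_def] step'_def by (simp add: divide_inverse power2_eq_square)
qed

lemma flat_continuous: "continuous_on S (flat m)"
  by (meson DERIV_isCont continuous_at_imp_continuous_on flat_deriv)

lemma step'_continuous: "continuous_on S step'"
  unfolding step'_def[abs_def] using flat_sum_pos
  by (intro continuous_intros continuous_on_compose2[OF flat_continuous[of UNIV]])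
    (auto simp: less_imp_neq[symmetric])

lemma step_0 [simp]: "t \<le> 0 \<Longrightarrow> step t = 0"
  by (simp add: step_def flat_def)

lemma step_1 [simp]: "t \<ge> 1 \<Longrightarrow> step t = 1"
  by (simp add: step_def flat_def)

lemma step_nonneg: "step t \<ge> 0" and step_le_1: "step t \<le> 1"
  using flat_sum_pos[of t] flat_nonneg[of 0 t] flat_nonneg[of 0 "1 - t"]
  by (auto simp: step_def field_simps)

lemma step'_0: "t \<le> 0 \<or> t \<ge> 1 \<Longrightarrow> step' t = 0"
  by (auto simp: step'_def flat_def)

text \<open>Continuity on the unit interval, and zero elsewhere. This is the constant
  \<open>B\<close> in all later estimates of cut-off gradients.\<close>

lemma step'_bound: obtains B where "B > 0" "\<And>t. \<bar>step' t\<bar> \<le> B"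
proof -
  have "compact (step' ` {0..1})"
    by (intro compact_continuous_image step'_continuous) auto
  then obtain B where "\<And>t. t \<in> {0..1} \<Longrightarrow> \<bar>step' t\<bar> \<le> B"
    using compact_imp_bounded bounded_real by (metis (mono_tags, lifting) bounded_iff image_eqI real_norm_def)
  then have "\<bar>step' t\<bar> \<le> max B 1" for t
    using step'_0[of t] by (cases "t \<in> {0..1}") (force simp: max_def)+
  then show ?thesis
    by (intro that[of "max B 1"]) auto
qed

lemma smooth_step: "smooth (\<lambda>x. step (a \<bullet> x + b))"
proof -
  have fl: "smooth (\<lambda>x. flat 0 (a \<bullet> x + b))" for a b
    by (simp add: smooth_iff times_differentiable_flat)
  have "smooth (\<lambda>x. flat 0 (1 - (a \<bullet> x + b)))"
    using fl[of "-a" "1 - b"] by (simp add: algebra_simps)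
  then show ?thesis
    unfolding step_def using fl[of a b] flat_sum_pos
    by (intro smooth_mult smooth_inverse smooth_add) (auto simp: less_imp_neq[symmetric])
qed

lemma grad_step: "grad (\<lambda>x. step (a \<bullet> x + b)) x = step' (a \<bullet> x + b) *\<^sub>R a"
proof (rule gradI)
  have "((\<lambda>x. step (a \<bullet> x + b)) has_derivative (\<lambda>v. (a \<bullet> v) * step' (a \<bullet> x + b))) (at x)"
    by (rule derivative_eq_intros step_deriv[THEN DERIV_compose_FDERIV] refl ext | simp)+
  then show "((\<lambda>x. step (a \<bullet> x + b)) has_derivative (\<lambda>v. v \<bullet> step' (a \<bullet> x + b) *\<^sub>R a)) (at x)"
    by (simp add: inner_commute mult.commute)
qed

lemma test_functionI:
  assumes "smooth \<phi>" "compact C" "C \<subseteq> S" "\<And>x. x \<notin> C \<Longrightarrow> \<phi> x = 0"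
  shows "test_function S \<phi>"
proof -
  have "closure {x. \<phi> x \<noteq> 0} \<subseteq> C"
    using assms by (intro closure_minimal) (auto simp: compact_imp_closed)
  then show ?thesis
    unfolding test_function_def using assms bounded_subset[OF compact_imp_bounded closure_subset]
    by (auto intro: bounded_subset[OF compact_imp_bounded])
qed

lemma test_functionE:
  assumes "test_function S \<phi>"
  obtains C where "compact C" "C \<subseteq> S" "\<And>x. x \<notin> C \<Longrightarrow> \<phi> x = 0"
  using assms closure_subset[of "{x. \<phi> x \<noteq> 0}"] unfolding test_function_def by blast

lemma test_function_smooth: "test_function S \<phi> \<Longrightarrow> smooth \<phi>"
  by (simp add: test_function_def)

lemma test_function_mono: "test_function S \<phi> \<Longrightarrow> S \<subseteq> S' \<Longrightarrow> test_function S' \<phi>"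
  by (auto simp: test_function_def)

lemma test_function_mult:
  assumes "test_function S \<phi>" "smooth \<psi>"
  shows "test_function S (\<lambda>x. \<phi> x * \<psi> x)"
proof -
  obtain C where "compact C" "C \<subseteq> S" "\<And>x. x \<notin> C \<Longrightarrow> \<phi> x = 0"
    using assms test_functionE by blast
  then show ?thesis
    using smooth_mult[OF test_function_smooth[OF assms(1)] assms(2)] by (intro test_functionI[of _ C]) auto
qed

lemma test_function_mult':
  assumes "test_function S \<phi>" "smooth \<psi>"
  shows "test_function S (\<lambda>x. \<psi> x * \<phi> x)"
  using test_function_mult[OF assms] by (simp add: mult.commute)

lemma test_function_translate:
  assumes "test_function S \<phi>" "(\<lambda>x. x - c) ` S \<subseteq> S'"
  shows "test_function S' (\<lambda>x. \<phi> (x + c))"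
proof -
  obtain C where C: "compact C" "C \<subseteq> S" "\<And>x. x \<notin> C \<Longrightarrow> \<phi> x = 0"
    using assms(1) by (rule test_functionE) blast
  show ?thesis
  proof (rule test_functionI[where C = "(\<lambda>x. x - c) ` C"])
    show "smooth (\<lambda>x. \<phi> (x + c))"
      using assms by (simp add: smooth_translate test_function_smooth)
    show "compact ((\<lambda>x. x - c) ` C)"
      using C by (intro compact_continuous_image continuous_intros)
    show "(\<lambda>x. x - c) ` C \<subseteq> S'"
      using assms(2) C by blast
    show "\<phi> (x + c) = 0" if "x \<notin> (\<lambda>x. x - c) ` C" for x
      using C(3)[of "x + c"] that by (force simp: image_iff)
  qed
qed

lemma test_function_grad_0:
  assumes "test_function S \<phi>" "x \<notin> S"
  shows "\<phi> x = 0" "grad \<phi> x = 0"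
proof -
  obtain C where C: "compact C" "C \<subseteq> S" "\<And>x. x \<notin> C \<Longrightarrow> \<phi> x = 0"
    using assms test_functionE by blast
  then show "\<phi> x = 0" "grad \<phi> x = 0"
    using assms grad_eq_0_outside[of C \<phi> x] by (auto simp: compact_imp_closed)
qed

lemma test_function_grad:
  assumes "test_function S \<phi>"
  shows "test_function S (partial_deriv i \<phi>)"
proof -
  obtain C where C: "compact C" "C \<subseteq> S" "\<And>x. x \<notin> C \<Longrightarrow> \<phi> x = 0"
    using assms test_functionE by blast
  show ?thesis
  proof (rule test_functionI[OF _ C(1,2)])
    show "smooth (partial_deriv i \<phi>)"
      using assms smooth_partial_deriv test_function_smooth by blast
    show "partial_deriv i \<phi> x = 0" if "x \<notin> C" for x
      using grad_eq_0_outside[of C \<phi> x] C that by (metis compact_imp_closed grad_nth zero_index)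
  qed
qed

lemma test_function_bounded:
  assumes "test_function S \<phi>"
  obtains B where "B > 0" "\<And>x. \<bar>\<phi> x\<bar> \<le> B"
proof -
  obtain C where C: "compact C" "C \<subseteq> S" "\<And>x. x \<notin> C \<Longrightarrow> \<phi> x = 0"
    using assms test_functionE by blast
  have "compact (\<phi> ` C)"
    using C assms by (intro compact_continuous_image smooth_continuous_on) (auto dest: test_function_smooth)
  then obtain B where B: "\<And>x. x \<in> C \<Longrightarrow> \<bar>\<phi> x\<bar> \<le> B"
    by (metis (mono_tags, lifting) bounded_iff compact_imp_bounded image_eqI real_norm_def)
  show ?thesis
  proof (rule that[of "max B 1"])
    fix x show "\<bar>\<phi> x\<bar> \<le> max B 1"
      using B[of x] C(3)[of x] by (cases "x \<in> C") auto
  qed auto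
qed

lemma test_function_grad_bounded:
  assumes "test_function S \<phi>"
  obtains B where "B > 0" "\<And>x. norm (grad \<phi> x) \<le> B"
proof -
  have "\<exists>B>0. \<forall>x. \<bar>partial_deriv i \<phi> x\<bar> \<le> B" for i
    using test_function_bounded[OF test_function_grad[OF assms]] by metis
  then obtain B where B: "\<And>i x. \<bar>partial_deriv i \<phi> x\<bar> \<le> B i" "\<And>i. B i > 0" by metis
  have "norm (grad \<phi> x) \<le> (\<Sum>i\<in>UNIV. B i)" for x
    by (rule order_trans[OF norm_le_l1_cart]) (auto intro!: sum_mono B)
  moreover have "(\<Sum>i\<in>UNIV. B i) > 0"
    using B(2) by (intro sum_pos) auto
  ultimately show ?thesis
    using that by blast
qed

lemma test_function_continuous_on: "test_function S \<phi> \<Longrightarrow> continuous_on A \<phi>"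
  by (simp add: smooth_continuous_on test_function_smooth)

section \<open>Smooth bumps inside a box\<close>

text \<open>For positive \<open>k\<close> each coordinate contributes two factors, which vanish
  within distance \<open>1 / k\<close> of the corresponding side of the box and equal 1 beyond
  distance \<open>2 / k\<close>; hence the limit is the indicator of the open box.\<close>

definition box_bump :: "nat \<Rightarrow> real^'n \<Rightarrow> real^'n \<Rightarrow> real^'n \<Rightarrow> real" where
  "box_bump k a b x = (\<Prod>i\<in>UNIV. step (real k * (x $ i - a $ i) - 1) * step (real k * (b $ i - x $ i) - 1))"

lemma box_bump_range: "0 \<le> box_bump k a b x" "box_bump k a b x \<le> 1"
  unfolding box_bump_def
  by (auto intro!: prod_nonneg prod_le_1 mult_nonneg_nonneg mult_le_one simp: step_nonneg step_le_1)

lemma test_function_box_bump: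
  "test_function (box a b) (box_bump k a b)"
proof (rule test_functionI)
  have "smooth (\<lambda>x. step (real k * (x $ i - a $ i) - 1))" for i
    using smooth_step[of "real k *\<^sub>R axis i 1" "- real k * a $ i - 1"]
    by (simp add: inner_axis' algebra_simps)
  moreover have "smooth (\<lambda>x. step (real k * (b $ i - x $ i) - 1))" for i
    using smooth_step[of "- real k *\<^sub>R axis i 1" "real k * b $ i - 1"]
    by (simp add: inner_axis' algebra_simps)
  ultimately show "smooth (box_bump k a b)"
    unfolding box_bump_def[abs_def] by (intro smooth_prod smooth_mult)
  let ?C = "cbox (\<chi> i. a $ i + 1 / real k) (\<chi> i. b $ i - 1 / real k)"
  \<comment> \<open>For \<open>k = 0\<close> every factor is \<open>step (-1)\<close>, so the
    function is zero; but \<open>1 / real 0 = 0\<close> would make \<open>?C\<close> the closed box,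
    which need not lie in the open one. Hence the empty set takes its place in that case.\<close>
  show "compact (if k = 0 then {} else ?C)" by auto
  show "(if k = 0 then {} else ?C) \<subseteq> box a b"
    by (auto simp: mem_box_cart split: if_splits)
      (smt (verit) divide_pos_pos of_nat_0_less_iff)+
  show "box_bump k a b x = 0" if "x \<notin> (if k = 0 then {} else ?C)" for x
  proof (cases "k = 0")
    case False
    then have "\<exists>i. x $ i < a $ i + 1 / real k \<or> x $ i > b $ i - 1 / real k"
      using that by (simp add: mem_box_cart) (meson not_le)
    then obtain i where "x $ i < a $ i + 1 / real k \<or> x $ i > b $ i - 1 / real k"
      by blast
    then have "real k * (x $ i - a $ i) - 1 \<le> 0 \<or> real k * (b $ i - x $ i) - 1 \<le> 0"
      using False by (auto simp: field_simps)
    then have "step (real k * (x $ i - a $ i) - 1) * step (real k * (b $ i - x $ i) - 1) = 0"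
      by auto
    then show ?thesis
      unfolding box_bump_def by (intro prod_zero) auto
  qed (simp add: box_bump_def)
qed

lemma box_bump_tendsto: "(\<lambda>k. box_bump k a b x) \<longlonglongrightarrow> indicator (box a b) x"
proof (cases "x \<in> box a b")
  case True
  have "\<forall>\<^sub>F k in sequentially. step (real k * (x $ i - a $ i) - 1) * step (real k * (b $ i - x $ i) - 1) = 1" for i
  proof -
    have pos: "x $ i - a $ i > 0" "b $ i - x $ i > 0"
      using True by (auto simp: mem_box_cart)
    have *: "\<forall>\<^sub>F k in sequentially. real k * c - 1 \<ge> 1" if "c > 0" for c
    proof -
      have "\<forall>\<^sub>F k in sequentially. real k \<ge> 2 / c"
        using filterlim_real_sequentially filterlim_at_top by blast
      then show ?thesis
        by eventually_elim (use that in \<open>simp add: field_simps\<close>)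
    qed
    show ?thesis
      using eventually_conj[OF *[OF pos(1)] *[OF pos(2)]]
      by (auto simp: mult.commute elim!: eventually_mono)
  qed
  then have "\<forall>\<^sub>F k in sequentially. \<forall>i. step (real k * (x $ i - a $ i) - 1) * step (real k * (b $ i - x $ i) - 1) = 1"
    by (simp add: eventually_all_finite)
  then have "\<forall>\<^sub>F k in sequentially. box_bump k a b x = 1"
    by eventually_elim (simp add: box_bump_def)
  then show ?thesis
    using True by (simp add: tendsto_eventually)
next
  case False
  then show ?thesis
    using test_function_grad_0(1)[OF test_function_box_bump False] by simp
qed

section \<open>The fundamental lemma of the calculus of variations\<close>

text \<open>The bumps take values between 0 and 1, so dominated convergence with majorant
  \<open>norm (j x)\<close> replaces a test function by the indicator of a box.\<close>

lemma integral_box_eq_0: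
  fixes j :: "real^'n \<Rightarrow> real"
  assumes M: "sets M = sets borel" and j: "integrable M j"
    and zero: "\<And>\<phi>. test_function U \<phi> \<Longrightarrow> (LINT x|M. \<phi> x * j x) = 0"
    and sub: "box a b \<subseteq> U"
  shows "(LINT x|M. indicator (box a b) x * j x) = 0"
proof -
  have bm: "box_bump k a b \<in> borel_measurable M" for k
    using M test_function_continuous_on[OF test_function_box_bump, of UNIV]
    by (metis borel_measurable_continuous_onI measurable_cong_sets)
  have [measurable]: "box a b \<in> sets M"
    using M by simp
  have "(\<lambda>k. LINT x|M. box_bump k a b x * j x) \<longlonglongrightarrow> (LINT x|M. indicator (box a b) x * j x)"
  proof (rule integral_dominated_convergence[where w = "\<lambda>x. norm (j x)"])
    show "AE x in M. (\<lambda>k. box_bump k a b x * j x) \<longlonglongrightarrow> indicator (box a b) x * j x"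
      by (intro AE_I2 tendsto_mult box_bump_tendsto tendsto_const)
    show "AE x in M. norm (box_bump k a b x * j x) \<le> norm (j x)" for k
      by (intro AE_I2) (simp add: abs_mult box_bump_range mult_left_le_one_le)
  qed (use j bm in auto)
  moreover have "(LINT x|M. box_bump k a b x * j x) = 0" for k
    by (intro zero test_function_mono[OF test_function_box_bump sub])
  ultimately show ?thesis
    by (simp add: LIMSEQ_const_iff)
qed

lemma box_Int_box_ex: "\<exists>p q. box a b \<inter> box c d = box p (q :: 'a::euclidean_space)"
  by (intro exI) (rule box_Int_box)

text \<open>Boxes are stable under intersection and generate the Borel sets, so the signed measure
  with density \<open>j\<close> vanishes on all Borel subsets of a box in \<open>U\<close>;
  countably many boxes exhaust \<open>U\<close>. The measure is left general because the lemma
  serves both \<open>lborel\<close> and the surface measures \<open>hyp\<close>.\<close>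

lemma AE_0_if_test_integrals_0:
  fixes j :: "real^'n \<Rightarrow> real"
  assumes M: "sets M = sets borel" and j: "integrable M j" and "open U"
    and zero: "\<And>\<phi>. test_function U \<phi> \<Longrightarrow> (LINT x|M. \<phi> x * j x) = 0"
  shows "AE x in M. x \<in> U \<longrightarrow> j x = 0"
proof -
  have [measurable_cong]: "sets M = sets borel" by fact
  have j_meas[measurable]: "j \<in> borel_measurable M" using j by simp
  have box: "AE x in M. x \<in> box a b \<longrightarrow> j x = 0" if sub: "box a b \<subseteq> U" for a b
  proof -
    let ?B = "box a b"
    let ?G = "range (\<lambda>(a, b). box a b :: (real^'n) set)"
    have B_meas[measurable]: "?B \<in> sets M" using M by simp
    have int: "integrable M (\<lambda>x. indicator (A \<inter> ?B) x * j x)" if "A \<in> sets M" for A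
      using that by (intro integrable_real_mult_indicator[where f = j, unfolded mult.commute[of "j _"]] j) auto
    have sm: "sets M = sigma_sets UNIV ?G"
      using M by (simp add: borel_eq_box)
    \<comment> \<open>Dynkin induction. Intersecting with the fixed box \<open>?B\<close> keeps
      every set inside \<open>U\<close>, where the integrals over boxes are known.\<close>
    have main: "(LINT x|M. indicator (A \<inter> ?B) x * j x) = 0" if "A \<in> sigma_sets UNIV ?G" for A
    proof (rule sigma_sets_induct_disjoint[OF _ _ that])
      show "Int_stable ?G"
      proof (rule Int_stableI)
        fix A B assume "A \<in> ?G" "B \<in> ?G"
        then obtain a b c d where "A = box a b" "B = box c d" by auto
        then show "A \<inter> B \<in> ?G"
          using box_Int_box_ex[of a b c d] by auto
      qed
    next
      fix A assume "A \<in> ?G"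
      then obtain c d where "A = box c d" by auto
      then obtain p q where pq: "A \<inter> ?B = box p q"
        using box_Int_box_ex by metis
      then have "box p q \<subseteq> U" using sub by blast
      from integral_box_eq_0[OF M j zero this] show "(LINT x|M. indicator (A \<inter> ?B) x * j x) = 0"
        by (simp add: pq)
    next
      fix A assume A: "A \<in> sigma_sets UNIV ?G" "(LINT x|M. indicator (A \<inter> ?B) x * j x) = 0"
      then have Am: "A \<in> sets M" by (simp add: sm)
      have "(LINT x|M. indicator ((UNIV - A) \<inter> ?B) x * j x)
          = (LINT x|M. indicator (UNIV \<inter> ?B) x * j x - indicator (A \<inter> ?B) x * j x)"
        by (intro Bochner_Integration.integral_cong) (auto simp: indicator_def)
      also have "\<dots> = (LINT x|M. indicator (UNIV \<inter> ?B) x * j x) - (LINT x|M. indicator (A \<inter> ?B) x * j x)"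
        using M by (intro Bochner_Integration.integral_diff int Am) auto
      also have "\<dots> = 0"
        using A integral_box_eq_0[OF M j zero sub] by simp
      finally show "(LINT x|M. indicator ((UNIV - A) \<inter> ?B) x * j x) = 0" .
    next
      fix A :: "nat \<Rightarrow> _"
      assume d: "disjoint_family A" and A: "range A \<subseteq> sigma_sets UNIV ?G"
        "\<And>i. (LINT x|M. indicator (A i \<inter> ?B) x * j x) = 0"
      have "A i \<in> sets M" for i using A(1) by (auto simp: sm)
      then have Am: "A i \<inter> ?B \<in> sets M" for i by auto
      have si: "set_integrable M (\<Union>i. A i \<inter> ?B) j"
        unfolding set_integrable_def using Am by (intro integrable_mult_indicator j sets.countable_UN) auto
      have "(\<Union>i. A i \<inter> ?B) = (\<Union>i. A i) \<inter> ?B" by auto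
      moreover have "(LINT x:(\<Union>i. A i \<inter> ?B)|M. j x) = (\<Sum>i. (LINT x:(A i \<inter> ?B)|M. j x))"
        using d by (intro lebesgue_integral_countable_add Am si) (auto simp: disjoint_family_on_def)
      ultimately show "(LINT x|M. indicator ((\<Union>i. A i) \<inter> ?B) x * j x) = 0"
        using A(2) by (simp add: set_lebesgue_integral_def)
    qed auto
    have "AE x in M. indicator ?B x * j x = 0"
    proof (rule density_unique_real)
      show "integrable M (\<lambda>x. indicator ?B x * j x)"
        using int[of UNIV] M by simp
      fix A assume "A \<in> sets M"
      then have "(LINT x|M. indicator (A \<inter> ?B) x * j x) = 0"
        using main by (simp add: sm)
      then show "(LINT x:A|M. indicator ?B x * j x) = (LINT x:A|M. 0)"
        by (simp add: set_lebesgue_integral_def indicator_inter_arith mult.assoc)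
    qed auto
    then show ?thesis
      by (auto simp: indicator_def elim!: eventually_mono)
  qed
  \<comment> \<open>Boxes with rational corners in the encoding of \<open>open_UNION_box\<close>;
    there are countably many of them.\<close>
  define a' where "a' = (\<lambda>f :: real^'n \<Rightarrow> real \<times> real. (\<Sum>i\<in>Basis. fst (f i) *\<^sub>R i))"
  define b' where "b' = (\<lambda>f :: real^'n \<Rightarrow> real \<times> real. (\<Sum>i\<in>Basis. snd (f i) *\<^sub>R i))"
  define I where "I = {f\<in>Basis \<rightarrow>\<^sub>E \<rat> \<times> \<rat>. box (a' f) (b' f) \<subseteq> U}"
  have U: "U = (\<Union>f\<in>I. box (a' f) (b' f))"
    unfolding I_def a'_def b'_def by (rule open_UNION_box[OF \<open>open U\<close>])
  have "countable I"
    unfolding I_def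
    by (rule countable_subset[of _ "Basis \<rightarrow>\<^sub>E \<rat> \<times> \<rat>"])
      (auto intro!: countable_PiE countable_SIGMA countable_rat)
  then have "AE x in M. \<forall>f\<in>I. x \<in> box (a' f) (b' f) \<longrightarrow> j x = 0"
    by (subst AE_ball_countable) (auto simp: I_def intro!: box)
  then show ?thesis
    by (subst U) (auto elim!: eventually_mono)
qed


section \<open>Weak derivatives\<close>

lemma test_function_integrable:
  fixes \<phi> :: "real^'n \<Rightarrow> real"
  assumes "test_function S \<phi>"
  shows "integrable lborel \<phi>"
proof -
  obtain C where C: "compact C" "C \<subseteq> S" "\<And>x. x \<notin> C \<Longrightarrow> \<phi> x = 0"
    using assms by (rule test_functionE) blast
  have "integrable lborel (\<lambda>x. indicator C x *\<^sub>R \<phi> x)"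
    using C assms by (intro borel_integrable_compact test_function_continuous_on)
  moreover have "(\<lambda>x. indicator C x *\<^sub>R \<phi> x) = \<phi>"
    using C(3) by (auto simp: fun_eq_iff indicator_def)
  ultimately show ?thesis by simp
qed

lemma borel_measurable_smooth: "smooth \<phi> \<Longrightarrow> \<phi> \<in> borel_measurable borel"
  by (intro borel_measurable_continuous_onI smooth_continuous_on)

lemma borel_measurable_grad: "smooth \<phi> \<Longrightarrow> grad \<phi> \<in> borel_measurable borel"
  by (intro borel_measurable_continuous_onI smooth_grad_continuous_on)

lemma borel_measurable_partial_deriv: "smooth \<phi> \<Longrightarrow> partial_deriv i \<phi> \<in> borel_measurable borel"
  by (intro borel_measurable_smooth smooth_partial_deriv)

lemma smooth_bound_on_segment:
  assumes "smooth \<phi>" "\<And>x. norm (grad \<phi> x) \<le> B"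
  shows "\<bar>\<phi> (x + v) - \<phi> x\<bar> \<le> B * norm v"
proof -
  have "norm (\<phi> (x + v) - \<phi> x) \<le> B * norm (x + v - x)"
  proof (rule differentiable_bound[where S = UNIV and f' = "\<lambda>x h. h \<bullet> grad \<phi> x"])
    show "onorm (\<lambda>h. h \<bullet> grad \<phi> x) \<le> B" for x
    proof (rule onorm_le)
      fix h have "norm (h \<bullet> grad \<phi> x) \<le> norm h * norm (grad \<phi> x)"
        using Cauchy_Schwarz_ineq2[of h "grad \<phi> x"] by simp
      also have "\<dots> \<le> B * norm h"
        using assms(2)[of x] by (simp add: mult.commute[of B] mult_left_mono)
      finally show "norm (h \<bullet> grad \<phi> x) \<le> B * norm h" .
    qed
  qed (auto intro: has_derivative_at_withinI smooth_has_derivative assms(1))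
  then show ?thesis by simp
qed

lemma integral_lborel_translate:
  fixes f :: "'a::euclidean_space \<Rightarrow> real"
  shows "(LINT x|lborel. f (x + c)) = (LINT x|lborel. f x)"
proof -
  have "(+) c = (\<lambda>x. x + c)" by (simp add: fun_eq_iff add.commute)
  then have "lborel = distr lborel borel (\<lambda>x. x + c)"
    using lborel_distr_plus[of c] by metis
  show ?thesis
  proof (cases "f \<in> borel_measurable borel")
    case True
    then show ?thesis
      by (subst (2) \<open>lborel = distr lborel borel (\<lambda>x. x + c)\<close>, subst integral_distr) auto
  next
    case False
    \<comment> \<open>Without measurability neither function is integrable, and both integrals have
      the default value 0.\<close>
    have "\<not> integrable lborel f" using False by (auto dest: borel_measurable_integrable)
    moreover have "\<not> integrable lborel (\<lambda>x. f (x + c))"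
    proof
      assume "integrable lborel (\<lambda>x. f (x + c))"
      then have "(\<lambda>x. f (x + c)) \<in> borel_measurable borel" by auto
      then have "(\<lambda>x. f (x - c + c)) \<in> borel_measurable borel"
        by (rule measurable_compose[rotated]) simp
      then show False using False by simp
    qed
    ultimately show ?thesis by (simp add: not_integrable_integral_eq)
  qed
qed

lemma tendsto_difference_quotient:
  fixes \<phi> :: "real^'n \<Rightarrow> real"
  assumes "smooth \<phi>"
  shows "(\<lambda>k. real (Suc k) * (\<phi> (x + (1 / real (Suc k)) *\<^sub>R v) - \<phi> x)) \<longlonglongrightarrow> v \<bullet> grad \<phi> x"
proof -
  have "((\<lambda>t. x + t *\<^sub>R v) has_derivative (\<lambda>t. t *\<^sub>R v)) (at 0)"
    by (auto intro!: derivative_eq_intros)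
  then have "((\<lambda>t. \<phi> (x + t *\<^sub>R v)) has_derivative (\<lambda>t. (t *\<^sub>R v) \<bullet> grad \<phi> x)) (at 0)"
    by (rule has_derivative_compose) (simp add: smooth_has_derivative assms)
  then have "((\<lambda>t. \<phi> (x + t *\<^sub>R v)) has_real_derivative v \<bullet> grad \<phi> x) (at 0)"
    unfolding has_field_derivative_def by (rule has_derivative_eq_rhs) (simp add: fun_eq_iff)
  then have "((\<lambda>h. (\<phi> (x + h *\<^sub>R v) - \<phi> x) / h) \<longlongrightarrow> v \<bullet> grad \<phi> x) (at 0)"
    by (simp add: DERIV_def)
  moreover have "filterlim (\<lambda>k. 1 / real (Suc k)) (at 0) sequentially"
    unfolding filterlim_at using LIMSEQ_inverse_real_of_nat by (auto simp: inverse_eq_divide)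
  ultimately have "(\<lambda>k. (\<phi> (x + (1 / real (Suc k)) *\<^sub>R v) - \<phi> x) / (1 / real (Suc k))) \<longlonglongrightarrow> v \<bullet> grad \<phi> x"
    by (rule filterlim_compose)
  then show ?thesis by (simp add: mult.commute)
qed

text \<open>Difference quotients have integral zero by translation invariance, and they converge
  boundedly, on a fixed ball, to the derivative. This treats every direction \<open>v\<close> at
  once.\<close>

lemma integral_test_function_grad:
  fixes \<phi> :: "real^'n \<Rightarrow> real"
  assumes "test_function S \<phi>"
  shows "(LINT x|lborel. v \<bullet> grad \<phi> x) = 0"
proof -
  obtain B where B: "B > 0" "\<And>x. norm (grad \<phi> x) \<le> B"
    using assms by (rule test_function_grad_bounded) blast
  obtain C where C: "compact C" "C \<subseteq> S" "\<And>x. x \<notin> C \<Longrightarrow> \<phi> x = 0"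
    using assms by (rule test_functionE) blast
  have sm: "smooth \<phi>" using assms by (rule test_function_smooth)
  note [measurable] = borel_measurable_smooth[OF sm] borel_measurable_grad[OF sm]
  obtain R where R: "C \<subseteq> cball 0 R"
    using C(1) using bounded_subset_cbox_symmetric bounded_pos compact_imp_bounded by (metis mem_cball_0 subsetI)
  \<comment> \<open>The shifts have length at most \<open>norm v\<close>, so both terms of the
    quotient vanish outside the enlarged ball.\<close>
  let ?K = "cball (0::real^'n) (R + norm v)"
  let ?q = "\<lambda>k x. real (Suc k) * (\<phi> (x + (1 / real (Suc k)) *\<^sub>R v) - \<phi> x)"
  have "(\<lambda>k. LINT x|lborel. ?q k x) \<longlonglongrightarrow> (LINT x|lborel. v \<bullet> grad \<phi> x)"
  proof (rule integral_dominated_convergence[where w = "\<lambda>x. indicator ?K x * (B * norm v)"])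
    show "AE x in lborel. (\<lambda>k. ?q k x) \<longlonglongrightarrow> v \<bullet> grad \<phi> x"
      by (intro AE_I2 tendsto_difference_quotient sm)
    show "integrable lborel (\<lambda>x. indicator ?K x * (B * norm v))"
      by (intro integrable_mult_left integrable_real_indicator)
        (auto intro!: emeasure_bounded_finite[unfolded infinity_ennreal_def])
    show "AE x in lborel. norm (?q k x) \<le> indicator ?K x * (B * norm v)" for k
    proof (rule AE_I2)
      fix x :: "real^'n"
      let ?w = "(1 / real (Suc k)) *\<^sub>R v"
      have nw: "norm ?w \<le> norm v"
        using mult_right_mono[of 1 "real (Suc k)" "norm v"] by (simp add: field_simps)
      show "norm (?q k x) \<le> indicator ?K x * (B * norm v)"
      proof (cases "x \<in> ?K")
        case True
        have "norm (?q k x) = real (Suc k) * \<bar>\<phi> (x + ?w) - \<phi> x\<bar>"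
          by (simp add: abs_mult)
        also have "\<dots> \<le> real (Suc k) * (B * norm ?w)"
          by (intro mult_left_mono smooth_bound_on_segment sm B) auto
        also have "\<dots> = B * norm v" by simp
        finally show ?thesis using True by simp
      next
        case False
        then have "norm x > R + norm v" by simp
        moreover have "norm (x + ?w) \<ge> norm x - norm ?w"
          by (metis add.commute norm_diff_ineq)
        ultimately have "x \<notin> cball 0 R" "x + ?w \<notin> cball 0 R"
          using nw norm_ge_zero[of v] unfolding mem_cball_0 by linarith+
        then have "\<phi> x = 0" "\<phi> (x + ?w) = 0" using R C(3) by blast+
        then show ?thesis using False by simp
      qed
    qed
  qed measurable
  moreover have "(LINT x|lborel. ?q k x) = 0" for k
  proof -
    have "integrable lborel (\<lambda>x. \<phi> (x + (1 / real (Suc k)) *\<^sub>R v))"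
      by (rule test_function_integrable[OF test_function_translate[OF assms, of _ UNIV]]) simp
    then have "(LINT x|lborel. \<phi> (x + (1 / real (Suc k)) *\<^sub>R v) - \<phi> x) = 0"
      using test_function_integrable[OF assms]
      by (simp add: integral_lborel_translate)
    then show ?thesis by simp
  qed
  ultimately show ?thesis by (simp add: LIMSEQ_const_iff)
qed

text \<open>The derivative of the product integrates to zero. Compact support is asked of one factor
  only: in \<open>H10_extension\<close> the other one may be nonzero on the boundary of the
  domain.\<close>

lemma integral_by_parts_test_function:
  fixes \<phi> :: "real^'n \<Rightarrow> real"
  assumes "test_function S \<phi>" "smooth \<psi>"
  shows "(LINT x|lborel. \<phi> x * (v \<bullet> grad \<psi> x)) = - (LINT x|lborel. (v \<bullet> grad \<phi> x) * \<psi> x)"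
proof -
  have i1: "integrable lborel (\<lambda>x. partial_deriv i \<phi> x * \<psi> x)" for i
    by (rule test_function_integrable[OF test_function_mult[OF test_function_grad[OF assms(1)] assms(2)]])
  have i2: "integrable lborel (\<lambda>x. \<phi> x * partial_deriv i \<psi> x)" for i
    by (rule test_function_integrable[OF test_function_mult[OF assms(1) smooth_partial_deriv[OF assms(2)]]])
  have "integrable lborel (\<lambda>x. \<Sum>i\<in>UNIV. v $ i * (partial_deriv i \<phi> x * \<psi> x))"
    by (intro Bochner_Integration.integrable_sum integrable_mult_right i1)
  then have I1: "integrable lborel (\<lambda>x. (v \<bullet> grad \<phi> x) * \<psi> x)"
    by (simp add: inner_vec_def sum_distrib_right mult.assoc)
  have "integrable lborel (\<lambda>x. \<Sum>i\<in>UNIV. v $ i * (\<phi> x * partial_deriv i \<psi> x))"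
    by (intro Bochner_Integration.integrable_sum integrable_mult_right i2)
  then have I2: "integrable lborel (\<lambda>x. \<phi> x * (v \<bullet> grad \<psi> x))"
    by (simp add: inner_vec_def sum_distrib_left mult_ac)
  have "(LINT x|lborel. v \<bullet> grad (\<lambda>x. \<phi> x * \<psi> x) x) = 0"
    by (rule integral_test_function_grad[OF test_function_mult[OF assms]])
  then have "(LINT x|lborel. (v \<bullet> grad \<phi> x) * \<psi> x + \<phi> x * (v \<bullet> grad \<psi> x)) = 0"
    using assms by (simp add: grad_mult test_function_smooth inner_add_right mult.commute)
  then show ?thesis
    using I1 I2 by simp
qed

section \<open>Borel representatives and uniqueness of weak derivatives\<close>

text \<open>A function in \<open>L2 S\<close> is only Lebesgue measurable, and arbitrary off
  \<open>S\<close>. The arguments on lines need Borel functions on the whole space, because the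
  product measures are formed from \<open>lborel\<close>. Integrability follows from
  \<open>\<bar>f' x\<bar> \<le> 1 + (f' x)\<^sup>2\<close> on the bounded set
  \<open>S\<close>.\<close>

lemma L2_representative:
  fixes f :: "real^'n \<Rightarrow> real"
  assumes "open S" "bounded S" "L2 S f"
  obtains f' where "f' \<in> borel_measurable borel" "integrable lborel f'" "integrable lborel (\<lambda>x. (f' x)\<^sup>2)"
    "\<And>x. x \<notin> S \<Longrightarrow> f' x = 0" "AE x in lborel. x \<in> S \<longrightarrow> f x = f' x"
proof -
  have S[measurable]: "S \<in> sets borel" using assms by simp
  have f: "f \<in> borel_measurable (lebesgue_on S)" "integrable (lebesgue_on S) (\<lambda>x. (f x)\<^sup>2)"
    using assms(3) by (auto simp: L2_def)
  have "(\<lambda>x. if x \<in> S then f x else 0) \<in> borel_measurable lebesgue"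
    using f(1) by (subst borel_measurable_if) auto
  then obtain f0 where f0: "f0 \<in> borel_measurable borel" "AE x in lborel. (if x \<in> S then f x else 0) = f0 x"
    using completion_ex_borel_measurable_real[of _ lborel] by auto
  define f' where "f' x = indicator S x * f0 x" for x
  have m[measurable]: "f' \<in> borel_measurable borel"
    unfolding f'_def using f0(1) by measurable
  have ae: "AE x in lborel. x \<in> S \<longrightarrow> f x = f' x"
    using f0(2) by (auto simp: f'_def elim!: eventually_mono)
  have "integrable lebesgue (\<lambda>x. indicator S x *\<^sub>R (f x)\<^sup>2)"
    using f(2) by (subst (asm) integrable_restrict_space) auto
  then have "integrable lebesgue (\<lambda>x. (f' x)\<^sup>2)"
  proof (rule integrable_cong_AE_imp)
    show "AE x in lebesgue. indicator S x *\<^sub>R (f x)\<^sup>2 = (f' x)\<^sup>2"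
      using AE_completion[OF ae] by (auto simp: f'_def indicator_def elim!: eventually_mono)
  qed (use m in \<open>auto intro: measurable_completion\<close>)
  then have sq: "integrable lborel (\<lambda>x. (f' x)\<^sup>2)"
    by (simp add: integrable_completion)
  have "integrable lborel (\<lambda>x. indicator S x + (f' x)\<^sup>2 :: real)"
    using sq assms(2) by (intro Bochner_Integration.integrable_add integrable_real_indicator)
      (auto intro!: emeasure_bounded_finite[unfolded infinity_ennreal_def])
  then have "integrable lborel f'"
  proof (rule Bochner_Integration.integrable_bound)
    have "\<bar>f' x\<bar> \<le> indicator S x + (f' x)\<^sup>2" for x
    proof (cases "x \<in> S")
      case True
      have "0 \<le> (\<bar>f' x\<bar> - 1)\<^sup>2" by simp
      then have "2 * \<bar>f' x\<bar> \<le> 1 + (f' x)\<^sup>2" by (simp add: power2_eq_square algebra_simps)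
      moreover have "0 \<le> (f' x)\<^sup>2" by simp
      ultimately show ?thesis using True by simp
    qed (simp add: f'_def)
    then show "AE x in lborel. norm (f' x) \<le> norm (indicator S x + (f' x)\<^sup>2 :: real)"
      by (intro AE_I2) (auto intro: order_trans)
  qed simp
  then show ?thesis
    using that m sq ae by (auto simp: f'_def)
qed

lemma integral_lebesgue_on_representative:
  fixes F F' :: "'a::euclidean_space \<Rightarrow> real"
  assumes "S \<in> sets borel" "F \<in> borel_measurable (lebesgue_on S)" "F' \<in> borel_measurable borel"
    and "\<And>x. x \<notin> S \<Longrightarrow> F' x = 0" and "AE x in lborel. x \<in> S \<longrightarrow> F x = F' x"
  shows "(LINT x|lebesgue_on S. F x) = (LINT x|lborel. F' x)"
proof -
  have "(LINT x|lebesgue_on S. F x) = (LINT x|lebesgue. indicator S x *\<^sub>R F x)"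
    using assms(1) by (intro integral_restrict_space) auto
  also have "\<dots> = (LINT x|lebesgue. F' x)"
  proof (rule integral_cong_AE)
    have "(\<lambda>x. if x \<in> S then F x else 0) \<in> borel_measurable lebesgue"
      using assms(1,2) by (subst borel_measurable_if) auto
    then show "(\<lambda>x. indicator S x *\<^sub>R F x) \<in> borel_measurable lebesgue"
      by (rule measurable_cong[THEN iffD1, rotated]) (auto simp: indicator_def)
    show "F' \<in> borel_measurable lebesgue"
      using assms(3) by (auto intro: measurable_completion)
    show "AE x in lebesgue. indicator S x *\<^sub>R F x = F' x"
      using AE_completion[OF assms(5)] assms(4) by (auto simp: indicator_def elim!: eventually_mono)
  qed
  also have "\<dots> = (LINT x|lborel. F' x)"
    using assms(3) by (intro integral_completion) simp
  finally show ?thesis .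
qed

text \<open>Weak derivatives ignore null sets, so the definition over \<open>lebesgue_on S\<close>
  can be read as an identity over \<open>lborel\<close> for Borel representatives extended by
  zero.\<close>

lemma weak_partial_iff_representative:
  fixes f g :: "real^'n \<Rightarrow> real"
  assumes S: "open S" and "L2 S f" "L2 S g"
    and f': "f' \<in> borel_measurable borel" "\<And>x. x \<notin> S \<Longrightarrow> f' x = 0" "AE x in lborel. x \<in> S \<longrightarrow> f x = f' x"
    and g': "g' \<in> borel_measurable borel" "\<And>x. x \<notin> S \<Longrightarrow> g' x = 0" "AE x in lborel. x \<in> S \<longrightarrow> g x = g' x"
  shows "weak_partial S i f g \<longleftrightarrow> (\<forall>\<phi>. test_function S \<phi> \<longrightarrow>
     (LINT x|lborel. f' x * (axis i 1 \<bullet> grad \<phi> x)) = - (LINT x|lborel. g' x * \<phi> x))"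
proof -
  have fg: "f \<in> borel_measurable (lebesgue_on S)" "g \<in> borel_measurable (lebesgue_on S)"
    using assms by (auto simp: L2_def)
  have *: "(LINT x|lebesgue_on S. f x * partial_deriv i \<phi> x) = (LINT x|lborel. f' x * (axis i 1 \<bullet> grad \<phi> x))"
    "(LINT x|lebesgue_on S. g x * \<phi> x) = (LINT x|lborel. g' x * \<phi> x)" if "test_function S \<phi>" for \<phi>
  proof -
    have b: "\<phi> \<in> borel_measurable borel" "partial_deriv i \<phi> \<in> borel_measurable borel"
      using test_function_smooth[OF that] by (auto intro: borel_measurable_smooth borel_measurable_partial_deriv)
    have "id \<in> borel_measurable (lebesgue_on S)" by simp
    then have "\<phi> \<in> borel_measurable (lebesgue_on S)" "partial_deriv i \<phi> \<in> borel_measurable (lebesgue_on S)"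
      using b[THEN measurable_compose[rotated], of id] by auto
    then show "(LINT x|lebesgue_on S. g x * \<phi> x) = (LINT x|lborel. g' x * \<phi> x)"
      using g' b S fg
      by (intro integral_lebesgue_on_representative borel_measurable_times) (auto elim!: eventually_mono)
    have "(LINT x|lebesgue_on S. f x * partial_deriv i \<phi> x) = (LINT x|lborel. f' x * partial_deriv i \<phi> x)"
      using f' b S fg \<open>partial_deriv i \<phi> \<in> borel_measurable (lebesgue_on S)\<close>
      by (intro integral_lebesgue_on_representative borel_measurable_times) (auto elim!: eventually_mono)
    then show "(LINT x|lebesgue_on S. f x * partial_deriv i \<phi> x) = (LINT x|lborel. f' x * (axis i 1 \<bullet> grad \<phi> x))"
      by (simp add: inner_axis')
  qed
  show ?thesis
    unfolding weak_partial_def using * by (auto simp: *)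
qed

text \<open>The difference of two candidates is orthogonal to all test functions, so the fundamental
  lemma applies to their representatives.\<close>

lemma weak_partial_unique:
  fixes f :: "real^'n \<Rightarrow> real"
  assumes "open S" "bounded S" "L2 S f" "L2 S g" "L2 S h" "weak_partial S i f g" "weak_partial S i f h"
  shows "AE x in lborel. x \<in> S \<longrightarrow> g x = h x"
proof -
  obtain f' where f': "f' \<in> borel_measurable borel" "\<And>x. x \<notin> S \<Longrightarrow> f' x = 0" "AE x in lborel. x \<in> S \<longrightarrow> f x = f' x"
    by (rule L2_representative[OF assms(1,2,3)]) blast
  obtain g' where g': "g' \<in> borel_measurable borel" "\<And>x. x \<notin> S \<Longrightarrow> g' x = 0" "AE x in lborel. x \<in> S \<longrightarrow> g x = g' x"
    and gi: "integrable lborel g'"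
    by (rule L2_representative[OF assms(1,2,4)]) blast
  obtain h' where h': "h' \<in> borel_measurable borel" "\<And>x. x \<notin> S \<Longrightarrow> h' x = 0" "AE x in lborel. x \<in> S \<longrightarrow> h x = h' x"
    and hi: "integrable lborel h'"
    by (rule L2_representative[OF assms(1,2,5)]) blast
  have "AE x in lborel. x \<in> S \<longrightarrow> g' x - h' x = 0"
  proof (rule AE_0_if_test_integrals_0[OF _ _ assms(1)])
    fix \<phi> assume \<phi>: "test_function S \<phi>"
    have i: "integrable lborel (\<lambda>x. \<phi> x * k x)" if "integrable lborel k" for k
    proof -
      obtain B where B: "\<And>x. \<bar>\<phi> x\<bar> \<le> B"
        using \<phi> by (rule test_function_bounded) blast
      then show ?thesis
        using that test_function_smooth[OF \<phi>, THEN borel_measurable_smooth]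
        by (intro Bochner_Integration.integrable_bound[OF integrable_mult_right[OF that, of B]] AE_I2)
          (auto simp: abs_mult intro!: mult_mono order_trans[OF B])
    qed
    have "(LINT x|lborel. f' x * (axis i 1 \<bullet> grad \<phi> x)) = - (LINT x|lborel. g' x * \<phi> x)"
      using assms(6) \<phi> weak_partial_iff_representative[OF assms(1,3,4) f' g'] by blast
    moreover have "(LINT x|lborel. f' x * (axis i 1 \<bullet> grad \<phi> x)) = - (LINT x|lborel. h' x * \<phi> x)"
      using assms(7) \<phi> weak_partial_iff_representative[OF assms(1,3,5) f' h'] by blast
    ultimately have "(LINT x|lborel. g' x * \<phi> x) = (LINT x|lborel. h' x * \<phi> x)"
      by simp
    then show "(LINT x|lborel. \<phi> x * (g' x - h' x)) = 0"
      using i[OF gi] i[OF hi] by (simp add: right_diff_distrib mult.commute)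
  qed (use gi hi in auto)
  with g'(3) h'(3) show ?thesis
    by eventually_elim auto
qed

lemma H1_wgrad:
  assumes "H1 S f"
  shows "L2 S (\<lambda>x. wgrad S f x $ i)" "weak_partial S i f (\<lambda>x. wgrad S f x $ i)"
proof -
  have "\<exists>g. L2 S g \<and> weak_partial S i f g" using assms by (auto simp: H1_def)
  from someI_ex[OF this] show "L2 S (\<lambda>x. wgrad S f x $ i)" "weak_partial S i f (\<lambda>x. wgrad S f x $ i)"
    by (simp_all add: wgrad_def)
qed

text \<open>\<open>wgrad\<close> picks its components by \<open>SOME\<close>. Uniqueness lets any
  explicit weak gradient replace this choice, almost everywhere.\<close>

lemma wgrad_eq_AE:
  fixes f :: "real^'n \<Rightarrow> real"
  assumes "open S" "bounded S" "L2 S f" "\<And>i. L2 S (\<lambda>x. G x $ i)" "\<And>i. weak_partial S i f (\<lambda>x. G x $ i)"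
  shows "AE x in lborel. x \<in> S \<longrightarrow> wgrad S f x = G x"
proof -
  have H: "H1 S f" using assms by (auto simp: H1_def)
  have "AE x in lborel. x \<in> S \<longrightarrow> wgrad S f x $ i = G x $ i" for i
    by (rule weak_partial_unique[OF assms(1-3) H1_wgrad(1)[OF H] assms(4) H1_wgrad(2)[OF H] assms(5)])
  then have "AE x in lborel. \<forall>i. x \<in> S \<longrightarrow> wgrad S f x $ i = G x $ i"
    by (intro eventually_all_finite) simp
  then show ?thesis by eventually_elim (simp add: vec_eq_iff)
qed

lemma borel_measurable_lebesgue_on_borel:
  "f \<in> borel_measurable borel \<Longrightarrow> f \<in> borel_measurable (lebesgue_on S)"
  using measurable_compose[OF id_borel_measurable_lebesgue_on] by auto

lemma L2_test_function:
  assumes "open S" "test_function S' \<phi>"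
  shows "L2 S \<phi>"
proof -
  have b: "\<phi> \<in> borel_measurable borel"
    using assms by (auto intro: borel_measurable_smooth test_function_smooth)
  have "integrable lborel (\<lambda>x. \<phi> x * \<phi> x)"
    by (rule test_function_integrable[OF test_function_mult[OF assms(2) test_function_smooth[OF assms(2)]]])
  then have "integrable lebesgue (\<lambda>x. (\<phi> x)\<^sup>2)"
    using b by (subst integrable_completion) (auto simp: power2_eq_square)
  then have "integrable (lebesgue_on S) (\<lambda>x. (\<phi> x)\<^sup>2)"
    using assms(1) integrable_mult_indicator[of S lebesgue "\<lambda>x. (\<phi> x)\<^sup>2"]
    by (subst integrable_restrict_space) auto
  then show ?thesis
    using b by (simp add: L2_def borel_measurable_lebesgue_on_borel)
qed

lemma weak_partial_test_function:
  assumes "open S" "test_function S \<phi>"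
  shows "weak_partial S i \<phi> (partial_deriv i \<phi>)"
proof -
  have b: "\<phi> \<in> borel_measurable borel" "partial_deriv i \<phi> \<in> borel_measurable borel"
    using test_function_smooth[OF assms(2)] by (auto intro: borel_measurable_smooth borel_measurable_partial_deriv)
  have 0: "\<And>x. x \<notin> S \<Longrightarrow> \<phi> x = 0" "\<And>x. x \<notin> S \<Longrightarrow> partial_deriv i \<phi> x = 0"
    using test_function_grad_0[OF assms(2)] test_function_grad_0(1)[OF test_function_grad[OF assms(2)]] by auto
  show ?thesis
    using integral_by_parts_test_function[OF assms(2) test_function_smooth, where v = "axis i 1"]
    by (subst weak_partial_iff_representative[OF assms(1) L2_test_function[OF assms]
          L2_test_function[OF assms(1) test_function_grad[OF assms(2)]] b(1) 0(1) _ b(2) 0(2)])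
      (auto simp: inner_axis')
qed

lemma wgrad_test_function:
  assumes "open S" "bounded S" "test_function S \<phi>"
  shows "AE x in lborel. x \<in> S \<longrightarrow> wgrad S \<phi> x = grad \<phi> x"
  by (rule wgrad_eq_AE[OF assms(1,2)])
    (auto intro: assms L2_test_function weak_partial_test_function test_function_grad)

lemma H1_test_function:
  assumes "open S" "test_function S \<phi>"
  shows "H1 S \<phi>"
  unfolding H1_def
  using L2_test_function[OF assms] weak_partial_test_function[OF assms]
    L2_test_function[OF assms(1) test_function_grad[OF assms(2)]] by auto

lemma test_function_zero: "test_function S (\<lambda>x. 0)"
  by (rule test_functionI[of _ "{}"]) (auto intro: smooth_const)

lemma AE_lebesgue_on:
  assumes "S \<in> sets borel" "AE x in lborel. x \<in> S \<longrightarrow> P x"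
  shows "AE x in lebesgue_on S. P x"
  using assms by (subst AE_restrict_space_iff) (auto intro!: AE_completion)

text \<open>The chosen gradient of the zero function is zero only almost everywhere, so this is not
  immediate. It makes the constant sequence show that test functions belong to
  \<open>H10\<close>.\<close>

lemma H1_norm_zero:
  assumes "open S" "bounded S"
  shows "H1_norm S (\<lambda>x. 0 :: real) = 0"
proof -
  have "AE x in lborel. x \<in> S \<longrightarrow> wgrad S (\<lambda>x. 0) x = 0"
  proof (rule wgrad_eq_AE[OF assms])
    show "weak_partial S i (\<lambda>x. 0) (\<lambda>x. (0 :: real^'a) $ i)" for i
      by (simp add: weak_partial_def)
  qed (use L2_test_function[OF assms(1) test_function_zero] in auto)
  then have "AE x in lebesgue_on S. wgrad S (\<lambda>x. 0) x = 0"
    using assms by (intro AE_lebesgue_on) auto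
  then have "(LINT x|lebesgue_on S. (norm (wgrad S (\<lambda>x. 0) x))\<^sup>2) = 0"
    by (intro integral_eq_zero_AE) (auto elim: eventually_mono)
  then show ?thesis by (simp add: H1_norm_def)
qed

lemma H10_test_function:
  assumes "open S" "bounded S" "test_function S \<phi>"
  shows "H10 S \<phi>"
  unfolding H10_def using assms H1_test_function H1_norm_zero[OF assms(1,2)]
  by (auto intro!: exI[of _ "\<lambda>_. \<phi>"])

text \<open>Weak directional derivatives, for functions that are integrable on the whole space; only
  their values on \<open>T\<close> are differentiated.\<close>

definition weak_dd :: "(real^'n) set \<Rightarrow> real^'n \<Rightarrow> (real^'n \<Rightarrow> real) \<Rightarrow> (real^'n \<Rightarrow> real) \<Rightarrow> bool" where
  "weak_dd T v w g \<longleftrightarrow> integrable lborel w \<and> integrable lborel g \<and>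
     (\<forall>\<phi>. test_function T \<phi> \<longrightarrow> (LINT x|lborel. w x * (v \<bullet> grad \<phi> x)) = - (LINT x|lborel. g x * \<phi> x))"

lemma integrable_mult_bounded:
  fixes w h :: "'a \<Rightarrow> real"
  assumes "integrable M w" "h \<in> borel_measurable M" "\<And>x. \<bar>h x\<bar> \<le> B"
  shows "integrable M (\<lambda>x. w x * h x)"
proof -
  have "norm (w x * h x) \<le> norm (B * w x)" for x
  proof -
    have "norm (w x * h x) = \<bar>h x\<bar> * \<bar>w x\<bar>" by (simp add: abs_mult)
    also have "\<dots> \<le> \<bar>B\<bar> * \<bar>w x\<bar>"
      using assms(3)[of x] by (intro mult_right_mono) auto
    finally show ?thesis by (simp add: abs_mult)
  qed
  then show ?thesis
    using assms by (intro Bochner_Integration.integrable_bound[OF integrable_mult_right[OF assms(1), of B]]) auto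
qed

lemma integrable_mult_test_function:
  assumes "integrable lborel w" "test_function S \<phi>"
  shows "integrable lborel (\<lambda>x. w x * \<phi> x)" "integrable lborel (\<lambda>x. w x * (v \<bullet> grad \<phi> x))"
proof -
  note [measurable] = assms(2)[THEN test_function_smooth, THEN borel_measurable_smooth]
    assms(2)[THEN test_function_smooth, THEN borel_measurable_grad]
  obtain B where "\<And>x. \<bar>\<phi> x\<bar> \<le> B"
    using assms(2) by (rule test_function_bounded) blast
  then show "integrable lborel (\<lambda>x. w x * \<phi> x)"
    by (intro integrable_mult_bounded[OF assms(1)]) auto
  obtain B where B: "\<And>x. norm (grad \<phi> x) \<le> B"
    using assms(2) by (rule test_function_grad_bounded) blast
  have "\<bar>v \<bullet> grad \<phi> x\<bar> \<le> norm v * B" for x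
    using Cauchy_Schwarz_ineq2[of v "grad \<phi> x"] B[of x]
    by (meson mult_left_mono norm_ge_zero order_trans)
  then show "integrable lborel (\<lambda>x. w x * (v \<bullet> grad \<phi> x))"
    by (intro integrable_mult_bounded[OF assms(1)]) auto
qed

text \<open>Directions other than the axes occur twice: as normals of faces, and as the oblique
  directions along which layers are swept.\<close>

lemma weak_dd_sum:
  assumes "\<And>j. weak_dd T (axis j 1) w (g j)"
  shows "weak_dd T v w (\<lambda>x. \<Sum>j\<in>UNIV. v $ j * g j x)"
  unfolding weak_dd_def
proof (intro conjI allI impI)
  have w: "integrable lborel w" and g: "\<And>j. integrable lborel (g j)"
    using assms by (auto simp: weak_dd_def)
  then show "integrable lborel w" "integrable lborel (\<lambda>x. \<Sum>j\<in>UNIV. v $ j * g j x)" by auto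
  fix \<phi> assume \<phi>: "test_function T \<phi>"
  have "(LINT x|lborel. w x * (v \<bullet> grad \<phi> x)) = (LINT x|lborel. (\<Sum>j\<in>UNIV. v $ j * (w x * (axis j 1 \<bullet> grad \<phi> x))))"
    by (simp add: inner_vec_def[of v] inner_axis' sum_distrib_left mult_ac)
  also have "\<dots> = (\<Sum>j\<in>UNIV. v $ j * (LINT x|lborel. w x * (axis j 1 \<bullet> grad \<phi> x)))"
    using integrable_mult_test_function[OF w \<phi>] by (subst Bochner_Integration.integral_sum) auto
  also have "\<dots> = - (\<Sum>j\<in>UNIV. v $ j * (LINT x|lborel. g j x * \<phi> x))"
    using assms \<phi> by (simp add: weak_dd_def sum_negf)
  also have "(\<Sum>j\<in>UNIV. v $ j * (LINT x|lborel. g j x * \<phi> x)) = (LINT x|lborel. (\<Sum>j\<in>UNIV. v $ j * (g j x * \<phi> x)))"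
    using integrable_mult_test_function[OF g \<phi>] by (subst Bochner_Integration.integral_sum) auto
  finally show "(LINT x|lborel. w x * (v \<bullet> grad \<phi> x)) = - (LINT x|lborel. (\<Sum>j\<in>UNIV. v $ j * g j x) * \<phi> x)"
    by (simp add: sum_distrib_right mult.assoc)
qed

lemma integrable_on_subset_lebesgue_on:
  fixes f :: "'a::euclidean_space \<Rightarrow> real"
  assumes "integrable (lebesgue_on S) f" "S \<in> sets lebesgue" "T \<in> sets lebesgue" "T \<subseteq> S"
  shows "integrable (lebesgue_on T) f"
proof -
  have "integrable lebesgue (\<lambda>x. indicator S x *\<^sub>R f x)"
    using assms by (subst (asm) integrable_restrict_space) auto
  then have "integrable lebesgue (\<lambda>x. indicator T x *\<^sub>R (indicator S x *\<^sub>R f x))"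
    using assms(3) by (rule integrable_mult_indicator[rotated])
  moreover have "(\<lambda>x. indicator T x *\<^sub>R (indicator S x *\<^sub>R f x)) = (\<lambda>x. indicator T x *\<^sub>R f x)"
    using assms(4) by (auto simp: indicator_def fun_eq_iff)
  ultimately have "integrable lebesgue (\<lambda>x. indicator T x *\<^sub>R f x)" by (simp only:)
  then show ?thesis
    using assms(3) by (subst integrable_restrict_space) auto
qed

lemma weak_partial_subset:
  assumes "open S" "open T" "T \<subseteq> S" "L2 S f" "L2 S g" "weak_partial S i f g"
  shows "weak_partial T i f g" "L2 T f"
proof -
  have m: "h \<in> borel_measurable (lebesgue_on T)" if "L2 S h" for h :: "real^'a \<Rightarrow> real"
    using that assms(3) by (auto simp: L2_def intro: measurable_restrict_mono)
  have eq: "(LINT x|lebesgue_on S. h x * \<phi> x) = (LINT x|lebesgue_on T. h x * \<phi> x)"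
    if "L2 S h" "test_function T \<phi>" for h \<phi> :: "real^'a \<Rightarrow> real"
  proof -
    have "(LINT x|lebesgue_on S. h x * \<phi> x) = (LINT x|lebesgue. indicator S x *\<^sub>R (h x * \<phi> x))"
      using assms by (intro integral_restrict_space) auto
    also have "\<dots> = (LINT x|lebesgue. indicator T x *\<^sub>R (h x * \<phi> x))"
      using test_function_grad_0(1)[OF that(2)] assms(3)
      by (intro Bochner_Integration.integral_cong) (auto simp: indicator_def)
    also have "\<dots> = (LINT x|lebesgue_on T. h x * \<phi> x)"
      using assms by (intro integral_restrict_space[symmetric]) auto
    finally show ?thesis .
  qed
  show "weak_partial T i f g"
    unfolding weak_partial_def
  proof (intro allI impI)
    fix \<phi> assume \<phi>: "test_function T \<phi>"
    then show "(LINT x|lebesgue_on T. f x * partial_deriv i \<phi> x) = - (LINT x|lebesgue_on T. g x * \<phi> x)"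
      using assms(6) test_function_mono[OF \<phi> assms(3)]
      by (simp add: weak_partial_def flip: eq[OF assms(4) test_function_grad[OF \<phi>]] eq[OF assms(5) \<phi>])
  qed
  have "integrable (lebesgue_on S) (\<lambda>x. (f x)\<^sup>2)" using assms by (simp add: L2_def)
  then have "integrable (lebesgue_on T) (\<lambda>x. (f x)\<^sup>2)"
    by (rule integrable_on_subset_lebesgue_on) (use assms(1-3) in auto)
  then show "L2 T f"
    using m[OF assms(4)] by (simp add: L2_def)
qed

section \<open>Integration over hyperplanes\<close>

text \<open>The hyperplane measure before completion. As a Borel measure it is a factor of
  \<open>lborel\<close> transversal to the direction \<open>n\<close>, see
  \<open>lborel_eq_distr_hyp\<close>.\<close>

definition hyp :: "real^'n \<Rightarrow> real \<Rightarrow> (real^'n) measure" where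
  "hyp n c = distr (restrict_space lborel {y. c \<le> n \<bullet> y \<and> n \<bullet> y \<le> c + 1}) borel
       (\<lambda>y. y - (n \<bullet> y - c) *\<^sub>R n)"

lemma hyperplane_measure_eq: "hyperplane_measure n c = completion (hyp n c)"
  by (simp add: hyperplane_measure_def hyp_def)

lemma sets_hyp [simp, measurable_cong]: "sets (hyp n c) = sets borel"
  by (simp add: hyp_def)

lemma space_hyp [simp]: "space (hyp n c) = UNIV"
  by (simp add: hyp_def)

lemma slab_borel [measurable]: "{y :: real^'n. c \<le> n \<bullet> y \<and> n \<bullet> y \<le> c + 1} \<in> sets borel"
proof -
  have "closed {y :: real^'n. c \<le> n \<bullet> y \<and> n \<bullet> y \<le> c + 1}"
    by (intro closed_Collect_conj closed_Collect_le continuous_intros)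
  then show ?thesis by simp
qed

lemma nn_integral_hyp:
  assumes [measurable]: "f \<in> borel_measurable borel"
  shows "(\<integral>\<^sup>+ x. f x \<partial>hyp n c) =
    (\<integral>\<^sup>+ y. f (y - (n \<bullet> y - c) *\<^sub>R n) * indicator {y. c \<le> n \<bullet> y \<and> n \<bullet> y \<le> c + 1} y \<partial>lborel)"
proof -
  have "(\<lambda>y. y - (n \<bullet> y - c) *\<^sub>R n) \<in> borel_measurable (restrict_space lborel {y. c \<le> n \<bullet> y \<and> n \<bullet> y \<le> c + 1})"
    by (intro measurable_restrict_space1) measurable
  then show ?thesis
    unfolding hyp_def by (subst nn_integral_distr) (auto simp: nn_integral_restrict_space)
qed

lemma emeasure_hyp:
  assumes "A \<in> sets borel"
  shows "emeasure (hyp n c) A =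
    emeasure lborel {y. c \<le> n \<bullet> y \<and> n \<bullet> y \<le> c + 1 \<and> y - (n \<bullet> y - c) *\<^sub>R n \<in> A}"
proof -
  have m: "(\<lambda>y. y - (n \<bullet> y - c) *\<^sub>R n) \<in> borel_measurable borel" by measurable
  have "{y. c \<le> n \<bullet> y \<and> n \<bullet> y \<le> c + 1 \<and> y - (n \<bullet> y - c) *\<^sub>R n \<in> A}
      = {y. c \<le> n \<bullet> y \<and> n \<bullet> y \<le> c + 1} \<inter> (\<lambda>y. y - (n \<bullet> y - c) *\<^sub>R n) -` A" by auto
  also have "\<dots> \<in> sets borel"
    using measurable_sets[OF m assms] slab_borel[of c n] by auto
  finally have S: "{y. c \<le> n \<bullet> y \<and> n \<bullet> y \<le> c + 1 \<and> y - (n \<bullet> y - c) *\<^sub>R n \<in> A} \<in> sets borel" .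
  have "emeasure (hyp n c) A = (\<integral>\<^sup>+ x. indicator A x \<partial>hyp n c)"
    using assms by simp
  also have "\<dots> = (\<integral>\<^sup>+ y. indicator A (y - (n \<bullet> y - c) *\<^sub>R n) * indicator {y. c \<le> n \<bullet> y \<and> n \<bullet> y \<le> c + 1} y \<partial>lborel)"
    by (rule nn_integral_hyp) (use assms in simp)
  also have "\<dots> = (\<integral>\<^sup>+ y. indicator {y. c \<le> n \<bullet> y \<and> n \<bullet> y \<le> c + 1 \<and> y - (n \<bullet> y - c) *\<^sub>R n \<in> A} y \<partial>lborel)"
    by (intro nn_integral_cong) (auto simp: indicator_def)
  finally show ?thesis using S by simp
qed

lemma nn_integral_lborel_translate:
  fixes f :: "'a::euclidean_space \<Rightarrow> ennreal"
  assumes "f \<in> borel_measurable borel"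
  shows "(\<integral>\<^sup>+ x. f (x + c) \<partial>lborel) = (\<integral>\<^sup>+ x. f x \<partial>lborel)"
proof -
  have "(+) c = (\<lambda>x. x + c)" by (simp add: fun_eq_iff add.commute)
  then have "lborel = distr lborel borel (\<lambda>x. x + c)"
    using lborel_distr_plus[of c] by metis
  then have "(\<integral>\<^sup>+ x. f x \<partial>lborel) = (\<integral>\<^sup>+ x. f x \<partial>distr lborel borel (\<lambda>x. x + c))" by metis
  also have "\<dots> = (\<integral>\<^sup>+ x. f (x + c) \<partial>lborel)"
    using assms by (intro nn_integral_distr) auto
  finally show ?thesis by simp
qed

text \<open>The slab for \<open>- n\<close> lies on the other side of the hyperplane; translation by
  the normal carries one slab to the other and keeps the projections.\<close>

lemma hyp_uminus:
  fixes n :: "real^'n"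
  assumes "norm n = 1"
  shows "hyp (- n) (- c) = hyp n c"
proof (rule measure_eqI)
  fix A :: "(real^'n) set" assume "A \<in> sets (hyp (- n) (- c))"
  then have A[measurable]: "A \<in> sets borel" by simp
  have nn: "n \<bullet> n = 1" using assms by (simp add: dot_square_norm)
  let ?f = "\<lambda>y. indicator A (y - (- n \<bullet> y - - c) *\<^sub>R (- n)) *
    (indicator {y. - c \<le> - n \<bullet> y \<and> - n \<bullet> y \<le> - c + 1} y :: ennreal)"
  have f: "?f \<in> borel_measurable borel"
    using slab_borel[of "-c" "-n"] by measurable
  have "emeasure (hyp (- n) (- c)) A = (\<integral>\<^sup>+ x. indicator A x \<partial>hyp (- n) (- c))" by simp
  also have "\<dots> = (\<integral>\<^sup>+ y. ?f y \<partial>lborel)"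
    by (rule nn_integral_hyp) simp
  also have "\<dots> = (\<integral>\<^sup>+ y. ?f (y + (- n)) \<partial>lborel)"
    by (rule nn_integral_lborel_translate[OF f, symmetric])
  also have "\<dots> = (\<integral>\<^sup>+ y. indicator A (y - (n \<bullet> y - c) *\<^sub>R n) * indicator {y. c \<le> n \<bullet> y \<and> n \<bullet> y \<le> c + 1} y \<partial>lborel)"
    by (intro nn_integral_cong) (auto simp: indicator_def inner_simps nn algebra_simps)
  also have "\<dots> = (\<integral>\<^sup>+ x. indicator A x \<partial>hyp n c)"
    by (rule nn_integral_hyp[symmetric]) simp
  finally show "emeasure (hyp (- n) (- c)) A = emeasure (hyp n c) A" by simp
qed simp

text \<open>Unfold \<open>hyp\<close> as an integral over a slab of thickness one, absorb the
  projection into the line parameter, exchange the integrals and shift by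
  \<open>t *\<^sub>R n\<close>: what remains is the length of the set of \<open>t\<close> that keep
  a given point in the slab, which is one. Only translation invariance enters.\<close>

lemma nn_integral_lborel_eq_hyp:
  fixes n :: "real^'n"
  assumes "norm n = 1" and [measurable]: "G \<in> borel_measurable borel"
  shows "(\<integral>\<^sup>+ x. \<integral>\<^sup>+ t. G (x + t *\<^sub>R n) \<partial>lborel \<partial>hyp n c) = (\<integral>\<^sup>+ z. G z \<partial>lborel)"
proof -
  have nn: "n \<bullet> n = 1" using assms by (simp add: dot_square_norm)
  let ?S = "{y. c \<le> n \<bullet> y \<and> n \<bullet> y \<le> c + 1}"
  let ?I = "\<lambda>y t. G (y + t *\<^sub>R n) * (indicator ?S y :: ennreal)"
  have "(\<integral>\<^sup>+ x. \<integral>\<^sup>+ t. G (x + t *\<^sub>R n) \<partial>lborel \<partial>hyp n c)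
      = (\<integral>\<^sup>+ y. (\<integral>\<^sup>+ t. G (y - (n \<bullet> y - c) *\<^sub>R n + t *\<^sub>R n) \<partial>lborel) * indicator ?S y \<partial>lborel)"
    by (rule nn_integral_hyp) measurable
  also have "\<dots> = (\<integral>\<^sup>+ y. (\<integral>\<^sup>+ t. ?I y t \<partial>lborel) \<partial>lborel)"
  proof (rule nn_integral_cong)
    fix y
    have "(\<integral>\<^sup>+ t. G (y - (n \<bullet> y - c) *\<^sub>R n + t *\<^sub>R n) \<partial>lborel)
        = (\<integral>\<^sup>+ t. G (y + (t + - (n \<bullet> y - c)) *\<^sub>R n) \<partial>lborel)"
      by (simp add: algebra_simps)
    also have "\<dots> = (\<integral>\<^sup>+ t. G (y + t *\<^sub>R n) \<partial>lborel)"
      by (rule nn_integral_lborel_translate) measurable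
    finally show "(\<integral>\<^sup>+ t. G (y - (n \<bullet> y - c) *\<^sub>R n + t *\<^sub>R n) \<partial>lborel) * indicator ?S y = (\<integral>\<^sup>+ t. ?I y t \<partial>lborel)"
      by (simp add: nn_integral_multc)
  qed
  also have "\<dots> = (\<integral>\<^sup>+ t. (\<integral>\<^sup>+ y. ?I y t \<partial>lborel) \<partial>lborel)"
    by (rule lborel_pair.Fubini'[symmetric]) measurable
  also have "\<dots> = (\<integral>\<^sup>+ t. (\<integral>\<^sup>+ y. G y * indicator ?S (y + (- t) *\<^sub>R n) \<partial>lborel) \<partial>lborel)"
  proof (rule nn_integral_cong)
    fix t :: real
    have "(\<integral>\<^sup>+ y. ?I y t \<partial>lborel) = (\<integral>\<^sup>+ y. ?I (y + (- t) *\<^sub>R n) t \<partial>lborel)"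
      by (rule nn_integral_lborel_translate[symmetric]) measurable
    then show "(\<integral>\<^sup>+ y. ?I y t \<partial>lborel) = (\<integral>\<^sup>+ y. G y * indicator ?S (y + (- t) *\<^sub>R n) \<partial>lborel)"
      by simp
  qed
  also have "\<dots> = (\<integral>\<^sup>+ y. (\<integral>\<^sup>+ t. G y * indicator ?S (y + (- t) *\<^sub>R n) \<partial>lborel) \<partial>lborel)"
    by (rule lborel_pair.Fubini') measurable
  also have "\<dots> = (\<integral>\<^sup>+ y. G y \<partial>lborel)"
  proof (rule nn_integral_cong)
    fix y
    have "(\<integral>\<^sup>+ t. G y * indicator ?S (y + (- t) *\<^sub>R n) \<partial>lborel) = (\<integral>\<^sup>+ t. G y * indicator {n \<bullet> y - c - 1..n \<bullet> y - c} t \<partial>lborel)"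
      by (intro nn_integral_cong) (auto simp: indicator_def inner_simps nn)
    also have "\<dots> = G y * (\<integral>\<^sup>+ t. indicator {n \<bullet> y - c - 1..n \<bullet> y - c} t \<partial>lborel)"
      by (intro nn_integral_cmult) measurable
    also have "\<dots> = G y" by simp
    finally show "(\<integral>\<^sup>+ t. G y * indicator ?S (y + (- t) *\<^sub>R n) \<partial>lborel) = G y" .
  qed
  finally show ?thesis .
qed

lemma emeasure_hyp_bounded:
  assumes "norm n = 1" "A \<in> sets borel" "bounded A"
  shows "emeasure (hyp n c) A < \<infinity>"
proof -
  obtain B where B: "\<And>x. x \<in> A \<Longrightarrow> norm x \<le> B" using assms(3) by (auto simp: bounded_iff)
  have "{y. c \<le> n \<bullet> y \<and> n \<bullet> y \<le> c + 1 \<and> y - (n \<bullet> y - c) *\<^sub>R n \<in> A} \<subseteq> cball 0 (B + 1)"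
  proof safe
    fix y assume y: "c \<le> n \<bullet> y" "n \<bullet> y \<le> c + 1" "y - (n \<bullet> y - c) *\<^sub>R n \<in> A"
    have "norm y \<le> norm (y - (n \<bullet> y - c) *\<^sub>R n) + norm ((n \<bullet> y - c) *\<^sub>R n)"
      by (metis diff_add_cancel norm_triangle_ineq)
    then show "y \<in> cball 0 (B + 1)"
      using B[OF y(3)] y assms(1) by simp
  qed
  then have "emeasure (hyp n c) A \<le> emeasure lborel (cball (0 :: real^'a) (B + 1))"
    unfolding emeasure_hyp[OF assms(2)] by (intro emeasure_mono) auto
  also have "\<dots> < \<infinity>" by (intro emeasure_bounded_finite) auto
  finally show ?thesis .
qed

lemma sigma_finite_hyp:
  assumes "norm n = 1"
  shows "sigma_finite_measure (hyp n c)"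
proof
  show "\<exists>A. countable A \<and> A \<subseteq> sets (hyp n c) \<and> \<Union>A = space (hyp n c) \<and> (\<forall>a\<in>A. emeasure (hyp n c) a \<noteq> \<infinity>)"
  proof (intro exI[of _ "range (\<lambda>k::nat. cball 0 (real k))"] conjI ballI)
    show "\<Union> (range (\<lambda>k::nat. cball (0 :: real^'a) (real k))) = space (hyp n c)"
      using real_arch_simple by (auto simp: space_hyp)
    show "emeasure (hyp n c) a \<noteq> \<infinity>" if "a \<in> range (\<lambda>k::nat. cball 0 (real k))" for a
      using that emeasure_hyp_bounded[OF assms, of a c] by auto
  qed auto
qed

lemma lborel_eq_distr_hyp:
  fixes n :: "real^'n"
  assumes "norm n = 1"
  shows "lborel = distr (hyp n c \<Otimes>\<^sub>M lborel) borel (\<lambda>(x, t). x + t *\<^sub>R n)"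
proof (rule measure_eqI)
  fix A :: "(real^'n) set" assume "A \<in> sets lborel"
  then have [measurable]: "A \<in> sets borel" by simp
  interpret sigma_finite_measure "hyp n c" using assms by (rule sigma_finite_hyp)
  have "emeasure (distr (hyp n c \<Otimes>\<^sub>M lborel) borel (\<lambda>(x, t). x + t *\<^sub>R n)) A
      = (\<integral>\<^sup>+ z. indicator A z \<partial>distr (hyp n c \<Otimes>\<^sub>M lborel) borel (\<lambda>(x, t). x + t *\<^sub>R n))" by simp
  also have "\<dots> = (\<integral>\<^sup>+ p. indicator A (case p of (x, t) \<Rightarrow> x + t *\<^sub>R n) \<partial>(hyp n c \<Otimes>\<^sub>M lborel))"
    by (intro nn_integral_distr) measurable
  also have "\<dots> = (\<integral>\<^sup>+ x. \<integral>\<^sup>+ t. indicator A (x + t *\<^sub>R n) \<partial>lborel \<partial>hyp n c)"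
    by (subst lborel.nn_integral_fst[symmetric]) (auto simp: split_beta)
  also have "\<dots> = (\<integral>\<^sup>+ z. indicator A z \<partial>lborel)"
    by (rule nn_integral_lborel_eq_hyp[OF assms]) measurable
  finally show "emeasure lborel A = emeasure (distr (hyp n c \<Otimes>\<^sub>M lborel) borel (\<lambda>(x, t). x + t *\<^sub>R n)) A"
    by simp
qed simp

lemma AE_hyp:
  fixes n :: "real^'n"
  assumes "norm n = 1" "AE z in lborel. Q z"
  shows "AE x in hyp n c. AE t in lborel. Q (x + t *\<^sub>R n)"
proof -
  obtain N where N: "{z. \<not> Q z} \<subseteq> N" "emeasure lborel N = 0" "N \<in> sets borel"
    using AE_E[OF assms(2)] by auto
  note [measurable] = N(3)
  have "(\<integral>\<^sup>+ x. \<integral>\<^sup>+ t. indicator N (x + t *\<^sub>R n) \<partial>lborel \<partial>hyp n c) = 0"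
    using N by (subst nn_integral_lborel_eq_hyp[OF assms(1)]) auto
  then have "AE x in hyp n c. (\<integral>\<^sup>+ t. indicator N (x + t *\<^sub>R n) \<partial>lborel) = 0"
    by (subst (asm) nn_integral_0_iff_AE) auto
  then show ?thesis
  proof eventually_elim
    fix x assume "(\<integral>\<^sup>+ t. indicator N (x + t *\<^sub>R n) \<partial>lborel) = 0"
    then have "AE t in lborel. (indicator N (x + t *\<^sub>R n) :: ennreal) = 0"
      by (subst (asm) nn_integral_0_iff_AE) auto
    then show "AE t in lborel. Q (x + t *\<^sub>R n)"
      using N(1) by (auto simp: indicator_def split: if_splits elim!: eventually_mono)
  qed
qed

lemma integral_hyp_Fubini:
  fixes n :: "real^'n" and G :: "real^'n \<Rightarrow> real"
  assumes n: "norm n = 1" and G: "integrable lborel G"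
  shows "AE x in hyp n c. integrable lborel (\<lambda>t. G (x + t *\<^sub>R n))"
    and "integrable (hyp n c) (\<lambda>x. LINT t|lborel. G (x + t *\<^sub>R n))"
    and "(LINT x|hyp n c. LINT t|lborel. G (x + t *\<^sub>R n)) = (LINT z|lborel. G z)"
proof -
  interpret sigma_finite_measure "hyp n c" using n by (rule sigma_finite_hyp)
  interpret pair_sigma_finite "hyp n c" "lborel :: real measure" ..
  have [measurable]: "G \<in> borel_measurable borel" using G by simp
  have m: "(\<lambda>(x, t). x + t *\<^sub>R n) \<in> (hyp n c \<Otimes>\<^sub>M lborel) \<rightarrow>\<^sub>M borel" by measurable
  have "integrable (distr (hyp n c \<Otimes>\<^sub>M lborel) borel (\<lambda>(x, t). x + t *\<^sub>R n)) G"
    using G lborel_eq_distr_hyp[OF n, of c] by metis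
  then have I: "integrable (hyp n c \<Otimes>\<^sub>M lborel) (\<lambda>p. G (case p of (x, t) \<Rightarrow> x + t *\<^sub>R n))"
    using m by (subst (asm) integrable_distr_eq) auto
  show "AE x in hyp n c. integrable lborel (\<lambda>t. G (x + t *\<^sub>R n))"
    using AE_integrable_fst'[OF I] by simp
  show "integrable (hyp n c) (\<lambda>x. LINT t|lborel. G (x + t *\<^sub>R n))"
    using integrable_fst'[OF I] by simp
  have "(LINT z|lborel. G z) = (LINT z|distr (hyp n c \<Otimes>\<^sub>M lborel) borel (\<lambda>(x, t). x + t *\<^sub>R n). G z)"
    using lborel_eq_distr_hyp[OF n, of c] by metis
  also have "\<dots> = (LINT p|(hyp n c \<Otimes>\<^sub>M lborel). G (case p of (x, t) \<Rightarrow> x + t *\<^sub>R n))"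
    using m by (intro integral_distr) auto
  also have "\<dots> = (LINT x|hyp n c. LINT t|lborel. G (x + t *\<^sub>R n))"
    using integral_fst'[OF I] by simp
  finally show "(LINT x|hyp n c. LINT t|lborel. G (x + t *\<^sub>R n)) = (LINT z|lborel. G z)" by simp
qed

lemma AE_hyp_mem:
  fixes n :: "real^'n"
  assumes "norm n = 1"
  shows "AE x in hyp n c. n \<bullet> x = c"
proof (rule AE_I)
  have nn: "n \<bullet> n = 1" using assms by (simp add: dot_square_norm)
  have "closed {x. n \<bullet> x = c}" by (rule closed_hyperplane)
  then have b: "{x. n \<bullet> x \<noteq> c} \<in> sets borel"
    by (simp add: Collect_neg_eq)
  then show "{x. n \<bullet> x \<noteq> c} \<in> sets (hyp n c)"
    by simp
  have "{y. c \<le> n \<bullet> y \<and> n \<bullet> y \<le> c + 1 \<and> y - (n \<bullet> y - c) *\<^sub>R n \<in> {x. n \<bullet> x \<noteq> c}} = {}"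
    by (auto simp: inner_simps nn)
  then show "emeasure (hyp n c) {x. n \<bullet> x \<noteq> c} = 0"
    using emeasure_hyp[OF b, of n c] by (simp only: emeasure_empty)
qed auto

text \<open>The cylinder of height one over an open portion of the hyperplane contains an open set;
  the point above \<open>x\<close> at half height shows that it is not empty.\<close>

lemma emeasure_hyp_pos:
  fixes n :: "real^'n"
  assumes n: "norm n = 1" and "open U" "x \<in> U" "n \<bullet> x = c"
  shows "emeasure (hyp n c) (U \<inter> {x. n \<bullet> x = c}) > 0"
proof -
  have nn: "n \<bullet> n = 1" using n by (simp add: dot_square_norm)
  let ?V = "{y. c < n \<bullet> y} \<inter> {y. n \<bullet> y < c + 1} \<inter> (\<lambda>y. y - (n \<bullet> y - c) *\<^sub>R n) -` U"
  have "open ((\<lambda>y. y - (n \<bullet> y - c) *\<^sub>R n) -` U)"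
    by (intro open_vimage \<open>open U\<close> continuous_intros)
  then have V: "open ?V"
    using open_halfspace_gt[of c n] open_halfspace_lt[of n "c + 1"] by (intro open_Int)
  moreover have "x + (1/2) *\<^sub>R n \<in> ?V"
    using assms by (simp add: inner_simps nn)
  ultimately have "\<not> negligible ?V"
    using open_not_negligible by blast
  then have "?V \<notin> null_sets lborel"
    using null_sets_completionI[of ?V lborel] unfolding negligible_iff_null_sets by blast
  then have "emeasure lborel ?V \<noteq> 0"
    using V unfolding null_sets_def by simp
  moreover have "emeasure lborel ?V \<le> emeasure (hyp n c) (U \<inter> {x. n \<bullet> x = c})"
  proof -
    have b: "U \<inter> {x. n \<bullet> x = c} \<in> sets borel"
      using \<open>open U\<close> closed_hyperplane[of n c] by (intro sets.Int) auto
    have bb: "{y. c \<le> n \<bullet> y \<and> n \<bullet> y \<le> c + 1 \<and> y - (n \<bullet> y - c) *\<^sub>R n \<in> U \<inter> {x. n \<bullet> x = c}} \<in> sets borel"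
    proof -
      have "(\<lambda>y. y - (n \<bullet> y - c) *\<^sub>R n) -` (U \<inter> {x. n \<bullet> x = c}) \<in> sets borel"
        using \<open>U \<inter> {x. n \<bullet> x = c} \<in> sets borel\<close>
        by (rule measurable_sets_borel[rotated]) measurable
      then have "{y. c \<le> n \<bullet> y \<and> n \<bullet> y \<le> c + 1} \<inter> (\<lambda>y. y - (n \<bullet> y - c) *\<^sub>R n) -` (U \<inter> {x. n \<bullet> x = c}) \<in> sets borel"
        by (intro sets.Int slab_borel)
      then show ?thesis
        by (rule back_subst[of "\<lambda>S. S \<in> sets borel"]) auto
    qed
    have "?V \<subseteq> {y. c \<le> n \<bullet> y \<and> n \<bullet> y \<le> c + 1 \<and> y - (n \<bullet> y - c) *\<^sub>R n \<in> U \<inter> {x. n \<bullet> x = c}}"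
      by (auto simp: inner_simps nn)
    then have "emeasure lborel ?V \<le> emeasure lborel {y. c \<le> n \<bullet> y \<and> n \<bullet> y \<le> c + 1 \<and> y - (n \<bullet> y - c) *\<^sub>R n \<in> U \<inter> {x. n \<bullet> x = c}}"
      by (rule emeasure_mono) (simp only: bb sets_lborel)
    then show ?thesis
      unfolding emeasure_hyp[OF b] .
  qed
  ultimately show ?thesis
    by (auto simp only: not_gr_zero le_zero_eq zero_less_iff_neq_zero)
qed

section \<open>Distinct hyperplanes and the uniqueness of unit normals\<close>

text \<open>Let \<open>?w\<close> be the part of \<open>m\<close> orthogonal to \<open>n\<close>.
  The cylinder over the intersection lies in a level set of \<open>?w\<close>, which is a null
  hyperplane if \<open>?w\<close> is nonzero; if it is zero, the hyperplanes are parallel and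
  distinct, and the level set is empty.\<close>

lemma null_hyperplane_Int:
  fixes n m :: "real^'n"
  assumes n: "norm n = 1" and m: "norm m = 1" and ne: "{x. n \<bullet> x = c} \<noteq> {x. m \<bullet> x = d}"
  shows "AE x in hyp n c. m \<bullet> x \<noteq> d"
proof (rule AE_I)
  have cl: "{x. m \<bullet> x = d} \<in> sets borel" using closed_hyperplane by simp
  then show "{x. m \<bullet> x = d} \<in> sets (hyp n c)" by simp
  let ?w = "m - (m \<bullet> n) *\<^sub>R n"
  have eq: "m \<bullet> (y - (n \<bullet> y - c) *\<^sub>R n) = d \<longleftrightarrow> ?w \<bullet> y = d - c * (m \<bullet> n)" for y
    by (auto simp: inner_simps algebra_simps)
  have *: "{y. c \<le> n \<bullet> y \<and> n \<bullet> y \<le> c + 1 \<and> y - (n \<bullet> y - c) *\<^sub>R n \<in> {x. m \<bullet> x = d}} \<subseteq> {y. ?w \<bullet> y = d - c * (m \<bullet> n)}"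
    using eq by auto
  have "emeasure lborel {y. ?w \<bullet> y = d - c * (m \<bullet> n)} = 0"
  proof (cases "?w = 0")
    case True
    then have mn: "m = (m \<bullet> n) *\<^sub>R n" by simp
    then have "\<bar>m \<bullet> n\<bar> = 1" using n m by (metis mult.right_neutral norm_scaleR)
    have "d \<noteq> c * (m \<bullet> n)"
    proof
      assume "d = c * (m \<bullet> n)"
      then have "m \<bullet> x = d \<longleftrightarrow> n \<bullet> x = c" for x
        using \<open>\<bar>m \<bullet> n\<bar> = 1\<close> by (subst mn) auto
      then show False using ne by auto
    qed
    then have "{y. ?w \<bullet> y = d - c * (m \<bullet> n)} = {}" using True by auto
    then show ?thesis by (simp only: emeasure_empty)
  next
    case False
    then have "negligible {y. ?w \<bullet> y = d - c * (m \<bullet> n)}"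
      by (intro negligible_hyperplane) auto
    moreover have "{y. ?w \<bullet> y = d - c * (m \<bullet> n)} \<in> sets borel"
      using closed_hyperplane[of ?w "d - c * (m \<bullet> n)"] by simp
    ultimately show ?thesis
      using null_sets_completion_iff[of "{y. ?w \<bullet> y = d - c * (m \<bullet> n)}" lborel]
      by (auto simp only: negligible_iff_null_sets sets_lborel)
  qed
  moreover have "{y. ?w \<bullet> y = d - c * (m \<bullet> n)} \<in> sets borel"
    using closed_hyperplane[of ?w "d - c * (m \<bullet> n)"] by simp
  ultimately show "emeasure (hyp n c) {x. m \<bullet> x = d} = 0"
    using emeasure_mono[OF *, of lborel] by (simp add: emeasure_hyp[OF cl])
qed auto

text \<open>From a point of \<open>F\<close> one may move a little along any vector orthogonal to
  \<open>m\<close> without leaving \<open>F\<close>. Moving along the part of \<open>n\<close>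
  orthogonal to \<open>m\<close> shows that this part is zero.\<close>

lemma unit_normal_unique:
  fixes n m :: "real^'n"
  assumes "norm n = 1" "norm m = 1" and F: "openin (top_of_set {x. m \<bullet> x = d}) F" "F \<noteq> {}"
    and sub: "F \<subseteq> {x. n \<bullet> x = c}"
  shows "n = m \<and> c = d \<or> n = - m \<and> c = - d"
proof -
  obtain x0 where x0: "x0 \<in> F" using F by blast
  then have mx: "m \<bullet> x0 = d" and nx: "n \<bullet> x0 = c" using F sub openin_imp_subset by blast+
  obtain e where e: "e > 0" "ball x0 e \<inter> {x. m \<bullet> x = d} \<subseteq> F"
    using F(1) x0 unfolding openin_contains_ball by blast
  have mm: "m \<bullet> m = 1" using assms(2) by (simp add: dot_square_norm)
  let ?w = "n - (n \<bullet> m) *\<^sub>R m"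
  have mw: "m \<bullet> ?w = 0" by (simp add: inner_simps mm inner_commute)
  have "?w = 0"
  proof (rule ccontr)
    assume "?w \<noteq> 0"
    \<comment> \<open>Makes the displacement half of the radius \<open>e\<close>.\<close>
    let ?s = "e / (2 * norm ?w)"
    have "dist x0 (x0 + ?s *\<^sub>R ?w) < e"
      using \<open>?w \<noteq> 0\<close> e(1) by (simp add: dist_norm)
    moreover have "m \<bullet> (x0 + ?s *\<^sub>R ?w) = d"
      using mw mx by (simp only: inner_add_right inner_scaleR_right)
    ultimately have "x0 + ?s *\<^sub>R ?w \<in> F"
      using e(2) by auto
    then have "n \<bullet> (x0 + ?s *\<^sub>R ?w) = c" using sub by blast
    then have "n \<bullet> ?w = 0"
      using nx e(1) \<open>?w \<noteq> 0\<close> by (simp only: inner_add_right inner_scaleR_right) simp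
    then have "?w \<bullet> ?w = 0"
      using mw by (simp only: inner_diff_left[of n "(n \<bullet> m) *\<^sub>R m"] inner_scaleR_left)
    then show False using \<open>?w \<noteq> 0\<close> by simp
  qed
  then have nm: "n = (n \<bullet> m) *\<^sub>R m" by simp
  then have "\<bar>n \<bullet> m\<bar> = 1" using assms(1,2) by (metis mult.right_neutral norm_scaleR)
  then have "n \<bullet> m = 1 \<or> n \<bullet> m = -1" by auto
  then show ?thesis
  proof
    assume "n \<bullet> m = 1"
    then have "n = m" using nm by simp
    then show ?thesis using mx nx by simp
  next
    assume "n \<bullet> m = -1"
    then have "n = - m" using nm by simp
    then show ?thesis using mx nx by simp
  qed
qed

definition face_like :: "(real^'n) set \<Rightarrow> bool" where
  "face_like F \<longleftrightarrow> F \<noteq> {} \<and> (\<exists>n c. norm n = 1 \<and> openin (top_of_set {x. n \<bullet> x = c}) F)"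

lemma face_like_openin:
  assumes "face_like F" "norm n = 1" "F \<subseteq> {x. n \<bullet> x = c}"
  shows "openin (top_of_set {x. n \<bullet> x = c}) F"
proof -
  obtain m d where md: "norm m = 1" "openin (top_of_set {x. m \<bullet> x = d}) F" "F \<noteq> {}"
    using assms by (auto simp: face_like_def)
  have "{x. n \<bullet> x = c} = {x. m \<bullet> x = d}"
    using unit_normal_unique[OF assms(2) md(1,2,3) assms(3)] by auto
  then show ?thesis using md by simp
qed

text \<open>The choice in \<open>surf\<close> is unique up to a common sign of normal and offset,
  and \<open>hyp_uminus\<close> removes the sign.\<close>

lemma surf_eq:
  assumes "face_like F" "norm n = 1" "F \<subseteq> {x. n \<bullet> x = c}"
  shows "surf F = completion (hyp n c)"
proof -
  let ?P = "\<lambda>p. norm (fst p) = 1 \<and> F \<subseteq> {x. fst p \<bullet> x = snd p}"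
  define p where "p = (SOME p. ?P p)"
  have "?P p"
    unfolding p_def by (rule someI[of ?P "(n, c)"]) (use assms in simp)
  then have "fst p = n \<and> snd p = c \<or> fst p = - n \<and> snd p = - c"
    using unit_normal_unique[OF _ assms(2) face_like_openin[OF assms]] assms(1) by (auto simp: face_like_def)
  then have "hyp (fst p) (snd p) = hyp n c"
    using hyp_uminus[OF assms(2)] by auto
  then show ?thesis
    by (simp add: surf_def Let_def hyperplane_measure_eq flip: p_def)
qed

lemma face_like_borel:
  assumes "face_like F"
  shows "F \<in> sets borel"
proof -
  obtain n c where "openin (top_of_set {x. n \<bullet> x = c}) F" using assms by (auto simp: face_like_def)
  then obtain U where "open U" "F = {x. n \<bullet> x = c} \<inter> U" by (auto simp: openin_open)
  then show ?thesis using closed_hyperplane[of n c] by auto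
qed

lemma face_like_pos:
  assumes "face_like F" "norm n = 1" "F \<subseteq> {x. n \<bullet> x = c}"
  shows "emeasure (hyp n c) F > 0"
proof -
  obtain U where U: "open U" "F = {x. n \<bullet> x = c} \<inter> U"
    using face_like_openin[OF assms] by (auto simp: openin_open)
  obtain x where "x \<in> F" using assms by (auto simp: face_like_def)
  then show ?thesis
    using emeasure_hyp_pos[OF assms(2) U(1), of x c] U(2) by (auto simp: Int_commute)
qed

lemma area_pos:
  assumes "face_like F" "norm n = 1" "F \<subseteq> {x. n \<bullet> x = c}" "bounded F"
  shows "area F > 0"
proof -
  have "area F = measure (hyp n c) F"
    unfolding area_def surf_eq[OF assms(1-3)]
    using face_like_borel[OF assms(1)] by (intro measure_completion) simp
  then show ?thesis
    using face_like_pos[OF assms(1-3)] emeasure_hyp_bounded[OF assms(2) face_like_borel[OF assms(1)] assms(4), of c]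
    by (simp add: measure_def enn2real_positive_iff)
qed

text \<open>Relative openness determines the normal up to sign. With the opposite sign, almost every
  point of \<open>F\<close> would have \<open>x - t *\<^sub>R n\<close> both inside and outside
  \<open>T\<close> for small \<open>t\<close>, while \<open>F\<close> has positive measure.\<close>

lemma outward_normal_eq:
  assumes F: "face_like F" and n: "is_outward_normal T F n"
  shows "outward_normal T F = n"
  unfolding outward_normal_def
proof (rule the_equality)
  fix m assume m: "is_outward_normal T F m"
  obtain x0 where x0: "x0 \<in> F" using F by (auto simp: face_like_def)
  have n1: "norm n = 1" "norm m = 1" using n m by (auto simp: is_outward_normal_def)
  have sub: "F \<subseteq> {x. n \<bullet> x = n \<bullet> x0}" "F \<subseteq> {x. m \<bullet> x = m \<bullet> x0}"
  proof -
    have "n \<bullet> (x - x0) = 0" "m \<bullet> (x - x0) = 0" if "x \<in> F" for x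
      using n m x0 that unfolding is_outward_normal_def by blast+
    then show "F \<subseteq> {x. n \<bullet> x = n \<bullet> x0}" "F \<subseteq> {x. m \<bullet> x = m \<bullet> x0}"
      by (simp_all add: inner_diff_right subset_iff)
  qed
  have "m = n \<or> m = - n"
    using unit_normal_unique[OF n1(2,1) face_like_openin[OF F n1(1) sub(1)] _ sub(2)] x0 by auto
  moreover have "m \<noteq> - n"
  proof
    assume mn: "m = - n"
    have "AE x in surf F. x \<in> F \<longrightarrow> (\<exists>\<epsilon>>0. \<forall>t. 0 < t \<and> t < \<epsilon> \<longrightarrow> x - t *\<^sub>R n \<in> T \<and> x + t *\<^sub>R n \<notin> T)"
      "AE x in surf F. x \<in> F \<longrightarrow> (\<exists>\<epsilon>>0. \<forall>t. 0 < t \<and> t < \<epsilon> \<longrightarrow> x - t *\<^sub>R m \<in> T \<and> x + t *\<^sub>R m \<notin> T)"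
      using n m by (auto simp: is_outward_normal_def)
    then have "AE x in surf F. x \<notin> F"
    proof eventually_elim
      fix x
      assume a: "x \<in> F \<longrightarrow> (\<exists>\<epsilon>>0. \<forall>t. 0 < t \<and> t < \<epsilon> \<longrightarrow> x - t *\<^sub>R n \<in> T \<and> x + t *\<^sub>R n \<notin> T)"
        "x \<in> F \<longrightarrow> (\<exists>\<epsilon>>0. \<forall>t. 0 < t \<and> t < \<epsilon> \<longrightarrow> x - t *\<^sub>R m \<in> T \<and> x + t *\<^sub>R m \<notin> T)"
      show "x \<notin> F"
      proof
        assume "x \<in> F"
        then obtain e e' where "e > 0" "\<And>t. 0 < t \<Longrightarrow> t < e \<Longrightarrow> x - t *\<^sub>R n \<in> T"
          "e' > 0" "\<And>t. 0 < t \<Longrightarrow> t < e' \<Longrightarrow> x - t *\<^sub>R n \<notin> T"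
          using a by (auto simp: mn)
        then show False
          using dense[of 0 "min e e'"] by auto
      qed
    qed
    then have "AE x in hyp n (n \<bullet> x0). x \<notin> F"
      unfolding surf_eq[OF F n1(1) sub(1)] by (simp add: AE_completion_iff)
    then have "emeasure (hyp n (n \<bullet> x0)) F = 0"
      using face_like_borel[OF F] by (subst (asm) AE_iff_null_sets[symmetric]) auto
    then show False using face_like_pos[OF F n1(1) sub(1)] by simp
  qed
  ultimately show "m = n" by blast
qed (rule n)

section \<open>Absolute continuity on lines and traces\<close>

text \<open>The exceptional points are the differences of a closed set and a compact segment, hence
  form a closed set. Openness makes the complement a domain for the fundamental lemma.\<close>

lemma open_segment_domain:
  fixes T :: "'a::euclidean_space set"
  assumes "open T"
  shows "open {x. \<forall>r\<in>{0..p}. x + r *\<^sub>R v \<in> T}"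
proof -
  have "closed (\<Union>x\<in>- T. \<Union>y\<in>(\<lambda>r. r *\<^sub>R v) ` {0..p}. {x - y})"
    using assms by (intro closed_compact_differences compact_continuous_image continuous_intros) auto
  moreover have "- {x. \<forall>r\<in>{0..p}. x + r *\<^sub>R v \<in> T} = (\<Union>x\<in>- T. \<Union>y\<in>(\<lambda>r. r *\<^sub>R v) ` {0..p}. {x - y})"
  proof (intro subset_antisym subsetI)
    fix x assume "x \<in> - {x. \<forall>r\<in>{0..p}. x + r *\<^sub>R v \<in> T}"
    then obtain r where "r \<in> {0..p}" "x + r *\<^sub>R v \<notin> T" by auto
    then show "x \<in> (\<Union>x\<in>- T. \<Union>y\<in>(\<lambda>r. r *\<^sub>R v) ` {0..p}. {x - y})"
      by (intro UN_I[of "x + r *\<^sub>R v"] UN_I[of "r *\<^sub>R v"]) auto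
  next
    fix x assume "x \<in> (\<Union>x\<in>- T. \<Union>y\<in>(\<lambda>r. r *\<^sub>R v) ` {0..p}. {x - y})"
    then obtain y r where "y \<notin> T" "r \<in> {0..p}" "x + r *\<^sub>R v = y" by auto
    then show "x \<in> - {x. \<forall>r\<in>{0..p}. x + r *\<^sub>R v \<in> T}" by blast
  qed
  ultimately show ?thesis by (simp add: open_closed)
qed

text \<open>For fixed \<open>r\<close> the L1 norm in \<open>x\<close> of the translate does not
  depend on \<open>r\<close>, so \<open>h\<close> alone decides; this justifies the exchanges of
  integrals below.\<close>

lemma integrable_translate_product:
  fixes g :: "real^'n \<Rightarrow> real"
  assumes "integrable lborel g" and h: "integrable lborel h"
  shows "integrable (lborel \<Otimes>\<^sub>M lborel) (\<lambda>(x, r). h r * g (x + r *\<^sub>R v))"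
proof -
  have [measurable]: "g \<in> borel_measurable borel" "h \<in> borel_measurable borel" using assms by auto
  have "integrable (lborel \<Otimes>\<^sub>M lborel) (\<lambda>(r, x). h r * g (x + r *\<^sub>R v))"
  proof (rule lborel_pair.Fubini_integrable)
    show "(\<lambda>(r, x). h r * g (x + r *\<^sub>R v)) \<in> borel_measurable (lborel \<Otimes>\<^sub>M lborel)" by measurable
    have tr: "integrable lborel (\<lambda>x. g (x + c))" for c
    proof -
      have "(+) c = (\<lambda>x. x + c)" by (simp add: fun_eq_iff add.commute)
      then have "lborel = distr lborel borel (\<lambda>x. x + c)"
        using lborel_distr_plus[of c] by metis
      then have "integrable (distr lborel borel (\<lambda>x. x + c)) g" using assms(1) by metis
      then show ?thesis by (subst (asm) integrable_distr_eq) auto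
    qed
    have "(LINT x|lborel. norm (case (r, x) of (r, x) \<Rightarrow> h r * g (x + r *\<^sub>R v))) = \<bar>h r\<bar> * (LINT x|lborel. \<bar>g x\<bar>)" for r
      using integral_lborel_translate[of "\<lambda>x. \<bar>g x\<bar>" "r *\<^sub>R v"] by (simp add: abs_mult)
    then show "integrable lborel (\<lambda>r. LINT x|lborel. norm (case (r, x) of (r, x) \<Rightarrow> h r * g (x + r *\<^sub>R v)))"
      using h by simp
    show "AE r in lborel. integrable lborel (\<lambda>x. case (r, x) of (r, x) \<Rightarrow> h r * g (x + r *\<^sub>R v))"
      using tr by (intro AE_I2) simp
  qed
  from lborel_pair.integrable_product_swap[OF this] show ?thesis
    by (simp add: split_beta)
qed

lemma integrable_lborel_translate:
  fixes g :: "'a::euclidean_space \<Rightarrow> real"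
  assumes "integrable lborel g"
  shows "integrable lborel (\<lambda>x. g (x + c))"
proof -
  have "(+) c = (\<lambda>x. x + c)" by (simp add: fun_eq_iff add.commute)
  then have "lborel = distr lborel borel (\<lambda>x. x + c)"
    using lborel_distr_plus[of c] by metis
  then have "integrable (distr lborel borel (\<lambda>x. x + c)) g" using assms(1) by metis
  then show ?thesis using assms by (subst (asm) integrable_distr_eq) auto
qed

lemma integrable_indicator_Icc: "integrable lborel (indicator {a..b} :: real \<Rightarrow> real)"
  by (intro integrable_real_indicator) (auto simp: emeasure_lborel_Icc_eq)

text \<open>The fundamental theorem of calculus along \<open>v\<close>, carried over to the test
  function. If from each support point the whole segment stays in \<open>T\<close>, all translates
  of \<open>\<phi>\<close> by at most \<open>s\<close> are test functions on \<open>T\<close>; the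
  weak derivative is shifted onto them, and the classical theorem for \<open>\<phi>\<close>
  integrates it in \<open>r\<close>.\<close>

lemma weak_dd_translate_diff:
  fixes T :: "(real^'n) set"
  assumes T: "open T" and wg: "weak_dd T v w g" and s: "s \<ge> 0"
  shows "AE x in lborel. (\<forall>r\<in>{0..s}. x + r *\<^sub>R v \<in> T) \<longrightarrow>
    w (x + s *\<^sub>R v) - w x = (LINT r|lborel. indicator {0..s} r * g (x + r *\<^sub>R v))"
proof -
  let ?U = "{x. \<forall>r\<in>{0..s}. x + r *\<^sub>R v \<in> T}"
  let ?J = "\<lambda>x. LINT r|lborel. indicator {0..s} r * g (x + r *\<^sub>R v)"
  have w: "integrable lborel w" and g: "integrable lborel g"
    and wd: "\<And>\<phi>. test_function T \<phi> \<Longrightarrow> (LINT x|lborel. w x * (v \<bullet> grad \<phi> x)) = - (LINT x|lborel. g x * \<phi> x)"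
    using wg by (auto simp: weak_dd_def)
  note [measurable] = borel_measurable_integrable[OF w, simplified] borel_measurable_integrable[OF g, simplified]
  have P: "integrable (lborel \<Otimes>\<^sub>M lborel) (\<lambda>(x, r). indicator {0..s} r * g (x + r *\<^sub>R v))"
    by (rule integrable_translate_product[OF g integrable_indicator_Icc])
  have J: "integrable lborel ?J"
    using lborel_pair.integrable_fst'[OF P] by simp
  have "AE x in lborel. x \<in> ?U \<longrightarrow> (w (x + s *\<^sub>R v) - w x) - ?J x = 0"
  proof (rule AE_0_if_test_integrals_0[OF _ _ open_segment_domain[OF T]])
    show "integrable lborel (\<lambda>x. w (x + s *\<^sub>R v) - w x - ?J x)"
      by (intro Bochner_Integration.integrable_diff J w integrable_lborel_translate)
    fix \<phi> assume \<phi>: "test_function ?U \<phi>"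
    then have sm: "smooth \<phi>" by (rule test_function_smooth)
    note [measurable] = borel_measurable_smooth[OF sm] borel_measurable_grad[OF sm]
    obtain B where B: "B > 0" "\<And>x. \<bar>\<phi> x\<bar> \<le> B"
      using \<phi> by (rule test_function_bounded) blast
    obtain D where D: "D > 0" "\<And>x. norm (grad \<phi> x) \<le> D"
      using \<phi> by (rule test_function_grad_bounded) blast
    have vD: "\<bar>v \<bullet> grad \<phi> x\<bar> \<le> norm v * D" for x
      using Cauchy_Schwarz_ineq2[of v "grad \<phi> x"] D(2)[of x]
      by (meson mult_left_mono norm_ge_zero order_trans)
    have int: "integrable lborel (\<lambda>x. \<phi> x * k x)" if "integrable lborel k" for k
      using integrable_mult_bounded[OF that, of \<phi> B] B by (simp add: mult.commute)
    have 1: "(LINT x|lborel. \<phi> x * w (x + s *\<^sub>R v)) = (LINT x|lborel. \<phi> (x + (- s) *\<^sub>R v) * w x)"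
      using integral_lborel_translate[of "\<lambda>x. \<phi> (x + (- s) *\<^sub>R v) * w x" "s *\<^sub>R v"] by simp
    have "(LINT x|lborel. \<phi> x * ?J x) = (LINT x|lborel. LINT r|lborel. indicator {0..s} r * (\<phi> x * g (x + r *\<^sub>R v)))"
    proof (rule Bochner_Integration.integral_cong[OF refl])
      fix x
      have "\<phi> x * ?J x = (LINT r|lborel. \<phi> x * (indicator {0..s} r * g (x + r *\<^sub>R v)))"
        by (rule integral_mult_right_zero[symmetric])
      then show "\<phi> x * ?J x = (LINT r|lborel. indicator {0..s} r * (\<phi> x * g (x + r *\<^sub>R v)))"
        by (simp add: mult_ac)
    qed
    also have "\<dots> = (LINT r|lborel. LINT x|lborel. indicator {0..s} r * (\<phi> x * g (x + r *\<^sub>R v)))"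
    proof (rule lborel_pair.Fubini_integral[symmetric])
      have "integrable (lborel \<Otimes>\<^sub>M lborel) (\<lambda>p. (case p of (x, r) \<Rightarrow> indicator {0..s} r * g (x + r *\<^sub>R v)) * \<phi> (fst p))"
        by (rule integrable_mult_bounded[OF P, of _ B]) (use B in auto)
      then show "integrable (lborel \<Otimes>\<^sub>M lborel) (\<lambda>(x, r). indicator {0..s} r * (\<phi> x * g (x + r *\<^sub>R v)))"
        by (simp add: split_beta' mult_ac)
    qed
    also have "\<dots> = (LINT r|lborel. LINT x|lborel. indicator {0..s} r * (- (w x * (v \<bullet> grad \<phi> (x + (- r) *\<^sub>R v)))))"
    proof (rule Bochner_Integration.integral_cong[OF refl])
      fix r :: real
      show "(LINT x|lborel. indicator {0..s} r * (\<phi> x * g (x + r *\<^sub>R v)))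
          = (LINT x|lborel. indicator {0..s} r * (- (w x * (v \<bullet> grad \<phi> (x + (- r) *\<^sub>R v)))))"
      proof (cases "r \<in> {0..s}")
        case True
        \<comment> \<open>Here the shape of \<open>?U\<close> is used: moving it by
          \<open>r *\<^sub>R v\<close> carries it into \<open>T\<close>.\<close>
        then have t: "test_function T (\<lambda>x. \<phi> (x + (- r) *\<^sub>R v))"
          by (intro test_function_translate[OF \<phi>]) auto
        have "(LINT x|lborel. \<phi> x * g (x + r *\<^sub>R v)) = (LINT x|lborel. g x * \<phi> (x + (- r) *\<^sub>R v))"
          using integral_lborel_translate[of "\<lambda>x. \<phi> (x + (- r) *\<^sub>R v) * g x" "r *\<^sub>R v"] by (simp add: mult.commute)
        also have "\<dots> = - (LINT x|lborel. w x * (v \<bullet> grad \<phi> (x + (- r) *\<^sub>R v)))"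
          using wd[OF t] unfolding grad_translate[OF sm] by simp
        finally show ?thesis using True by simp
      qed simp
    qed
    also have "\<dots> = (LINT x|lborel. LINT r|lborel. indicator {0..s} r * (- (w x * (v \<bullet> grad \<phi> (x + (- r) *\<^sub>R v)))))"
    proof (rule lborel_pair.Fubini_integral)
      have "integrable (lborel \<Otimes>\<^sub>M lborel) (\<lambda>(x, r). indicator {0..s} r * w (x + r *\<^sub>R 0))"
        by (rule integrable_translate_product[OF w integrable_indicator_Icc])
      from integrable_mult_bounded[OF this, of "\<lambda>(x, r). - (v \<bullet> grad \<phi> (x + (- r) *\<^sub>R v))" "norm v * D"]
      have "integrable (lborel \<Otimes>\<^sub>M lborel) (\<lambda>p. (case p of (x, r) \<Rightarrow> indicator {0..s} r * w (x + r *\<^sub>R 0)) *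
          (case p of (x, r) \<Rightarrow> - (v \<bullet> grad \<phi> (x + (- r) *\<^sub>R v))))"
        using vD by (auto simp: split_beta)
      then show "integrable (lborel \<Otimes>\<^sub>M lborel) (\<lambda>(x, r). indicator {0..s} r * (- (w x * (v \<bullet> grad \<phi> (x + (- r) *\<^sub>R v)))))"
        by (simp add: split_beta' mult_ac)
    qed
    also have "\<dots> = (LINT x|lborel. w x * (\<phi> (x + (- s) *\<^sub>R v) - \<phi> x))"
    proof (rule Bochner_Integration.integral_cong[OF refl])
      fix x
      have "(LINT r|lborel. indicator {0..s} r *\<^sub>R (- (v \<bullet> grad \<phi> (x + (- r) *\<^sub>R v)))) = \<phi> (x + (- s) *\<^sub>R v) - \<phi> (x + (- 0) *\<^sub>R v)"
      proof (rule integral_FTC_Icc[OF s])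
        fix r :: real
        have "((\<lambda>r. x + (- r) *\<^sub>R v) has_derivative (\<lambda>h. - h *\<^sub>R v)) (at r within {0..s})"
          by (auto intro!: derivative_eq_intros)
        then have "((\<lambda>r. \<phi> (x + (- r) *\<^sub>R v)) has_derivative (\<lambda>h. (- h *\<^sub>R v) \<bullet> grad \<phi> (x + (- r) *\<^sub>R v))) (at r within {0..s})"
          by (rule has_derivative_compose) (rule smooth_has_derivative[OF sm])
        then show "((\<lambda>r. \<phi> (x + (- r) *\<^sub>R v)) has_vector_derivative - (v \<bullet> grad \<phi> (x + (- r) *\<^sub>R v))) (at r within {0..s})"
          by (simp add: has_vector_derivative_def)
        show "continuous_on {0..s} (\<lambda>r. - (v \<bullet> grad \<phi> (x + (- r) *\<^sub>R v)))"
          by (intro continuous_intros continuous_on_compose2[OF smooth_grad_continuous_on[OF sm, of UNIV]]) auto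
      qed
      then have "w x * (LINT r|lborel. indicator {0..s} r * (- (v \<bullet> grad \<phi> (x + (- r) *\<^sub>R v)))) = w x * (\<phi> (x + (- s) *\<^sub>R v) - \<phi> x)"
        by simp
      then show "(LINT r|lborel. indicator {0..s} r * (- (w x * (v \<bullet> grad \<phi> (x + (- r) *\<^sub>R v))))) = w x * (\<phi> (x + (- s) *\<^sub>R v) - \<phi> x)"
        by (subst (asm) integral_mult_right_zero[symmetric]) (simp add: mult_ac)
    qed
    finally have 2: "(LINT x|lborel. \<phi> x * ?J x) = (LINT x|lborel. w x * (\<phi> (x + (- s) *\<^sub>R v) - \<phi> x))" .
    have i1: "integrable lborel (\<lambda>x. w x * \<phi> (x + (- s) *\<^sub>R v))"
      by (rule integrable_mult_bounded[OF w, of _ B]) (use B in auto)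
    have i2: "integrable lborel (\<lambda>x. w x * \<phi> x)"
      by (rule integrable_mult_bounded[OF w, of _ B]) (use B in auto)
    have "(LINT x|lborel. \<phi> x * (w (x + s *\<^sub>R v) - w x - ?J x))
        = (LINT x|lborel. \<phi> x * w (x + s *\<^sub>R v)) - (LINT x|lborel. \<phi> x * w x) - (LINT x|lborel. \<phi> x * ?J x)"
      using int[OF integrable_lborel_translate[OF w]] int[OF w] int[OF J]
      by (simp add: right_diff_distrib)
    also have "\<dots> = 0"
      unfolding 1 2 using i1 i2 by (simp add: right_diff_distrib mult.commute)
    finally show "(LINT x|lborel. \<phi> x * (w (x + s *\<^sub>R v) - w x - ?J x)) = 0" .
  qed simp
  then show ?thesis by eventually_elim simp
qed

text \<open>The preceding identity holds for each length \<open>s\<close> at almost every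
  \<open>x\<close>; Fubini exchanges the two quantifiers. The segments have rational lengths
  \<open>p\<close>, so that countably many null sets are to be united.\<close>

lemma weak_dd_line_AE:
  fixes T :: "(real^'n) set"
  assumes T: "open T" and wg: "weak_dd T v w g"
  shows "AE x in lborel. \<forall>p\<in>\<rat>. (\<forall>r\<in>{0..p}. x + r *\<^sub>R v \<in> T) \<longrightarrow>
    (AE s in lborel. 0 \<le> s \<and> s \<le> p \<longrightarrow>
      w (x + s *\<^sub>R v) = w x + (LINT r|lborel. indicator {0..s} r * g (x + r *\<^sub>R v)))"
proof -
  have [measurable]: "w \<in> borel_measurable borel" "g \<in> borel_measurable borel"
    using wg by (auto simp: weak_dd_def)
  have "AE x in lborel. (\<forall>r\<in>{0..p}. x + r *\<^sub>R v \<in> T) \<longrightarrow>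
    (AE s in lborel. 0 \<le> s \<and> s \<le> p \<longrightarrow>
      w (x + s *\<^sub>R v) = w x + (LINT r|lborel. indicator {0..s} r * g (x + r *\<^sub>R v)))" for p
  proof -
    let ?U = "{x. \<forall>r\<in>{0..p}. x + r *\<^sub>R v \<in> T}"
    let ?P = "\<lambda>x s. x \<in> ?U \<longrightarrow> 0 \<le> s \<and> s \<le> p \<longrightarrow>
      w (x + s *\<^sub>R v) = w x + (LINT r|lborel. indicator {0..s} r * g (x + r *\<^sub>R v))"
    have [measurable]: "?U \<in> sets borel" using open_segment_domain[OF T] by simp
    have "(\<lambda>q. LINT r|lborel. indicator {0..snd q} r * g (fst q + r *\<^sub>R v)) \<in> borel_measurable (lborel \<Otimes>\<^sub>M lborel)"
    proof (rule lborel.borel_measurable_lebesgue_integral)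
      have "(\<lambda>z. indicator {q. 0 \<le> snd q \<and> snd q \<le> snd (fst q)} z * g (fst (fst z) + snd z *\<^sub>R v))
          \<in> borel_measurable ((lborel \<Otimes>\<^sub>M lborel) \<Otimes>\<^sub>M lborel)" by measurable
      then show "(\<lambda>(q, r). indicator {0..snd q} r * g (fst q + r *\<^sub>R v)) \<in> borel_measurable ((lborel \<Otimes>\<^sub>M lborel) \<Otimes>\<^sub>M lborel)"
        by (rule measurable_cong[THEN iffD1, rotated]) (auto simp: indicator_def)
    qed
    then have "{q \<in> space (lborel \<Otimes>\<^sub>M lborel). ?P (fst q) (snd q)} \<in> sets (lborel \<Otimes>\<^sub>M lborel)"
      by measurable
    moreover have "AE s in lborel. AE x in lborel. ?P x s"
    proof (rule AE_I2)
      fix s :: real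
      show "AE x in lborel. ?P x s"
      proof (cases "0 \<le> s \<and> s \<le> p")
        case True
        then show ?thesis
          using weak_dd_translate_diff[OF assms, of s] by (auto elim!: eventually_mono)
      qed auto
    qed
    ultimately have "AE x in lborel. AE s in lborel. ?P x s"
      by (subst lborel_pair.AE_commute) 
    then show ?thesis
      by eventually_elim auto
  qed
  then show ?thesis
    by (subst AE_ball_countable) (auto simp: countable_rat)
qed

lemma AE_lborel_affine:
  assumes "AE t in lborel. P (t :: real)" "c \<noteq> 0"
  shows "AE t in lborel. P (a + c * t)"
proof -
  obtain N where N: "{t. \<not> P t} \<subseteq> N" "emeasure lborel N = 0" "N \<in> sets borel"
    using AE_E[OF assms(1)] by auto
  have "AE t in lborel. t \<notin> N"
    using N by (intro AE_not_in) (auto simp: null_sets_def)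
  then have "AE t in lborel. a + c * t \<notin> N"
    using N(3) by (intro AE_borel_affine[OF assms(2)]) auto
  then show ?thesis
    by eventually_elim (use N(1) in auto)
qed

lemma AE_lborel_obtain:
  assumes "AE t in lborel. P (t :: real)" "a < b"
  obtains t where "a < t" "t < b" "P t"
proof -
  have "\<not> (AE t in lborel. t \<notin> {a<..<b})"
    using assms(2) by (subst AE_iff_null_sets[symmetric]) (auto simp: null_sets_def)
  then have "\<exists>t. t \<in> {a<..<b} \<and> P t"
    using assms(1) by (metis (mono_tags, lifting) eventually_mono)
  then show ?thesis using that by auto
qed

section \<open>Traces along almost every line\<close>

text \<open>From almost every starting point \<open>t1\<close> the function is an indefinite
  integral on the way down to zero, \<open>W t = (W t1 + ?I t1) - ?I t\<close>. The bracket cannot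
  depend on \<open>t1\<close>, since two such formulas overlap near zero; this constant is
  \<open>\<tau>\<close>.\<close>

lemma line_trace:
  fixes W g :: "real \<Rightarrow> real"
  assumes g: "integrable lborel g"
    and H: "AE t1 in lborel. \<forall>p\<in>\<rat>. (\<forall>r\<in>{0..p}. t1 - r \<in> A) \<longrightarrow>
      (AE s in lborel. 0 \<le> s \<and> s \<le> p \<longrightarrow>
        W (t1 - s) = W t1 + (LINT r|lborel. indicator {0..s} r * g (t1 - r)))"
  shows "\<exists>\<tau>. \<forall>\<epsilon>>0. {0<..<\<epsilon>} \<subseteq> A \<longrightarrow>
    (AE t in lborel. 0 < t \<and> t < \<epsilon> \<longrightarrow> W t = \<tau> - (LINT r|lborel. indicator {0..t} r * g r))"
proof -
  let ?I = "\<lambda>t. LINT r|lborel. indicator {0..t} r * g r"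
  have ii: "integrable lborel (\<lambda>r. indicator {a..b} r * g r)" for a b
    using integrable_mult_indicator[OF _ g, of "{a..b}"] by simp
  have good: "AE t1 in lborel. 0 < t1 \<and> {0<..t1} \<subseteq> A \<longrightarrow>
    (AE t in lborel. 0 < t \<and> t < t1 \<longrightarrow> W t = (W t1 + ?I t1) - ?I t)"
    using H
  proof eventually_elim
    fix t1
    assume h: "\<forall>p\<in>\<rat>. (\<forall>r\<in>{0..p}. t1 - r \<in> A) \<longrightarrow>
      (AE s in lborel. 0 \<le> s \<and> s \<le> p \<longrightarrow>
        W (t1 - s) = W t1 + (LINT r|lborel. indicator {0..s} r * g (t1 - r)))"
    show "0 < t1 \<and> {0<..t1} \<subseteq> A \<longrightarrow>
      (AE t in lborel. 0 < t \<and> t < t1 \<longrightarrow> W t = (W t1 + ?I t1) - ?I t)"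
    proof
      assume a: "0 < t1 \<and> {0<..t1} \<subseteq> A"
      \<comment> \<open>Rational lengths below \<open>t1\<close> keep the segment inside
        \<open>{0<..t1}\<close>, and together they reach every \<open>s < t1\<close>.\<close>
      have "AE s in lborel. \<forall>p\<in>\<rat> \<inter> {..<t1}. 0 \<le> s \<and> s \<le> p \<longrightarrow>
          W (t1 - s) = W t1 + (LINT r|lborel. indicator {0..s} r * g (t1 - r))"
      proof (subst AE_ball_countable)
        show "countable (\<rat> \<inter> {..<t1})" by (simp add: countable_rat)
        show "\<forall>p\<in>\<rat> \<inter> {..<t1}. AE s in lborel. 0 \<le> s \<and> s \<le> p \<longrightarrow>
          W (t1 - s) = W t1 + (LINT r|lborel. indicator {0..s} r * g (t1 - r))"
        proof
          fix p assume p: "p \<in> \<rat> \<inter> {..<t1}"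
          have "\<forall>r\<in>{0..p}. t1 - r \<in> A"
            using p a by (auto intro!: subsetD[of "{0<..t1}" A])
          then show "AE s in lborel. 0 \<le> s \<and> s \<le> p \<longrightarrow>
            W (t1 - s) = W t1 + (LINT r|lborel. indicator {0..s} r * g (t1 - r))"
            using h p by blast
        qed
      qed
      then have "AE s in lborel. 0 < s \<and> s < t1 \<longrightarrow>
          W (t1 - s) = W t1 + (LINT r|lborel. indicator {0..s} r * g (t1 - r))"
      proof eventually_elim
        fix s
        assume *: "\<forall>p\<in>\<rat> \<inter> {..<t1}. 0 \<le> s \<and> s \<le> p \<longrightarrow>
          W (t1 - s) = W t1 + (LINT r|lborel. indicator {0..s} r * g (t1 - r))"
        show "0 < s \<and> s < t1 \<longrightarrow> W (t1 - s) = W t1 + (LINT r|lborel. indicator {0..s} r * g (t1 - r))"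
        proof
          assume s: "0 < s \<and> s < t1"
          then obtain p where "p \<in> \<rat>" "s < p" "p < t1" using Rats_dense_in_real by blast
          then show "W (t1 - s) = W t1 + (LINT r|lborel. indicator {0..s} r * g (t1 - r))"
            using * s by (meson IntI less_imp_le lessThan_iff)
        qed
      qed
      from AE_lborel_affine[OF this, of "-1" t1]
      have "AE t in lborel. 0 < t1 - t \<and> t1 - t < t1 \<longrightarrow>
          W t = W t1 + (LINT r|lborel. indicator {0..t1 - t} r * g (t1 - r))" by simp
      then show "AE t in lborel. 0 < t \<and> t < t1 \<longrightarrow> W t = (W t1 + ?I t1) - ?I t"
      proof (eventually_elim, intro impI)
        fix t assume *: "0 < t1 - t \<and> t1 - t < t1 \<longrightarrow>
          W t = W t1 + (LINT r|lborel. indicator {0..t1 - t} r * g (t1 - r))" "0 < t \<and> t < t1"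
        have "(LINT r|lborel. indicator {0..t1 - t} r * g (t1 - r)) = (LINT r|lborel. indicator {t..t1} r * g r)"
          using lborel_integral_real_affine[of "-1" "\<lambda>r. indicator {t..t1} r * g r" t1]
          by (simp add: indicator_def conj_commute if_distrib algebra_simps cong: if_cong)
        also have "\<dots> = (LINT r|lborel. indicator {0..t1} r * g r - indicator {0..t} r * g r)"
        proof (rule integral_cong_AE)
          have "AE r in lborel. r \<noteq> t" by (rule AE_lborel_singleton)
          then show "AE r in lborel. indicator {t..t1} r * g r = indicator {0..t1} r * g r - indicator {0..t} r * g r"
            by eventually_elim (use *(2) in \<open>auto simp: indicator_def\<close>)
        qed (use g in auto)
        also have "\<dots> = ?I t1 - ?I t"
          by (intro Bochner_Integration.integral_diff ii)
        finally show "W t = (W t1 + ?I t1) - ?I t" using * by simp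
      qed
    qed
  qed
  show ?thesis
  proof (cases "\<exists>\<epsilon>>0. {0<..<\<epsilon>} \<subseteq> A")
    case True
    then obtain \<epsilon>0 where e0: "\<epsilon>0 > 0" "{0<..<\<epsilon>0} \<subseteq> A" by blast
    then obtain t0 where t0: "0 < t0" "t0 < \<epsilon>0"
      "0 < t0 \<and> {0<..t0} \<subseteq> A \<longrightarrow> (AE t in lborel. 0 < t \<and> t < t0 \<longrightarrow> W t = (W t0 + ?I t0) - ?I t)"
      using AE_lborel_obtain[OF good, of 0 \<epsilon>0] by blast
    define \<tau> where "\<tau> = W t0 + ?I t0"
    have \<tau>: "AE t in lborel. 0 < t \<and> t < t0 \<longrightarrow> W t = \<tau> - ?I t"
    proof -
      have "{0<..t0} \<subseteq> A" using e0(2) t0(2) by (auto simp: subset_iff)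
      then show ?thesis using t0 by (simp add: \<tau>_def)
    qed
    show ?thesis
    proof (intro exI[of _ \<tau>] allI impI)
      fix \<epsilon> :: real assume \<epsilon>: "\<epsilon> > 0" "{0<..<\<epsilon>} \<subseteq> A"
      \<comment> \<open>Starting points are good only almost everywhere, and
        \<open>\<epsilon>\<close> itself need not be one, so it is approached from below by these
        bounds.\<close>
      have "AE t in lborel. 0 < t \<and> t < \<epsilon> - \<epsilon> / real (k + 2) \<longrightarrow> W t = \<tau> - ?I t" for k
      proof -
        have "\<epsilon> - \<epsilon> / real (k + 2) < \<epsilon>" "0 \<le> \<epsilon> - \<epsilon> / real (k + 2)" using \<epsilon>(1) by (auto simp: field_simps)
        then obtain t1 where t1: "\<epsilon> - \<epsilon> / real (k + 2) < t1" "t1 < \<epsilon>" and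
          *: "0 < t1 \<and> {0<..t1} \<subseteq> A \<longrightarrow> (AE t in lborel. 0 < t \<and> t < t1 \<longrightarrow> W t = (W t1 + ?I t1) - ?I t)"
          using AE_lborel_obtain[OF good, of "\<epsilon> - \<epsilon> / real (k + 2)" \<epsilon>] by blast
        have t1p: "0 < t1" using t1 \<open>0 \<le> \<epsilon> - \<epsilon> / real (k + 2)\<close> by linarith
        have "{0<..t1} \<subseteq> A" using \<epsilon>(2) t1(2) by (auto simp: subset_iff)
        then have a: "AE t in lborel. 0 < t \<and> t < t1 \<longrightarrow> W t = (W t1 + ?I t1) - ?I t"
          using * t1p by blast
        \<comment> \<open>A point at which both formulas hold identifies the two constants.\<close>
        obtain t where "0 < t" "t < min t0 t1" "(0 < t \<and> t < t0 \<longrightarrow> W t = \<tau> - ?I t) \<and>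
            (0 < t \<and> t < t1 \<longrightarrow> W t = (W t1 + ?I t1) - ?I t)"
          using AE_lborel_obtain[OF eventually_conj[OF \<tau> a], of 0 "min t0 t1"] t0(1) t1p by auto
        then have "\<tau> = W t1 + ?I t1" by simp
        then show ?thesis using a t1(1) by (auto elim!: eventually_mono)
      qed
      then have "AE t in lborel. \<forall>k. 0 < t \<and> t < \<epsilon> - \<epsilon> / real (k + 2) \<longrightarrow> W t = \<tau> - ?I t"
        unfolding AE_all_countable by blast
      then show "AE t in lborel. 0 < t \<and> t < \<epsilon> \<longrightarrow> W t = \<tau> - ?I t"
      proof (eventually_elim, intro impI)
        fix t assume *: "\<forall>k. 0 < t \<and> t < \<epsilon> - \<epsilon> / real (k + 2) \<longrightarrow> W t = \<tau> - ?I t" "0 < t \<and> t < \<epsilon>"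
        obtain k :: nat where "real k > \<epsilon> / (\<epsilon> - t)" using reals_Archimedean2 by blast
        then have "\<epsilon> < real k * (\<epsilon> - t)" using *(2) by (simp add: field_simps)
        also have "\<dots> \<le> real (k + 2) * (\<epsilon> - t)" using *(2) by (intro mult_right_mono) auto
        finally have "t < \<epsilon> - \<epsilon> / real (k + 2)" by (simp add: field_simps)
        then show "W t = \<tau> - ?I t" using * by blast
      qed
    qed
  qed blast
qed

text \<open>The boundary values of a function with weak derivative \<open>g\<close> along the normal \<open>n\<close>: on almost
  every line in direction \<open>n\<close>, the function is \<open>\<tau>\<close> minus an integral of \<open>g\<close>.\<close>

definition normal_trace_at ::
  "(real^'n) set \<Rightarrow> real^'n \<Rightarrow> (real^'n \<Rightarrow> real) \<Rightarrow> (real^'n \<Rightarrow> real) \<Rightarrow> real^'n \<Rightarrow> real \<Rightarrow> bool" where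
  "normal_trace_at T n w g x \<tau> \<longleftrightarrow> integrable lborel (\<lambda>r. g (x - r *\<^sub>R n)) \<and>
    (\<forall>\<epsilon>>0. (\<forall>t. 0 < t \<and> t < \<epsilon> \<longrightarrow> x - t *\<^sub>R n \<in> T) \<longrightarrow>
      (AE t in lborel. 0 < t \<and> t < \<epsilon> \<longrightarrow>
        w (x - t *\<^sub>R n) = \<tau> - (LINT r|lborel. indicator {0..t} r * g (x - r *\<^sub>R n))))"

text \<open>By \<open>AE_hyp\<close>, almost every line in direction \<open>n\<close> consists
  almost everywhere of good starting points, which after the reflection of \<open>t\<close> to
  \<open>- t\<close> is the hypothesis of \<open>line_trace\<close>.\<close>

lemma normal_trace_exists:
  fixes T :: "(real^'n) set"
  assumes T: "open T" and n: "norm n = 1" and wg: "weak_dd T n w g"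
  shows "AE x in hyp n c. \<exists>\<tau>. normal_trace_at T n w g x \<tau>"
proof -
  have g: "integrable lborel g" using wg by (simp add: weak_dd_def)
  have [measurable]: "g \<in> borel_measurable borel" using g by simp
  have "AE x in hyp n c. integrable lborel (\<lambda>r. g (x + r *\<^sub>R n))"
    by (rule integral_hyp_Fubini(1)[OF n g])
  moreover have "AE x in hyp n c. AE t in lborel. \<forall>p\<in>\<rat>. (\<forall>r\<in>{0..p}. (x + t *\<^sub>R n) + r *\<^sub>R n \<in> T) \<longrightarrow>
    (AE s in lborel. 0 \<le> s \<and> s \<le> p \<longrightarrow>
      w ((x + t *\<^sub>R n) + s *\<^sub>R n) = w (x + t *\<^sub>R n) + (LINT r|lborel. indicator {0..s} r * g ((x + t *\<^sub>R n) + r *\<^sub>R n)))"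
    by (rule AE_hyp[OF n weak_dd_line_AE[OF T wg]])
  ultimately show ?thesis
  proof eventually_elim
    fix x
    assume i: "integrable lborel (\<lambda>r. g (x + r *\<^sub>R n))"
      and l: "AE t in lborel. \<forall>p\<in>\<rat>. (\<forall>r\<in>{0..p}. (x + t *\<^sub>R n) + r *\<^sub>R n \<in> T) \<longrightarrow>
    (AE s in lborel. 0 \<le> s \<and> s \<le> p \<longrightarrow>
      w ((x + t *\<^sub>R n) + s *\<^sub>R n) = w (x + t *\<^sub>R n) + (LINT r|lborel. indicator {0..s} r * g ((x + t *\<^sub>R n) + r *\<^sub>R n)))"
    have i': "integrable lborel (\<lambda>r. g (x - r *\<^sub>R n))"
      using lborel_integrable_real_affine[OF i, of "-1" 0] by simp
    have e: "(x + (- t) *\<^sub>R n) + s *\<^sub>R n = x - (t - s) *\<^sub>R n" for t s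
      by (simp add: algebra_simps)
    from AE_lborel_affine[OF l, of "-1" 0]
    have "AE t in lborel. \<forall>p\<in>\<rat>. (\<forall>r\<in>{0..p}. x - (t - r) *\<^sub>R n \<in> T) \<longrightarrow>
    (AE s in lborel. 0 \<le> s \<and> s \<le> p \<longrightarrow>
      w (x - (t - s) *\<^sub>R n) = w (x - t *\<^sub>R n) + (LINT r|lborel. indicator {0..s} r * g (x - (t - r) *\<^sub>R n)))"
      unfolding mult_minus1 add_0_left add_0 e by simp
    then have "\<exists>\<tau>. \<forall>\<epsilon>>0. {0<..<\<epsilon>} \<subseteq> {t. x - t *\<^sub>R n \<in> T} \<longrightarrow>
      (AE t in lborel. 0 < t \<and> t < \<epsilon> \<longrightarrow> w (x - t *\<^sub>R n) = \<tau> - (LINT r|lborel. indicator {0..t} r * g (x - r *\<^sub>R n)))"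
      by (intro line_trace[OF i']) simp
    then show "\<exists>\<tau>. normal_trace_at T n w g x \<tau>"
      unfolding normal_trace_at_def using i' by (auto simp: subset_iff)
  qed
qed

lemma indefinite_integral_tendsto_0:
  fixes g :: "real \<Rightarrow> real"
  assumes g: "integrable lborel g"
  shows "((\<lambda>t. LINT r|lborel. indicator {0..t} r * g r) \<longlongrightarrow> 0) (at_right 0)"
proof (rule tendsto_at_right_sequentially[of 0 1])
  fix S :: "nat \<Rightarrow> real"
  assume S: "\<And>n. 0 < S n" "S \<longlonglongrightarrow> 0"
  have "(\<lambda>k. LINT r|lborel. indicator {0..S k} r * g r) \<longlonglongrightarrow> (LINT r|(lborel :: real measure). 0)"
  proof (rule integral_dominated_convergence[where w = "\<lambda>r. \<bar>g r\<bar>" and f = "\<lambda>r. 0" and s = "\<lambda>k r. indicator {0..S k} r * g r"])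
    have "AE r in lborel. r \<noteq> (0::real)" by (rule AE_lborel_singleton)
    then show "AE r in lborel. (\<lambda>k. indicator {0..S k} r * g r) \<longlonglongrightarrow> 0"
    proof eventually_elim
      fix r :: real assume "r \<noteq> 0"
      have "\<forall>\<^sub>F k in sequentially. indicator {0..S k} r * g r = 0"
      proof (cases "r < 0")
        case False
        then have "\<forall>\<^sub>F k in sequentially. S k < r"
          using S(2) \<open>r \<noteq> 0\<close> by (intro order_tendstoD(2)) auto
        then show ?thesis by eventually_elim auto
      qed auto
      then show "(\<lambda>k. indicator {0..S k} r * g r) \<longlonglongrightarrow> 0"
        by (rule tendsto_eventually)
    qed
  qed (use g in \<open>auto simp: indicator_def abs_mult\<close>)
  then show "(\<lambda>k. LINT r|lborel. indicator {0..S k} r * g r) \<longlonglongrightarrow> 0" by simp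
qed auto

lemma Lim_cong_eventually:
  assumes "\<forall>\<^sub>F x in F. f x = g x"
  shows "Lim F f = Lim F g"
  unfolding Topological_Spaces.Lim_def using tendsto_cong[OF assms] by simp

lemma borel_measurable_lebesgue_on_AE:
  fixes f g :: "'a::euclidean_space \<Rightarrow> 'b::euclidean_space"
  assumes S: "S \<in> sets lebesgue" and f: "f \<in> borel_measurable (lebesgue_on S)"
    and ae: "AE x in lebesgue_on S. f x = g x"
  shows "g \<in> borel_measurable (lebesgue_on S)"
proof -
  have "(\<lambda>x. if x \<in> S then f x else 0) \<in> borel_measurable lebesgue"
    using f S by (simp add: borel_measurable_if)
  moreover have "AE x in lebesgue. (if x \<in> S then f x else 0) = (if x \<in> S then g x else 0)"
    using ae S by (auto simp: AE_restrict_space_iff elim!: eventually_mono)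
  ultimately have "(\<lambda>x. if x \<in> S then g x else 0) \<in> borel_measurable lebesgue"
    by (rule borel_measurable_AE)
  then show ?thesis
    using S by (simp add: borel_measurable_if)
qed

text \<open>\<open>face_trace\<close> is a limit of means of the chosen gradient \<open>wg\<close>,
  which on the line agrees only almost everywhere with the function \<open>h\<close> that has a
  limit at zero. The means do not see the difference.\<close>

lemma face_trace_eq:
  fixes W wg :: "real^'n \<Rightarrow> real^'n"
  assumes on: "outward_normal T F = n" and n: "norm n = 1"
    and tr: "\<And>i. normal_trace_at T n (\<lambda>z. W z $ i) (g i) x (\<tau> $ i)"
    and seg: "0 < \<epsilon>0" "\<And>t. 0 < t \<Longrightarrow> t < \<epsilon>0 \<Longrightarrow> x - t *\<^sub>R n \<in> T"
    and ae: "AE t in lborel. x - t *\<^sub>R n \<in> T \<longrightarrow> wg (x - t *\<^sub>R n) = W (x - t *\<^sub>R n)"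
  shows "face_trace T F wg x = \<tau>"
proof -
  have nn: "n \<bullet> n = 1" using n by (simp add: dot_square_norm)
  have gi: "integrable lborel (\<lambda>r. g i (x - r *\<^sub>R n))" for i
    using tr[of i] by (simp add: normal_trace_at_def)
  define I where "I i t = (LINT r|lborel. indicator {0..t} r * g i (x - r *\<^sub>R n))" for i t
  define h :: "real \<Rightarrow> real^'n" where "h t = (\<chi> i. \<tau> $ i - I i t)" for t
  have Im: "I i \<in> borel_measurable borel" for i
  proof -
    have [measurable]: "(\<lambda>r. g i (x - r *\<^sub>R n)) \<in> borel_measurable borel" using gi[of i] by simp
    have "(\<lambda>t. LINT r|lborel. indicator {0..t} r * g i (x - r *\<^sub>R n)) \<in> borel_measurable lborel"
    proof (rule lborel.borel_measurable_lebesgue_integral)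
      have "(\<lambda>z. indicator {q. 0 \<le> snd q \<and> snd q \<le> fst q} z * g i (x - snd z *\<^sub>R n))
          \<in> borel_measurable (lborel \<Otimes>\<^sub>M lborel)" by measurable
      then show "(\<lambda>(t, r). indicator {0..t} r * g i (x - r *\<^sub>R n)) \<in> borel_measurable (lborel \<Otimes>\<^sub>M lborel)"
        by (rule measurable_cong[THEN iffD1, rotated]) (auto simp: indicator_def)
    qed
    then show ?thesis by (simp add: I_def[abs_def])
  qed
  have hm: "h \<in> borel_measurable borel"
    using Im by (subst borel_measurable_euclidean_space) (auto simp: h_def Basis_vec_def inner_axis)
  have hlim: "(h \<longlongrightarrow> \<tau>) (at_right 0)"
  proof (rule vec_tendstoI)
    fix i
    have "((\<lambda>t. \<tau> $ i - I i t) \<longlongrightarrow> \<tau> $ i - 0) (at_right 0)"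
      unfolding I_def by (intro tendsto_intros indefinite_integral_tendsto_0 gi)
    then show "((\<lambda>t. h t $ i) \<longlongrightarrow> \<tau> $ i) (at_right 0)" by (simp add: h_def)
  qed
  have "AE t in lborel. \<forall>i. 0 < t \<and> t < \<epsilon>0 \<longrightarrow> W (x - t *\<^sub>R n) $ i = \<tau> $ i - I i t"
    using tr seg by (intro eventually_all_finite) (simp add: normal_trace_at_def I_def)
  with ae have eq: "AE t in lborel. 0 < t \<and> t < \<epsilon>0 \<longrightarrow> wg (x - t *\<^sub>R n) = h t"
    by eventually_elim (use seg(2) in \<open>auto simp: h_def vec_eq_iff\<close>)
  \<comment> \<open>A function on the whole space whose values on the line through \<open>x\<close>
    are exactly those of \<open>h\<close>, so that \<open>face_trace_continuous\<close>
    applies.\<close>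
  define w' where "w' y = h (n \<bullet> (x - y))" for y
  have w': "w' (x - t *\<^sub>R n) = h t" for t
    by (simp add: w'_def nn)
  have "face_trace T F w' x = \<tau>"
    by (rule face_trace_continuous[where r = 1])
      (use hlim hm in \<open>auto simp: on w' intro: borel_measurable_lebesgue_on_borel\<close>)
  moreover have "face_trace T F wg x = face_trace T F w' x"
    unfolding face_trace_def on
  proof (rule Lim_cong_eventually)
    have "(1 / \<epsilon>) *\<^sub>R (LINT t|lebesgue_on {0<..<\<epsilon>}. wg (x - t *\<^sub>R n)) = (1 / \<epsilon>) *\<^sub>R (LINT t|lebesgue_on {0<..<\<epsilon>}. w' (x - t *\<^sub>R n))"
      if \<epsilon>: "0 < \<epsilon>" "\<epsilon> < \<epsilon>0" for \<epsilon>
    proof -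
      have a: "AE t in lebesgue_on {0<..<\<epsilon>}. h t = wg (x - t *\<^sub>R n)"
        using eq \<epsilon> by (intro AE_lebesgue_on) (auto elim!: eventually_mono)
      have "h \<in> borel_measurable (lebesgue_on {0<..<\<epsilon>})"
        using hm by (rule borel_measurable_lebesgue_on_borel)
      moreover from this have "(\<lambda>t. wg (x - t *\<^sub>R n)) \<in> borel_measurable (lebesgue_on {0<..<\<epsilon>})"
        using a by (rule borel_measurable_lebesgue_on_AE[rotated]) simp
      ultimately have "(LINT t|lebesgue_on {0<..<\<epsilon>}. h t) = (LINT t|lebesgue_on {0<..<\<epsilon>}. wg (x - t *\<^sub>R n))"
        using a by (rule integral_cong_AE)
      then show ?thesis by (simp add: w')
    qed
    then show "\<forall>\<^sub>F \<epsilon> in at_right 0. (1 / \<epsilon>) *\<^sub>R (LINT t|lebesgue_on {0<..<\<epsilon>}. wg (x - t *\<^sub>R n))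
        = (1 / \<epsilon>) *\<^sub>R (LINT t|lebesgue_on {0<..<\<epsilon>}. w' (x - t *\<^sub>R n))"
      using seg(1) by (auto simp: eventually_at_right_field)
  qed
  ultimately show ?thesis by simp
qed

section \<open>One-sided approximate identities\<close>

text \<open>The derivative of \<open>step (real (Suc k) * t - 1)\<close>: mass one between
  \<open>1 / real (Suc k)\<close> and \<open>2 / real (Suc k)\<close>. The gap at zero gives the
  associated cut-off compact support inside the cell.\<close>

definition layer_kernel :: "nat \<Rightarrow> real \<Rightarrow> real" where
  "layer_kernel k t = real (Suc k) * step' (real (Suc k) * t - 1)"

lemma layer_kernel_measurable [measurable]: "layer_kernel k \<in> borel_measurable borel"
proof -
  have "continuous_on UNIV (layer_kernel k)"
    unfolding layer_kernel_def[abs_def]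
    by (intro continuous_intros continuous_on_compose2[OF step'_continuous[of UNIV]]) auto
  then show ?thesis by (rule borel_measurable_continuous_onI)
qed

lemma layer_kernel_0: "t \<le> 1 / real (Suc k) \<or> t \<ge> 2 / real (Suc k) \<Longrightarrow> layer_kernel k t = 0"
  unfolding layer_kernel_def by (subst step'_0) (auto simp: field_simps)

lemma layer_kernel_bound:
  assumes "\<And>t. \<bar>step' t\<bar> \<le> B"
  shows "\<bar>layer_kernel k t\<bar> \<le> B * (real (Suc k) * indicator {0..2 / real (Suc k)} t)"
proof (cases "t \<in> {0..2 / real (Suc k)}")
  case True
  then show ?thesis
    using mult_left_mono[OF assms, of "real (Suc k)"] by (simp add: layer_kernel_def abs_mult mult.commute)
next
  case False
  then have "t \<le> 1 / real (Suc k) \<or> t \<ge> 2 / real (Suc k)"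
    by (cases "t < 0") (auto intro: order_trans[of t 0])
  then show ?thesis using False by (simp add: layer_kernel_0)
qed

lemma integrable_layer_bound: "integrable lborel (\<lambda>t. B * (real (Suc k) * indicator {0..2 / real (Suc k)} t))"
  by (intro integrable_mult_right integrable_indicator_Icc)

lemma integral_layer_bound: "(LINT t|lborel. B * (real (Suc k) * indicator {0..2 / real (Suc k)} t)) = 2 * B"
  by (simp del: of_nat_Suc)

lemma integral_layer_kernel: "(LINT t|lborel. layer_kernel k t) = 1"
proof -
  let ?K = "real (Suc k)"
  have "(LINT t|lborel. indicator {1 / ?K..2 / ?K} t *\<^sub>R layer_kernel k t) = step (?K * (2 / ?K) - 1) - step (?K * (1 / ?K) - 1)"
  proof (rule integral_FTC_Icc)
    fix t
    have "((\<lambda>t. step (?K * t - 1)) has_real_derivative (step' (?K * t - 1) * ?K)) (at t within {1 / ?K..2 / ?K})"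
      by (rule DERIV_chain2[OF step_deriv]) (auto intro!: derivative_eq_intros)
    then show "((\<lambda>t. step (?K * t - 1)) has_vector_derivative layer_kernel k t) (at t within {1 / ?K..2 / ?K})"
      by (simp add: has_real_derivative_iff_has_vector_derivative layer_kernel_def mult.commute)
    show "continuous_on {1 / ?K..2 / ?K} (layer_kernel k)"
      unfolding layer_kernel_def[abs_def]
      by (intro continuous_intros continuous_on_compose2[OF step'_continuous[of UNIV]]) auto
  qed (auto simp: field_simps)
  moreover have "(\<lambda>t. indicator {1 / ?K..2 / ?K} t *\<^sub>R layer_kernel k t) = layer_kernel k"
  proof
    fix t
    show "indicator {1 / ?K..2 / ?K} t *\<^sub>R layer_kernel k t = layer_kernel k t"
      using layer_kernel_0[of t k] by (cases "1 / ?K \<le> t \<and> t \<le> 2 / ?K") auto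
  qed
  ultimately show ?thesis by (simp del: of_nat_Suc)
qed

text \<open>For large \<open>k\<close> the kernel lives where \<open>f\<close> is close to
  \<open>q0\<close>, and its L1 norm is at most \<open>2 * B\<close> whatever \<open>k\<close>
  is.\<close>

lemma layer_kernel_limit:
  fixes f q :: "real \<Rightarrow> real"
  assumes f[measurable]: "f \<in> borel_measurable borel" and "\<epsilon> > 0"
    and eq: "AE t in lborel. 0 < t \<and> t < \<epsilon> \<longrightarrow> f t = q t"
    and lim: "(q \<longlongrightarrow> q0) (at_right 0)"
  shows "(\<lambda>k. LINT t|lborel. f t * layer_kernel k t) \<longlonglongrightarrow> q0"
proof (rule LIMSEQ_I)
  fix e :: real assume "e > 0"
  obtain B where B: "B > 0" "\<And>t. \<bar>step' t\<bar> \<le> B" using step'_bound by blast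
  \<comment> \<open>Makes the final bound \<open>2 * (\<eta> * B)\<close> equal to
    \<open>e / 2\<close>.\<close>
  define \<eta> where "\<eta> = e / (4 * B)"
  have "\<eta> > 0" using \<open>e > 0\<close> B by (simp add: \<eta>_def)
  have "\<forall>\<^sub>F t in at_right 0. dist (q t) q0 < \<eta>"
    using tendstoD[OF lim \<open>\<eta> > 0\<close>] .
  then obtain b where b: "b > 0" "\<And>t. 0 < t \<Longrightarrow> t < b \<Longrightarrow> \<bar>q t - q0\<bar> < \<eta>"
    unfolding eventually_at_right_field dist_real_def by auto
  define m where "m = min b \<epsilon>"
  have m: "m > 0" "m \<le> b" "m \<le> \<epsilon>" using b(1) \<open>\<epsilon> > 0\<close> by (auto simp: m_def)
  obtain N :: nat where N: "real N > 2 / m" using reals_Archimedean2 by blast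
  show "\<exists>no. \<forall>k\<ge>no. norm ((LINT t|lborel. f t * layer_kernel k t) - q0) < e"
  proof (intro exI[of _ N] allI impI)
    fix k assume "k \<ge> N"
    then have "2 / m < real (Suc k)" using N by linarith
    then have K: "2 / real (Suc k) < m"
      using m(1) by (simp add: field_simps)
    have bound: "AE t in lborel. norm ((f t - q0) * layer_kernel k t) \<le> (\<eta> * B) * (real (Suc k) * indicator {0..2 / real (Suc k)} t)"
      using eq
    proof eventually_elim
      fix t assume eq: "0 < t \<and> t < \<epsilon> \<longrightarrow> f t = q t"
      show "norm ((f t - q0) * layer_kernel k t) \<le> (\<eta> * B) * (real (Suc k) * indicator {0..2 / real (Suc k)} t)"
      proof (cases "t \<le> 1 / real (Suc k) \<or> t \<ge> 2 / real (Suc k)")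
        case True
        then show ?thesis using B \<open>\<eta> > 0\<close> by (simp add: layer_kernel_0)
      next
        case False
        then have t: "0 < t" "t < b" "t < \<epsilon>"
          using K m by (auto intro: less_trans[of 0 "1 / real (Suc k)"])
        then have "\<bar>f t - q0\<bar> \<le> \<eta>" using eq b(2)[of t] by simp
        then have "norm ((f t - q0) * layer_kernel k t) \<le> \<eta> * (B * (real (Suc k) * indicator {0..2 / real (Suc k)} t))"
          unfolding real_norm_def abs_mult using layer_kernel_bound[OF B(2), of k t] \<open>\<eta> > 0\<close>
          by (intro mult_mono) auto
        then show ?thesis by (simp only: mult.assoc)
      qed
    qed
    have int: "integrable lborel (\<lambda>t. (f t - q0) * layer_kernel k t)"
      by (rule Bochner_Integration.integrable_bound[OF integrable_layer_bound[of "\<eta> * B" k]])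
        (use bound B \<open>\<eta> > 0\<close> in \<open>auto elim!: eventually_mono\<close>)
    have intk: "integrable lborel (layer_kernel k)"
      by (rule Bochner_Integration.integrable_bound[OF integrable_layer_bound[of B k]])
        (use layer_kernel_bound[OF B(2)] B in \<open>auto\<close>)
    have "(LINT t|lborel. f t * layer_kernel k t) = (LINT t|lborel. (f t - q0) * layer_kernel k t + q0 * layer_kernel k t)"
      by (simp add: algebra_simps)
    also have "\<dots> = (LINT t|lborel. (f t - q0) * layer_kernel k t) + q0"
      using int intk by (simp add: integral_layer_kernel)
    finally have "norm ((LINT t|lborel. f t * layer_kernel k t) - q0) = norm (LINT t|lborel. (f t - q0) * layer_kernel k t)"
      by simp
    also have "\<dots> \<le> (LINT t|lborel. norm ((f t - q0) * layer_kernel k t))"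
      by (rule integral_norm_bound)
    also have "\<dots> \<le> (LINT t|lborel. (\<eta> * B) * (real (Suc k) * indicator {0..2 / real (Suc k)} t))"
      using bound int by (intro integral_mono_AE integrable_layer_bound) auto
    also have "\<dots> = 2 * (\<eta> * B)" by (rule integral_layer_bound)
    also have "\<dots> < e" using B(1) \<open>e > 0\<close> by (simp add: \<eta>_def)
    finally show "norm ((LINT t|lborel. f t * layer_kernel k t) - q0) < e" .
  qed
qed

text \<open>Built from the kernels that arise as derivatives of the cut-offs in
  \<open>local_gauss_green\<close>. As the \<open>lim\<close> of a sequence of parameter integrals
  it is Borel on the whole space, also where the limit does not exist; on the normals that enter the
  cell it is the \<open>\<tau>\<close> of \<open>normal_trace_at\<close>.\<close>

definition btrace :: "real^'n \<Rightarrow> (real^'n \<Rightarrow> real) \<Rightarrow> real^'n \<Rightarrow> real" where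
  "btrace n w x = lim (\<lambda>k. LINT t|lborel. w (x - t *\<^sub>R n) * layer_kernel k t)"

lemma layer_integral_measurable:
  fixes w :: "real^'n \<Rightarrow> real"
  assumes [measurable]: "w \<in> borel_measurable borel"
  shows "(\<lambda>x. LINT t|lborel. w (x - t *\<^sub>R n) * layer_kernel k t) \<in> borel_measurable borel"
proof -
  have "(\<lambda>x. LINT t|lborel. w (x - t *\<^sub>R n) * layer_kernel k t) \<in> borel_measurable lborel"
    by (rule lborel.borel_measurable_lebesgue_integral) measurable
  then show ?thesis by simp
qed

lemma btrace_measurable:
  fixes w :: "real^'n \<Rightarrow> real"
  assumes "w \<in> borel_measurable borel"
  shows "btrace n w \<in> borel_measurable borel"
  unfolding btrace_def[abs_def] using layer_integral_measurable[OF assms]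
  by (intro borel_measurable_lim_metric)

text \<open>The factor \<open>\<psi>\<close> stands for the values of a test function along the
  line.\<close>

lemma normal_trace_at_kernel_limit:
  fixes w :: "real^'n \<Rightarrow> real"
  assumes w[measurable]: "w \<in> borel_measurable borel" and tr: "normal_trace_at T n w g x \<tau>"
    and seg: "0 < \<epsilon>" "\<And>t. 0 < t \<Longrightarrow> t < \<epsilon> \<Longrightarrow> x - t *\<^sub>R n \<in> T"
    and \<psi>[measurable]: "\<psi> \<in> borel_measurable borel" and \<psi>l: "(\<psi> \<longlongrightarrow> \<psi>0) (at_right 0)"
  shows "(\<lambda>k. LINT t|lborel. w (x - t *\<^sub>R n) * \<psi> t * layer_kernel k t) \<longlonglongrightarrow> \<tau> * \<psi>0"
proof (rule layer_kernel_limit)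
  let ?I = "\<lambda>t. LINT r|lborel. indicator {0..t} r * g (x - r *\<^sub>R n)"
  have "AE t in lborel. 0 < t \<and> t < \<epsilon> \<longrightarrow> w (x - t *\<^sub>R n) = \<tau> - ?I t"
    using tr seg by (auto simp: normal_trace_at_def)
  then show "AE t in lborel. 0 < t \<and> t < \<epsilon> \<longrightarrow> w (x - t *\<^sub>R n) * \<psi> t = (\<tau> - ?I t) * \<psi> t"
    by eventually_elim auto
  have "integrable lborel (\<lambda>r. g (x - r *\<^sub>R n))" using tr by (simp add: normal_trace_at_def)
  then have "((\<lambda>t. (\<tau> - ?I t) * \<psi> t) \<longlongrightarrow> (\<tau> - 0) * \<psi>0) (at_right 0)"
    by (intro tendsto_intros \<psi>l indefinite_integral_tendsto_0)
  then show "((\<lambda>t. (\<tau> - ?I t) * \<psi> t) \<longlongrightarrow> \<tau> * \<psi>0) (at_right 0)" by simp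
qed (use seg in auto)

lemma btrace_tendsto:
  assumes w: "w \<in> borel_measurable borel" and tr: "normal_trace_at T n w g x \<tau>"
    and seg: "0 < \<epsilon>" "\<And>t. 0 < t \<Longrightarrow> t < \<epsilon> \<Longrightarrow> x - t *\<^sub>R n \<in> T"
  shows "btrace n w x = \<tau>"
    and "(\<lambda>k. LINT t|lborel. w (x - t *\<^sub>R n) * layer_kernel k t) \<longlonglongrightarrow> btrace n w x"
proof -
  have "(\<lambda>k. LINT t|lborel. w (x - t *\<^sub>R n) * 1 * layer_kernel k t) \<longlonglongrightarrow> \<tau> * 1"
    by (rule normal_trace_at_kernel_limit[OF w tr seg]) auto
  then have *: "(\<lambda>k. LINT t|lborel. w (x - t *\<^sub>R n) * layer_kernel k t) \<longlonglongrightarrow> \<tau>" by simp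
  then show "btrace n w x = \<tau>" unfolding btrace_def by (rule limI)
  with * show "(\<lambda>k. LINT t|lborel. w (x - t *\<^sub>R n) * layer_kernel k t) \<longlonglongrightarrow> btrace n w x" by simp
qed


section \<open>Integrability of the boundary values\<close>

lemma norm_integral_le_nn_integral:
  fixes f :: "'a \<Rightarrow> real"
  shows "ennreal (norm (integral\<^sup>L M f)) \<le> (\<integral>\<^sup>+ x. ennreal (norm (f x)) \<partial>M)"
proof (cases "integrable M f")
  case True
  then show ?thesis by (rule integral_norm_bound_ennreal)
qed (simp add: not_integrable_integral_eq)

text \<open>The values of \<open>s\<close> at which a fixed point is met by the moving layer lie in
  an interval of length \<open>\<delta> / \<bar>n \<bullet> v\<bar>\<close>, because the layer is
  crossed transversally. Averaging over \<open>s\<close> therefore gains the factor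
  \<open>\<delta>\<close>.\<close>

lemma layer_sweep:
  fixes q :: "real^'n \<Rightarrow> ennreal" and A :: "(real^'n) set"
  assumes [measurable]: "q \<in> borel_measurable borel" "A \<in> sets borel"
    and A: "\<And>z. z \<in> A \<Longrightarrow> 0 \<le> c - n \<bullet> z \<and> c - n \<bullet> z \<le> \<delta>" and nv: "n \<bullet> v \<noteq> 0" and "\<delta> \<ge> 0"
  shows "(\<integral>\<^sup>+ s. indicator {0..1} s * (\<integral>\<^sup>+ z. indicator A z * q (z + s *\<^sub>R v) \<partial>lborel) \<partial>lborel)
    \<le> ennreal (\<delta> / \<bar>n \<bullet> v\<bar>) * (\<integral>\<^sup>+ z. q z \<partial>lborel)"
proof -
  have "(\<integral>\<^sup>+ s. indicator {0..1} s * (\<integral>\<^sup>+ z. indicator A z * q (z + s *\<^sub>R v) \<partial>lborel) \<partial>lborel)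
      \<le> (\<integral>\<^sup>+ (s::real). (\<integral>\<^sup>+ z. indicator A (z - s *\<^sub>R v) * q z \<partial>lborel) \<partial>lborel)"
  proof (rule nn_integral_mono)
    fix s :: real
    have "(\<integral>\<^sup>+ z. indicator A z * q (z + s *\<^sub>R v) \<partial>lborel) = (\<integral>\<^sup>+ z. indicator A (z - s *\<^sub>R v) * q z \<partial>lborel)"
      using nn_integral_lborel_translate[of "\<lambda>z. indicator A (z - s *\<^sub>R v) * q z" "s *\<^sub>R v"] by simp
    then show "indicator {0..1} s * (\<integral>\<^sup>+ z. indicator A z * q (z + s *\<^sub>R v) \<partial>lborel)
      \<le> (\<integral>\<^sup>+ z. indicator A (z - s *\<^sub>R v) * q z \<partial>lborel)"
      by (auto simp: indicator_def)
  qed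
  also have "\<dots> = (\<integral>\<^sup>+ z. (\<integral>\<^sup>+ s. indicator A (z - s *\<^sub>R v) * q z \<partial>lborel) \<partial>lborel)"
    by (rule lborel_pair.Fubini') measurable
  also have "\<dots> \<le> (\<integral>\<^sup>+ z. ennreal (\<delta> / \<bar>n \<bullet> v\<bar>) * q z \<partial>lborel)"
  proof (rule nn_integral_mono)
    fix z
    let ?a = "(n \<bullet> z - c) / (n \<bullet> v)" and ?b = "(n \<bullet> z - c + \<delta>) / (n \<bullet> v)"
    have "indicator A (z - s *\<^sub>R v) \<le> (indicator {min ?a ?b..max ?a ?b} s :: ennreal)" for s
    proof (cases "z - s *\<^sub>R v \<in> A")
      case True
      from A[OF True] have s: "n \<bullet> z - c \<le> s * (n \<bullet> v)" "s * (n \<bullet> v) \<le> n \<bullet> z - c + \<delta>"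
        by (auto simp: inner_simps)
      have "min ?a ?b \<le> s \<and> s \<le> max ?a ?b"
      proof (cases "n \<bullet> v > 0")
        case True
        then have "?a \<le> s" "s \<le> ?b" using s by (auto simp: field_simps)
        then show ?thesis by auto
      next
        case False
        then have "n \<bullet> v < 0" using nv by auto
        then have "?b \<le> s" "s \<le> ?a" using s by (auto simp: field_simps)
        then show ?thesis by auto
      qed
      then show ?thesis by (simp add: indicator_def)
    qed simp
    then have "(\<integral>\<^sup>+ s. indicator A (z - s *\<^sub>R v) * q z \<partial>lborel) \<le> (\<integral>\<^sup>+ s. indicator {min ?a ?b..max ?a ?b} s * q z \<partial>lborel)"
      by (intro nn_integral_mono mult_right_mono) auto
    also have "\<dots> = emeasure lborel {min ?a ?b..max ?a ?b} * q z"
      by (subst nn_integral_multc) auto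
    also have "emeasure lborel {min ?a ?b..max ?a ?b} = ennreal (max ?a ?b - min ?a ?b)"
      by (simp add: emeasure_lborel_Icc)
    also have "max ?a ?b - min ?a ?b = \<delta> / \<bar>n \<bullet> v\<bar>"
    proof -
      have "max ?a ?b - min ?a ?b = \<bar>?b - ?a\<bar>" by (simp add: max_def min_def abs_if)
      also have "?b - ?a = \<delta> / (n \<bullet> v)" by (simp add: diff_divide_distrib[symmetric])
      finally show ?thesis using \<open>\<delta> \<ge> 0\<close> by simp
    qed
    finally show "(\<integral>\<^sup>+ s. indicator A (z - s *\<^sub>R v) * q z \<partial>lborel) \<le> ennreal (\<delta> / \<bar>n \<bullet> v\<bar>) * q z" .
  qed
  also have "\<dots> = ennreal (\<delta> / \<bar>n \<bullet> v\<bar>) * (\<integral>\<^sup>+ z. q z \<partial>lborel)"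
    by (rule nn_integral_cmult) measurable
  finally show ?thesis .
qed

text \<open>On the layer, \<open>\<bar>w z\<bar>\<close> is at most its value further along the
  segment plus the integral of the derivative over the segment. Averaging the first term over the
  segment lets \<open>layer_sweep\<close> treat both alike, so the mass of \<open>w\<close> in a
  layer is at most proportional to the thickness.\<close>

lemma layer_bound_direction:
  fixes T A :: "(real^'n) set"
  assumes T: "open T" and wg: "weak_dd T v w g" and A[measurable]: "A \<in> sets borel"
    and seg: "\<And>z s. z \<in> A \<Longrightarrow> s \<in> {0..1} \<Longrightarrow> z + s *\<^sub>R v \<in> T"
    and lay: "\<And>z. z \<in> A \<Longrightarrow> 0 \<le> c - n \<bullet> z \<and> c - n \<bullet> z \<le> \<delta>" and nv: "n \<bullet> v \<noteq> 0" and "\<delta> \<ge> 0"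
  shows "(\<integral>\<^sup>+ z. indicator A z * ennreal \<bar>w z\<bar> \<partial>lborel)
    \<le> ennreal (\<delta> / \<bar>n \<bullet> v\<bar>) * ((\<integral>\<^sup>+ z. ennreal \<bar>w z\<bar> \<partial>lborel) + (\<integral>\<^sup>+ z. ennreal \<bar>g z\<bar> \<partial>lborel))"
proof -
  have [measurable]: "w \<in> borel_measurable borel" "g \<in> borel_measurable borel"
    using wg by (auto simp: weak_dd_def)
  let ?G = "\<lambda>z. \<integral>\<^sup>+ r. indicator {0..1} r * ennreal \<bar>g (z + r *\<^sub>R v)\<bar> \<partial>lborel"
  have step: "(\<integral>\<^sup>+ z. indicator A z * ennreal \<bar>w z\<bar> \<partial>lborel)
      \<le> (\<integral>\<^sup>+ z. indicator A z * ennreal \<bar>w (z + s *\<^sub>R v)\<bar> \<partial>lborel) + (\<integral>\<^sup>+ z. indicator A z * ?G z \<partial>lborel)"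
    if s: "s \<in> {0..1}" for s
  proof -
    have "AE z in lborel. indicator A z * ennreal \<bar>w z\<bar> \<le> indicator A z * ennreal \<bar>w (z + s *\<^sub>R v)\<bar> + indicator A z * ?G z"
    proof (rule eventually_mono)
      show "AE z in lborel. (\<forall>r\<in>{0..s}. z + r *\<^sub>R v \<in> T) \<longrightarrow> w (z + s *\<^sub>R v) - w z = (LINT r|lborel. indicator {0..s} r * g (z + r *\<^sub>R v))"
        using s by (intro weak_dd_translate_diff[OF T wg]) simp
    next
      fix z
      assume *: "(\<forall>r\<in>{0..s}. z + r *\<^sub>R v \<in> T) \<longrightarrow> w (z + s *\<^sub>R v) - w z = (LINT r|lborel. indicator {0..s} r * g (z + r *\<^sub>R v))"
      show "indicator A z * ennreal \<bar>w z\<bar> \<le> indicator A z * ennreal \<bar>w (z + s *\<^sub>R v)\<bar> + indicator A z * ?G z"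
      proof (cases "z \<in> A")
        case True
        then have "w (z + s *\<^sub>R v) - w z = (LINT r|lborel. indicator {0..s} r * g (z + r *\<^sub>R v))"
          using * seg s by auto
        moreover have "ennreal \<bar>LINT r|lborel. indicator {0..s} r * g (z + r *\<^sub>R v)\<bar> \<le> ?G z"
        proof -
          have "ennreal (norm (LINT r|lborel. indicator {0..s} r * g (z + r *\<^sub>R v))) \<le> (\<integral>\<^sup>+ r. norm (indicator {0..s} r * g (z + r *\<^sub>R v)) \<partial>lborel)"
            by (rule norm_integral_le_nn_integral)
          also have "\<dots> \<le> ?G z"
            using s by (intro nn_integral_mono) (auto simp: indicator_def)
          finally show ?thesis by simp
        qed
        moreover have "\<bar>w z\<bar> \<le> \<bar>w (z + s *\<^sub>R v)\<bar> + \<bar>w (z + s *\<^sub>R v) - w z\<bar>" by simp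
        then have "ennreal \<bar>w z\<bar> \<le> ennreal \<bar>w (z + s *\<^sub>R v)\<bar> + ennreal \<bar>w (z + s *\<^sub>R v) - w z\<bar>"
          by (subst ennreal_plus[symmetric]) (auto intro: ennreal_leI simp del: ennreal_plus)
        ultimately show ?thesis
          using True by (auto intro: order_trans add_left_mono)
      qed simp
    qed
    then have "(\<integral>\<^sup>+ z. indicator A z * ennreal \<bar>w z\<bar> \<partial>lborel)
        \<le> (\<integral>\<^sup>+ z. indicator A z * ennreal \<bar>w (z + s *\<^sub>R v)\<bar> + indicator A z * ?G z \<partial>lborel)"
      by (rule nn_integral_mono_AE)
    also have "\<dots> = (\<integral>\<^sup>+ z. indicator A z * ennreal \<bar>w (z + s *\<^sub>R v)\<bar> \<partial>lborel) + (\<integral>\<^sup>+ z. indicator A z * ?G z \<partial>lborel)"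
      by (rule nn_integral_add) measurable
    finally show ?thesis .
  qed
  have "(\<integral>\<^sup>+ z. indicator A z * ennreal \<bar>w z\<bar> \<partial>lborel)
      = (\<integral>\<^sup>+ (s::real). indicator {0..1} s * (\<integral>\<^sup>+ z. indicator A z * ennreal \<bar>w z\<bar> \<partial>lborel) \<partial>lborel)"
    by (subst nn_integral_multc) auto
  also have "\<dots> \<le> (\<integral>\<^sup>+ (s::real). indicator {0..1} s * (\<integral>\<^sup>+ z. indicator A z * ennreal \<bar>w (z + s *\<^sub>R v)\<bar> \<partial>lborel)
      + indicator {0..1} s * (\<integral>\<^sup>+ z. indicator A z * ?G z \<partial>lborel) \<partial>lborel)"
  proof (rule nn_integral_mono)
    fix s :: real
    show "indicator {0..1} s * (\<integral>\<^sup>+ z. indicator A z * ennreal \<bar>w z\<bar> \<partial>lborel)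
      \<le> indicator {0..1} s * (\<integral>\<^sup>+ z. indicator A z * ennreal \<bar>w (z + s *\<^sub>R v)\<bar> \<partial>lborel)
      + indicator {0..1} s * (\<integral>\<^sup>+ z. indicator A z * ?G z \<partial>lborel)"
      using step[of s] by (cases "s \<in> {0..1}") auto
  qed
  also have "\<dots> = (\<integral>\<^sup>+ (s::real). indicator {0..1} s * (\<integral>\<^sup>+ z. indicator A z * ennreal \<bar>w (z + s *\<^sub>R v)\<bar> \<partial>lborel) \<partial>lborel)
      + (\<integral>\<^sup>+ (s::real). indicator {0..1} s * (\<integral>\<^sup>+ z. indicator A z * ?G z \<partial>lborel) \<partial>lborel)"
    by (rule nn_integral_add) measurable
  also have "(\<integral>\<^sup>+ (s::real). indicator {0..1} s * (\<integral>\<^sup>+ z. indicator A z * ?G z \<partial>lborel) \<partial>lborel)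
      = (\<integral>\<^sup>+ z. indicator A z * ?G z \<partial>lborel)"
    by (subst nn_integral_multc) auto
  also have "\<dots> = (\<integral>\<^sup>+ z. \<integral>\<^sup>+ r. indicator A z * (indicator {0..1} r * ennreal \<bar>g (z + r *\<^sub>R v)\<bar>) \<partial>lborel \<partial>lborel)"
    by (intro nn_integral_cong nn_integral_cmult[symmetric]) measurable
  also have "\<dots> = (\<integral>\<^sup>+ r. \<integral>\<^sup>+ z. indicator A z * (indicator {0..1} r * ennreal \<bar>g (z + r *\<^sub>R v)\<bar>) \<partial>lborel \<partial>lborel)"
    by (rule lborel_pair.Fubini'[symmetric]) measurable
  also have "\<dots> = (\<integral>\<^sup>+ r. indicator {0..1} r * (\<integral>\<^sup>+ z. indicator A z * ennreal \<bar>g (z + r *\<^sub>R v)\<bar> \<partial>lborel) \<partial>lborel)"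
    by (subst nn_integral_cmult[symmetric]) (auto simp: mult_ac)
  also have "(\<integral>\<^sup>+ (s::real). indicator {0..1} s * (\<integral>\<^sup>+ z. indicator A z * ennreal \<bar>w (z + s *\<^sub>R v)\<bar> \<partial>lborel) \<partial>lborel)
     + (\<integral>\<^sup>+ r. indicator {0..1} r * (\<integral>\<^sup>+ z. indicator A z * ennreal \<bar>g (z + r *\<^sub>R v)\<bar> \<partial>lborel) \<partial>lborel)
     \<le> ennreal (\<delta> / \<bar>n \<bullet> v\<bar>) * (\<integral>\<^sup>+ z. ennreal \<bar>w z\<bar> \<partial>lborel) + ennreal (\<delta> / \<bar>n \<bullet> v\<bar>) * (\<integral>\<^sup>+ z. ennreal \<bar>g z\<bar> \<partial>lborel)"
    by (intro add_mono layer_sweep[OF _ A lay nv \<open>\<delta> \<ge> 0\<close>]) measurable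
  finally show ?thesis by (simp add: distrib_left)
qed

text \<open>No single direction need carry the whole layer into the piece, so the direction depends
  on the point: near \<open>y\<close> it is \<open>x0 - y\<close>, for a fixed interior point
  \<open>x0\<close> off the hyperplane. Compactness leaves finitely many \<open>y\<close>.\<close>

lemma layer_bound_convex:
  fixes T C :: "(real^'n) set"
  assumes T: "open T" and w: "\<And>v. weak_dd T v w (g v)" and n: "n \<noteq> 0"
    and C: "convex C" "compact C" "interior C \<noteq> {}" "interior C \<subseteq> T"
  obtains M \<delta>0 where "M < \<infinity>" "\<delta>0 > 0"
    "\<And>\<delta>. 0 \<le> \<delta> \<Longrightarrow> \<delta> \<le> \<delta>0 \<Longrightarrow>
      (\<integral>\<^sup>+ z. indicator {z. z \<in> interior C \<and> 0 \<le> c - n \<bullet> z \<and> c - n \<bullet> z \<le> \<delta>} z * ennreal \<bar>w z\<bar> \<partial>lborel) \<le> ennreal \<delta> * M"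
proof -
  have wm: "w \<in> borel_measurable borel" using w[of 0] by (auto simp: weak_dd_def)
  have fin: "(\<integral>\<^sup>+ z. ennreal \<bar>w z\<bar> \<partial>lborel) < \<infinity>" "(\<integral>\<^sup>+ z. ennreal \<bar>g v z\<bar> \<partial>lborel) < \<infinity>" for v
    using w[of v] by (auto simp: weak_dd_def integrable_iff_bounded)
  have "\<exists>x0\<in>interior C. n \<bullet> x0 \<noteq> c"
  proof (rule ccontr)
    assume "\<not> ?thesis"
    then have "interior C \<subseteq> {x. n \<bullet> x = c}" by auto
    then have "negligible (interior C)"
      using negligible_hyperplane[of n c] n negligible_subset by blast
    then show False using open_not_negligible C(3) by blast
  qed
  then obtain x0 where x0: "x0 \<in> interior C" "n \<bullet> x0 \<noteq> c" by blast
  obtain r where r: "r > 0" "ball x0 r \<subseteq> interior C"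
    using x0 open_interior[of C] open_contains_ball by blast
  define h0 where "h0 = \<bar>c - n \<bullet> x0\<bar>"
  have h0: "h0 > 0" using x0 by (simp add: h0_def)
  \<comment> \<open>Where \<open>c - n \<bullet> y\<close> is at most \<open>h0 / 2\<close> in
    absolute value, \<open>x0 - y\<close> is transversal to the hyperplane.\<close>
  define D where "D = C \<inter> {y. c - n \<bullet> y \<in> {-h0/2..h0/2}}"
  have "closed {y. c - n \<bullet> y \<in> {-h0/2..h0/2}}"
    unfolding atLeastAtMost_iff by (intro closed_Collect_conj closed_Collect_le continuous_intros)
  then have "compact D" using C(2) by (auto simp: D_def)
  moreover have "D \<subseteq> (\<Union>y\<in>D. ball y r)" using r by auto
  ultimately obtain Y where Y: "Y \<subseteq> D" "finite Y" "D \<subseteq> (\<Union>y\<in>Y. ball y r)"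
    using compactE_image[of D D "\<lambda>y. ball y r"] by (metis open_ball)
  define M where "M = (\<Sum>y\<in>Y. ennreal (1 / \<bar>n \<bullet> (x0 - y)\<bar>) * ((\<integral>\<^sup>+ z. ennreal \<bar>w z\<bar> \<partial>lborel) + (\<integral>\<^sup>+ z. ennreal \<bar>g (x0 - y) z\<bar> \<partial>lborel)))"
  show ?thesis
  proof (rule that[of M "h0 / 2"])
    show "M < \<infinity>"
      unfolding M_def using fin Y(2) by (auto simp: ennreal_mult_less_top)
    show "h0 / 2 > 0" using h0 by simp
    fix \<delta> :: real assume \<delta>: "0 \<le> \<delta>" "\<delta> \<le> h0 / 2"
    let ?L = "{z. z \<in> interior C \<and> 0 \<le> c - n \<bullet> z \<and> c - n \<bullet> z \<le> \<delta>}"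
    have Lm[measurable]: "?L \<inter> ball y r \<in> sets borel" for y
    proof -
      have "?L \<inter> ball y r = interior C \<inter> ball y r \<inter> ({z. n \<bullet> z \<le> c} \<inter> {z. n \<bullet> z \<ge> c - \<delta>})" by auto
      also have "\<dots> \<in> sets borel"
        using closed_halfspace_le[of n c] closed_halfspace_ge[of "c - \<delta>" n]
        by (intro sets.Int) auto
      finally show ?thesis .
    qed
    have "(\<integral>\<^sup>+ z. indicator ?L z * ennreal \<bar>w z\<bar> \<partial>lborel) \<le> (\<integral>\<^sup>+ z. (\<Sum>y\<in>Y. indicator (?L \<inter> ball y r) z * ennreal \<bar>w z\<bar>) \<partial>lborel)"
    proof (rule nn_integral_mono)
      fix z
      show "indicator ?L z * ennreal \<bar>w z\<bar> \<le> (\<Sum>y\<in>Y. indicator (?L \<inter> ball y r) z * ennreal \<bar>w z\<bar>)"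
      proof (cases "z \<in> ?L")
        case True
        then have "z \<in> D" using \<delta> h0 interior_subset[of C] by (auto simp: D_def)
        then obtain y where y: "y \<in> Y" "z \<in> ball y r" using Y(3) by blast
        have "indicator ?L z * ennreal \<bar>w z\<bar> = indicator (?L \<inter> ball y r) z * ennreal \<bar>w z\<bar>"
          using y by (auto simp: indicator_def)
        also have "\<dots> \<le> (\<Sum>y\<in>Y. indicator (?L \<inter> ball y r) z * ennreal \<bar>w z\<bar>)"
          by (rule member_le_sum[OF y(1)]) (auto simp: Y)
        finally show ?thesis .
      qed auto
    qed
    also have "\<dots> = (\<Sum>y\<in>Y. \<integral>\<^sup>+ z. indicator (?L \<inter> ball y r) z * ennreal \<bar>w z\<bar> \<partial>lborel)"
      using wm by (intro nn_integral_sum) measurable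
    also have "\<dots> \<le> (\<Sum>y\<in>Y. ennreal \<delta> * (ennreal (1 / \<bar>n \<bullet> (x0 - y)\<bar>) *
        ((\<integral>\<^sup>+ z. ennreal \<bar>w z\<bar> \<partial>lborel) + (\<integral>\<^sup>+ z. ennreal \<bar>g (x0 - y) z\<bar> \<partial>lborel))))"
    proof (rule sum_mono)
      fix y assume "y \<in> Y"
      then have "y \<in> D" using Y(1) by blast
      then have y': "y \<in> C" "- h0 / 2 \<le> c - n \<bullet> y" "c - n \<bullet> y \<le> h0 / 2" by (simp_all add: D_def)
      then have y: "y \<in> C" "\<bar>c - n \<bullet> y\<bar> \<le> h0 / 2" by linarith+
      have nv: "n \<bullet> (x0 - y) \<noteq> 0"
      proof
        assume "n \<bullet> (x0 - y) = 0"
        then have "n \<bullet> y = n \<bullet> x0" by (simp add: inner_diff_right)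
        then show False using y(2) h0 by (simp add: h0_def)
      qed
      have "(\<integral>\<^sup>+ z. indicator (?L \<inter> ball y r) z * ennreal \<bar>w z\<bar> \<partial>lborel)
          \<le> ennreal (\<delta> / \<bar>n \<bullet> (x0 - y)\<bar>) * ((\<integral>\<^sup>+ z. ennreal \<bar>w z\<bar> \<partial>lborel) + (\<integral>\<^sup>+ z. ennreal \<bar>g (x0 - y) z\<bar> \<partial>lborel))"
      proof (rule layer_bound_direction[OF T w Lm _ _ nv \<delta>(1)])
        fix z s assume z: "z \<in> ?L \<inter> ball y r" and s: "s \<in> {0..1::real}"
        have "x0 + (z - y) \<in> ball x0 r" using z by (simp add: dist_norm norm_minus_commute)
        then have "x0 + (z - y) \<in> interior C" using r by blast
        \<comment> \<open>Both ends of the segment lie in the convex interior, the second because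
          \<open>z\<close> is within \<open>r\<close> of \<open>y\<close>.\<close>
        then have "(1 - s) *\<^sub>R z + s *\<^sub>R (x0 + (z - y)) \<in> interior C"
          using z s convex_interior[OF C(1)] by (intro convexD) auto
        moreover have "(1 - s) *\<^sub>R z + s *\<^sub>R (x0 + (z - y)) = z + s *\<^sub>R (x0 - y)"
          by (simp add: algebra_simps)
        ultimately show "z + s *\<^sub>R (x0 - y) \<in> T" using C(4) by auto
      qed auto
      also have "ennreal (\<delta> / \<bar>n \<bullet> (x0 - y)\<bar>) = ennreal \<delta> * ennreal (1 / \<bar>n \<bullet> (x0 - y)\<bar>)"
        using \<delta>(1) by (simp add: ennreal_mult[symmetric])
      finally show "(\<integral>\<^sup>+ z. indicator (?L \<inter> ball y r) z * ennreal \<bar>w z\<bar> \<partial>lborel)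
          \<le> ennreal \<delta> * (ennreal (1 / \<bar>n \<bullet> (x0 - y)\<bar>) * ((\<integral>\<^sup>+ z. ennreal \<bar>w z\<bar> \<partial>lborel) + (\<integral>\<^sup>+ z. ennreal \<bar>g (x0 - y) z\<bar> \<partial>lborel)))"
        by (simp only: mult.assoc)
    qed
    also have "\<dots> = ennreal \<delta> * M" by (simp add: M_def sum_distrib_left)
    finally show "(\<integral>\<^sup>+ z. indicator ?L z * ennreal \<bar>w z\<bar> \<partial>lborel) \<le> ennreal \<delta> * M" .
  qed
qed

lemma negligible_AE:
  assumes "negligible N"
  shows "AE z in lborel. z \<notin> N"
proof -
  have "AE z in lebesgue. z \<notin> N"
    using assms by (intro AE_not_in) (simp add: negligible_iff_null_sets)
  then show ?thesis by (simp add: AE_completion_iff)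
qed

text \<open>Almost every point of \<open>T\<close> is interior to some piece, since frontiers of
  convex sets are null; the bounds of the pieces add up.\<close>

lemma layer_bound:
  fixes T :: "(real^'n) set"
  assumes T: "open T" and w: "\<And>v. weak_dd T v w (g v)" and n: "n \<noteq> 0"
    and S: "finite S" "\<And>C. C \<in> S \<Longrightarrow> convex C \<and> compact C" "T = interior (\<Union>S)"
    and w0: "\<And>z. z \<notin> T \<Longrightarrow> w z = 0"
  obtains M \<delta>0 where "M < \<infinity>" "\<delta>0 > 0"
    "\<And>\<delta>. 0 \<le> \<delta> \<Longrightarrow> \<delta> \<le> \<delta>0 \<Longrightarrow>
      (\<integral>\<^sup>+ z. indicator {z. 0 \<le> c - n \<bullet> z \<and> c - n \<bullet> z \<le> \<delta>} z * ennreal \<bar>w z\<bar> \<partial>lborel) \<le> ennreal \<delta> * M"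
proof -
  have wm: "w \<in> borel_measurable borel" using w[of 0] by (auto simp: weak_dd_def)
  define S' where "S' = {C\<in>S. interior C \<noteq> {}}"
  have S': "finite S'" "S' \<subseteq> S" using S by (auto simp: S'_def)
  define P where "P C M \<delta>0 \<longleftrightarrow> M < \<infinity> \<and> \<delta>0 > 0 \<and> (\<forall>\<delta>. 0 \<le> \<delta> \<longrightarrow> \<delta> \<le> \<delta>0 \<longrightarrow>
      (\<integral>\<^sup>+ z. indicator {z. z \<in> interior C \<and> 0 \<le> c - n \<bullet> z \<and> c - n \<bullet> z \<le> \<delta>} z * ennreal \<bar>w z\<bar> \<partial>lborel) \<le> ennreal \<delta> * M)"
    for C M \<delta>0
  have "\<exists>M \<delta>0. P C M \<delta>0" if "C \<in> S'" for C
  proof -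
    have C: "convex C" "compact C" "interior C \<noteq> {}" using that S by (auto simp: S'_def)
    have "C \<subseteq> \<Union>S" using that by (auto simp: S'_def)
    then have "interior C \<subseteq> T" unfolding S(3) by (rule interior_mono)
    obtain M \<delta>0 where "M < \<infinity>" "\<delta>0 > 0" "\<And>\<delta>. 0 \<le> \<delta> \<Longrightarrow> \<delta> \<le> \<delta>0 \<Longrightarrow>
      (\<integral>\<^sup>+ z. indicator {z. z \<in> interior C \<and> 0 \<le> c - n \<bullet> z \<and> c - n \<bullet> z \<le> \<delta>} z * ennreal \<bar>w z\<bar> \<partial>lborel) \<le> ennreal \<delta> * M"
      by (rule layer_bound_convex[OF T w n C \<open>interior C \<subseteq> T\<close>, of c]) blast
    then show ?thesis unfolding P_def by blast
  qed
  then obtain M d where P: "\<And>C. C \<in> S' \<Longrightarrow> P C (M C) (d C)" by metis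
  then have M: "\<And>C. C \<in> S' \<Longrightarrow> M C < \<infinity>" and d: "\<And>C. C \<in> S' \<Longrightarrow> d C > 0"
    and b: "\<And>C \<delta>. C \<in> S' \<Longrightarrow> 0 \<le> \<delta> \<Longrightarrow> \<delta> \<le> d C \<Longrightarrow>
      (\<integral>\<^sup>+ z. indicator {z. z \<in> interior C \<and> 0 \<le> c - n \<bullet> z \<and> c - n \<bullet> z \<le> \<delta>} z * ennreal \<bar>w z\<bar> \<partial>lborel) \<le> ennreal \<delta> * M C"
    unfolding P_def by blast+
  show ?thesis
  proof (rule that[of "\<Sum>C\<in>S'. M C" "Min (insert 1 (d ` S'))"])
    show "(\<Sum>C\<in>S'. M C) < \<infinity>" using M S'(1) by auto
    show "Min (insert 1 (d ` S')) > 0" using d S'(1) by auto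
    fix \<delta> :: real assume \<delta>: "0 \<le> \<delta>" "\<delta> \<le> Min (insert 1 (d ` S'))"
    let ?L = "\<lambda>C. {z. z \<in> interior C \<and> 0 \<le> c - n \<bullet> z \<and> c - n \<bullet> z \<le> \<delta>}"
    have Lm[measurable]: "?L C \<in> sets borel" for C
    proof -
      have "?L C = interior C \<inter> ({z. n \<bullet> z \<le> c} \<inter> {z. n \<bullet> z \<ge> c - \<delta>})" by auto
      also have "\<dots> \<in> sets borel"
        using closed_halfspace_le[of n c] closed_halfspace_ge[of "c - \<delta>" n]
        by (intro sets.Int) auto
      finally show ?thesis .
    qed
    have "AE z in lborel. \<forall>C\<in>S. z \<notin> frontier C"
      using S(1,2) by (intro AE_finite_allI negligible_AE negligible_convex_frontier) auto
    then have "AE z in lborel. indicator {z. 0 \<le> c - n \<bullet> z \<and> c - n \<bullet> z \<le> \<delta>} z * ennreal \<bar>w z\<bar>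
        \<le> (\<Sum>C\<in>S'. indicator (?L C) z * ennreal \<bar>w z\<bar>)"
    proof eventually_elim
      fix z assume fr: "\<forall>C\<in>S. z \<notin> frontier C"
      show "indicator {z. 0 \<le> c - n \<bullet> z \<and> c - n \<bullet> z \<le> \<delta>} z * ennreal \<bar>w z\<bar>
        \<le> (\<Sum>C\<in>S'. indicator (?L C) z * ennreal \<bar>w z\<bar>)"
      proof (cases "z \<in> T \<and> 0 \<le> c - n \<bullet> z \<and> c - n \<bullet> z \<le> \<delta>")
        case True
        then obtain C where C: "C \<in> S" "z \<in> C" using S(3) interior_subset by blast
        then have "z \<in> interior C" using fr closure_subset by (auto simp: frontier_def)
        then have C': "C \<in> S'" using C by (auto simp: S'_def)
        have "indicator {z. 0 \<le> c - n \<bullet> z \<and> c - n \<bullet> z \<le> \<delta>} z * ennreal \<bar>w z\<bar> = indicator (?L C) z * ennreal \<bar>w z\<bar>"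
          using True \<open>z \<in> interior C\<close> by (auto simp: indicator_def)
        also have "\<dots> \<le> (\<Sum>C\<in>S'. indicator (?L C) z * ennreal \<bar>w z\<bar>)"
          by (rule member_le_sum[OF C']) (auto simp: S')
        finally show ?thesis .
      next
        case False
        then show ?thesis using w0[of z] by (auto simp: indicator_def)
      qed
    qed
    then have "(\<integral>\<^sup>+ z. indicator {z. 0 \<le> c - n \<bullet> z \<and> c - n \<bullet> z \<le> \<delta>} z * ennreal \<bar>w z\<bar> \<partial>lborel)
       \<le> (\<integral>\<^sup>+ z. (\<Sum>C\<in>S'. indicator (?L C) z * ennreal \<bar>w z\<bar>) \<partial>lborel)"
      by (rule nn_integral_mono_AE)
    also have "\<dots> = (\<Sum>C\<in>S'. \<integral>\<^sup>+ z. indicator (?L C) z * ennreal \<bar>w z\<bar> \<partial>lborel)"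
      using wm by (intro nn_integral_sum) measurable
    also have "\<dots> \<le> (\<Sum>C\<in>S'. ennreal \<delta> * M C)"
      using \<delta> S'(1) by (intro sum_mono b) auto
    finally show "(\<integral>\<^sup>+ z. indicator {z. 0 \<le> c - n \<bullet> z \<and> c - n \<bullet> z \<le> \<delta>} z * ennreal \<bar>w z\<bar> \<partial>lborel)
      \<le> ennreal \<delta> * (\<Sum>C\<in>S'. M C)"
      by (simp add: sum_distrib_left)
  qed
qed

lemma nn_integral_reflect:
  fixes f :: "real \<Rightarrow> ennreal"
  assumes "f \<in> borel_measurable borel"
  shows "(\<integral>\<^sup>+ t. f (- t) \<partial>lborel) = (\<integral>\<^sup>+ t. f t \<partial>lborel)"
  using nn_integral_real_affine[OF assms, of "-1" 0] by simp

text \<open>Fatou's lemma for the kernel averages. The kernel is at most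
  \<open>B * real (Suc k)\<close>, on a layer of thickness \<open>2 / real (Suc k)\<close> whose
  mass is at most that thickness times \<open>M\<close>; so the averages are bounded in L1 by
  \<open>2 * B * M\<close>.\<close>

lemma btrace_integrable:
  fixes T :: "(real^'n) set"
  assumes T: "open T" and w: "\<And>v. weak_dd T v w (g v)" and n: "norm n = 1"
    and S: "finite S" "\<And>C. C \<in> S \<Longrightarrow> convex C \<and> compact C" "T = interior (\<Union>S)"
    and w0: "\<And>z. z \<notin> T \<Longrightarrow> w z = 0" and F[measurable]: "F \<in> sets borel"
    and seg: "AE x in hyp n c. x \<in> F \<longrightarrow> (\<exists>\<epsilon>>0. \<forall>t. 0 < t \<and> t < \<epsilon> \<longrightarrow> x - t *\<^sub>R n \<in> T)"
  shows "integrable (hyp n c) (\<lambda>x. indicator F x * btrace n w x)"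
proof -
  have wm[measurable]: "w \<in> borel_measurable borel" using w[of 0] by (auto simp: weak_dd_def)
  note [measurable] = btrace_measurable[OF wm] layer_integral_measurable[OF wm]
  have nn: "n \<bullet> n = 1" using n by (simp add: dot_square_norm)
  obtain B where B: "B > 0" "\<And>t. \<bar>step' t\<bar> \<le> B" using step'_bound by blast
  have "n \<noteq> 0" using n by auto
  obtain M \<delta>0 where M: "M < \<infinity>" "\<delta>0 > 0"
    "\<And>\<delta>. 0 \<le> \<delta> \<Longrightarrow> \<delta> \<le> \<delta>0 \<Longrightarrow>
      (\<integral>\<^sup>+ z. indicator {z. 0 \<le> c - n \<bullet> z \<and> c - n \<bullet> z \<le> \<delta>} z * ennreal \<bar>w z\<bar> \<partial>lborel) \<le> ennreal \<delta> * M"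
    by (rule layer_bound[OF T w \<open>n \<noteq> 0\<close> S w0, of c]) blast+
  \<comment> \<open>From \<open>N\<close> on the layers are thin enough for the bound
    \<open>M\<close>.\<close>
  obtain N :: nat where N: "real N > 2 / \<delta>0" using reals_Archimedean2 by blast
  let ?u = "\<lambda>k x. LINT t|lborel. w (x - t *\<^sub>R n) * layer_kernel k t"
  have lim: "AE x in hyp n c. x \<in> F \<longrightarrow> (\<lambda>k. ?u k x) \<longlonglongrightarrow> btrace n w x"
    using normal_trace_exists[OF T n w, of c] seg
  proof eventually_elim
    fix x assume "\<exists>\<tau>. normal_trace_at T n w (g n) x \<tau>"
      "x \<in> F \<longrightarrow> (\<exists>\<epsilon>>0. \<forall>t. 0 < t \<and> t < \<epsilon> \<longrightarrow> x - t *\<^sub>R n \<in> T)"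
    then show "x \<in> F \<longrightarrow> (\<lambda>k. ?u k x) \<longlonglongrightarrow> btrace n w x"
      using btrace_tendsto(2)[OF wm] by blast
  qed
  have bound: "(\<integral>\<^sup>+ x. ennreal \<bar>?u k x\<bar> \<partial>hyp n c) \<le> ennreal (2 * B) * M" if "k \<ge> N" for k
  proof -
    let ?K = "real (Suc k)"
    let ?L = "{z. 0 \<le> c - n \<bullet> z \<and> c - n \<bullet> z \<le> 2 / ?K}"
    let ?G = "\<lambda>z. ennreal (B * ?K) * (indicator ?L z * ennreal \<bar>w z\<bar>)"
    have [measurable]: "?L \<in> sets borel"
    proof -
      have "?L = {z. n \<bullet> z \<le> c} \<inter> {z. n \<bullet> z \<ge> c - 2 / ?K}" by auto
      also have "\<dots> \<in> sets borel"
        using closed_halfspace_le[of n c] closed_halfspace_ge[of "c - 2 / ?K" n]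
        by (intro sets.Int) auto
      finally show ?thesis .
    qed
    have "(\<integral>\<^sup>+ x. ennreal \<bar>?u k x\<bar> \<partial>hyp n c) \<le> (\<integral>\<^sup>+ x. \<integral>\<^sup>+ t. ?G (x + t *\<^sub>R n) \<partial>lborel \<partial>hyp n c)"
    proof (rule nn_integral_mono_AE)
      show "AE x in hyp n c. ennreal \<bar>?u k x\<bar> \<le> (\<integral>\<^sup>+ t. ?G (x + t *\<^sub>R n) \<partial>lborel)"
        using AE_hyp_mem[OF n, of c]
      proof eventually_elim
        fix x assume x: "n \<bullet> x = c"
        have "ennreal (norm (?u k x)) \<le> (\<integral>\<^sup>+ t. norm (w (x - t *\<^sub>R n) * layer_kernel k t) \<partial>lborel)"
          by (rule norm_integral_le_nn_integral)
        also have "\<dots> \<le> (\<integral>\<^sup>+ t. ?G (x + (- t) *\<^sub>R n) \<partial>lborel)"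
        proof (rule nn_integral_mono)
          fix t
          have i: "indicator ?L (x + (- t) *\<^sub>R n) = (indicator {0..2 / ?K} t :: real)"
            using x by (auto simp: indicator_def inner_simps nn)
          have "norm (w (x - t *\<^sub>R n) * layer_kernel k t) \<le> \<bar>w (x - t *\<^sub>R n)\<bar> * (B * (?K * indicator {0..2 / ?K} t))"
            unfolding real_norm_def abs_mult by (intro mult_left_mono layer_kernel_bound B) auto
          then have "ennreal (norm (w (x - t *\<^sub>R n) * layer_kernel k t)) \<le> ennreal (B * ?K * (indicator ?L (x + (- t) *\<^sub>R n) * \<bar>w (x - t *\<^sub>R n)\<bar>))"
            unfolding i by (intro ennreal_leI) (simp only: mult_ac)
          also have "\<dots> = ?G (x + (- t) *\<^sub>R n)"
            using B by (simp add: ennreal_mult ennreal_indicator del: of_nat_Suc)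
          finally show "ennreal (norm (w (x - t *\<^sub>R n) * layer_kernel k t)) \<le> ?G (x + (- t) *\<^sub>R n)" .
        qed
        also have "\<dots> = (\<integral>\<^sup>+ t. ?G (x + t *\<^sub>R n) \<partial>lborel)"
          by (rule nn_integral_reflect) measurable
        finally show "ennreal \<bar>?u k x\<bar> \<le> (\<integral>\<^sup>+ t. ?G (x + t *\<^sub>R n) \<partial>lborel)" by simp
      qed
    qed
    also have "\<dots> = (\<integral>\<^sup>+ z. ?G z \<partial>lborel)"
      by (rule nn_integral_lborel_eq_hyp[OF n]) measurable
    also have "\<dots> = ennreal (B * ?K) * (\<integral>\<^sup>+ z. indicator ?L z * ennreal \<bar>w z\<bar> \<partial>lborel)"
      by (rule nn_integral_cmult) measurable
    also have "\<dots> \<le> ennreal (B * ?K) * (ennreal (2 / ?K) * M)"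
    proof (intro mult_left_mono M(3))
      have "2 / \<delta>0 < ?K" using N that by linarith
      then show "2 / ?K \<le> \<delta>0" using M(2) by (simp add: field_simps del: of_nat_Suc)
    qed auto
    also have "\<dots> = ennreal (2 * B) * M"
      using B by (simp add: ennreal_mult[symmetric] mult.assoc[symmetric] mult.commute[of B] del: of_nat_Suc)
    finally show ?thesis .
  qed
  have "(\<integral>\<^sup>+ x. ennreal (norm (indicator F x * btrace n w x)) \<partial>hyp n c)
      \<le> (\<integral>\<^sup>+ x. liminf (\<lambda>k. ennreal \<bar>?u (k + N) x\<bar>) \<partial>hyp n c)"
  proof (rule nn_integral_mono_AE)
    show "AE x in hyp n c. ennreal (norm (indicator F x * btrace n w x)) \<le> liminf (\<lambda>k. ennreal \<bar>?u (k + N) x\<bar>)"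
      using lim
    proof eventually_elim
      fix x assume *: "x \<in> F \<longrightarrow> (\<lambda>k. ?u k x) \<longlonglongrightarrow> btrace n w x"
      show "ennreal (norm (indicator F x * btrace n w x)) \<le> liminf (\<lambda>k. ennreal \<bar>?u (k + N) x\<bar>)"
      proof (cases "x \<in> F")
        case True
        then have "(\<lambda>k. ?u k x) \<longlonglongrightarrow> btrace n w x" using * by blast
        from LIMSEQ_ignore_initial_segment[OF this, of N]
        have "(\<lambda>k. ennreal \<bar>?u (k + N) x\<bar>) \<longlonglongrightarrow> ennreal \<bar>btrace n w x\<bar>"
          by (intro tendsto_ennrealI tendsto_rabs)
        then have "liminf (\<lambda>k. ennreal \<bar>?u (k + N) x\<bar>) = ennreal \<bar>btrace n w x\<bar>"
          by (intro lim_imp_Liminf) auto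
        then show ?thesis using True by simp
      qed simp
    qed
  qed
  also have "\<dots> \<le> liminf (\<lambda>k. \<integral>\<^sup>+ x. ennreal \<bar>?u (k + N) x\<bar> \<partial>hyp n c)"
    by (rule nn_integral_liminf) measurable
  also have "\<dots> \<le> ennreal (2 * B) * M"
    by (rule order_trans[OF Liminf_le_Limsup Limsup_bounded]) (auto intro!: always_eventually bound)
  also have "\<dots> < \<infinity>" using M(1) by (auto simp: ennreal_mult_less_top)
  finally show ?thesis
    by (intro integrableI_bounded) measurable
qed

section \<open>Gauss--Green for flat boundary portions\<close>

lemma integral_norm_le_AE:
  fixes f h :: "'a \<Rightarrow> real"
  assumes "f \<in> borel_measurable M" "integrable M h" "AE x in M. \<bar>f x\<bar> \<le> h x"
  shows "\<bar>integral\<^sup>L M f\<bar> \<le> integral\<^sup>L M h"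
proof -
  have f: "integrable M f"
    by (rule Bochner_Integration.integrable_bound[OF assms(2,1)]) (use assms(3) in \<open>auto elim!: eventually_mono\<close>)
  have "\<bar>integral\<^sup>L M f\<bar> \<le> (LINT x|M. \<bar>f x\<bar>)"
    using integral_norm_bound[of M f] by simp
  also have "\<dots> \<le> integral\<^sup>L M h"
    using f assms by (intro integral_mono_AE) auto
  finally show ?thesis .
qed

text \<open>On each line the averages converge by the trace formula. For the integrals a majorant is
  needed: along a line that meets the support within the layer, \<open>w\<close> is at most its
  trace plus the integral of \<open>\<bar>g n\<bar>\<close> over the line, and both are integrable
  over the hyperplane.\<close>

lemma layer_limit:
  fixes T V :: "(real^'n) set"
  assumes T: "open T" and w: "\<And>v. weak_dd T v w (g v)" and n: "norm n = 1"
    and S: "finite S" "\<And>C. C \<in> S \<Longrightarrow> convex C \<and> compact C" "T = interior (\<Union>S)"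
    and w0: "\<And>z. z \<notin> T \<Longrightarrow> w z = 0" and V: "open V" "\<And>z. z \<in> V \<Longrightarrow> z \<in> T \<longleftrightarrow> n \<bullet> z < c"
    and \<phi>: "test_function V \<phi>"
  shows "integrable (hyp n c) (\<lambda>x. \<phi> x * btrace n w x)"
    and "(\<lambda>k. LINT z|lborel. w z * \<phi> z * layer_kernel k (c - n \<bullet> z)) \<longlonglongrightarrow> (LINT x|hyp n c. \<phi> x * btrace n w x)"
proof -
  have wm[measurable]: "w \<in> borel_measurable borel" and wi: "integrable lborel w" and gi: "integrable lborel (g n)"
    using w[of n] by (auto simp: weak_dd_def)
  have sm: "smooth \<phi>" using \<phi> by (rule test_function_smooth)
  note [measurable] = btrace_measurable[OF wm] borel_measurable_smooth[OF sm] borel_measurable_integrable[OF gi, simplified]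
  have nn: "n \<bullet> n = 1" using n by (simp add: dot_square_norm)
  obtain B where B: "B > 0" "\<And>t. \<bar>step' t\<bar> \<le> B" using step'_bound by blast
  obtain P where P: "P > 0" "\<And>x. \<bar>\<phi> x\<bar> \<le> P" using \<phi> by (rule test_function_bounded) blast
  obtain C where C: "compact C" "C \<subseteq> V" "\<And>x. x \<notin> C \<Longrightarrow> \<phi> x = 0" using \<phi> by (rule test_functionE) blast
  define F where "F = V \<inter> {x. n \<bullet> x = c}"
  have [measurable]: "F \<in> sets borel"
    using V(1) closed_hyperplane[of n c] by (auto simp: F_def)
  have segF: "\<exists>\<epsilon>>0. \<forall>t. 0 < t \<and> t < \<epsilon> \<longrightarrow> x - t *\<^sub>R n \<in> T" if "x \<in> F" for x
  proof -
    have x: "x \<in> V" "n \<bullet> x = c" using that by (auto simp: F_def)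
    obtain e where e: "e > 0" "ball x e \<subseteq> V" using V(1) x(1) open_contains_ball by blast
    have "x - t *\<^sub>R n \<in> T" if "0 < t" "t < e" for t
    proof -
      have "x - t *\<^sub>R n \<in> V" using that e(2) n by (intro subsetD[OF e(2)]) (simp add: dist_norm)
      then show ?thesis using V(2) that x by (simp add: inner_simps nn)
    qed
    then show ?thesis using e(1) by blast
  qed
  have I: "integrable (hyp n c) (\<lambda>x. indicator F x * btrace n w x)"
    by (rule btrace_integrable[OF T w n S w0]) (auto intro: segF)
  have "integrable (hyp n c) (\<lambda>x. indicator F x * btrace n w x * \<phi> x)"
    by (rule integrable_mult_bounded[OF I]) (use P in auto)
  then show int: "integrable (hyp n c) (\<lambda>x. \<phi> x * btrace n w x)"
  proof (rule integrable_cong_AE_imp)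
    show "AE x in hyp n c. indicator F x * btrace n w x * \<phi> x = \<phi> x * btrace n w x"
      using AE_hyp_mem[OF n, of c]
    proof eventually_elim
      fix x assume "n \<bullet> x = c"
      then show "indicator F x * btrace n w x * \<phi> x = \<phi> x * btrace n w x"
        using test_function_grad_0(1)[OF \<phi>, of x] by (auto simp: F_def indicator_def)
    qed
  qed measurable
  let ?G = "\<lambda>k z. w z * \<phi> z * layer_kernel k (c - n \<bullet> z)"
  let ?u = "\<lambda>k x. LINT t|lborel. ?G k (x + t *\<^sub>R n)"
  have Gi: "integrable lborel (?G k)" for k
  proof -
    have "\<bar>layer_kernel k t\<bar> \<le> B * real (Suc k)" for t
      by (rule order_trans[OF layer_kernel_bound[OF B(2)]]) (use B in \<open>auto simp: indicator_def\<close>)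
    then have "integrable lborel (\<lambda>z. w z * \<phi> z * layer_kernel k (c - n \<bullet> z))"
      by (intro integrable_mult_bounded[where h = "\<lambda>z. layer_kernel k (c - n \<bullet> z)" and B = "B * real (Suc k)"]
          integrable_mult_bounded[OF wi, where B = P]) (use P in auto)
    then show ?thesis .
  qed
  have inner: "?u k x = (LINT t|lborel. w (x - t *\<^sub>R n) * \<phi> (x - t *\<^sub>R n) * layer_kernel k t)" if "n \<bullet> x = c" for k x
    using lborel_integral_real_affine[of "-1" "\<lambda>t. ?G k (x + t *\<^sub>R n)" 0] that by (simp add: inner_simps nn)
  \<comment> \<open>The distance of the support from the complement of \<open>V\<close>. If a layer
    thinner than \<open>\<delta>\<close> meets the support on some line, this line stays in
    \<open>V\<close> down to its foot on the hyperplane.\<close>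
  obtain \<delta> where \<delta>: "\<delta> > 0" "\<And>y z. y \<in> C \<Longrightarrow> dist y z < \<delta> \<Longrightarrow> z \<in> V"
  proof -
    have "C \<inter> - V = {}" using C(2) by blast
    then obtain d where d: "d > 0" "\<And>y z. y \<in> C \<Longrightarrow> z \<in> - V \<Longrightarrow> d \<le> dist y z"
      using separate_compact_closed[OF C(1), of "- V"] V(1) by (auto simp: closed_Compl)
    show ?thesis
      by (rule that[OF d(1)]) (use d(2) in \<open>force simp: not_le[symmetric]\<close>)
  qed
  obtain N :: nat where N: "real N > 2 / \<delta>" using reals_Archimedean2 by blast
  have Kd: "2 / real (Suc (k + N)) < \<delta>" for k
  proof -
    have "2 / \<delta> < real (Suc (k + N))" using N by linarith
    then show ?thesis using \<delta>(1) by (simp add: field_simps del: of_nat_Suc)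
  qed
  \<comment> \<open>\<open>P\<close> bounds \<open>\<phi>\<close>, \<open>2 * B\<close> bounds the
    L1 norm of the kernel, and the bracket bounds \<open>w\<close> on the line.\<close>
  define D where "D x = (indicator F x * \<bar>btrace n w x\<bar> + (LINT r|lborel. \<bar>g n (x + r *\<^sub>R n)\<bar>)) * P * (2 * B)" for x
  have "(\<lambda>k. LINT x|hyp n c. ?u (k + N) x) \<longlonglongrightarrow> (LINT x|hyp n c. \<phi> x * btrace n w x)"
  proof (rule integral_dominated_convergence[where w = D])
    have "integrable (hyp n c) (\<lambda>x. \<bar>indicator F x * btrace n w x\<bar>)" using I by simp
    moreover have "integrable (hyp n c) (\<lambda>x. LINT r|lborel. \<bar>g n (x + r *\<^sub>R n)\<bar>)"
      using gi by (intro integral_hyp_Fubini(2)[OF n]) simp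
    ultimately show "integrable (hyp n c) D"
      unfolding D_def[abs_def] by (intro integrable_mult_left Bochner_Integration.integrable_add) (simp_all add: abs_mult)
    show "?u (k + N) \<in> borel_measurable (hyp n c)" for k
      using integral_hyp_Fubini(2)[OF n Gi, of c "k + N"] by simp
    show "AE x in hyp n c. (\<lambda>k. ?u (k + N) x) \<longlonglongrightarrow> \<phi> x * btrace n w x"
      using AE_hyp_mem[OF n, of c] normal_trace_exists[OF T n w, of c]
    proof eventually_elim
      fix x assume x: "n \<bullet> x = c" and "\<exists>\<tau>. normal_trace_at T n w (g n) x \<tau>"
      then obtain \<tau> where \<tau>: "normal_trace_at T n w (g n) x \<tau>" by blast
      have "(\<lambda>k. LINT t|lborel. w (x - t *\<^sub>R n) * \<phi> (x - t *\<^sub>R n) * layer_kernel k t) \<longlonglongrightarrow> \<phi> x * btrace n w x"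
      proof (cases "x \<in> V")
        case True
        then have "x \<in> F" using x by (simp add: F_def)
        then obtain \<epsilon> where e: "\<epsilon> > 0" "\<And>t. 0 < t \<Longrightarrow> t < \<epsilon> \<Longrightarrow> x - t *\<^sub>R n \<in> T" using segF by blast
        have "((\<lambda>t. \<phi> (x - t *\<^sub>R n)) \<longlongrightarrow> \<phi> (x - 0 *\<^sub>R n)) (at_right 0)"
          using smooth_continuous_on[OF sm, of UNIV]
          by (intro isCont_tendsto_compose[of _ \<phi>] tendsto_intros) (simp add: continuous_on_eq_continuous_at)
        then have "(\<lambda>k. LINT t|lborel. w (x - t *\<^sub>R n) * \<phi> (x - t *\<^sub>R n) * layer_kernel k t) \<longlonglongrightarrow> \<tau> * \<phi> x"
          by (intro normal_trace_at_kernel_limit[OF wm \<tau> e]) auto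
        then show ?thesis using btrace_tendsto(1)[OF wm \<tau> e] by (simp add: mult.commute)
      next
        case False
        then have "x \<notin> C" using C(2) by blast
        then obtain e where e: "e > 0" "ball x e \<subseteq> - C"
          using C(1) by (meson ComplI compact_imp_closed open_Compl open_contains_ball)
        have "(\<lambda>k. LINT t|lborel. (w (x - t *\<^sub>R n) * \<phi> (x - t *\<^sub>R n)) * layer_kernel k t) \<longlonglongrightarrow> 0"
        proof (rule layer_kernel_limit[OF _ e(1), where q = "\<lambda>t. 0"])
          show "AE t in lborel. 0 < t \<and> t < e \<longrightarrow> w (x - t *\<^sub>R n) * \<phi> (x - t *\<^sub>R n) = 0"
          proof (intro AE_I2 impI)
            fix t assume "0 < t \<and> t < e"
            then have "x - t *\<^sub>R n \<in> ball x e" using n by (simp add: dist_norm)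
            then have "x - t *\<^sub>R n \<notin> C" using e(2) by blast
            then show "w (x - t *\<^sub>R n) * \<phi> (x - t *\<^sub>R n) = 0" using C(3) by simp
          qed
        qed auto
        then show ?thesis using test_function_grad_0(1)[OF \<phi> False] by simp
      qed
      from LIMSEQ_ignore_initial_segment[OF this, of N]
      show "(\<lambda>k. ?u (k + N) x) \<longlonglongrightarrow> \<phi> x * btrace n w x"
        by (simp only: inner[OF x])
    qed
    show "AE x in hyp n c. norm (?u (k + N) x) \<le> D x" for k
      using AE_hyp_mem[OF n, of c] normal_trace_exists[OF T n w, of c]
    proof eventually_elim
      fix x assume x: "n \<bullet> x = c" and "\<exists>\<tau>. normal_trace_at T n w (g n) x \<tau>"
      then obtain \<tau> where \<tau>: "normal_trace_at T n w (g n) x \<tau>" by blast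
      let ?K = "k + N"
      let ?I = "LINT r|lborel. \<bar>g n (x + r *\<^sub>R n)\<bar>"
      have D0: "0 \<le> D x"
        unfolding D_def using P B by (intro mult_nonneg_nonneg add_nonneg_nonneg Bochner_Integration.integral_nonneg) auto
      show "norm (?u ?K x) \<le> D x"
      proof (cases "\<exists>t. layer_kernel ?K t \<noteq> 0 \<and> x - t *\<^sub>R n \<in> C")
        case False
        then have z: "(\<lambda>t. w (x - t *\<^sub>R n) * \<phi> (x - t *\<^sub>R n) * layer_kernel ?K t) = (\<lambda>t. 0)"
          using C(3) by (auto simp: fun_eq_iff)
        show ?thesis using D0 unfolding inner[OF x] z by simp
      next
        case True
        then obtain t where t: "layer_kernel ?K t \<noteq> 0" "x - t *\<^sub>R n \<in> C" by blast
        have t': "1 / real (Suc ?K) < t" "t < 2 / real (Suc ?K)" using layer_kernel_0[of t ?K] t(1) by (meson not_le)+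
        then have t0: "0 < t" "t < \<delta>" using Kd[of k] by (auto intro: less_trans[of 0 "1 / real (Suc ?K)"])
        have inV: "x - s *\<^sub>R n \<in> V" if "0 \<le> s" "s < \<delta>" for s
        proof (rule \<delta>(2)[OF t(2)])
          have "dist (x - t *\<^sub>R n) (x - s *\<^sub>R n) = norm ((s - t) *\<^sub>R n)"
            by (simp add: dist_norm algebra_simps)
          also have "\<dots> = \<bar>s - t\<bar>" using n by simp
          finally show "dist (x - t *\<^sub>R n) (x - s *\<^sub>R n) < \<delta>" using that t0 by linarith
        qed
        have xF: "x \<in> F" using inV[of 0] \<delta>(1) x by (simp add: F_def)
        have seg: "x - s *\<^sub>R n \<in> T" if "0 < s" "s < \<delta>" for s
          using inV[of s] V(2) that x by (simp add: inner_simps nn)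
        have \<tau>b: "\<tau> = btrace n w x" using btrace_tendsto(1)[OF wm \<tau> \<delta>(1) seg] by simp
        have gx: "integrable lborel (\<lambda>r. g n (x - r *\<^sub>R n))" using \<tau> by (simp add: normal_trace_at_def)
        have refl: "(LINT r|lborel. \<bar>g n (x - r *\<^sub>R n)\<bar>) = ?I"
          using lborel_integral_real_affine[of "-1" "\<lambda>r. \<bar>g n (x + r *\<^sub>R n)\<bar>" 0] by simp
        have "AE s in lborel. 0 < s \<and> s < \<delta> \<longrightarrow> w (x - s *\<^sub>R n) = \<tau> - (LINT r|lborel. indicator {0..s} r * g n (x - r *\<^sub>R n))"
          using \<tau> seg \<delta>(1) by (auto simp: normal_trace_at_def)
        then have "AE s in lborel. \<bar>w (x - s *\<^sub>R n) * \<phi> (x - s *\<^sub>R n) * layer_kernel ?K s\<bar>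
            \<le> ((\<bar>\<tau>\<bar> + ?I) * P * B) * (real (Suc ?K) * indicator {0..2 / real (Suc ?K)} s)"
        proof eventually_elim
          fix s assume s: "0 < s \<and> s < \<delta> \<longrightarrow> w (x - s *\<^sub>R n) = \<tau> - (LINT r|lborel. indicator {0..s} r * g n (x - r *\<^sub>R n))"
          have I0: "?I \<ge> 0" by (intro Bochner_Integration.integral_nonneg) auto
          show "\<bar>w (x - s *\<^sub>R n) * \<phi> (x - s *\<^sub>R n) * layer_kernel ?K s\<bar>
            \<le> ((\<bar>\<tau>\<bar> + ?I) * P * B) * (real (Suc ?K) * indicator {0..2 / real (Suc ?K)} s)"
          proof (cases "s \<le> 1 / real (Suc ?K) \<or> s \<ge> 2 / real (Suc ?K)")
            case True
            then show ?thesis using P B I0 by (simp only: layer_kernel_0) simp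
          next
            case False
            then have "0 < s \<and> s < \<delta>" using Kd[of k] by (auto intro: less_trans[of 0 "1 / real (Suc ?K)"])
            then have "w (x - s *\<^sub>R n) = \<tau> - (LINT r|lborel. indicator {0..s} r * g n (x - r *\<^sub>R n))" using s by blast
            moreover have "\<bar>LINT r|lborel. indicator {0..s} r * g n (x - r *\<^sub>R n)\<bar> \<le> ?I"
              unfolding refl[symmetric]
              by (rule integral_norm_le_AE) (use gx in \<open>auto simp: indicator_def\<close>)
            ultimately have wb: "\<bar>w (x - s *\<^sub>R n)\<bar> \<le> \<bar>\<tau>\<bar> + ?I" by linarith
            have "\<bar>w (x - s *\<^sub>R n) * \<phi> (x - s *\<^sub>R n) * layer_kernel ?K s\<bar>
              \<le> (\<bar>\<tau>\<bar> + ?I) * P * (B * (real (Suc ?K) * indicator {0..2 / real (Suc ?K)} s))"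
              unfolding abs_mult using wb P I0 by (intro mult_mono layer_kernel_bound B mult_nonneg_nonneg) auto
            then show ?thesis by (simp only: mult.assoc)
          qed
        qed
        then have "\<bar>?u ?K x\<bar> \<le> (LINT s|lborel. ((\<bar>\<tau>\<bar> + ?I) * P * B) * (real (Suc ?K) * indicator {0..2 / real (Suc ?K)} s))"
          unfolding inner[OF x] by (intro integral_norm_le_AE integrable_layer_bound) measurable
        also have "\<dots> = 2 * ((\<bar>\<tau>\<bar> + ?I) * P * B)" by (rule integral_layer_bound)
        also have "\<dots> = D x" using xF by (simp add: D_def \<tau>b)
        finally show ?thesis by simp
      qed
    qed
  qed measurable
  then have "(\<lambda>k. LINT x|hyp n c. ?u k x) \<longlonglongrightarrow> (LINT x|hyp n c. \<phi> x * btrace n w x)"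
    by (rule LIMSEQ_offset)
  then show "(\<lambda>k. LINT z|lborel. w z * \<phi> z * layer_kernel k (c - n \<bullet> z)) \<longlonglongrightarrow> (LINT x|hyp n c. \<phi> x * btrace n w x)"
    by (simp only: integral_hyp_Fubini(3)[OF n Gi])
qed

text \<open>\<open>g i v\<close> is the derivative of the component \<open>i\<close> of \<open>W\<close> in direction \<open>v\<close>, and \<open>A *v W\<close> has
  weak divergence \<open>- f\<close> in \<open>T\<close>.\<close>

definition div_field ::
  "(real^'n) set \<Rightarrow> real^'n^'n \<Rightarrow> (real^'n \<Rightarrow> real^'n) \<Rightarrow> ('n \<Rightarrow> real^'n \<Rightarrow> real^'n \<Rightarrow> real) \<Rightarrow> (real^'n \<Rightarrow> real) \<Rightarrow> bool" where
  "div_field T A W g f \<longleftrightarrow> (\<forall>i v. weak_dd T v (\<lambda>z. W z $ i) (g i v)) \<and> (\<forall>z. z \<notin> T \<longrightarrow> W z = 0) \<and>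
     integrable lborel f \<and> (\<forall>z. z \<notin> T \<longrightarrow> f z = 0) \<and>
     (\<forall>\<phi>. test_function T \<phi> \<longrightarrow> (LINT z|lborel. (A *v W z) \<bullet> grad \<phi> z) = (LINT z|lborel. f z * \<phi> z))"

text \<open>What is used of the shape of a cell: convex compact pieces for the layer estimates, and
  closedness of their union for the regularity of its interior.\<close>

definition convex_union :: "(real^'n) set \<Rightarrow> bool" where
  "convex_union T \<longleftrightarrow> (\<exists>S. finite S \<and> (\<forall>C\<in>S. convex C \<and> compact C) \<and> T = interior (\<Union>S))"

definition flux_density :: "real^'n^'n \<Rightarrow> (real^'n \<Rightarrow> real^'n) \<Rightarrow> real^'n \<Rightarrow> real^'n \<Rightarrow> real" where
  "flux_density A W n x = (A *v (\<chi> i. btrace n (\<lambda>z. W z $ i) x)) \<bullet> n"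

lemma matrix_inner_sum:
  "((A :: real^'n^'n) *v w) \<bullet> v = (\<Sum>j\<in>UNIV. (\<Sum>i\<in>UNIV. v $ i * A $ i $ j) * w $ j)"
proof -
  have "(A *v w) \<bullet> v = (\<Sum>i\<in>UNIV. \<Sum>j\<in>UNIV. v $ i * A $ i $ j * w $ j)"
    by (simp add: inner_vec_def matrix_vector_mult_def sum_distrib_left sum_distrib_right mult_ac)
  also have "\<dots> = (\<Sum>j\<in>UNIV. \<Sum>i\<in>UNIV. v $ i * A $ i $ j * w $ j)" by (rule sum.swap)
  finally show ?thesis by (simp add: sum_distrib_right)
qed

lemma flux_density_sum:
  "flux_density A W n x = (\<Sum>j\<in>UNIV. (\<Sum>i\<in>UNIV. n $ i * A $ i $ j) * btrace n (\<lambda>z. W z $ j) x)"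
  by (simp add: flux_density_def matrix_inner_sum)

lemma div_field_integrable:
  assumes "div_field T A W g f" "smooth \<phi>" "\<And>z. \<bar>\<phi> z\<bar> \<le> B" "smooth \<psi>" "\<And>z. norm (grad \<psi> z) \<le> D"
  shows "integrable lborel (\<lambda>z. ((A *v W z) \<bullet> grad \<psi> z) * \<phi> z)" "integrable lborel (\<lambda>z. f z * \<phi> z)"
proof -
  note [measurable] = borel_measurable_smooth[OF assms(2)] borel_measurable_grad[OF assms(4)]
  have Wi: "integrable lborel (\<lambda>z. W z $ j)" for j
    using assms(1) by (auto simp: div_field_def weak_dd_def)
  have g: "\<bar>partial_deriv i \<psi> z\<bar> \<le> D" for i z
    using assms(5)[of z] component_le_norm_cart[of "grad \<psi> z" i] by simp
  have "integrable lborel (\<lambda>z. (\<Sum>j\<in>UNIV. (\<Sum>i\<in>UNIV. A $ i $ j * (W z $ j * partial_deriv i \<psi> z))) * \<phi> z)"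
  proof (rule integrable_mult_bounded[where B = B])
    have "integrable lborel (\<lambda>z. W z $ j * partial_deriv i \<psi> z)" for i j
      using g assms(4) by (intro integrable_mult_bounded[OF Wi, of _ D]) (auto simp: borel_measurable_partial_deriv)
    then show "integrable lborel (\<lambda>z. \<Sum>j\<in>UNIV. \<Sum>i\<in>UNIV. A $ i $ j * (W z $ j * partial_deriv i \<psi> z))"
      by (intro Bochner_Integration.integrable_sum integrable_mult_right)
  qed (use assms in auto)
  then show "integrable lborel (\<lambda>z. ((A *v W z) \<bullet> grad \<psi> z) * \<phi> z)"
    by (simp add: matrix_inner_sum sum_distrib_right sum_distrib_left mult_ac)
  show "integrable lborel (\<lambda>z. f z * \<phi> z)"
    using assms by (intro integrable_mult_bounded[of _ f _ B]) (auto simp: div_field_def)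
qed

lemma smooth_grad_bounded_step:
  "smooth (\<lambda>z. step (real (Suc k) * (c - n \<bullet> z) - 1))"
  "grad (\<lambda>z. step (real (Suc k) * (c - n \<bullet> z) - 1)) z = - layer_kernel k (c - n \<bullet> z) *\<^sub>R n"
proof -
  have eq: "(\<lambda>z. step (real (Suc k) * (c - n \<bullet> z) - 1)) = (\<lambda>z. step ((- real (Suc k) *\<^sub>R n) \<bullet> z + (real (Suc k) * c - 1)))"
    by (auto simp: fun_eq_iff algebra_simps)
  show "smooth (\<lambda>z. step (real (Suc k) * (c - n \<bullet> z) - 1))"
    unfolding eq by (rule smooth_step)
  show "grad (\<lambda>z. step (real (Suc k) * (c - n \<bullet> z) - 1)) z = - layer_kernel k (c - n \<bullet> z) *\<^sub>R n"
    unfolding eq grad_step by (simp add: layer_kernel_def algebra_simps)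
qed

text \<open>Test the divergence with \<open>\<phi>\<close> times a step in the depth
  \<open>c - n \<bullet> z\<close>. By the product rule the gradient has an extra term, minus the
  layer kernel times \<open>n\<close>, whose integral tends to the surface integral by
  \<open>layer_limit\<close>, while the step tends to 1 on the part of \<open>T\<close> in
  \<open>V\<close>.\<close>

lemma local_gauss_green:
  fixes T V :: "(real^'n) set"
  assumes T: "open T" and d: "div_field T A W g f" and n: "norm n = 1" and S: "convex_union T"
    and V: "open V" "\<And>z. z \<in> V \<Longrightarrow> z \<in> T \<longleftrightarrow> n \<bullet> z < c"
    and \<phi>: "test_function V \<phi>"
  shows "integrable (hyp n c) (\<lambda>x. \<phi> x * flux_density A W n x)"
    and "(LINT z|lborel. (A *v W z) \<bullet> grad \<phi> z) - (LINT z|lborel. f z * \<phi> z)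
      = (LINT x|hyp n c. \<phi> x * flux_density A W n x)"
proof -
  obtain SS where SS: "finite SS" "\<And>C. C \<in> SS \<Longrightarrow> convex C \<and> compact C" "T = interior (\<Union>SS)"
    using S by (auto simp: convex_union_def)
  have w: "\<And>i v. weak_dd T v (\<lambda>z. W z $ i) (g i v)" and W0: "\<And>z. z \<notin> T \<Longrightarrow> W z = 0" and f0: "\<And>z. z \<notin> T \<Longrightarrow> f z = 0"
    and fi: "integrable lborel f"
    and dv: "\<And>\<phi>. test_function T \<phi> \<Longrightarrow> (LINT z|lborel. (A *v W z) \<bullet> grad \<phi> z) = (LINT z|lborel. f z * \<phi> z)"
    using d by (auto simp: div_field_def)
  have Wi: "integrable lborel (\<lambda>z. W z $ j)" for j using w[of 0 j] by (auto simp: weak_dd_def)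
  have sm: "smooth \<phi>" using \<phi> by (rule test_function_smooth)
  note [measurable] = borel_measurable_smooth[OF sm] borel_measurable_integrable[OF fi, simplified]
  obtain P where P: "P > 0" "\<And>x. \<bar>\<phi> x\<bar> \<le> P" using \<phi> by (rule test_function_bounded) blast
  obtain D where D: "D > 0" "\<And>x. norm (grad \<phi> x) \<le> D" using \<phi> by (rule test_function_grad_bounded) blast
  obtain C where C: "compact C" "C \<subseteq> V" "\<And>x. x \<notin> C \<Longrightarrow> \<phi> x = 0" using \<phi> by (rule test_functionE) blast
  obtain B where B: "B > 0" "\<And>t. \<bar>step' t\<bar> \<le> B" using step'_bound by blast
  let ?a = "\<lambda>j. \<Sum>i\<in>UNIV. n $ i * A $ i $ j"
  have L: "integrable (hyp n c) (\<lambda>x. \<phi> x * btrace n (\<lambda>z. W z $ j) x)"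
    "(\<lambda>k. LINT z|lborel. W z $ j * \<phi> z * layer_kernel k (c - n \<bullet> z)) \<longlonglongrightarrow> (LINT x|hyp n c. \<phi> x * btrace n (\<lambda>z. W z $ j) x)" for j
    using layer_limit[OF T w n SS _ V \<phi>] W0 by auto
  have e: "\<phi> x * flux_density A W n x = (\<Sum>j\<in>UNIV. ?a j * (\<phi> x * btrace n (\<lambda>z. W z $ j) x))" for x
    by (simp add: flux_density_sum sum_distrib_left mult_ac)
  show "integrable (hyp n c) (\<lambda>x. \<phi> x * flux_density A W n x)"
    unfolding e by (intro Bochner_Integration.integrable_sum integrable_mult_right L)
  let ?s = "\<lambda>k z. step (real (Suc k) * (c - n \<bullet> z) - 1)"
  have s1: "\<bar>?s k z\<bar> \<le> 1" for k z using step_nonneg step_le_1 by (simp add: abs_le_iff order_trans[of _ 0])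
  note ss = smooth_grad_bounded_step(1)[of _ c n]
  have lk: "\<bar>layer_kernel k t\<bar> \<le> B * real (Suc k)" for k t
    by (rule order_trans[OF layer_kernel_bound[OF B(2)]]) (use B in \<open>auto simp: indicator_def\<close>)
  have Ki: "integrable lborel (\<lambda>z. W z $ j * \<phi> z * layer_kernel k (c - n \<bullet> z))" for j k
    using lk P by (intro integrable_mult_bounded[where h = "\<lambda>z. layer_kernel k (c - n \<bullet> z)" and B = "B * real (Suc k)"]
          integrable_mult_bounded[OF Wi, where B = P]) auto
  have id: "(LINT z|lborel. ((A *v W z) \<bullet> grad \<phi> z) * ?s k z) - (LINT z|lborel. (f z * \<phi> z) * ?s k z)
      = (\<Sum>j\<in>UNIV. ?a j * (LINT z|lborel. W z $ j * \<phi> z * layer_kernel k (c - n \<bullet> z)))" for k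
  proof -
    have t: "test_function T (\<lambda>z. \<phi> z * ?s k z)"
    proof (rule test_functionI)
      show "smooth (\<lambda>z. \<phi> z * ?s k z)" by (intro smooth_mult sm ss)
      \<comment> \<open>The step is zero down to depth \<open>1 / real (Suc k)\<close>, so the
        support of the product stays strictly below the hyperplane, inside \<open>T\<close>.\<close>
      let ?C = "C \<inter> {z. n \<bullet> z \<le> c - 1 / real (Suc k)}"
      show "compact ?C" using C(1) closed_halfspace_le by (intro compact_Int_closed)
      show "?C \<subseteq> T"
      proof
        fix z assume z: "z \<in> ?C"
        moreover have "1 / real (Suc k) > 0" by simp
        moreover have "n \<bullet> z \<le> c - 1 / real (Suc k)" using z by blast
        ultimately have "n \<bullet> z < c" by linarith
        then show "z \<in> T" using z V(2) C(2) by auto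
      qed
      fix z assume z: "z \<notin> ?C"
      show "\<phi> z * ?s k z = 0"
      proof (cases "z \<in> C")
        case True
        then have "c - n \<bullet> z < 1 / real (Suc k)" using z by auto
        then have "real (Suc k) * (c - n \<bullet> z) - 1 \<le> 0" by (simp add: field_simps del: of_nat_Suc)
        then show ?thesis by simp
      qed (simp add: C(3))
    qed
    have gr: "grad (\<lambda>z. \<phi> z * ?s k z) z = ?s k z *\<^sub>R grad \<phi> z - (\<phi> z * layer_kernel k (c - n \<bullet> z)) *\<^sub>R n" for z
      by (simp add: grad_mult[OF sm ss] smooth_grad_bounded_step(2) del: of_nat_Suc)
    have "(A *v W z) \<bullet> grad (\<lambda>z. \<phi> z * ?s k z) z
        = ((A *v W z) \<bullet> grad \<phi> z) * ?s k z - (\<Sum>j\<in>UNIV. ?a j * (W z $ j * \<phi> z * layer_kernel k (c - n \<bullet> z)))" for z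
    proof -
      have "(A *v W z) \<bullet> grad (\<lambda>z. \<phi> z * ?s k z) z
        = ((A *v W z) \<bullet> grad \<phi> z) * ?s k z - (\<phi> z * layer_kernel k (c - n \<bullet> z)) * ((A *v W z) \<bullet> n)"
        by (simp add: gr inner_diff_right mult.commute del: of_nat_Suc)
      also have "(\<phi> z * layer_kernel k (c - n \<bullet> z)) * ((A *v W z) \<bullet> n) = (\<Sum>j\<in>UNIV. ?a j * (W z $ j * \<phi> z * layer_kernel k (c - n \<bullet> z)))"
        unfolding matrix_inner_sum sum_distrib_left by (simp add: mult_ac)
      finally show ?thesis .
    qed
    then have "(LINT z|lborel. ((A *v W z) \<bullet> grad \<phi> z) * ?s k z - (\<Sum>j\<in>UNIV. ?a j * (W z $ j * \<phi> z * layer_kernel k (c - n \<bullet> z))))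
        = (LINT z|lborel. f z * (\<phi> z * ?s k z))"
      using dv[OF t] by (simp del: of_nat_Suc)
    moreover have "integrable lborel (\<lambda>z. ((A *v W z) \<bullet> grad \<phi> z) * ?s k z)"
      by (rule div_field_integrable(1)[OF d ss s1 sm D(2)])
    moreover have "integrable lborel (\<lambda>z. \<Sum>j\<in>UNIV. ?a j * (W z $ j * \<phi> z * layer_kernel k (c - n \<bullet> z)))"
      by (intro Bochner_Integration.integrable_sum integrable_mult_right Ki)
    ultimately have "(LINT z|lborel. ((A *v W z) \<bullet> grad \<phi> z) * ?s k z)
        - (LINT z|lborel. (\<Sum>j\<in>UNIV. ?a j * (W z $ j * \<phi> z * layer_kernel k (c - n \<bullet> z)))) = (LINT z|lborel. f z * (\<phi> z * ?s k z))"
      by (simp add: Bochner_Integration.integral_diff del: of_nat_Suc)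
    moreover have "(LINT z|lborel. (\<Sum>j\<in>UNIV. ?a j * (W z $ j * \<phi> z * layer_kernel k (c - n \<bullet> z))))
        = (\<Sum>j\<in>UNIV. ?a j * (LINT z|lborel. W z $ j * \<phi> z * layer_kernel k (c - n \<bullet> z)))"
      using Ki by (subst Bochner_Integration.integral_sum) auto
    ultimately show ?thesis by (simp add: mult.assoc del: of_nat_Suc)
  qed
  have slim: "(\<lambda>k. ?s k z) \<longlonglongrightarrow> 1" if "n \<bullet> z < c" for z
  proof (rule tendsto_eventually)
    obtain N :: nat where N: "real N > 2 / (c - n \<bullet> z)" using reals_Archimedean2 by blast
    have "?s k z = 1" if "k \<ge> N" for k
    proof -
      have "2 / (c - n \<bullet> z) < real (Suc k)" using N that by linarith
      then have "2 < real (Suc k) * (c - n \<bullet> z)" using \<open>n \<bullet> z < c\<close> by (simp add: field_simps del: of_nat_Suc)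
      then show ?thesis by simp
    qed
    then show "\<forall>\<^sub>F k in sequentially. ?s k z = 1" by (auto simp: eventually_sequentially)
  qed
  have lim: "(\<lambda>k. LINT z|lborel. h z * ?s k z) \<longlonglongrightarrow> (LINT z|lborel. h z)"
    if h: "integrable lborel h" "\<And>z. z \<notin> T \<or> z \<notin> V \<Longrightarrow> h z = 0" for h :: "real^'n \<Rightarrow> real"
  proof (rule integral_dominated_convergence[where w = "\<lambda>z. \<bar>h z\<bar>"])
    show "AE z in lborel. (\<lambda>k. h z * ?s k z) \<longlonglongrightarrow> h z"
    proof (rule AE_I2)
      fix z
      show "(\<lambda>k. h z * ?s k z) \<longlonglongrightarrow> h z"
      proof (cases "z \<in> T \<and> z \<in> V")
        case True
        then have "(\<lambda>k. h z * ?s k z) \<longlonglongrightarrow> h z * 1" using V(2) by (intro tendsto_mult slim tendsto_const) auto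
        then show ?thesis by simp
      qed (use h(2)[of z] in auto)
    qed
    show "AE z in lborel. norm (h z * ?s k z) \<le> \<bar>h z\<bar>" for k
      using s1 by (intro AE_I2) (simp add: abs_mult mult_left_le del: of_nat_Suc)
    show "(\<lambda>z. h z * ?s k z) \<in> borel_measurable lborel" for k
      using h(1) borel_measurable_smooth[OF ss] by auto
  qed (use h in auto)
  have "integrable lborel (\<lambda>z. ((A *v W z) \<bullet> grad \<phi> z) * 1)"
    by (rule div_field_integrable(1)[OF d smooth_const _ sm D(2), of _ 1]) simp
  then have "(\<lambda>k. LINT z|lborel. ((A *v W z) \<bullet> grad \<phi> z) * ?s k z) \<longlonglongrightarrow> (LINT z|lborel. (A *v W z) \<bullet> grad \<phi> z)"
    using W0 test_function_grad_0(2)[OF \<phi>] by (intro lim) auto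
  moreover have "(\<lambda>k. LINT z|lborel. (f z * \<phi> z) * ?s k z) \<longlonglongrightarrow> (LINT z|lborel. f z * \<phi> z)"
    using div_field_integrable(2)[OF d sm P(2) sm D(2)] f0 test_function_grad_0(1)[OF \<phi>] by (intro lim) auto
  ultimately have "(\<lambda>k. (LINT z|lborel. ((A *v W z) \<bullet> grad \<phi> z) * ?s k z) - (LINT z|lborel. (f z * \<phi> z) * ?s k z))
      \<longlonglongrightarrow> (LINT z|lborel. (A *v W z) \<bullet> grad \<phi> z) - (LINT z|lborel. f z * \<phi> z)"
    by (rule tendsto_diff)
  moreover have "(\<lambda>k. (LINT z|lborel. ((A *v W z) \<bullet> grad \<phi> z) * ?s k z) - (LINT z|lborel. (f z * \<phi> z) * ?s k z))
      \<longlonglongrightarrow> (\<Sum>j\<in>UNIV. ?a j * (LINT x|hyp n c. \<phi> x * btrace n (\<lambda>z. W z $ j) x))"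
    unfolding id by (intro tendsto_sum tendsto_mult tendsto_const L)
  ultimately have "(LINT z|lborel. (A *v W z) \<bullet> grad \<phi> z) - (LINT z|lborel. f z * \<phi> z)
      = (\<Sum>j\<in>UNIV. ?a j * (LINT x|hyp n c. \<phi> x * btrace n (\<lambda>z. W z $ j) x))"
    by (rule LIMSEQ_unique)
  also have "\<dots> = (LINT x|hyp n c. \<phi> x * flux_density A W n x)"
    unfolding e using L(1) by (subst Bochner_Integration.integral_sum) auto
  finally show "(LINT z|lborel. (A *v W z) \<bullet> grad \<phi> z) - (LINT z|lborel. f z * \<phi> z)
      = (LINT x|hyp n c. \<phi> x * flux_density A W n x)" .
qed

section \<open>Localization of additive functionals of test functions\<close>

lemma bump_at_point:
  fixes x :: "real^'n"
  assumes "open V" "x \<in> V"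
  obtains \<psi> U where "test_function V \<psi>" "open U" "x \<in> U" "\<And>y. y \<in> U \<Longrightarrow> \<psi> y = 1"
proof -
  obtain a b where ab': "box a b \<subseteq> V" "x \<in> box a b"
    by (rule open_contains_box[OF assms])
  note ab = ab'(2,1)
  have pos: "x $ i - a $ i > 0" "b $ i - x $ i > 0" for i
    using ab(1) by (auto simp: mem_box_cart)
  have "\<forall>\<^sub>F k::nat in sequentially. real k * c > 2" if "c > 0" for c
  proof -
    have "\<forall>\<^sub>F k::nat in sequentially. real k > 2 / c"
      using filterlim_real_sequentially filterlim_at_top_dense by blast
    then show ?thesis by eventually_elim (use that in \<open>simp add: field_simps\<close>)
  qed
  then have "\<forall>\<^sub>F k::nat in sequentially. \<forall>i. real k * (x $ i - a $ i) > 2 \<and> real k * (b $ i - x $ i) > 2"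
    using pos by (intro eventually_all_finite eventually_conj) auto
  then obtain k :: nat where k: "\<And>i. real k * (x $ i - a $ i) > 2 \<and> real k * (b $ i - x $ i) > 2"
    by (auto dest!: eventually_happens'[OF sequentially_bot])
  let ?U = "{y. \<forall>i. real k * (y $ i - a $ i) > 2 \<and> real k * (b $ i - y $ i) > 2}"
  show ?thesis
  proof (rule that[of "box_bump k a b" ?U])
    show "test_function V (box_bump k a b)"
      by (rule test_function_mono[OF test_function_box_bump ab(2)])
    have "?U = (\<Inter>i\<in>UNIV. {y. real k * (y $ i - a $ i) > 2} \<inter> {y. real k * (b $ i - y $ i) > 2})" by auto
    also have "open \<dots>"
      by (intro open_INT open_Int ballI open_Collect_less continuous_intros) auto
    finally show "open ?U" .
    show "box_bump k a b y = 1" if "y \<in> ?U" for y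
    proof -
      have "step (real k * (y $ i - a $ i) - 1) * step (real k * (b $ i - y $ i) - 1) = 1" for i
      proof -
        have "real k * (y $ i - a $ i) > 2" "real k * (b $ i - y $ i) > 2" using that by auto
        then show ?thesis by simp
      qed
      then show ?thesis by (simp add: box_bump_def)
    qed
  qed (use k in auto)
qed

text \<open>Cover the support by finitely many of the sets \<open>V\<close> and split off bump functions one by one.\<close>

lemma test_function_localize:
  fixes L :: "(real^'n \<Rightarrow> real) \<Rightarrow> real"
  assumes add: "\<And>\<phi> \<psi>. test_function UNIV \<phi> \<Longrightarrow> test_function UNIV \<psi> \<Longrightarrow> L (\<lambda>x. \<phi> x + \<psi> x) = L \<phi> + L \<psi>"
    and loc: "\<And>x. x \<in> U \<Longrightarrow> \<exists>V. open V \<and> x \<in> V \<and> (\<forall>\<psi>. test_function V \<psi> \<longrightarrow> L \<psi> = 0)"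
    and \<phi>: "test_function U \<phi>"
  shows "L \<phi> = 0"
proof -
  obtain C where C: "compact C" "C \<subseteq> U" "\<And>x. x \<notin> C \<Longrightarrow> \<phi> x = 0" using \<phi> by (rule test_functionE) blast
  define Q where "Q x V O' \<psi> \<longleftrightarrow> open O' \<and> x \<in> O' \<and> test_function V \<psi> \<and> (\<forall>y\<in>O'. \<psi> y = 1) \<and>
      (\<forall>\<psi>. test_function V \<psi> \<longrightarrow> L \<psi> = 0)" for x V O' \<psi>
  have "\<exists>V O' \<psi>. Q x V O' \<psi>" if "x \<in> C" for x
  proof -
    have "x \<in> U" using C(2) that by (rule subsetD)
    from loc[OF this] obtain V where V: "open V" "x \<in> V" "\<forall>\<psi>. test_function V \<psi> \<longrightarrow> L \<psi> = 0"
      by (elim exE conjE)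
    obtain \<psi> O' where "test_function V \<psi>" "open O'" "x \<in> O'" "\<And>y. y \<in> O' \<Longrightarrow> \<psi> y = 1"
      using V(1,2) by (rule bump_at_point) blast
    then show ?thesis using V unfolding Q_def by blast
  qed
  then obtain V O' \<psi> where Q: "\<And>x. x \<in> C \<Longrightarrow> Q x (V x) (O' x) (\<psi> x)" by metis
  then have O': "\<And>x. x \<in> C \<Longrightarrow> open (O' x)" "\<And>x. x \<in> C \<Longrightarrow> x \<in> O' x"
    and \<psi>: "\<And>x. x \<in> C \<Longrightarrow> test_function (V x) (\<psi> x)" "\<And>x y. x \<in> C \<Longrightarrow> y \<in> O' x \<Longrightarrow> \<psi> x y = 1"
    and V: "\<And>x \<theta>. x \<in> C \<Longrightarrow> test_function (V x) \<theta> \<Longrightarrow> L \<theta> = 0"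
    unfolding Q_def by blast+
  have "C \<subseteq> (\<Union>x\<in>C. O' x)" using O'(2) by blast
  then obtain X where X: "X \<subseteq> C" "finite X" "C \<subseteq> (\<Union>x\<in>X. O' x)"
    using compactE_image[OF C(1), of C O'] O'(1) by metis
  have \<phi>U: "test_function UNIV \<phi>" by (rule test_function_mono[OF \<phi>]) simp
  have main: "L \<phi> = L (\<lambda>y. \<phi> y * (\<Prod>x\<in>Y. 1 - \<psi> x y)) \<and> test_function UNIV (\<lambda>y. \<phi> y * (\<Prod>x\<in>Y. 1 - \<psi> x y))"
    if "finite Y" "Y \<subseteq> X" for Y
    using that
  proof (induction Y rule: finite_induct)
    case empty
    then show ?case using \<phi>U by simp
  next
    case (insert a Y)
    let ?\<theta> = "\<lambda>y. \<phi> y * (\<Prod>x\<in>Y. 1 - \<psi> x y)"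
    have IH: "L \<phi> = L ?\<theta>" "test_function UNIV ?\<theta>" using insert by auto
    have aC: "a \<in> C" using insert.prems X(1) by auto
    have sa: "smooth (\<psi> a)" using test_function_smooth[OF \<psi>(1)[OF aC]] .
    have t1: "test_function (V a) (\<lambda>y. ?\<theta> y * \<psi> a y)"
      by (rule test_function_mult'[OF \<psi>(1)[OF aC] test_function_smooth[OF IH(2)]])
    have t1': "test_function UNIV (\<lambda>y. ?\<theta> y * \<psi> a y)" by (rule test_function_mono[OF t1]) simp
    have t2: "test_function UNIV (\<lambda>y. ?\<theta> y * (1 - \<psi> a y))"
      by (rule test_function_mult[OF IH(2) smooth_diff[OF smooth_const sa]])
    have "L (\<lambda>y. ?\<theta> y * \<psi> a y + ?\<theta> y * (1 - \<psi> a y)) = L (\<lambda>y. ?\<theta> y * \<psi> a y) + L (\<lambda>y. ?\<theta> y * (1 - \<psi> a y))"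
      by (rule add[OF t1' t2])
    moreover have "(\<lambda>y. ?\<theta> y * \<psi> a y + ?\<theta> y * (1 - \<psi> a y)) = ?\<theta>" by (simp add: algebra_simps)
    moreover have "L (\<lambda>y. ?\<theta> y * \<psi> a y) = 0" by (rule V[OF aC t1])
    ultimately have "L ?\<theta> = L (\<lambda>y. ?\<theta> y * (1 - \<psi> a y))" by simp
    moreover have "(\<lambda>y. ?\<theta> y * (1 - \<psi> a y)) = (\<lambda>y. \<phi> y * (\<Prod>x\<in>insert a Y. 1 - \<psi> x y))"
      using insert.hyps by (simp add: mult_ac)
    ultimately show ?case using IH(1) t2 by simp
  qed
  have "(\<lambda>y. \<phi> y * (\<Prod>x\<in>X. 1 - \<psi> x y)) = (\<lambda>y. 0)"
  proof
    fix y
    show "\<phi> y * (\<Prod>x\<in>X. 1 - \<psi> x y) = 0"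
    proof (cases "y \<in> C")
      case True
      then obtain x where "x \<in> X" "y \<in> O' x" using X(3) by blast
      then have "\<psi> x y = 1" using X(1) \<psi>(2) by blast
      then show ?thesis using \<open>x \<in> X\<close> X(2) by (auto intro!: prod_zero)
    qed (simp add: C(3))
  qed
  then have "L \<phi> = L (\<lambda>y. 0)" using main[OF X(2)] by simp
  moreover have "L (\<lambda>y. 0 + 0) = L (\<lambda>y. 0) + L (\<lambda>y. 0)"
    by (rule add) (rule test_function_zero)+
  ultimately show ?thesis by simp
qed

section \<open>Gauss--Green away from the skeleton\<close>

text \<open>The unit normal and the offset chosen in the definition of \<open>surf\<close>.\<close>

definition nrm :: "(real^'n) set \<Rightarrow> real^'n" where
  "nrm F = fst (SOME p. norm (fst p) = 1 \<and> F \<subseteq> {x. fst p \<bullet> x = snd p})"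

definition off :: "(real^'n) set \<Rightarrow> real" where
  "off F = snd (SOME p. norm (fst p) = 1 \<and> F \<subseteq> {x :: real^'n. fst p \<bullet> x = snd p})"

definition hpl :: "(real^'n) set \<Rightarrow> (real^'n) set" where
  "hpl F = {x. nrm F \<bullet> x = off F}"

definition skeleton :: "(real^'n) set set \<Rightarrow> (real^'n) set" where
  "skeleton Fs = (\<Union>F\<in>Fs. \<Union>G\<in>{G\<in>Fs. hpl F \<noteq> hpl G}. hpl F \<inter> hpl G)"

lemma face_like_nrm:
  assumes "face_like F"
  shows "norm (nrm F) = 1" "F \<subseteq> hpl F" "closed (hpl F)" "closure F \<subseteq> hpl F"
    "openin (top_of_set (hpl F)) F" "surf F = completion (hyp (nrm F) (off F))"
proof -
  let ?P = "\<lambda>p. norm (fst p) = 1 \<and> F \<subseteq> {x. fst p \<bullet> x = snd p}"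
  obtain m d where "norm m = 1" "openin (top_of_set {x. m \<bullet> x = d}) F"
    using assms by (auto simp: face_like_def)
  then have "?P (m, d)" using openin_imp_subset by auto
  from someI[of ?P, OF this] show n: "norm (nrm F) = 1" and F: "F \<subseteq> hpl F"
    by (simp_all add: nrm_def off_def hpl_def)
  show c: "closed (hpl F)" unfolding hpl_def by (rule closed_hyperplane)
  show "closure F \<subseteq> hpl F" by (rule closure_minimal[OF F c])
  show "openin (top_of_set (hpl F)) F" "surf F = completion (hyp (nrm F) (off F))"
    using face_like_openin[OF assms n] surf_eq[OF assms n] F by (auto simp: hpl_def)
qed

lemma closed_skeleton:
  assumes "finite Fs" "\<And>F. F \<in> Fs \<Longrightarrow> face_like F"
  shows "closed (skeleton Fs)"
  unfolding skeleton_def using assms by (intro closed_UN) (auto intro!: closed_Int closed_UN simp: face_like_nrm(3))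

lemma same_hyperplane:
  assumes "face_like F" "norm n = 1" "hpl F = {x. n \<bullet> x = c}"
  shows "nrm F = n \<and> off F = c \<or> nrm F = - n \<and> off F = - c" "hyp (nrm F) (off F) = hyp n c"
proof -
  have "openin (top_of_set {x. n \<bullet> x = c}) F" "F \<noteq> {}" "F \<subseteq> {x. nrm F \<bullet> x = off F}"
    using face_like_nrm[OF assms(1)] assms by (auto simp: hpl_def face_like_def)
  from unit_normal_unique[OF face_like_nrm(1)[OF assms(1)] assms(2) this]
  show 1: "nrm F = n \<and> off F = c \<or> nrm F = - n \<and> off F = - c" .
  then show "hyp (nrm F) (off F) = hyp n c" using hyp_uminus[OF assms(2)] by auto
qed

text \<open>Off the skeleton all hyperplanes through \<open>x\<close> coincide; the remaining ones
  are finitely many closed sets and avoid a ball.\<close>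

lemma ball_off_skeleton:
  assumes fin: "finite Fs" and fl: "\<And>F. F \<in> Fs \<Longrightarrow> face_like F" and x: "x \<notin> skeleton Fs" "F0 \<in> Fs" "x \<in> hpl F0"
  obtains \<rho> where "\<rho> > 0" "\<And>F. F \<in> Fs \<Longrightarrow> ball x \<rho> \<inter> hpl F \<noteq> {} \<Longrightarrow> hpl F = hpl F0"
proof -
  let ?C = "\<Union>F\<in>{F\<in>Fs. hpl F \<noteq> hpl F0}. hpl F"
  have "closed ?C" using fin fl by (intro closed_UN) (auto simp: face_like_nrm(3))
  moreover have "x \<notin> ?C" using x by (auto simp: skeleton_def)
  ultimately obtain \<rho> where \<rho>: "\<rho> > 0" "ball x \<rho> \<subseteq> - ?C"
    by (meson ComplI open_Compl open_contains_ball)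
  show ?thesis
    by (rule that[OF \<rho>(1)]) (use \<rho>(2) in blast)
qed

text \<open>An open half-ball is connected and free of frontier points, so it lies in
  \<open>T\<close> or misses it. If both lay in \<open>T\<close>, the ball would lie in
  \<open>interior (closure T) = T\<close> although its centre is a frontier point; if both missed
  it, \<open>x\<close> would not be in the closure. Regular openness thus excludes a crack along the
  hyperplane.\<close>

lemma half_ball:
  fixes T :: "(real^'n) set"
  assumes T: "open T" "interior (closure T) = T" and x: "x \<in> frontier T" and n: "norm n = 1" "n \<bullet> x = c"
    and \<rho>: "\<rho> > 0" and fr: "frontier T \<inter> ball x \<rho> \<subseteq> {z. n \<bullet> z = c}"
  shows "(\<forall>z\<in>ball x \<rho>. z \<in> T \<longleftrightarrow> n \<bullet> z < c) \<or> (\<forall>z\<in>ball x \<rho>. z \<in> T \<longleftrightarrow> (- n) \<bullet> z < - c)"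
proof -
  have nn: "n \<bullet> n = 1" using n by (simp add: dot_square_norm)
  let ?M = "ball x \<rho> \<inter> {z. n \<bullet> z < c}" and ?P = "ball x \<rho> \<inter> {z. n \<bullet> z > c}"
  have side: "A \<subseteq> T \<or> A \<inter> T = {}" if "connected A" "A \<inter> frontier T = {}" for A
    using connected_Int_frontier[OF that(1), of T] that(2) by blast
  have "?M \<subseteq> T \<or> ?M \<inter> T = {}"
    by (rule side) (use fr in \<open>auto intro!: convex_connected convex_Int convex_ball convex_halfspace_lt\<close>)
  moreover have "?P \<subseteq> T \<or> ?P \<inter> T = {}"
    by (rule side) (use fr in \<open>auto intro!: convex_connected convex_Int convex_ball convex_halfspace_gt\<close>)
  moreover have near: "\<exists>z' s'. (0::real) < s' \<and> z' = z + s' *\<^sub>R m \<and> z' \<in> U" if "open U" "z \<in> U" for z m :: "real^'n" and U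
  proof -
    have "((\<lambda>s. z + s *\<^sub>R m) \<longlongrightarrow> z + 0 *\<^sub>R m) (at_right 0)" by (intro tendsto_intros)
    then have "\<forall>\<^sub>F s in at_right 0. z + s *\<^sub>R m \<in> U" using that by (auto dest: topological_tendstoD)
    then show ?thesis unfolding eventually_at_right_field using dense by (metis)
  qed
  have not_both: "\<not> (?M \<subseteq> T \<and> ?P \<subseteq> T)"
  proof
    assume MP: "?M \<subseteq> T \<and> ?P \<subseteq> T"
    have "ball x \<rho> \<subseteq> closure T"
    proof
      fix z assume z: "z \<in> ball x \<rho>"
      show "z \<in> closure T"
      proof (cases "n \<bullet> z = c")
        case True
        have "\<exists>y\<in>T. y \<in> U" if U: "open U" "z \<in> U" for U
        proof -
          obtain s' where s': "0 < s'" "z + s' *\<^sub>R n \<in> U \<inter> ball x \<rho>"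
            using near[of "U \<inter> ball x \<rho>" z n] U z by auto
          then have "z + s' *\<^sub>R n \<in> ?P" using True by (auto simp: inner_simps nn)
          then show ?thesis using MP s' by blast
        qed
        then show ?thesis by (auto simp: closure_iff_nhds_not_empty)
      next
        case False
        then show ?thesis using MP z closure_subset[of T] by (auto simp: neq_iff)
      qed
    qed
    then have "ball x \<rho> \<subseteq> T" using interior_maximal[of "ball x \<rho>" "closure T"] T(2) by auto
    then have "x \<in> T" using \<rho> by auto
    then show False using x T(1) by (simp add: frontier_def interior_open)
  qed
  have not_neither: "\<not> (?M \<inter> T = {} \<and> ?P \<inter> T = {})"
  proof
    assume MP: "?M \<inter> T = {} \<and> ?P \<inter> T = {}"
    have "x \<in> closure T" using x by (simp add: frontier_def)
    then obtain z where z: "z \<in> T" "z \<in> ball x \<rho>"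
      using \<rho> by (metis closure_approachable dist_commute mem_ball)
    then have "\<not> n \<bullet> z < c" "\<not> n \<bullet> z > c" using MP by blast+
    then have "n \<bullet> z = c" by simp
    obtain s' where s': "0 < s'" "z + s' *\<^sub>R n \<in> T \<inter> ball x \<rho>"
      using near[OF open_Int[OF T(1) open_ball, of x \<rho>], of z n] z by auto
    then have "z + s' *\<^sub>R n \<in> ?P" using \<open>n \<bullet> z = c\<close> by (auto simp: inner_simps nn)
    then show False using MP s' by blast
  qed
  \<comment> \<open>A point of the open set \<open>T\<close> on the hyperplane would have neighbours
    in \<open>T\<close> on both sides.\<close>
  have plane: "z \<notin> T" if a: "?M \<inter> T = {} \<or> ?P \<inter> T = {}" "z \<in> ball x \<rho>" "n \<bullet> z = c" for z
  proof
    assume z: "z \<in> T"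
    obtain s' where s': "0 < s'" "z + s' *\<^sub>R n \<in> T \<inter> ball x \<rho>"
      using near[OF open_Int[OF T(1) open_ball, of x \<rho>], of z n] z a(2) by auto
    obtain s'' where s'': "0 < s''" "z + s'' *\<^sub>R (- n) \<in> T \<inter> ball x \<rho>"
      using near[OF open_Int[OF T(1) open_ball, of x \<rho>], of z "- n"] z a(2) by auto
    have "z + s' *\<^sub>R n \<in> ?P" "z + s'' *\<^sub>R (- n) \<in> ?M" using s' s'' a(3) by (auto simp: inner_simps nn)
    then show False using a(1) s' s'' by blast
  qed
  ultimately consider "?M \<subseteq> T" "?P \<inter> T = {}" | "?P \<subseteq> T" "?M \<inter> T = {}"
    using not_both not_neither by blast
  then show ?thesis
  proof cases
    case 1
    have "\<forall>z\<in>ball x \<rho>. z \<in> T \<longleftrightarrow> n \<bullet> z < c"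
    proof
      fix z assume z: "z \<in> ball x \<rho>"
      show "z \<in> T \<longleftrightarrow> n \<bullet> z < c"
        using 1 plane[OF _ z] z by (cases "n \<bullet> z" c rule: linorder_cases) auto
    qed
    then show ?thesis by blast
  next
    case 2
    have "\<forall>z\<in>ball x \<rho>. z \<in> T \<longleftrightarrow> (- n) \<bullet> z < - c"
    proof
      fix z assume z: "z \<in> ball x \<rho>"
      show "z \<in> T \<longleftrightarrow> (- n) \<bullet> z < - c"
        using 2 plane[OF _ z] z by (cases "n \<bullet> z" c rule: linorder_cases) auto
    qed
    then show ?thesis by blast
  qed
qed

text \<open>The union of the pieces is closed, so it contains \<open>closure T\<close>, and taking
  interiors gives back \<open>T\<close>.\<close>

lemma convex_union_regular:
  assumes "convex_union T"
  shows "open T" "interior (closure T) = T"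
proof -
  obtain S where S: "finite S" "\<And>C. C \<in> S \<Longrightarrow> compact C" "T = interior (\<Union>S)"
    using assms by (auto simp: convex_union_def)
  show o: "open T" using S(3) by simp
  have "closed (\<Union>S)" using S by (intro closed_Union) (auto simp: compact_imp_closed)
  then have "closure T \<subseteq> \<Union>S" unfolding S(3) by (intro closure_minimal interior_subset)
  then have "interior (closure T) \<subseteq> T" unfolding S(3) by (rule interior_mono)
  then show "interior (closure T) = T"
    using interior_maximal[OF closure_subset o] by blast
qed

section \<open>A single cell and its faces\<close>

text \<open>What arguments about one cell use of \<open>polytopal_mesh\<close>. The family
  \<open>Fs\<close> is meant to be that of the whole mesh, so that one skeleton serves all
  cells.\<close>

definition mesh_cell :: "(real^'n) set set \<Rightarrow> (real^'n) set \<Rightarrow> bool" where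
  "mesh_cell Fs T \<longleftrightarrow> finite Fs \<and> disjoint Fs \<and> (\<forall>F\<in>Fs. face_like F \<and> closure F - F \<in> null_sets (surf F)) \<and>
     convex_union T \<and> frontier T = (\<Union>F\<in>faces_of Fs T. closure F) \<and>
     (\<forall>F\<in>faces_of Fs T. is_outward_normal T F (outward_normal T F))"

definition face_offset :: "(real^'n) set \<Rightarrow> (real^'n) set \<Rightarrow> real" where
  "face_offset T F = outward_normal T F \<bullet> (SOME x. x \<in> F)"

lemma outward_normal_props:
  assumes "face_like F" "is_outward_normal T F (outward_normal T F)"
  defines "n \<equiv> outward_normal T F" and "c \<equiv> face_offset T F"
  shows "norm n = 1" "F \<subseteq> {x. n \<bullet> x = c}" "hpl F = {x. n \<bullet> x = c}" "surf F = completion (hyp n c)"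
    "AE x in hyp n c. x \<in> F \<longrightarrow> (\<exists>\<epsilon>>0. \<forall>t. 0 < t \<and> t < \<epsilon> \<longrightarrow> x - t *\<^sub>R n \<in> T \<and> x + t *\<^sub>R n \<notin> T)"
proof -
  show n1: "norm n = 1" using assms(2) by (simp add: n_def is_outward_normal_def)
  have "(SOME x. x \<in> F) \<in> F" using assms(1) by (auto simp: face_like_def intro: someI)
  then have "n \<bullet> (x - (SOME x. x \<in> F)) = 0" if "x \<in> F" for x
    using assms(2) that unfolding n_def is_outward_normal_def by blast
  then show sub: "F \<subseteq> {x. n \<bullet> x = c}"
    by (auto simp: c_def face_offset_def n_def inner_diff_right)
  have "F \<noteq> {}" using assms(1) by (auto simp: face_like_def)
  have "openin (top_of_set {x. nrm F \<bullet> x = off F}) F"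
    using face_like_nrm(5)[OF assms(1)] by (simp add: hpl_def)
  from unit_normal_unique[OF n1 face_like_nrm(1)[OF assms(1)] this \<open>F \<noteq> {}\<close> sub]
  show "hpl F = {x. n \<bullet> x = c}" by (auto simp: hpl_def)
  show s: "surf F = completion (hyp n c)" by (rule surf_eq[OF assms(1) n1 sub])
  have "AE x in surf F. x \<in> F \<longrightarrow> (\<exists>\<epsilon>>0. \<forall>t. 0 < t \<and> t < \<epsilon> \<longrightarrow> x - t *\<^sub>R n \<in> T \<and> x + t *\<^sub>R n \<notin> T)"
    using assms(2) by (simp add: is_outward_normal_def n_def)
  then show "AE x in hyp n c. x \<in> F \<longrightarrow> (\<exists>\<epsilon>>0. \<forall>t. 0 < t \<and> t < \<epsilon> \<longrightarrow> x - t *\<^sub>R n \<in> T \<and> x + t *\<^sub>R n \<notin> T)"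
    unfolding s AE_completion_iff .
qed

definition face_integral ::
  "(real^'n) set \<Rightarrow> (real^'n) set \<Rightarrow> real^'n^'n \<Rightarrow> (real^'n \<Rightarrow> real^'n) \<Rightarrow> (real^'n \<Rightarrow> real) \<Rightarrow> real" where
  "face_integral T F A W \<phi> = (LINT x|hyp (outward_normal T F) (face_offset T F).
     indicator F x * flux_density A W (outward_normal T F) x * \<phi> x)"

lemma face_integral_eq_0:
  assumes "\<And>x. x \<in> F \<Longrightarrow> \<phi> x = 0"
  shows "face_integral T F A W \<phi> = 0"
proof -
  have "(\<lambda>x. indicator F x * flux_density A W (outward_normal T F) x * \<phi> x) = (\<lambda>x. 0)"
    using assms by (auto simp: fun_eq_iff indicator_def)
  then show ?thesis by (simp add: face_integral_def)
qed

lemma flux_density_integrable: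
  assumes m: "mesh_cell Fs T" and d: "div_field T A W g f" and F: "F \<in> faces_of Fs T"
  shows "integrable (hyp (outward_normal T F) (face_offset T F)) (\<lambda>x. indicator F x * flux_density A W (outward_normal T F) x)"
proof -
  let ?n = "outward_normal T F" and ?c = "face_offset T F"
  have "F \<in> Fs" using F by (simp add: faces_of_def)
  then have fl: "face_like F" and on: "is_outward_normal T F ?n"
    using m F unfolding mesh_cell_def by blast+
  note props = outward_normal_props[OF fl on]
  have "convex_union T" using m unfolding mesh_cell_def by blast
  then obtain SS where SS: "finite SS" "\<And>C. C \<in> SS \<Longrightarrow> convex C \<and> compact C" "T = interior (\<Union>SS)"
    by (auto simp: convex_union_def)
  have "integrable (hyp ?n ?c) (\<lambda>x. indicator F x * btrace ?n (\<lambda>z. W z $ j) x)" for j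
  proof (rule btrace_integrable[where g = "g j" and S = SS])
    show "open T" using SS(3) by simp
    show "AE x in hyp ?n ?c. x \<in> F \<longrightarrow> (\<exists>\<epsilon>>0. \<forall>t. 0 < t \<and> t < \<epsilon> \<longrightarrow> x - t *\<^sub>R ?n \<in> T)"
      using props(5) by eventually_elim blast
  qed (use d SS props face_like_borel[OF fl] in \<open>auto simp: div_field_def\<close>)
  then have "integrable (hyp ?n ?c) (\<lambda>x. \<Sum>j\<in>UNIV. (\<Sum>i\<in>UNIV. ?n $ i * A $ i $ j) * (indicator F x * btrace ?n (\<lambda>z. W z $ j) x))"
    by (intro Bochner_Integration.integrable_sum integrable_mult_right)
  then show ?thesis by (simp add: flux_density_sum sum_distrib_left mult_ac)
qed

lemma grad_add: "smooth f \<Longrightarrow> smooth g \<Longrightarrow> grad (\<lambda>x. f x + g x) x = grad f x + grad g x"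
  by (rule gradI) (auto intro!: has_derivative_add smooth_has_derivative simp: inner_add_right)

text \<open>\<open>L\<close> is the defect of the formula. It is additive in the test function, so
  by \<open>test_function_localize\<close> it is enough that it vanishes near each point: inside
  \<open>T\<close> by the divergence equation, outside because every term is zero, at a frontier
  point by \<open>half_ball\<close> and \<open>local_gauss_green\<close>.\<close>

lemma gauss_green_off_skeleton:
  fixes T :: "(real^'n) set"
  assumes m: "mesh_cell Fs T" and d: "div_field T A W g f" and \<phi>: "test_function (- skeleton Fs) \<phi>"
  shows "(LINT z|lborel. (A *v W z) \<bullet> grad \<phi> z) - (LINT z|lborel. f z * \<phi> z)
    = (\<Sum>F\<in>faces_of Fs T. face_integral T F A W \<phi>)"
proof -
  have fin: "finite Fs" and disj: "disjoint Fs" and fl: "\<And>F. F \<in> Fs \<Longrightarrow> face_like F"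
    and nul: "\<And>F. F \<in> Fs \<Longrightarrow> closure F - F \<in> null_sets (surf F)" and cu: "convex_union T"
    and fr: "frontier T = (\<Union>F\<in>faces_of Fs T. closure F)"
    and on: "\<And>F. F \<in> faces_of Fs T \<Longrightarrow> is_outward_normal T F (outward_normal T F)"
    using m by (auto simp: mesh_cell_def)
  have sub: "faces_of Fs T \<subseteq> Fs" by (auto simp: faces_of_def)
  have finT: "finite (faces_of Fs T)" using fin sub finite_subset by blast
  note T = convex_union_regular[OF cu]
  have W0: "\<And>z. z \<notin> T \<Longrightarrow> W z = 0" and f0: "\<And>z. z \<notin> T \<Longrightarrow> f z = 0"
    and dv: "\<And>\<phi>. test_function T \<phi> \<Longrightarrow> (LINT z|lborel. (A *v W z) \<bullet> grad \<phi> z) = (LINT z|lborel. f z * \<phi> z)"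
    using d by (auto simp: div_field_def)
  define L where "L \<phi> = (LINT z|lborel. (A *v W z) \<bullet> grad \<phi> z) - (LINT z|lborel. f z * \<phi> z)
    - (\<Sum>F\<in>faces_of Fs T. face_integral T F A W \<phi>)" for \<phi>
  have "L \<phi> = 0"
  proof (rule test_function_localize[OF _ _ \<phi>])
    fix \<phi> \<psi> :: "real^'n \<Rightarrow> real" assume tt: "test_function UNIV \<phi>" "test_function UNIV \<psi>"
    have sm: "smooth \<phi>" "smooth \<psi>" using tt by (auto dest: test_function_smooth)
    have v: "integrable lborel (\<lambda>z. (A *v W z) \<bullet> grad \<theta> z) \<and> integrable lborel (\<lambda>z. f z * \<theta> z) \<and>
       (\<forall>F\<in>faces_of Fs T. integrable (hyp (outward_normal T F) (face_offset T F))
         (\<lambda>x. indicator F x * flux_density A W (outward_normal T F) x * \<theta> x))" if t: "test_function UNIV \<theta>" for \<theta>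
    proof -
      obtain P where P: "P > 0" "\<And>x. \<bar>\<theta> x\<bar> \<le> P" using t by (rule test_function_bounded) blast
      obtain D where D: "D > 0" "\<And>x. norm (grad \<theta> x) \<le> D" using t by (rule test_function_grad_bounded) blast
      have s: "smooth \<theta>" using t by (rule test_function_smooth)
      have "integrable lborel (\<lambda>z. ((A *v W z) \<bullet> grad \<theta> z) * 1)"
        by (rule div_field_integrable(1)[OF d smooth_const _ s D(2), of _ 1]) simp
      moreover have "integrable lborel (\<lambda>z. f z * \<theta> z)" by (rule div_field_integrable(2)[OF d s P(2) s D(2)])
      moreover have "integrable (hyp (outward_normal T F) (face_offset T F))
         (\<lambda>x. indicator F x * flux_density A W (outward_normal T F) x * \<theta> x)" if "F \<in> faces_of Fs T" for F
        by (rule integrable_mult_bounded[OF flux_density_integrable[OF m d that]])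
          (use P borel_measurable_smooth[OF s] in auto)
      ultimately show ?thesis by simp
    qed
    have "face_integral T F A W (\<lambda>x. \<phi> x + \<psi> x) = face_integral T F A W \<phi> + face_integral T F A W \<psi>"
      if "F \<in> faces_of Fs T" for F
      unfolding face_integral_def using v[OF tt(1)] v[OF tt(2)] that by (simp add: distrib_left)
    then show "L (\<lambda>x. \<phi> x + \<psi> x) = L \<phi> + L \<psi>"
      unfolding L_def using v[OF tt(1)] v[OF tt(2)]
      by (simp add: grad_add[OF sm] inner_add_right distrib_left sum.distrib)
  next
    fix x assume "x \<in> - skeleton Fs"
    then have xs: "x \<notin> skeleton Fs" by simp
    consider "x \<in> T" | "x \<notin> closure T" | "x \<in> frontier T"
      using T(1) by (auto simp: frontier_def interior_open)
    then show "\<exists>V. open V \<and> x \<in> V \<and> (\<forall>\<psi>. test_function V \<psi> \<longrightarrow> L \<psi> = 0)"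
    proof cases
      case 1
      have "L \<psi> = 0" if t: "test_function T \<psi>" for \<psi>
      proof -
        have "face_integral T F A W \<psi> = 0" if F: "F \<in> faces_of Fs T" for F
        proof -
          have "F \<inter> T = {}" using F T(1) by (auto simp: faces_of_def frontier_def interior_open)
          then show ?thesis using test_function_grad_0(1)[OF t] by (intro face_integral_eq_0) blast
        qed
        then show ?thesis using dv[OF t] by (simp add: L_def)
      qed
      then show ?thesis using T(1) 1 by blast
    next
      case 2
      have "L \<psi> = 0" if t: "test_function (- closure T) \<psi>" for \<psi>
      proof -
        have p0: "\<psi> z = 0 \<and> grad \<psi> z = 0" if "z \<in> closure T" for z using test_function_grad_0[OF t, of z] that by auto
        have "face_integral T F A W \<psi> = 0" if F: "F \<in> faces_of Fs T" for F
        proof -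
          have "F \<subseteq> closure T" using F by (auto simp: faces_of_def frontier_def)
          then show ?thesis using p0 by (intro face_integral_eq_0) blast
        qed
        moreover have "(\<lambda>z. (A *v W z) \<bullet> grad \<psi> z) = (\<lambda>z. 0)" "(\<lambda>z. f z * \<psi> z) = (\<lambda>z. 0)"
        proof -
          have "(A *v W z) \<bullet> grad \<psi> z = 0 \<and> f z * \<psi> z = 0" for z
            using p0[of z] W0[of z] f0[of z] closure_subset[of T] by (cases "z \<in> T") auto
          then show "(\<lambda>z. (A *v W z) \<bullet> grad \<psi> z) = (\<lambda>z. 0)" "(\<lambda>z. f z * \<psi> z) = (\<lambda>z. 0)"
            by (auto simp: fun_eq_iff)
        qed
        ultimately show ?thesis by (simp add: L_def)
      qed
      then show ?thesis using 2 by (intro exI[of _ "- closure T"]) auto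
    next
      case 3
      then obtain F0 where F0: "F0 \<in> faces_of Fs T" "x \<in> closure F0" using fr by blast
      then have F0s: "F0 \<in> Fs" using sub by blast
      have xF0: "x \<in> hpl F0" using F0 face_like_nrm(4)[OF fl[OF F0s]] by blast
      obtain \<rho> where \<rho>: "\<rho> > 0" "\<And>F. F \<in> Fs \<Longrightarrow> ball x \<rho> \<inter> hpl F \<noteq> {} \<Longrightarrow> hpl F = hpl F0"
        by (rule ball_off_skeleton[OF fin fl xs F0s xF0]) blast+
      have frH: "z \<in> hpl F0 \<and> (\<exists>F\<in>faces_of Fs T. z \<in> closure F \<and> hpl F = hpl F0)"
        if z: "z \<in> frontier T" "z \<in> ball x \<rho>" for z
      proof -
        obtain F where F: "F \<in> faces_of Fs T" "z \<in> closure F" using z fr by blast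
        then have "z \<in> hpl F" using face_like_nrm(4)[OF fl] sub by blast
        then show ?thesis using \<rho>(2)[of F] F z(2) sub by blast
      qed
      have n0: "norm (nrm F0) = 1" "nrm F0 \<bullet> x = off F0"
        using face_like_nrm(1)[OF fl[OF F0s]] xF0 by (auto simp: hpl_def)
      have "(\<forall>z\<in>ball x \<rho>. z \<in> T \<longleftrightarrow> nrm F0 \<bullet> z < off F0) \<or> (\<forall>z\<in>ball x \<rho>. z \<in> T \<longleftrightarrow> (- nrm F0) \<bullet> z < - off F0)"
        by (rule half_ball[OF T 3 n0 \<rho>(1)]) (use frH in \<open>auto simp: hpl_def\<close>)
      then obtain n c where n: "norm n = 1" "hpl F0 = {x. n \<bullet> x = c}" and V: "\<And>z. z \<in> ball x \<rho> \<Longrightarrow> z \<in> T \<longleftrightarrow> n \<bullet> z < c"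
      proof
        assume "\<forall>z\<in>ball x \<rho>. z \<in> T \<longleftrightarrow> nrm F0 \<bullet> z < off F0"
        then show ?thesis using that[of "nrm F0" "off F0"] n0 by (auto simp: hpl_def)
      next
        assume "\<forall>z\<in>ball x \<rho>. z \<in> T \<longleftrightarrow> (- nrm F0) \<bullet> z < - off F0"
        then show ?thesis using that[of "- nrm F0" "- off F0"] n0 by (auto simp: hpl_def)
      qed
      have nn: "n \<bullet> n = 1" using n(1) by (simp add: dot_square_norm)
      \<comment> \<open>Faces that meet the ball share the normal \<open>n\<close>. For the opposite
        sign, \<open>y + t *\<^sub>R n\<close> would lie in \<open>T\<close> for almost every
        \<open>y\<close> in a relatively open piece of the face, against the description of
        \<open>T\<close> in the ball; and such a piece has positive measure.\<close>
      have normal: "outward_normal T F = n \<and> face_offset T F = c" if F: "F \<in> faces_of Fs T" "F \<inter> ball x \<rho> \<noteq> {}" for F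
      proof -
        have Fs: "F \<in> Fs" using F sub by blast
        note props = outward_normal_props[OF fl[OF Fs] on[OF F(1)]]
        have "hpl F = hpl F0" using \<rho>(2)[OF Fs] F(2) face_like_nrm(2)[OF fl[OF Fs]] by blast
        have oi: "openin (top_of_set {x. n \<bullet> x = c}) F" using face_like_nrm(5)[OF fl[OF Fs]] \<open>hpl F = hpl F0\<close> n(2) by simp
        have Fne: "F \<noteq> {}" using F(2) by blast
        have "outward_normal T F = n \<and> face_offset T F = c \<or> outward_normal T F = - n \<and> face_offset T F = - c"
          using unit_normal_unique[OF props(1) n(1) oi Fne] props(2) by blast
        moreover have "outward_normal T F \<noteq> - n"
        proof
          assume neg: "outward_normal T F = - n"
          have "- n \<noteq> n"
          proof
            assume "- n = n"
            then have "n \<bullet> n = - (n \<bullet> n)" by (metis inner_minus_left)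
            then show False using nn by simp
          qed
          then have "face_offset T F = - c"
            using neg \<open>outward_normal T F = n \<and> face_offset T F = c \<or> outward_normal T F = - n \<and> face_offset T F = - c\<close>
            by metis
          then have hy: "hyp (outward_normal T F) (face_offset T F) = hyp n c"
            using neg hyp_uminus[OF n(1)] by simp
          obtain U where U: "open U" "F = {x. n \<bullet> x = c} \<inter> U" using oi by (auto simp: openin_open)
          obtain y where y: "y \<in> F" "y \<in> ball x \<rho>" using F(2) by blast
          have "emeasure (hyp n c) ((U \<inter> ball x \<rho>) \<inter> {x. n \<bullet> x = c}) > 0"
            using U y by (intro emeasure_hyp_pos[OF n(1), of _ y]) auto
          moreover have "AE y in hyp n c. y \<notin> (U \<inter> ball x \<rho>) \<inter> {x. n \<bullet> x = c}"
            using props(5) unfolding hy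
          proof eventually_elim
            fix y assume *: "y \<in> F \<longrightarrow> (\<exists>\<epsilon>>0. \<forall>t. 0 < t \<and> t < \<epsilon> \<longrightarrow> y - t *\<^sub>R outward_normal T F \<in> T \<and> y + t *\<^sub>R outward_normal T F \<notin> T)"
            show "y \<notin> (U \<inter> ball x \<rho>) \<inter> {x. n \<bullet> x = c}"
            proof
              assume y: "y \<in> (U \<inter> ball x \<rho>) \<inter> {x. n \<bullet> x = c}"
              then have "y \<in> F" using U(2) by blast
              then obtain \<epsilon> where "\<epsilon> > 0" "\<forall>t. 0 < t \<and> t < \<epsilon> \<longrightarrow> y - t *\<^sub>R (- n) \<in> T"
                using * unfolding neg by blast
              then have e: "\<epsilon> > 0" "\<And>t. 0 < t \<Longrightarrow> t < \<epsilon> \<Longrightarrow> y + t *\<^sub>R n \<in> T" by auto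
              obtain e' where e': "e' > 0" "ball y e' \<subseteq> ball x \<rho>"
                using y open_ball[of x \<rho>] open_contains_ball by blast
              define t where "t = min \<epsilon> e' / 2"
              have t: "0 < t" "t < \<epsilon>" "t < e'" using e e' by (auto simp: t_def)
              have "y + t *\<^sub>R n \<in> ball y e'" using t n(1) by (simp add: dist_norm)
              then have "n \<bullet> (y + t *\<^sub>R n) < c" using V e(2)[OF t(1,2)] e' by blast
              then show False using y t by (simp add: inner_simps nn)
            qed
          qed
          moreover have "(U \<inter> ball x \<rho>) \<inter> {x. n \<bullet> x = c} \<in> sets (hyp n c)"
            using U(1) closed_hyperplane[of n c] by (auto intro!: sets.Int)
          ultimately show False
            by (subst (asm) AE_iff_null_sets[symmetric]) auto
        qed
        ultimately show ?thesis by blast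
      qed
      have "L \<psi> = 0" if t: "test_function (ball x \<rho>) \<psi>" for \<psi>
      proof -
        let ?I = "{F\<in>faces_of Fs T. F \<inter> ball x \<rho> \<noteq> {}}"
        have p0: "\<psi> z = 0" if "z \<notin> ball x \<rho>" for z using test_function_grad_0(1)[OF t that] .
        have s: "smooth \<psi>" using t by (rule test_function_smooth)
        obtain P where P: "P > 0" "\<And>x. \<bar>\<psi> x\<bar> \<le> P" using t by (rule test_function_bounded) blast
        have int: "integrable (hyp n c) (\<lambda>x. indicator F x * flux_density A W n x * \<psi> x)" if "F \<in> ?I" for F
        proof -
          have "F \<in> faces_of Fs T" "outward_normal T F = n" "face_offset T F = c" using that normal by auto
          then have "integrable (hyp n c) (\<lambda>x. indicator F x * flux_density A W n x)"
            using flux_density_integrable[OF m d, of F] by simp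
          then show ?thesis
            by (rule integrable_mult_bounded[where B = P]) (use P borel_measurable_smooth[OF s] in auto)
        qed
        have "(\<Sum>F\<in>faces_of Fs T. face_integral T F A W \<psi>) = (\<Sum>F\<in>?I. face_integral T F A W \<psi>)"
        proof (rule sum.mono_neutral_right[OF finT])
          show "\<forall>F\<in>faces_of Fs T - ?I. face_integral T F A W \<psi> = 0"
          proof
            fix F assume "F \<in> faces_of Fs T - ?I"
            then have "F \<inter> ball x \<rho> = {}" by blast
            then show "face_integral T F A W \<psi> = 0" using p0 by (intro face_integral_eq_0) blast
          qed
        qed auto
        also have "\<dots> = (\<Sum>F\<in>?I. LINT x|hyp n c. indicator F x * flux_density A W n x * \<psi> x)"
          by (intro sum.cong refl) (use normal in \<open>auto simp: face_integral_def\<close>)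
        also have "\<dots> = (LINT x|hyp n c. (\<Sum>F\<in>?I. indicator F x * flux_density A W n x * \<psi> x))"
          by (rule Bochner_Integration.integral_sum[symmetric]) (rule int)
        \<comment> \<open>On the hyperplane inside the ball the indicators of these faces add up to
          1 almost everywhere: the points there are frontier points of \<open>T\<close>, hence in
          the closure of a face, face boundaries are null, and faces are disjoint.\<close>
        also have "\<dots> = (LINT x|hyp n c. \<psi> x * flux_density A W n x)"
        proof (rule integral_cong_AE)
          have "(\<lambda>x. \<Sum>F\<in>?I. indicator F x * flux_density A W n x * \<psi> x) \<in> borel_measurable (hyp n c)"
            by (intro borel_measurable_sum borel_measurable_integrable int)
          then show "(\<lambda>x. \<Sum>F\<in>?I. indicator F x * flux_density A W n x * \<psi> x) \<in> borel_measurable (hyp n c)" .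
          show "(\<lambda>x. \<psi> x * flux_density A W n x) \<in> borel_measurable (hyp n c)"
            by (rule borel_measurable_integrable[OF local_gauss_green(1)[OF T(1) d n(1) cu open_ball V t]])
          have "AE x in hyp n c. \<forall>F\<in>?I. x \<notin> closure F - F"
          proof (rule AE_finite_allI)
            show "finite ?I" using finT by simp
            fix F assume F: "F \<in> ?I"
            then have Fs: "F \<in> Fs" "outward_normal T F = n" "face_offset T F = c" using sub normal by auto
            have "AE x in surf F. x \<notin> closure F - F" using nul[OF Fs(1)] by (rule AE_not_in)
            then show "AE x in hyp n c. x \<notin> closure F - F"
              using outward_normal_props(4)[OF fl[OF Fs(1)] on[of F]] F Fs by (metis (mono_tags, lifting) AE_completion_iff mem_Collect_eq)
          qed
          with AE_hyp_mem[OF n(1), of c]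
          show "AE z in hyp n c. (\<Sum>F\<in>?I. indicator F z * flux_density A W n z * \<psi> z) = \<psi> z * flux_density A W n z"
          proof eventually_elim
            fix z assume z: "n \<bullet> z = c" "\<forall>F\<in>?I. z \<notin> closure F - F"
            show "(\<Sum>F\<in>?I. indicator F z * flux_density A W n z * \<psi> z) = \<psi> z * flux_density A W n z"
            proof (cases "z \<in> ball x \<rho>")
              case True
              have "z \<notin> T" using V[OF True] z(1) by simp
              moreover have "z \<in> closure T"
              proof -
                have "z - e *\<^sub>R n \<in> T" if "0 < e" "ball z (2 * e) \<subseteq> ball x \<rho>" for e
                proof -
                  have "z - e *\<^sub>R n \<in> ball z (2 * e)" using that(1) n(1) by (simp add: dist_norm)
                  then have "z - e *\<^sub>R n \<in> ball x \<rho>" using that(2) by blast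
                  moreover have "n \<bullet> (z - e *\<^sub>R n) < c" using that(1) z(1) by (simp add: inner_simps nn)
                  ultimately show ?thesis using V by blast
                qed
                moreover obtain r where r: "r > 0" "ball z r \<subseteq> ball x \<rho>" using True open_ball[of x \<rho>] open_contains_ball by blast
                ultimately show ?thesis
                  unfolding closure_approachable
                proof (intro allI impI)
                  fix e :: real assume *: "0 < e" and st: "\<And>e. 0 < e \<Longrightarrow> ball z (2 * e) \<subseteq> ball x \<rho> \<Longrightarrow> z - e *\<^sub>R n \<in> T"
                  have "z - (min (e / 2) (r / 2)) *\<^sub>R n \<in> T"
                    using * r by (intro st) (auto intro: order_trans[OF subset_ball])
                  moreover have "dist (z - (min (e / 2) (r / 2)) *\<^sub>R n) z < e"
                    using * r(1) n(1) by (simp add: dist_norm)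
                  ultimately show "\<exists>y\<in>T. dist y z < e" by blast
                qed
              qed
              ultimately have "z \<in> frontier T" using T(1) by (simp add: frontier_def interior_open)
              then obtain F where F: "F \<in> faces_of Fs T" "z \<in> closure F" "hpl F = hpl F0" using frH True by blast
              have "F \<inter> ball x \<rho> \<noteq> {}"
                using F(2) True open_Int_closure_eq_empty[OF open_ball, of x \<rho> F] by blast
              then have FI: "F \<in> ?I" using F(1) by blast
              then have zF: "z \<in> F" using z(2) F(2) by blast
              have "indicator G z * flux_density A W n z * \<psi> z = 0" if "G \<in> ?I - {F}" for G
              proof -
                have "G \<in> Fs" "F \<in> Fs" "G \<noteq> F" using that F(1) sub by auto
                then have "z \<notin> G" using disj zF by (auto simp: disjoint_def)
                then show ?thesis by simp
              qed
              then have "(\<Sum>G\<in>?I - {F}. indicator G z * flux_density A W n z * \<psi> z) = 0"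
                by (intro sum.neutral ballI)
              moreover have "finite ?I" using finT by simp
              ultimately have "(\<Sum>F\<in>?I. indicator F z * flux_density A W n z * \<psi> z) = indicator F z * flux_density A W n z * \<psi> z"
                by (subst sum.remove[OF _ FI]) simp_all
              then show ?thesis using zF by simp
            qed (simp add: p0)
          qed
        qed
        also have "\<dots> = (LINT z|lborel. (A *v W z) \<bullet> grad \<psi> z) - (LINT z|lborel. f z * \<psi> z)"
          by (rule local_gauss_green(2)[OF T(1) d n(1) cu open_ball V t, symmetric])
        finally show ?thesis by (simp add: L_def)
      qed
      then show ?thesis using \<rho>(1) by (intro exI[of _ "ball x \<rho>"]) auto
    qed
  qed
  then show ?thesis by (simp add: L_def)
qed

section \<open>Cutting off the skeleton\<close>

text \<open>Fubini in direction \<open>n\<close>: the fibres have length at most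
  \<open>2 * a\<close> and stand over \<open>E\<close>.\<close>

lemma emeasure_slab_le:
  fixes n :: "real^'n"
  assumes n: "norm n = 1" and a: "a \<ge> 0" and D: "D \<in> sets borel" and E: "E \<in> sets borel"
    and sub: "\<And>z. z \<in> D \<Longrightarrow> \<bar>n \<bullet> z - c\<bar> \<le> a"
    and prj: "\<And>x t. n \<bullet> x = c \<Longrightarrow> \<bar>t\<bar> \<le> a \<Longrightarrow> x + t *\<^sub>R n \<in> D \<Longrightarrow> x \<in> E"
  shows "emeasure lborel D \<le> ennreal (2 * a) * emeasure (hyp n c) E"
proof -
  have nn: "n \<bullet> n = 1" using n by (simp add: dot_square_norm)
  note [measurable] = D E
  have "emeasure lborel D = (\<integral>\<^sup>+ z. indicator D z \<partial>lborel)" by simp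
  also have "\<dots> = (\<integral>\<^sup>+ x. \<integral>\<^sup>+ t. indicator D (x + t *\<^sub>R n) \<partial>lborel \<partial>hyp n c)"
    by (rule nn_integral_lborel_eq_hyp[OF n, symmetric]) measurable
  also have "\<dots> \<le> (\<integral>\<^sup>+ x. ennreal (2 * a) * indicator E x \<partial>hyp n c)"
  proof (rule nn_integral_mono_AE)
    show "AE x in hyp n c. (\<integral>\<^sup>+ t. indicator D (x + t *\<^sub>R n) \<partial>lborel) \<le> ennreal (2 * a) * indicator E x"
      using AE_hyp_mem[OF n, of c]
    proof eventually_elim
      fix x assume x: "n \<bullet> x = c"
      have "indicator D (x + t *\<^sub>R n) \<le> (indicator {-a..a} t * indicator E x :: ennreal)" for t
      proof (cases "x + t *\<^sub>R n \<in> D")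
        case True
        then have "\<bar>t\<bar> \<le> a" using sub[OF True] x by (simp add: inner_simps nn)
        then show ?thesis using prj[OF x _ True] by (auto simp: indicator_def)
      qed simp
      then have "(\<integral>\<^sup>+ t. indicator D (x + t *\<^sub>R n) \<partial>lborel) \<le> (\<integral>\<^sup>+ t. indicator {-a..a} t * indicator E x \<partial>lborel)"
        by (intro nn_integral_mono) auto
      also have "\<dots> = ennreal (2 * a) * indicator E x"
        using a by (subst nn_integral_multc) auto
      finally show "(\<integral>\<^sup>+ t. indicator D (x + t *\<^sub>R n) \<partial>lborel) \<le> ennreal (2 * a) * indicator E x" .
    qed
  qed
  also have "\<dots> = ennreal (2 * a) * emeasure (hyp n c) E"
    by (subst nn_integral_cmult) auto
  finally show ?thesis .
qed

definition two_slabs :: "real^'n \<Rightarrow> real \<Rightarrow> real^'n \<Rightarrow> real \<Rightarrow> real \<Rightarrow> (real^'n) set" where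
  "two_slabs n c m d a = {z. \<bar>n \<bullet> z - c\<bar> \<le> a \<and> \<bar>m \<bullet> z - d\<bar> \<le> a}"

lemma closed_slab: "closed {z :: real^'n. \<bar>n \<bullet> z - c\<bar> \<le> a}"
  by (intro closed_Collect_le continuous_intros)

lemma closed_two_slabs: "closed (two_slabs n c m d a)"
  unfolding two_slabs_def by (intro closed_Collect_conj closed_slab)

lemma emeasure_slab_ball:
  fixes w :: "real^'n"
  assumes "w \<noteq> 0"
  obtains M where "M < \<infinity>" "\<And>a. 0 \<le> a \<Longrightarrow> a \<le> 1 \<Longrightarrow> emeasure lborel ({y. \<bar>w \<bullet> y - e\<bar> \<le> a} \<inter> cball 0 R) \<le> ennreal a * M"
proof -
  let ?w = "w /\<^sub>R norm w" and ?e = "e / norm w"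
  have n: "norm ?w = 1" using assms by simp
  \<comment> \<open>For \<open>a \<le> 1\<close> the foot of a point of the slab is at distance at
    most \<open>1 / norm w\<close> from it.\<close>
  let ?E = "cball (0 :: real^'n) (R + 1 / norm w)"
  let ?M = "ennreal (2 / norm w) * emeasure (hyp ?w ?e) ?E"
  show ?thesis
  proof (rule that[of ?M])
    show "?M < \<infinity>" using emeasure_hyp_bounded[OF n, of ?E ?e] by (auto simp: ennreal_mult_less_top)
    fix a :: real assume a: "0 \<le> a" "a \<le> 1"
    have "emeasure lborel ({y. \<bar>w \<bullet> y - e\<bar> \<le> a} \<inter> cball 0 R) \<le> ennreal (2 * (a / norm w)) * emeasure (hyp ?w ?e) ?E"
    proof (rule emeasure_slab_le[OF n])
      show "{y. \<bar>w \<bullet> y - e\<bar> \<le> a} \<inter> cball 0 R \<in> sets borel" using closed_slab[of w e a] by auto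
      show "\<bar>?w \<bullet> z - ?e\<bar> \<le> a / norm w" if "z \<in> {y. \<bar>w \<bullet> y - e\<bar> \<le> a} \<inter> cball 0 R" for z
      proof -
        have "?w \<bullet> z - ?e = (w \<bullet> z - e) / norm w" by (simp add: field_simps diff_divide_distrib)
        then show ?thesis using that assms by (simp add: divide_right_mono)
      qed
      fix x t assume t: "\<bar>t\<bar> \<le> a / norm w" and z: "x + t *\<^sub>R ?w \<in> {y. \<bar>w \<bullet> y - e\<bar> \<le> a} \<inter> cball 0 R"
      have "norm x \<le> norm (x + t *\<^sub>R ?w) + norm (t *\<^sub>R ?w)"
        by (metis add_diff_cancel norm_triangle_ineq4)
      also have "\<dots> \<le> R + 1 / norm w"
      proof (rule add_mono)
        show "norm (x + t *\<^sub>R ?w) \<le> R" using z by simp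
        have "norm (t *\<^sub>R ?w) = \<bar>t\<bar>" unfolding norm_scaleR[of t] n by simp
        also have "\<dots> \<le> 1 / norm w" using t a assms by (meson divide_right_mono norm_ge_zero order_trans)
        finally show "norm (t *\<^sub>R ?w) \<le> 1 / norm w" .
      qed
      finally show "x \<in> ?E" by simp
    qed (use a in auto)
    also have "\<dots> = ennreal a * ?M"
      using a by (simp add: ennreal_mult[symmetric] mult.assoc[symmetric] mult.commute[of a])
    finally show "emeasure lborel ({y. \<bar>w \<bullet> y - e\<bar> \<le> a} \<inter> cball 0 R) \<le> ennreal a * ?M" .
  qed
qed

text \<open>Two distinct hyperplanes meet in codimension two, so the volume is quadratic in the width.\<close>

lemma emeasure_two_slabs:
  fixes n m :: "real^'n"
  assumes n: "norm n = 1" and m: "norm m = 1" and ne: "{x. n \<bullet> x = c} \<noteq> {x. m \<bullet> x = d}"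
  obtains M a0 where "M \<ge> 0" "a0 > 0"
    "\<And>a. 0 \<le> a \<Longrightarrow> a \<le> a0 \<Longrightarrow> emeasure lborel (two_slabs n c m d a \<inter> cball 0 R) \<le> ennreal (M * a\<^sup>2)"
proof -
  \<comment> \<open>The part of \<open>m\<close> orthogonal to \<open>n\<close>. For the projection
    \<open>x\<close> of \<open>y\<close> to the first hyperplane, \<open>m \<bullet> x - d\<close>
    equals \<open>?w \<bullet> y - ?e\<close>.\<close>
  let ?w = "m - (m \<bullet> n) *\<^sub>R n" and ?e = "d - c * (m \<bullet> n)"
  \<comment> \<open>Moving to the foot changes \<open>m \<bullet> x\<close> by at most
    \<open>a\<close> and the norm by at most 1, hence the doubled width and the larger ball.\<close>
  let ?E = "\<lambda>a. {x. \<bar>m \<bullet> x - d\<bar> \<le> 2 * a} \<inter> cball 0 (R + 1)"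
  have Eb: "?E a \<in> sets borel" for a using closed_slab[of m d "2 * a"] by auto
  have 1: "emeasure lborel (two_slabs n c m d a \<inter> cball 0 R) \<le> ennreal (2 * a) * emeasure (hyp n c) (?E a)"
    if a: "0 \<le> a" "a \<le> 1" for a
  proof (rule emeasure_slab_le[OF n a(1) _ Eb])
    show "two_slabs n c m d a \<inter> cball 0 R \<in> sets borel" using closed_two_slabs[of n c m d a] by auto
    show "\<bar>n \<bullet> z - c\<bar> \<le> a" if "z \<in> two_slabs n c m d a \<inter> cball 0 R" for z using that by (simp add: two_slabs_def)
    fix x t assume t: "\<bar>t\<bar> \<le> a" and z: "x + t *\<^sub>R n \<in> two_slabs n c m d a \<inter> cball 0 R"
    have "norm x \<le> norm (x + t *\<^sub>R n) + norm (t *\<^sub>R n)"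
      by (metis add_diff_cancel norm_triangle_ineq4)
    also have "\<dots> \<le> R + 1" using z t a n by simp
    finally have "x \<in> cball 0 (R + 1)" by simp
    moreover have "\<bar>m \<bullet> x - d\<bar> \<le> 2 * a"
    proof -
      have "\<bar>t * (m \<bullet> n)\<bar> \<le> a"
        using Cauchy_Schwarz_ineq2[of m n] n m t by (simp add: abs_mult mult_le_one) (smt (verit) mult_left_le abs_ge_zero)
      moreover have "\<bar>m \<bullet> x + t * (m \<bullet> n) - d\<bar> \<le> a" using z by (simp add: two_slabs_def inner_simps)
      ultimately show ?thesis by linarith
    qed
    ultimately show "x \<in> ?E a" by simp
  qed
  have 2: "emeasure (hyp n c) (?E a) \<le> emeasure lborel ({y. \<bar>?w \<bullet> y - ?e\<bar> \<le> 2 * a} \<inter> cball 0 (R + 2))" for a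
    unfolding emeasure_hyp[OF Eb]
  proof (rule emeasure_mono)
    show "{y. c \<le> n \<bullet> y \<and> n \<bullet> y \<le> c + 1 \<and> y - (n \<bullet> y - c) *\<^sub>R n \<in> ?E a} \<subseteq> {y. \<bar>?w \<bullet> y - ?e\<bar> \<le> 2 * a} \<inter> cball 0 (R + 2)"
    proof
      fix y assume "y \<in> {y. c \<le> n \<bullet> y \<and> n \<bullet> y \<le> c + 1 \<and> y - (n \<bullet> y - c) *\<^sub>R n \<in> ?E a}"
      then have y: "c \<le> n \<bullet> y" "n \<bullet> y \<le> c + 1" "\<bar>m \<bullet> (y - (n \<bullet> y - c) *\<^sub>R n) - d\<bar> \<le> 2 * a" "norm (y - (n \<bullet> y - c) *\<^sub>R n) \<le> R + 1"
        by auto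
      have "m \<bullet> (y - (n \<bullet> y - c) *\<^sub>R n) - d = ?w \<bullet> y - ?e" by (simp add: inner_simps algebra_simps)
      moreover have "norm y \<le> norm (y - (n \<bullet> y - c) *\<^sub>R n) + norm ((n \<bullet> y - c) *\<^sub>R n)"
        by (metis diff_add_cancel norm_triangle_ineq)
      then have "norm y \<le> R + 2" using y n by simp
      ultimately show "y \<in> {y. \<bar>?w \<bullet> y - ?e\<bar> \<le> 2 * a} \<inter> cball 0 (R + 2)" using y(3) by simp
    qed
    show "{y. \<bar>?w \<bullet> y - ?e\<bar> \<le> 2 * a} \<inter> cball 0 (R + 2) \<in> sets lborel"
      unfolding sets_lborel by (intro borel_closed closed_Int closed_slab closed_cball)
  qed
  show ?thesis
  proof (cases "?w = 0")
    case False
    obtain M where M: "M < \<infinity>" "\<And>a. 0 \<le> a \<Longrightarrow> a \<le> 1 \<Longrightarrow> emeasure lborel ({y. \<bar>?w \<bullet> y - ?e\<bar> \<le> a} \<inter> cball 0 (R + 2)) \<le> ennreal a * M"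
      by (rule emeasure_slab_ball[OF False, of ?e "R + 2"]) blast
    then obtain M' where M': "M = ennreal M'" "M' \<ge> 0" by (cases M) auto
    show ?thesis
    proof (rule that[of "4 * M'" "1 / 2"])
      fix a :: real assume a: "0 \<le> a" "a \<le> 1 / 2"
      have "emeasure lborel (two_slabs n c m d a \<inter> cball 0 R) \<le> ennreal (2 * a) * emeasure (hyp n c) (?E a)"
        using 1[of a] a by simp
      also have "emeasure (hyp n c) (?E a) \<le> ennreal (2 * a) * M"
        using order_trans[OF 2[of a] M(2)[of "2 * a"]] a by simp
      finally have "emeasure lborel (two_slabs n c m d a \<inter> cball 0 R) \<le> ennreal (2 * a) * (ennreal (2 * a) * M)"
        by (simp add: mult_left_mono)
      also have "\<dots> = ennreal (4 * M' * a\<^sup>2)"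
        using a M' by (simp add: ennreal_mult[symmetric] power2_eq_square mult_ac)
      finally show "emeasure lborel (two_slabs n c m d a \<inter> cball 0 R) \<le> ennreal (4 * M' * a\<^sup>2)" .
    qed (use M' in auto)
  next
    case True
    have "?e \<noteq> 0"
    proof
      assume e: "?e = 0"
      have mn: "m = (m \<bullet> n) *\<^sub>R n" using True by simp
      then have "\<bar>m \<bullet> n\<bar> = 1" using n m by (metis mult.right_neutral norm_scaleR)
      then have "m \<bullet> x = d \<longleftrightarrow> n \<bullet> x = c" for x
        using e by (subst mn) auto
      then show False using ne by auto
    qed
    \<comment> \<open>The hyperplanes are parallel; for \<open>a\<close> up to this bound the two
      slabs are disjoint.\<close>
    show ?thesis
    proof (rule that[of 0 "min 1 (\<bar>?e\<bar> / 4)"])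
      fix a :: real assume a: "0 \<le> a" "a \<le> min 1 (\<bar>?e\<bar> / 4)"
      have "{y. \<bar>?w \<bullet> y - ?e\<bar> \<le> 2 * a} = {}" unfolding True using a \<open>?e \<noteq> 0\<close> by auto
      then have "emeasure (hyp n c) (?E a) = 0" using 2[of a] by simp
      then show "emeasure lborel (two_slabs n c m d a \<inter> cball 0 R) \<le> ennreal (0 * a\<^sup>2)"
        using 1[of a] a by simp
    qed (use \<open>?e \<noteq> 0\<close> in auto)
  qed
qed

section \<open>Cut-off functions and the vanishing of their contribution\<close>

text \<open>For a unit vector \<open>n\<close>, equal to 1 within distance
  \<open>1 / real (Suc k)\<close> of the hyperplane and to 0 beyond
  \<open>2 / real (Suc k)\<close>.\<close>

definition plane_bump :: "nat \<Rightarrow> real^'n \<Rightarrow> real \<Rightarrow> real^'n \<Rightarrow> real" where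
  "plane_bump k n c z = step (2 - real (Suc k) * (n \<bullet> z - c)) * step (2 + real (Suc k) * (n \<bullet> z - c))"

lemma plane_bump_factors:
  "(\<lambda>z. step (2 - real (Suc k) * (n \<bullet> z - c))) = (\<lambda>z. step ((- real (Suc k) *\<^sub>R n) \<bullet> z + (2 + real (Suc k) * c)))"
  "(\<lambda>z. step (2 + real (Suc k) * (n \<bullet> z - c))) = (\<lambda>z. step ((real (Suc k) *\<^sub>R n) \<bullet> z + (2 - real (Suc k) * c)))"
  by (auto simp: fun_eq_iff algebra_simps)

lemma smooth_plane_bump_factors:
  "smooth (\<lambda>z. step (2 - real (Suc k) * (n \<bullet> z - c)))" "smooth (\<lambda>z. step (2 + real (Suc k) * (n \<bullet> z - c)))"
  unfolding plane_bump_factors by (rule smooth_step)+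

lemma smooth_plane_bump: "smooth (plane_bump k n c)"
  unfolding plane_bump_def[abs_def] by (intro smooth_mult smooth_plane_bump_factors)

lemma grad_plane_bump_le:
  assumes B: "\<And>t. \<bar>step' t\<bar> \<le> B" and n: "norm n = 1"
  shows "norm (grad (plane_bump k n c) z) \<le> 2 * B * real (Suc k)"
proof -
  note sm = smooth_plane_bump_factors
  have g: "norm (grad (\<lambda>z. step (2 - real (Suc k) * (n \<bullet> z - c))) z) \<le> B * real (Suc k)"
    "norm (grad (\<lambda>z. step (2 + real (Suc k) * (n \<bullet> z - c))) z) \<le> B * real (Suc k)"
    unfolding plane_bump_factors grad_step using n B
    by (auto simp: abs_mult intro!: mult_right_mono simp del: of_nat_Suc)
  have "grad (plane_bump k n c) z = step (2 + real (Suc k) * (n \<bullet> z - c)) *\<^sub>R grad (\<lambda>z. step (2 - real (Suc k) * (n \<bullet> z - c))) z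
      + step (2 - real (Suc k) * (n \<bullet> z - c)) *\<^sub>R grad (\<lambda>z. step (2 + real (Suc k) * (n \<bullet> z - c))) z"
    unfolding plane_bump_def[abs_def] by (rule grad_mult[OF sm])
  also have "norm \<dots> \<le> 1 * (B * real (Suc k)) + 1 * (B * real (Suc k))"
  proof (rule order_trans[OF norm_triangle_ineq add_mono])
    show "norm (step (2 + real (Suc k) * (n \<bullet> z - c)) *\<^sub>R grad (\<lambda>z. step (2 - real (Suc k) * (n \<bullet> z - c))) z) \<le> 1 * (B * real (Suc k))"
      unfolding norm_scaleR by (rule mult_mono[OF _ g(1)]) (simp_all add: step_nonneg step_le_1 del: of_nat_Suc)
    show "norm (step (2 - real (Suc k) * (n \<bullet> z - c)) *\<^sub>R grad (\<lambda>z. step (2 + real (Suc k) * (n \<bullet> z - c))) z) \<le> 1 * (B * real (Suc k))"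
      unfolding norm_scaleR by (rule mult_mono[OF _ g(2)]) (simp_all add: step_nonneg step_le_1 del: of_nat_Suc)
  qed
  finally show ?thesis by (simp add: mult_ac)
qed

lemma plane_bump_range: "0 \<le> plane_bump k n c z" "plane_bump k n c z \<le> 1"
  by (auto simp: plane_bump_def step_nonneg step_le_1 mult_le_one)

lemma plane_bump_1: "\<bar>n \<bullet> z - c\<bar> \<le> 1 / real (Suc k) \<Longrightarrow> plane_bump k n c z = 1"
proof -
  assume "\<bar>n \<bullet> z - c\<bar> \<le> 1 / real (Suc k)"
  then have "real (Suc k) * \<bar>n \<bullet> z - c\<bar> \<le> 1" by (simp add: field_simps del: of_nat_Suc)
  then have "\<bar>real (Suc k) * (n \<bullet> z - c)\<bar> \<le> 1" by (simp add: abs_mult)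
  then show ?thesis by (simp add: plane_bump_def abs_le_iff del: of_nat_Suc)
qed

lemma plane_bump_0: "\<bar>n \<bullet> z - c\<bar> \<ge> 2 / real (Suc k) \<Longrightarrow> plane_bump k n c z = 0"
proof -
  assume "\<bar>n \<bullet> z - c\<bar> \<ge> 2 / real (Suc k)"
  then have "2 \<le> real (Suc k) * \<bar>n \<bullet> z - c\<bar>" by (simp add: field_simps del: of_nat_Suc)
  then have "2 \<le> \<bar>real (Suc k) * (n \<bullet> z - c)\<bar>" by (simp add: abs_mult)
  then have "2 - real (Suc k) * (n \<bullet> z - c) \<le> 0 \<or> 2 + real (Suc k) * (n \<bullet> z - c) \<le> 0" by linarith
  then show ?thesis by (auto simp: plane_bump_def simp del: of_nat_Suc)
qed

text \<open>The product of the bumps is subtracted, not each bump: the function differs from 1 only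
  where both hyperplanes are near, which confines its gradient to the intersection of two
  slabs.\<close>

definition pair_cut :: "nat \<Rightarrow> real^'n \<Rightarrow> real \<Rightarrow> real^'n \<Rightarrow> real \<Rightarrow> real^'n \<Rightarrow> real" where
  "pair_cut k n c m d z = 1 - plane_bump k n c z * plane_bump k m d z"

lemma smooth_pair_cut: "smooth (pair_cut k n c m d)"
  unfolding pair_cut_def[abs_def] by (intro smooth_diff smooth_const smooth_mult smooth_plane_bump)

lemma pair_cut_range: "0 \<le> pair_cut k n c m d z" "pair_cut k n c m d z \<le> 1"
  using plane_bump_range[of k n c z] plane_bump_range[of k m d z]
  by (auto simp: pair_cut_def mult_le_one)

text \<open>Two bumps with two steps each give the factor 4; off the two slabs the function is
  constantly 1.\<close>

lemma grad_pair_cut_le: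
  assumes B: "\<And>t. \<bar>step' t\<bar> \<le> B" and n: "norm n = 1" "norm m = 1"
  shows "norm (grad (pair_cut k n c m d) z) \<le> 4 * B * (real (Suc k) * indicator (two_slabs n c m d (2 / real (Suc k))) z)"
proof (cases "z \<in> two_slabs n c m d (2 / real (Suc k))")
  case True
  have "((\<lambda>z. 1 - plane_bump k n c z * plane_bump k m d z) has_derivative
      (\<lambda>v. v \<bullet> (- (plane_bump k m d z *\<^sub>R grad (plane_bump k n c) z + plane_bump k n c z *\<^sub>R grad (plane_bump k m d) z)))) (at z)"
    by (rule derivative_eq_intros smooth_has_derivative[OF smooth_plane_bump] refl ext | simp add: inner_add_right inner_minus_right algebra_simps)+
  then have "grad (pair_cut k n c m d) z = - (plane_bump k m d z *\<^sub>R grad (plane_bump k n c) z + plane_bump k n c z *\<^sub>R grad (plane_bump k m d) z)"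
    unfolding pair_cut_def[abs_def] by (rule gradI)
  also have "norm \<dots> \<le> 1 * (2 * B * real (Suc k)) + 1 * (2 * B * real (Suc k))"
    unfolding norm_minus_cancel
  proof (rule order_trans[OF norm_triangle_ineq add_mono])
    show "norm (plane_bump k m d z *\<^sub>R grad (plane_bump k n c) z) \<le> 1 * (2 * B * real (Suc k))"
      "norm (plane_bump k n c z *\<^sub>R grad (plane_bump k m d) z) \<le> 1 * (2 * B * real (Suc k))"
      unfolding norm_scaleR using plane_bump_range[of k n c z] plane_bump_range[of k m d z]
      by (intro mult_mono[OF _ grad_plane_bump_le[OF B]]; simp add: n)+
  qed
  finally show ?thesis using True by (simp add: mult_ac)
next
  case False
  have "((\<lambda>z. 1) has_derivative (\<lambda>v. v \<bullet> 0)) (at z)" by simp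
  then have "(pair_cut k n c m d has_derivative (\<lambda>v. v \<bullet> 0)) (at z)"
  proof (rule has_derivative_transform_within_open)
    show "open (- two_slabs n c m d (2 / real (Suc k)))" by (intro open_Compl closed_two_slabs)
    show "1 = pair_cut k n c m d y" if "y \<in> - two_slabs n c m d (2 / real (Suc k))" for y
    proof -
      have "\<bar>n \<bullet> y - c\<bar> \<ge> 2 / real (Suc k) \<or> \<bar>m \<bullet> y - d\<bar> \<ge> 2 / real (Suc k)"
        using that by (auto simp: two_slabs_def)
      then show ?thesis using plane_bump_0[of k n y c] plane_bump_0[of k m y d] by (auto simp: pair_cut_def)
    qed
  qed (use False in auto)
  then have "grad (pair_cut k n c m d) z = 0" by (rule gradI)
  then show ?thesis using False by simp
qed

lemma grad_prod_le:
  fixes p :: "'i \<Rightarrow> real^'n \<Rightarrow> real"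
  assumes "finite I" "\<And>i. i \<in> I \<Longrightarrow> smooth (p i)" "\<And>i z. i \<in> I \<Longrightarrow> 0 \<le> p i z \<and> p i z \<le> 1"
  shows "norm (grad (\<lambda>z. \<Prod>i\<in>I. p i z) z) \<le> (\<Sum>i\<in>I. norm (grad (p i) z))"
  using assms
proof (induction I rule: finite_induct)
  case empty
  have "grad (\<lambda>z. 1) z = (0 :: real^'n)" by (rule gradI) simp
  then show ?case by simp
next
  case (insert i I)
  have s: "smooth (p i)" "smooth (\<lambda>z. \<Prod>i\<in>I. p i z)" using insert.prems by (auto intro: smooth_prod)
  have "grad (\<lambda>z. \<Prod>i\<in>insert i I. p i z) z = (\<Prod>i\<in>I. p i z) *\<^sub>R grad (p i) z + p i z *\<^sub>R grad (\<lambda>z. \<Prod>i\<in>I. p i z) z"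
    using insert.hyps grad_mult[OF s] by simp
  also have "norm \<dots> \<le> 1 * norm (grad (p i) z) + 1 * norm (grad (\<lambda>z. \<Prod>i\<in>I. p i z) z)"
  proof (rule order_trans[OF norm_triangle_ineq add_mono])
    have "0 \<le> (\<Prod>i\<in>I. p i z)" "(\<Prod>i\<in>I. p i z) \<le> 1" using insert.prems by (auto intro: prod_nonneg prod_le_1)
    then show "norm ((\<Prod>i\<in>I. p i z) *\<^sub>R grad (p i) z) \<le> 1 * norm (grad (p i) z)"
      by (simp add: mult_left_le_one_le)
    show "norm (p i z *\<^sub>R grad (\<lambda>z. \<Prod>i\<in>I. p i z) z) \<le> 1 * norm (grad (\<lambda>z. \<Prod>i\<in>I. p i z) z)"
      using insert.prems(2)[of i z] by (simp add: mult_left_le_one_le)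
  qed
  also have "\<dots> \<le> norm (grad (p i) z) + (\<Sum>i\<in>I. norm (grad (p i) z))"
    using insert by simp
  finally show ?case using insert.hyps by simp
qed

lemma bump_on_ball:
  obtains \<omega> :: "real^'n \<Rightarrow> real" where "test_function UNIV \<omega>" "\<And>z. z \<in> ball 0 R \<Longrightarrow> \<omega> z = 1"
    "\<And>z. z \<in> ball 0 R \<Longrightarrow> grad \<omega> z = 0"
proof -
  \<comment> \<open>The margin 2 is the distance from the sides at which a bump with
    \<open>k = 1\<close> reaches the value 1.\<close>
  let ?a = "(\<chi> i. - (R + 2)) :: real^'n" and ?b = "(\<chi> i. R + 2) :: real^'n"
  have 1: "box_bump 1 ?a ?b z = 1" if "z \<in> ball 0 R" for z
  proof -
    have "\<bar>z $ i\<bar> \<le> R" for i using component_le_norm_cart[of z i] that by simp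
    then have R: "- R \<le> z $ i \<and> z $ i \<le> R" for i by (metis abs_le_iff minus_le_iff)
    have "step (real 1 * (z $ i - ?a $ i) - 1) * step (real 1 * (?b $ i - z $ i) - 1) = 1" for i
    proof -
      have "step (real 1 * (z $ i - ?a $ i) - 1) = 1" "step (real 1 * (?b $ i - z $ i) - 1) = 1"
        using R[of i] by (auto intro!: step_1)
      then show ?thesis by simp
    qed
    then show ?thesis unfolding box_bump_def by simp
  qed
  have "grad (box_bump 1 ?a ?b) z = 0" if "z \<in> ball 0 R" for z
  proof (rule gradI)
    have "((\<lambda>z. 1) has_derivative (\<lambda>v. v \<bullet> 0)) (at z)" by simp
    then show "(box_bump 1 ?a ?b has_derivative (\<lambda>v. v \<bullet> 0)) (at z)"
      by (rule has_derivative_transform_within_open[OF _ open_ball[of 0 R]]) (use that 1 in auto)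
  qed
  then show ?thesis
    using that[of "box_bump 1 ?a ?b"] 1 test_function_mono[OF test_function_box_bump] by blast
qed

definition face_pairs :: "(real^'n) set set \<Rightarrow> ((real^'n) set \<times> (real^'n) set) set" where
  "face_pairs Fs = {p \<in> Fs \<times> Fs. hpl (fst p) \<noteq> hpl (snd p)}"

definition skeleton_cut :: "(real^'n) set set \<Rightarrow> nat \<Rightarrow> real^'n \<Rightarrow> real" where
  "skeleton_cut Fs k z = (\<Prod>p\<in>face_pairs Fs. pair_cut k (nrm (fst p)) (off (fst p)) (nrm (snd p)) (off (snd p)) z)"

lemma finite_face_pairs: "finite Fs \<Longrightarrow> finite (face_pairs Fs)"
  unfolding face_pairs_def by (rule finite_subset[of _ "Fs \<times> Fs"]) auto

lemma skeleton_cut_range: "0 \<le> skeleton_cut Fs k z" "skeleton_cut Fs k z \<le> 1"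
  unfolding skeleton_cut_def by (auto intro!: prod_nonneg prod_le_1 pair_cut_range)

lemma smooth_skeleton_cut: "smooth (skeleton_cut Fs k)"
  unfolding skeleton_cut_def[abs_def] by (intro smooth_prod smooth_pair_cut)

text \<open>\<open>\<omega>\<close> provides the compact support, while the cut-off vanishes on an
  open neighbourhood of the skeleton.\<close>

lemma test_function_skeleton_cut:
  assumes fin: "finite Fs" and \<omega>: "test_function UNIV \<omega>"
  shows "test_function (- skeleton Fs) (\<lambda>z. skeleton_cut Fs k z * \<omega> z)"
proof -
  obtain C where C: "compact C" "C \<subseteq> UNIV" "\<And>x. x \<notin> C \<Longrightarrow> \<omega> x = 0" using \<omega> by (rule test_functionE) blast
  let ?N = "\<lambda>p. {z. \<bar>nrm (fst p) \<bullet> z - off (fst p)\<bar> < 1 / real (Suc k)} \<inter> {z. \<bar>nrm (snd p) \<bullet> z - off (snd p)\<bar> < 1 / real (Suc k)}"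
  have N: "open (\<Union>p\<in>face_pairs Fs. ?N p)"
    by (intro open_UN open_Int ballI open_Collect_less continuous_intros)
  show ?thesis
  proof (rule test_functionI)
    show "smooth (\<lambda>z. skeleton_cut Fs k z * \<omega> z)" by (intro smooth_mult smooth_skeleton_cut test_function_smooth[OF \<omega>])
    show "compact (C - (\<Union>p\<in>face_pairs Fs. ?N p))" using C(1) N by (rule compact_diff)
    have "skeleton Fs \<subseteq> (\<Union>p\<in>face_pairs Fs. ?N p)"
    proof
      fix z assume "z \<in> skeleton Fs"
      then obtain F G where "F \<in> Fs" "G \<in> Fs" "hpl F \<noteq> hpl G" "z \<in> hpl F" "z \<in> hpl G" by (auto simp: skeleton_def)
      then show "z \<in> (\<Union>p\<in>face_pairs Fs. ?N p)"
        by (intro UN_I[of "(F, G)"]) (auto simp: face_pairs_def hpl_def)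
    qed
    then show "C - (\<Union>p\<in>face_pairs Fs. ?N p) \<subseteq> - skeleton Fs" by blast
    fix z assume z: "z \<notin> C - (\<Union>p\<in>face_pairs Fs. ?N p)"
    show "skeleton_cut Fs k z * \<omega> z = 0"
    proof (cases "z \<in> C")
      case True
      then obtain p where p: "p \<in> face_pairs Fs" "z \<in> ?N p" using z by blast
      then have "plane_bump k (nrm (fst p)) (off (fst p)) z = 1" "plane_bump k (nrm (snd p)) (off (snd p)) z = 1"
        by (auto intro!: plane_bump_1)
      then have "pair_cut k (nrm (fst p)) (off (fst p)) (nrm (snd p)) (off (snd p)) z = 0" by (simp add: pair_cut_def)
      then show ?thesis unfolding skeleton_cut_def using p(1) finite_face_pairs[OF fin] by (auto intro!: prod_zero)
    qed (simp add: C(3))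
  qed
qed

lemma not_in_two_slabs_eventually:
  assumes "n \<bullet> z \<noteq> c \<or> m \<bullet> z \<noteq> d"
  shows "\<forall>\<^sub>F k in sequentially. z \<notin> two_slabs n c m d (2 / real (Suc k))"
    "\<forall>\<^sub>F k in sequentially. pair_cut k n c m d z = 1"
proof -
  define e where "e = max \<bar>n \<bullet> z - c\<bar> \<bar>m \<bullet> z - d\<bar>"
  have e: "e > 0" using assms by (auto simp: e_def)
  obtain N :: nat where N: "real N > 2 / e" using reals_Archimedean2 by blast
  have lt: "2 / real (Suc k) < e" if "k \<ge> N" for k
  proof -
    have "2 / e < real (Suc k)" using N that by linarith
    then show ?thesis using e by (simp add: field_simps del: of_nat_Suc)
  qed
  have "z \<notin> two_slabs n c m d (2 / real (Suc k))" if "k \<ge> N" for k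
    using lt[OF that] by (auto simp: two_slabs_def e_def)
  then show "\<forall>\<^sub>F k in sequentially. z \<notin> two_slabs n c m d (2 / real (Suc k))" by (auto simp: eventually_sequentially)
  have "pair_cut k n c m d z = 1" if "k \<ge> N" for k
  proof -
    have "2 / real (Suc k) \<le> \<bar>n \<bullet> z - c\<bar> \<or> 2 / real (Suc k) \<le> \<bar>m \<bullet> z - d\<bar>"
      using lt[OF that] unfolding e_def by linarith
    then show ?thesis using plane_bump_0[of k n z c] plane_bump_0[of k m z d] by (auto simp: pair_cut_def)
  qed
  then show "\<forall>\<^sub>F k in sequentially. pair_cut k n c m d z = 1" by (auto simp: eventually_sequentially)
qed

lemma skeleton_cut_tendsto:
  assumes fin: "finite Fs" and z: "z \<notin> skeleton Fs"
  shows "(\<lambda>k. skeleton_cut Fs k z) \<longlonglongrightarrow> 1"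
proof -
  have "\<forall>\<^sub>F k in sequentially. \<forall>p\<in>face_pairs Fs. pair_cut k (nrm (fst p)) (off (fst p)) (nrm (snd p)) (off (snd p)) z = 1"
  proof (rule eventually_ball_finite[OF finite_face_pairs[OF fin]], rule ballI)
    fix p assume p: "p \<in> face_pairs Fs"
    then have "z \<notin> hpl (fst p) \<or> z \<notin> hpl (snd p)" using z unfolding face_pairs_def skeleton_def by force
    then show "\<forall>\<^sub>F k in sequentially. pair_cut k (nrm (fst p)) (off (fst p)) (nrm (snd p)) (off (snd p)) z = 1"
      by (intro not_in_two_slabs_eventually) (auto simp: hpl_def)
  qed
  then have "\<forall>\<^sub>F k in sequentially. skeleton_cut Fs k z = 1"
    by eventually_elim (simp add: skeleton_cut_def)
  then show ?thesis by (rule tendsto_eventually)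
qed

text \<open>With \<open>?K = real (Suc k)\<close>, Young's inequality splits \<open>q z * ?K\<close>
  into \<open>\<eta> * ?K\<^sup>2\<close> and \<open>(q z)\<^sup>2 / \<eta>\<close>. The first part
  stays small because the volume is of order \<open>1 / ?K\<^sup>2\<close>; the second is integrated
  over sets shrinking to a null set, and this uses that \<open>q\<close> is square
  integrable.\<close>

lemma pair_term_tendsto_0:
  fixes q :: "real^'n \<Rightarrow> real"
  assumes n: "norm n = 1" "norm m = 1" and ne: "{x. n \<bullet> x = c} \<noteq> {x. m \<bullet> x = d}"
    and q: "q \<in> borel_measurable borel" "\<And>z. q z \<ge> 0" "integrable lborel (\<lambda>z. (q z)\<^sup>2)" "\<And>z. z \<notin> cball 0 R \<Longrightarrow> q z = 0"
    and qi: "integrable lborel q"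
  shows "(\<lambda>k. LINT z|lborel. q z * (real (Suc k) * indicator (two_slabs n c m d (2 / real (Suc k))) z)) \<longlonglongrightarrow> 0"
proof (rule LIMSEQ_I)
  fix e :: real assume e: "e > 0"
  let ?N = "\<lambda>k. two_slabs n c m d (2 / real (Suc k))"
  have Nb[measurable]: "?N k \<in> sets borel" for k using closed_two_slabs[of n c m d] by auto
  note [measurable] = q(1)
  obtain M a0 where M: "M \<ge> 0" "a0 > 0"
    "\<And>a. 0 \<le> a \<Longrightarrow> a \<le> a0 \<Longrightarrow> emeasure lborel (two_slabs n c m d a \<inter> cball 0 R) \<le> ennreal (M * a\<^sup>2)"
    by (rule emeasure_two_slabs[OF n ne, of R]) blast
  \<comment> \<open>The first part will contribute at most \<open>4 * M * \<eta>\<close>, the volume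
    bound \<open>M * (2 / ?K)\<^sup>2\<close> times \<open>\<eta> * ?K\<^sup>2\<close>; this choice
    keeps it below \<open>e\<close>.\<close>
  define \<eta> where "\<eta> = e / (4 * M + 1)"
  have \<eta>: "\<eta> > 0" "4 * M * \<eta> < e" using e M(1) by (auto simp: \<eta>_def field_simps)
  have "(\<lambda>k. LINT z|lborel. (q z)\<^sup>2 * indicator (?N k) z) \<longlonglongrightarrow> (LINT z|(lborel :: (real^'n) measure). 0)"
  proof (rule integral_dominated_convergence[where w = "\<lambda>z. (q z)\<^sup>2"])
    have "n \<noteq> 0" using n by auto
    then have "AE z in lborel. z \<notin> {z. n \<bullet> z = c}" by (intro negligible_AE negligible_hyperplane) auto
    then show "AE z in lborel. (\<lambda>k. (q z)\<^sup>2 * indicator (?N k) z) \<longlonglongrightarrow> 0"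
    proof eventually_elim
      fix z assume "z \<notin> {z. n \<bullet> z = c}"
      then have "\<forall>\<^sub>F k in sequentially. z \<notin> ?N k" by (intro not_in_two_slabs_eventually) auto
      then have "\<forall>\<^sub>F k in sequentially. (q z)\<^sup>2 * indicator (?N k) z = 0" by eventually_elim simp
      then show "(\<lambda>k. (q z)\<^sup>2 * indicator (?N k) z) \<longlonglongrightarrow> 0" by (simp add: tendsto_eventually)
    qed
    show "(\<lambda>z. (q z)\<^sup>2 * indicator (?N k) z) \<in> borel_measurable lborel" for k by measurable
    show "AE z in lborel. norm ((q z)\<^sup>2 * indicator (?N k) z) \<le> (q z)\<^sup>2" for k by (auto simp: indicator_def)
  qed (use q in auto)
  then have "(\<lambda>k. LINT z|lborel. (q z)\<^sup>2 * indicator (?N k) z) \<longlonglongrightarrow> 0" by simp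
  \<comment> \<open>What is left of \<open>e\<close> for the second part, multiplied by
    \<open>\<eta>\<close>.\<close>
  moreover have "0 < \<eta> * (e - 4 * M * \<eta>)" using \<eta> by simp
  ultimately have "\<forall>\<^sub>F k in sequentially. (LINT z|lborel. (q z)\<^sup>2 * indicator (?N k) z) < \<eta> * (e - 4 * M * \<eta>)"
    by (rule order_tendstoD(2))
  then obtain N1 where N1: "\<And>k. k \<ge> N1 \<Longrightarrow> (LINT z|lborel. (q z)\<^sup>2 * indicator (?N k) z) < \<eta> * (e - 4 * M * \<eta>)"
    unfolding eventually_sequentially by blast
  obtain N2 :: nat where N2: "real N2 > 2 / a0" using reals_Archimedean2 by blast
  show "\<exists>no. \<forall>k\<ge>no. norm ((LINT z|lborel. q z * (real (Suc k) * indicator (?N k) z)) - 0) < e"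
  proof (intro exI[of _ "max N1 N2"] allI impI)
    fix k assume k: "k \<ge> max N1 N2"
    let ?K = "real (Suc k)"
    have "2 / a0 < ?K" using N2 k by linarith
    then have ka: "2 / ?K \<le> a0" using M(2) by (simp add: field_simps del: of_nat_Suc)
    let ?V = "?N k \<inter> cball 0 R"
    have Vm: "emeasure lborel ?V \<le> ennreal (M * (2 / ?K)\<^sup>2)" using M(3)[OF _ ka] by simp
    then have Vf: "emeasure lborel ?V < \<infinity>" by (auto intro: le_less_trans)
    have mV: "measure lborel ?V \<le> M * (2 / ?K)\<^sup>2"
      using Vm M(1) by (simp add: measure_def enn2real_leI)
    have Vb: "?V \<in> sets lborel" unfolding sets_lborel by (intro borel_closed closed_Int closed_two_slabs closed_cball)
    have iV: "integrable lborel (indicator ?V :: _ \<Rightarrow> real)" by (rule integrable_real_indicator[OF Vb Vf])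
    have iq: "integrable lborel (\<lambda>z. (q z)\<^sup>2 * indicator (?N k) z)"
    proof (rule integrable_mult_bounded[OF q(3), of _ 1])
      show "indicator (?N k) \<in> borel_measurable lborel" by measurable
    qed (simp add: indicator_def)
    have pt: "q z * (?K * indicator (?N k) z) \<le> \<eta> * ?K\<^sup>2 * indicator ?V z + (1 / \<eta>) * ((q z)\<^sup>2 * indicator (?N k) z)" for z
    proof (cases "z \<in> ?V")
      case True
      have "0 \<le> (\<eta> * ?K - q z)\<^sup>2" by simp
      then have "2 * (q z * ?K * \<eta>) \<le> \<eta>\<^sup>2 * ?K\<^sup>2 + (q z)\<^sup>2"
        by (simp add: power2_diff power_mult_distrib mult_ac del: of_nat_Suc)
      moreover have "0 \<le> q z * ?K * \<eta>" using q(2)[of z] \<eta> by simp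
      ultimately have "(q z * ?K) * \<eta> \<le> (\<eta> * ?K\<^sup>2 + (1 / \<eta>) * (q z)\<^sup>2) * \<eta>"
      proof -
        have "(\<eta> * ?K\<^sup>2 + (1 / \<eta>) * (q z)\<^sup>2) * \<eta> = \<eta>\<^sup>2 * ?K\<^sup>2 + (q z)\<^sup>2"
          using \<eta>(1) by (simp add: distrib_right distrib_left power2_eq_square mult_ac del: of_nat_Suc)
        then show ?thesis using \<open>2 * (q z * ?K * \<eta>) \<le> \<eta>\<^sup>2 * ?K\<^sup>2 + (q z)\<^sup>2\<close> \<open>0 \<le> q z * ?K * \<eta>\<close> by linarith
      qed
      then have "q z * ?K \<le> \<eta> * ?K\<^sup>2 + (1 / \<eta>) * (q z)\<^sup>2" using \<eta>(1) mult_right_le_imp_le by blast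
      then show ?thesis using True by (simp del: of_nat_Suc)
    next
      case False
      then show ?thesis using q(4)[of z] \<eta> by (cases "z \<in> cball 0 R") (auto simp: indicator_def)
    qed
    have "integrable lborel (\<lambda>z. q z * (?K * indicator (?N k) z))"
    proof (rule integrable_mult_bounded[OF qi, of _ ?K])
      show "(\<lambda>z. ?K * indicator (?N k) z) \<in> borel_measurable lborel" by measurable
    qed (simp add: indicator_def del: of_nat_Suc)
    then have "(LINT z|lborel. q z * (?K * indicator (?N k) z))
        \<le> (LINT z|lborel. \<eta> * ?K\<^sup>2 * indicator ?V z + (1 / \<eta>) * ((q z)\<^sup>2 * indicator (?N k) z))"
      by (intro integral_mono Bochner_Integration.integrable_add integrable_mult_right iV iq pt)
    also have "\<dots> = \<eta> * ?K\<^sup>2 * measure lborel ?V + (1 / \<eta>) * (LINT z|lborel. (q z)\<^sup>2 * indicator (?N k) z)"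
      using iV iq by (subst Bochner_Integration.integral_add) auto
    also have "\<dots> < \<eta> * ?K\<^sup>2 * (M * (2 / ?K)\<^sup>2) + (1 / \<eta>) * (\<eta> * (e - 4 * M * \<eta>))"
      using \<eta>(1) N1[of k] k mV by (intro add_le_less_mono mult_left_mono mult_strict_left_mono) auto
    also have "\<dots> = e" using \<eta>(1) by (simp add: field_simps power2_eq_square del: of_nat_Suc)
    finally have "(LINT z|lborel. q z * (?K * indicator (?N k) z)) < e" .
    moreover have "(LINT z|lborel. q z * (?K * indicator (?N k) z)) \<ge> 0"
      using q(2) by (intro Bochner_Integration.integral_nonneg) auto
    ultimately show "norm ((LINT z|lborel. q z * (?K * indicator (?N k) z)) - 0) < e" by simp
  qed
qed

section \<open>Balance of the fluxes of one cell\<close>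

text \<open>In \<open>gauss_green_off_skeleton\<close> with cut-offs that tend to 1 the three terms
  converge separately. The gradient term tends to zero, which leaves the source with its minus
  sign.\<close>

lemma flux_balance:
  fixes T :: "(real^'n) set"
  assumes m: "mesh_cell Fs T" and d: "div_field T A W g f" and b: "bounded T"
    and W2: "integrable lborel (\<lambda>z. (norm (W z))\<^sup>2)"
  shows "(\<Sum>F\<in>faces_of Fs T. face_integral T F A W (\<lambda>x. 1)) = - (LINT z|lborel. f z)"
proof -
  have fin: "finite Fs" and fl: "\<And>F. F \<in> Fs \<Longrightarrow> face_like F"
    and on: "\<And>F. F \<in> faces_of Fs T \<Longrightarrow> is_outward_normal T F (outward_normal T F)"
    using m by (auto simp: mesh_cell_def)
  have sub: "faces_of Fs T \<subseteq> Fs" by (auto simp: faces_of_def)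
  have W0: "\<And>z. z \<notin> T \<Longrightarrow> W z = 0" and f0: "\<And>z. z \<notin> T \<Longrightarrow> f z = 0" and fi: "integrable lborel f"
    using d by (auto simp: div_field_def)
  have Wi: "integrable lborel (\<lambda>z. W z $ j)" for j using d by (auto simp: div_field_def weak_dd_def)
  have Wm[measurable]: "W \<in> borel_measurable borel"
    using Wi by (subst borel_measurable_euclidean_space) (auto simp: Basis_vec_def inner_axis)
  have nWi: "integrable lborel (\<lambda>z. norm (W z))"
  proof (rule Bochner_Integration.integrable_bound)
    show "integrable lborel (\<lambda>z. \<Sum>j\<in>UNIV. \<bar>W z $ j\<bar>)" using Wi by auto
    show "AE z in lborel. norm (norm (W z)) \<le> norm (\<Sum>j\<in>UNIV. \<bar>W z $ j\<bar>)"
      using norm_le_l1_cart by (intro AE_I2) (auto intro: order_trans)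
  qed measurable
  obtain R where R: "closure T \<subseteq> ball 0 R"
    using b by (metis bounded_closure bounded_subset_ballD)
  obtain \<omega> :: "real^'n \<Rightarrow> real" where \<omega>: "test_function UNIV \<omega>" "\<And>z. z \<in> ball 0 R \<Longrightarrow> \<omega> z = 1"
    "\<And>z. z \<in> ball 0 R \<Longrightarrow> grad \<omega> z = 0" by (rule bump_on_ball) blast
  obtain B where B: "B > 0" "\<And>t. \<bar>step' t\<bar> \<le> B" using step'_bound by blast
  obtain A0 where A0: "A0 > 0" "\<And>w. norm (A *v w) \<le> A0 * norm w"
    using linear_bounded_pos[OF matrix_vector_mul_linear[of A]] by (metis mult.commute)
  let ?\<chi> = "skeleton_cut Fs"
  let ?p = "\<lambda>p k. two_slabs (nrm (fst p)) (off (fst p)) (nrm (snd p)) (off (snd p)) (2 / real (Suc k))"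
  note sm = smooth_skeleton_cut[of Fs] test_function_smooth[OF \<omega>(1)]
  \<comment> \<open>On the cell \<open>\<omega>\<close> is 1 with zero gradient, so only the
    skeleton cut-off is differentiated.\<close>
  have gr: "grad (\<lambda>z. ?\<chi> k z * \<omega> z) z = grad (?\<chi> k) z" if "z \<in> T" for k z
    using grad_mult[OF sm, of k z] \<omega>(2,3)[of z] R that closure_subset[of T] by auto
  have gchi: "norm (grad (?\<chi> k) z) \<le> (\<Sum>p\<in>face_pairs Fs. 4 * B * (real (Suc k) * indicator (?p p k) z))" for k z
  proof -
    have "norm (grad (?\<chi> k) z) \<le> (\<Sum>p\<in>face_pairs Fs. norm (grad (pair_cut k (nrm (fst p)) (off (fst p)) (nrm (snd p)) (off (snd p))) z))"
      unfolding skeleton_cut_def[abs_def]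
      by (rule grad_prod_le[OF finite_face_pairs[OF fin] smooth_pair_cut]) (simp add: pair_cut_range)
    also have "\<dots> \<le> (\<Sum>p\<in>face_pairs Fs. 4 * B * (real (Suc k) * indicator (?p p k) z))"
      by (intro sum_mono grad_pair_cut_le B) (auto simp: face_pairs_def face_like_nrm(1) fl)
    finally show ?thesis .
  qed
  have gg: "(LINT z|lborel. (A *v W z) \<bullet> grad (\<lambda>z. ?\<chi> k z * \<omega> z) z) - (LINT z|lborel. f z * (?\<chi> k z * \<omega> z))
     = (\<Sum>F\<in>faces_of Fs T. face_integral T F A W (\<lambda>z. ?\<chi> k z * \<omega> z))" for k
    by (rule gauss_green_off_skeleton[OF m d test_function_skeleton_cut[OF fin \<omega>(1)]])
  have l1: "(\<lambda>k. LINT z|lborel. (A *v W z) \<bullet> grad (\<lambda>z. ?\<chi> k z * \<omega> z) z) \<longlonglongrightarrow> 0"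
  proof (rule Lim_null_comparison[OF always_eventually])
    have pb: "?p p k \<in> sets borel" for p k
      using closed_two_slabs[of "nrm (fst p)" "off (fst p)" "nrm (snd p)" "off (snd p)" "2 / real (Suc k)"] by simp
    have int: "integrable lborel (\<lambda>z. norm (W z) * (real (Suc k) * indicator (?p p k) z))" for p k
    proof (rule integrable_mult_bounded[OF nWi, of _ "real (Suc k)"])
      show "(\<lambda>z. real (Suc k) * indicator (?p p k) z) \<in> borel_measurable lborel"
        using pb by (intro borel_measurable_times borel_measurable_const borel_measurable_indicator) simp
    qed (simp add: indicator_def del: of_nat_Suc)
    show "\<forall>k. norm (LINT z|lborel. (A *v W z) \<bullet> grad (\<lambda>z. ?\<chi> k z * \<omega> z) z)
      \<le> (\<Sum>p\<in>face_pairs Fs. A0 * 4 * B * (LINT z|lborel. norm (W z) * (real (Suc k) * indicator (?p p k) z)))"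
    proof
      fix k
      have "\<bar>LINT z|lborel. (A *v W z) \<bullet> grad (\<lambda>z. ?\<chi> k z * \<omega> z) z\<bar>
        \<le> (LINT z|lborel. (\<Sum>p\<in>face_pairs Fs. A0 * 4 * B * (norm (W z) * (real (Suc k) * indicator (?p p k) z))))"
      proof (rule integral_norm_le_AE)
        have t: "test_function (- skeleton Fs) (\<lambda>z. ?\<chi> k z * \<omega> z)" by (rule test_function_skeleton_cut[OF fin \<omega>(1)])
        obtain D where D: "D > 0" "\<And>x. norm (grad (\<lambda>z. ?\<chi> k z * \<omega> z) x) \<le> D" using t by (rule test_function_grad_bounded) blast
        have "integrable lborel (\<lambda>z. ((A *v W z) \<bullet> grad (\<lambda>z. ?\<chi> k z * \<omega> z) z) * 1)"
          by (rule div_field_integrable(1)[OF d smooth_const _ test_function_smooth[OF t] D(2), of _ 1]) simp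
        then show "(\<lambda>z. (A *v W z) \<bullet> grad (\<lambda>z. ?\<chi> k z * \<omega> z) z) \<in> borel_measurable lborel" by auto
        show "integrable lborel (\<lambda>z. \<Sum>p\<in>face_pairs Fs. A0 * 4 * B * (norm (W z) * (real (Suc k) * indicator (?p p k) z)))"
          by (intro Bochner_Integration.integrable_sum integrable_mult_right int)
        show "AE z in lborel. \<bar>(A *v W z) \<bullet> grad (\<lambda>z. ?\<chi> k z * \<omega> z) z\<bar>
          \<le> (\<Sum>p\<in>face_pairs Fs. A0 * 4 * B * (norm (W z) * (real (Suc k) * indicator (?p p k) z)))"
        proof (rule AE_I2)
          fix z
          show "\<bar>(A *v W z) \<bullet> grad (\<lambda>z. ?\<chi> k z * \<omega> z) z\<bar>
            \<le> (\<Sum>p\<in>face_pairs Fs. A0 * 4 * B * (norm (W z) * (real (Suc k) * indicator (?p p k) z)))"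
          proof (cases "z \<in> T")
            case True
            have "\<bar>(A *v W z) \<bullet> grad (\<lambda>z. ?\<chi> k z * \<omega> z) z\<bar> \<le> norm (A *v W z) * norm (grad (?\<chi> k) z)"
              unfolding gr[OF True] by (rule Cauchy_Schwarz_ineq2)
            also have "\<dots> \<le> (A0 * norm (W z)) * (\<Sum>p\<in>face_pairs Fs. 4 * B * (real (Suc k) * indicator (?p p k) z))"
              using A0 by (intro mult_mono A0 gchi) auto
            finally show ?thesis by (simp add: sum_distrib_left mult_ac)
          qed (simp add: W0)
        qed
      qed
      also have "\<dots> = (\<Sum>p\<in>face_pairs Fs. A0 * 4 * B * (LINT z|lborel. norm (W z) * (real (Suc k) * indicator (?p p k) z)))"
        using int by (subst Bochner_Integration.integral_sum) auto
      finally show "norm (LINT z|lborel. (A *v W z) \<bullet> grad (\<lambda>z. ?\<chi> k z * \<omega> z) z)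
        \<le> (\<Sum>p\<in>face_pairs Fs. A0 * 4 * B * (LINT z|lborel. norm (W z) * (real (Suc k) * indicator (?p p k) z)))" by simp
    qed
    have "(\<lambda>k. LINT z|lborel. norm (W z) * (real (Suc k) * indicator (?p p k) z)) \<longlonglongrightarrow> 0" if "p \<in> face_pairs Fs" for p
    proof (rule pair_term_tendsto_0[where R = R])
      show "norm (nrm (fst p)) = 1" "norm (nrm (snd p)) = 1" using that by (auto simp: face_pairs_def face_like_nrm(1) fl)
      show "{x. nrm (fst p) \<bullet> x = off (fst p)} \<noteq> {x. nrm (snd p) \<bullet> x = off (snd p)}"
        using that by (auto simp: face_pairs_def hpl_def)
      fix z :: "real^'n" assume "z \<notin> cball 0 R"
      then have "z \<notin> T" using R closure_subset[of T] by auto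
      then show "norm (W z) = 0" by (simp add: W0)
    qed (use W2 nWi in auto)
    then have "(\<lambda>k. \<Sum>p\<in>face_pairs Fs. A0 * 4 * B * (LINT z|lborel. norm (W z) * (real (Suc k) * indicator (?p p k) z)))
        \<longlonglongrightarrow> (\<Sum>p\<in>face_pairs Fs. A0 * 4 * B * 0)"
      by (intro tendsto_sum tendsto_mult tendsto_const)
    then show "(\<lambda>k. \<Sum>p\<in>face_pairs Fs. A0 * 4 * B * (LINT z|lborel. norm (W z) * (real (Suc k) * indicator (?p p k) z))) \<longlonglongrightarrow> 0"
      by simp
  qed
  obtain P where P: "P > 0" "\<And>x. \<bar>\<omega> x\<bar> \<le> P" using \<omega>(1) by (rule test_function_bounded) blast
  have bd: "\<bar>?\<chi> k z * \<omega> z\<bar> \<le> P" for k z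
  proof -
    have "\<bar>?\<chi> k z * \<omega> z\<bar> \<le> 1 * P"
      unfolding abs_mult using skeleton_cut_range[of Fs k z] P by (intro mult_mono) auto
    then show ?thesis by simp
  qed
  note bm = borel_measurable_smooth[OF smooth_mult[OF sm]]
  have l2: "(\<lambda>k. LINT z|lborel. f z * (?\<chi> k z * \<omega> z)) \<longlonglongrightarrow> (LINT z|lborel. f z)"
  proof (rule integral_dominated_convergence[where w = "\<lambda>z. \<bar>f z\<bar> * P"])
    have "AE z in lborel. \<forall>F\<in>Fs. z \<notin> hpl F"
    proof (rule AE_finite_allI[OF fin])
      fix F assume "F \<in> Fs"
      then have "nrm F \<noteq> 0" using face_like_nrm(1)[OF fl] by force
      then show "AE z in lborel. z \<notin> hpl F" unfolding hpl_def by (intro negligible_AE negligible_hyperplane) auto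
    qed
    then show "AE z in lborel. (\<lambda>k. f z * (?\<chi> k z * \<omega> z)) \<longlonglongrightarrow> f z"
    proof eventually_elim
      fix z assume z: "\<forall>F\<in>Fs. z \<notin> hpl F"
      show "(\<lambda>k. f z * (?\<chi> k z * \<omega> z)) \<longlonglongrightarrow> f z"
      proof (cases "z \<in> T")
        case True
        then have "\<omega> z = 1" using \<omega>(2) R closure_subset[of T] by blast
        moreover have "z \<notin> skeleton Fs" using z by (auto simp: skeleton_def)
        then have "(\<lambda>k. f z * (?\<chi> k z * \<omega> z)) \<longlonglongrightarrow> f z * (1 * \<omega> z)"
          by (intro tendsto_mult tendsto_const skeleton_cut_tendsto[OF fin])
        ultimately show ?thesis by simp
      qed (simp add: f0)
    qed
    show "AE z in lborel. norm (f z * (?\<chi> k z * \<omega> z)) \<le> \<bar>f z\<bar> * P" for k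
      unfolding real_norm_def abs_mult[of "f _"] using bd by (intro AE_I2 mult_left_mono) auto
  qed (use fi bm in auto)
  have l3: "(\<lambda>k. face_integral T F A W (\<lambda>z. ?\<chi> k z * \<omega> z)) \<longlonglongrightarrow> face_integral T F A W (\<lambda>z. 1)" if F: "F \<in> faces_of Fs T" for F
  proof -
    let ?n = "outward_normal T F" and ?c = "face_offset T F"
    have Fs: "F \<in> Fs" using F sub by blast
    note props = outward_normal_props[OF fl[OF Fs] on[OF F]]
    note I = flux_density_integrable[OF m d F]
    show ?thesis
      unfolding face_integral_def
    proof (rule integral_dominated_convergence[where w = "\<lambda>x. \<bar>indicator F x * flux_density A W ?n x\<bar> * P"])
      \<comment> \<open>Other hyperplanes meet that of \<open>F\<close> in sets of surface measure
        zero, so almost all of \<open>F\<close> is off the skeleton.\<close>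
      have "AE x in hyp ?n ?c. \<forall>G\<in>{G\<in>Fs. hpl G \<noteq> hpl F}. x \<notin> hpl G"
      proof (rule AE_finite_allI)
        show "finite {G\<in>Fs. hpl G \<noteq> hpl F}" using fin by simp
        fix G assume G: "G \<in> {G\<in>Fs. hpl G \<noteq> hpl F}"
        then have "AE x in hyp ?n ?c. nrm G \<bullet> x \<noteq> off G"
          using props(3) by (intro null_hyperplane_Int props(1) face_like_nrm(1) fl) (auto simp: hpl_def)
        then show "AE x in hyp ?n ?c. x \<notin> hpl G" by (simp add: hpl_def)
      qed
      then show "AE x in hyp ?n ?c. (\<lambda>k. indicator F x * flux_density A W ?n x * (?\<chi> k x * \<omega> x)) \<longlonglongrightarrow> indicator F x * flux_density A W ?n x * 1"
      proof eventually_elim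
        fix x assume x: "\<forall>G\<in>{G\<in>Fs. hpl G \<noteq> hpl F}. x \<notin> hpl G"
        show "(\<lambda>k. indicator F x * flux_density A W ?n x * (?\<chi> k x * \<omega> x)) \<longlonglongrightarrow> indicator F x * flux_density A W ?n x * 1"
        proof (cases "x \<in> F")
          case True
          then have "x \<in> closure T" using F by (auto simp: faces_of_def frontier_def)
          then have "\<omega> x = 1" using \<omega>(2) R by blast
          moreover have "x \<notin> skeleton Fs"
          proof
            assume "x \<in> skeleton Fs"
            then obtain G H where "G \<in> Fs" "H \<in> Fs" "hpl G \<noteq> hpl H" "x \<in> hpl G" "x \<in> hpl H" by (auto simp: skeleton_def)
            then show False using x by (cases "hpl G = hpl F") auto
          qed
          then have "(\<lambda>k. indicator F x * flux_density A W ?n x * (?\<chi> k x * \<omega> x)) \<longlonglongrightarrow> indicator F x * flux_density A W ?n x * (1 * \<omega> x)"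
            by (intro tendsto_mult tendsto_const skeleton_cut_tendsto[OF fin])
          ultimately show ?thesis by simp
        qed simp
      qed
      show "AE x in hyp ?n ?c. norm (indicator F x * flux_density A W ?n x * (?\<chi> k x * \<omega> x)) \<le> \<bar>indicator F x * flux_density A W ?n x\<bar> * P" for k
        unfolding real_norm_def abs_mult[of _ "?\<chi> k _ * _"] using bd by (intro AE_I2 mult_left_mono) auto
      show "integrable (hyp ?n ?c) (\<lambda>x. \<bar>indicator F x * flux_density A W ?n x\<bar> * P)" using I by simp
      show "(\<lambda>x. indicator F x * flux_density A W ?n x * 1) \<in> borel_measurable (hyp ?n ?c)" using I by simp
      show "(\<lambda>x. indicator F x * flux_density A W ?n x * (?\<chi> k x * \<omega> x)) \<in> borel_measurable (hyp ?n ?c)" for k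
        using bm[of k] by (intro borel_measurable_times[OF borel_measurable_integrable[OF I]]) simp
    qed
  qed
  have "(\<lambda>k. (LINT z|lborel. (A *v W z) \<bullet> grad (\<lambda>z. ?\<chi> k z * \<omega> z) z) - (LINT z|lborel. f z * (?\<chi> k z * \<omega> z)))
      \<longlonglongrightarrow> 0 - (LINT z|lborel. f z)"
    by (intro tendsto_diff l1 l2)
  moreover have "(\<lambda>k. \<Sum>F\<in>faces_of Fs T. face_integral T F A W (\<lambda>z. ?\<chi> k z * \<omega> z)) \<longlonglongrightarrow> (\<Sum>F\<in>faces_of Fs T. face_integral T F A W (\<lambda>z. 1))"
    by (intro tendsto_sum l3)
  ultimately show ?thesis
    unfolding gg using LIMSEQ_unique by fastforce
qed

section \<open>Conservation and boundary values\<close>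

lemma AE_face_off_skeleton:
  assumes fin: "finite Fs" and fl: "\<And>F. F \<in> Fs \<Longrightarrow> face_like F" and F: "F \<in> Fs"
    and n: "norm n = 1" "hpl F = {x. n \<bullet> x = c}"
  shows "AE x in hyp n c. x \<in> F \<longrightarrow> x \<notin> skeleton Fs"
proof -
  have "AE x in hyp n c. \<forall>G\<in>{G\<in>Fs. hpl G \<noteq> hpl F}. x \<notin> hpl G"
  proof (rule AE_finite_allI)
    show "finite {G\<in>Fs. hpl G \<noteq> hpl F}" using fin by simp
    fix G assume G: "G \<in> {G\<in>Fs. hpl G \<noteq> hpl F}"
    then have "AE x in hyp n c. nrm G \<bullet> x \<noteq> off G"
      using n by (intro null_hyperplane_Int face_like_nrm(1) fl) (auto simp: hpl_def)
    then show "AE x in hyp n c. x \<notin> hpl G" by (simp add: hpl_def)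
  qed
  then show ?thesis
  proof eventually_elim
    fix x assume x: "\<forall>G\<in>{G\<in>Fs. hpl G \<noteq> hpl F}. x \<notin> hpl G"
    show "x \<in> F \<longrightarrow> x \<notin> skeleton Fs"
    proof (intro impI notI)
      assume "x \<in> F" "x \<in> skeleton Fs"
      then obtain G H where "G \<in> Fs" "H \<in> Fs" "hpl G \<noteq> hpl H" "x \<in> hpl G" "x \<in> hpl H" by (auto simp: skeleton_def)
      then show False using x by (cases "hpl G = hpl F") auto
    qed
  qed
qed

text \<open>Another face lies either in a different hyperplane, which a small ball avoids, or in
  that of \<open>F\<close>, where \<open>F\<close> is relatively open and disjoint from it.\<close>

lemma ball_meets_only_face:
  assumes fin: "finite Fs" and disj: "disjoint Fs" and fl: "\<And>F. F \<in> Fs \<Longrightarrow> face_like F"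
    and F: "F \<in> Fs" and x: "x \<in> F" "x \<notin> skeleton Fs" and U: "open U" "x \<in> U"
  obtains \<rho> where "\<rho> > 0" "ball x \<rho> \<subseteq> U" "ball x \<rho> \<subseteq> - skeleton Fs"
    "\<And>G. G \<in> Fs \<Longrightarrow> G \<noteq> F \<Longrightarrow> ball x \<rho> \<inter> G = {}"
proof -
  have xF: "x \<in> hpl F" using x(1) face_like_nrm(2)[OF fl[OF F]] by blast
  obtain \<rho>1 where \<rho>1: "\<rho>1 > 0" "\<And>G. G \<in> Fs \<Longrightarrow> ball x \<rho>1 \<inter> hpl G \<noteq> {} \<Longrightarrow> hpl G = hpl F"
    by (rule ball_off_skeleton[OF fin fl x(2) F xF]) blast+
  obtain \<rho>2 where \<rho>2: "\<rho>2 > 0" "ball x \<rho>2 \<inter> hpl F \<subseteq> F"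
    using face_like_nrm(5)[OF fl[OF F]] x(1) unfolding openin_contains_ball by blast
  have "open (U \<inter> - skeleton Fs)" "x \<in> U \<inter> - skeleton Fs"
    using U x(2) closed_skeleton[OF fin fl] by auto
  then obtain \<rho>3 where \<rho>3: "\<rho>3 > 0" "ball x \<rho>3 \<subseteq> U \<inter> - skeleton Fs"
    by (rule openE)
  define \<rho> where "\<rho> = min \<rho>1 (min \<rho>2 \<rho>3)"
  have sub: "ball x \<rho> \<subseteq> ball x \<rho>1" "ball x \<rho> \<subseteq> ball x \<rho>2" "ball x \<rho> \<subseteq> ball x \<rho>3"
    by (auto simp: \<rho>_def)
  show ?thesis
  proof (rule that[of \<rho>])
    show "\<rho> > 0" using \<rho>1 \<rho>2 \<rho>3 by (simp add: \<rho>_def)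
    show "ball x \<rho> \<subseteq> U" "ball x \<rho> \<subseteq> - skeleton Fs" using sub \<rho>3(2) by blast+
    fix G assume G: "G \<in> Fs" "G \<noteq> F"
    show "ball x \<rho> \<inter> G = {}"
    proof (rule ccontr)
      assume "ball x \<rho> \<inter> G \<noteq> {}"
      then obtain y where y: "y \<in> ball x \<rho>" "y \<in> G" by blast
      then have "y \<in> hpl G" using face_like_nrm(2)[OF fl[OF G(1)]] by blast
      then have "hpl G = hpl F" using \<rho>1(2)[OF G(1)] y(1) sub by blast
      then have "y \<in> F" using \<open>y \<in> hpl G\<close> y(1) sub(2) \<rho>2(2) by blast
      then show False using disj G F y(2) by (auto simp: disjoint_def)
    qed
  qed
qed

lemma face_hyp_eq:
  assumes "face_like F" "is_outward_normal T F (outward_normal T F)"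
  shows "hyp (outward_normal T F) (face_offset T F) = hyp (nrm F) (off F)"
  using same_hyperplane(2)[OF assms(1) outward_normal_props(1,3)[OF assms]] by simp

text \<open>Adding the formulas of all cells turns \<open>H\<close> into a statement about faces.
  Near a point of \<open>F\<close> off the skeleton only the two cells at \<open>F\<close>
  contribute, so the sum \<open>j\<close> of their flux densities is orthogonal to all test
  functions there. Conservation thus holds pointwise almost everywhere, before integration.\<close>

lemma flux_conservation:
  fixes \<Omega> :: "(real^'n) set"
  assumes fin: "finite Th" and m: "\<And>T. T \<in> Th \<Longrightarrow> mesh_cell Fs T"
    and d: "\<And>T. T \<in> Th \<Longrightarrow> div_field T (A T) (W T) (g T) (f T)" and \<Omega>: "open \<Omega>"
    and H: "\<And>\<phi>. test_function \<Omega> \<phi> \<Longrightarrow>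
      (\<Sum>T\<in>Th. (LINT z|lborel. (A T *v W T z) \<bullet> grad \<phi> z) - (LINT z|lborel. f T z * \<phi> z)) = 0"
    and F: "F \<in> Fs" "F \<subseteq> \<Omega>" and cells: "cells_of Th F = {T, T'}" "T \<noteq> T'"
  shows "face_integral T F (A T) (W T) (\<lambda>x. 1) + face_integral T' F (A T') (W T') (\<lambda>x. 1) = 0"
proof -
  have Th: "T \<in> Th" "T' \<in> Th" and FT: "F \<in> faces_of Fs T" "F \<in> faces_of Fs T'"
    and others: "\<And>T''. T'' \<in> Th \<Longrightarrow> F \<in> faces_of Fs T'' \<Longrightarrow> T'' = T \<or> T'' = T'"
    using cells(1) F(1) by (auto simp: cells_of_def faces_of_def)
  have fin_s: "finite Fs" and disj: "disjoint Fs" and fl: "\<And>F. F \<in> Fs \<Longrightarrow> face_like F"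
    using m[OF Th(1)] by (auto simp: mesh_cell_def)
  have on: "is_outward_normal T'' G (outward_normal T'' G)" if "T'' \<in> Th" "G \<in> faces_of Fs T''" for T'' G
    using m[OF that(1)] that(2) by (auto simp: mesh_cell_def)
  let ?M = "hyp (nrm F) (off F)"
  let ?q = "\<lambda>T x. indicator F x * flux_density (A T) (W T) (outward_normal T F) x"
  have hyp: "hyp (outward_normal T F) (face_offset T F) = ?M" "hyp (outward_normal T' F) (face_offset T' F) = ?M"
    using face_hyp_eq[OF fl[OF F(1)] on] Th FT by auto
  have I: "integrable ?M (?q T)" "integrable ?M (?q T')"
    using flux_density_integrable[OF m[OF Th(1)] d[OF Th(1)] FT(1)] flux_density_integrable[OF m[OF Th(2)] d[OF Th(2)] FT(2)]
    by (simp_all add: hyp)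
  define j where "j x = ?q T x + ?q T' x" for x
  have Ij: "integrable ?M j" unfolding j_def[abs_def] using I by simp
  define V where "V x = (SOME V. open V \<and> x \<in> V \<and> V \<subseteq> \<Omega> \<and> V \<subseteq> - skeleton Fs \<and> (\<forall>G\<in>Fs - {F}. V \<inter> G = {}))" for x
  have V: "open (V x)" "x \<in> V x" "V x \<subseteq> \<Omega>" "V x \<subseteq> - skeleton Fs" "\<And>G. G \<in> Fs - {F} \<Longrightarrow> V x \<inter> G = {}"
    if "x \<in> F - skeleton Fs" for x
  proof -
    have x: "x \<in> F" "x \<notin> skeleton Fs" "x \<in> \<Omega>" using that F(2) by blast+
    obtain \<rho> where "\<rho> > 0" "ball x \<rho> \<subseteq> \<Omega>" "ball x \<rho> \<subseteq> - skeleton Fs" "\<And>G. G \<in> Fs \<Longrightarrow> G \<noteq> F \<Longrightarrow> ball x \<rho> \<inter> G = {}"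
      by (rule ball_meets_only_face[OF fin_s disj fl F(1) x(1,2) \<Omega> x(3)]) blast+
    then have "\<exists>V. open V \<and> x \<in> V \<and> V \<subseteq> \<Omega> \<and> V \<subseteq> - skeleton Fs \<and> (\<forall>G\<in>Fs - {F}. V \<inter> G = {})"
      by (intro exI[of _ "ball x \<rho>"]) auto
    from someI_ex[OF this] show "open (V x)" "x \<in> V x" "V x \<subseteq> \<Omega>" "V x \<subseteq> - skeleton Fs" "\<And>G. G \<in> Fs - {F} \<Longrightarrow> V x \<inter> G = {}"
      unfolding V_def by blast+
  qed
  have loc: "(LINT x|?M. \<phi> x * j x) = 0" if x: "x \<in> F - skeleton Fs" and \<phi>: "test_function (V x) \<phi>" for x \<phi>
  proof -
    have p0: "\<phi> y = 0" if "y \<notin> V x" for y using test_function_grad_0(1)[OF \<phi> that] .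
    have t1: "test_function (- skeleton Fs) \<phi>" and t2: "test_function \<Omega> \<phi>"
      using test_function_mono[OF \<phi>] V(3,4)[OF x] by blast+
    have z: "face_integral T'' G (A T'') (W T'') \<phi> = 0" if "G \<in> Fs" "G \<noteq> F" for T'' G
      using V(5)[OF x, of G] that p0 by (intro face_integral_eq_0) blast
    have "0 = (\<Sum>T\<in>Th. (LINT z|lborel. (A T *v W T z) \<bullet> grad \<phi> z) - (LINT z|lborel. f T z * \<phi> z))"
      using H[OF t2] by simp
    also have "\<dots> = (\<Sum>T\<in>Th. \<Sum>G\<in>faces_of Fs T. face_integral T G (A T) (W T) \<phi>)"
      by (intro sum.cong refl gauss_green_off_skeleton[OF m d t1])
    also have "\<dots> = (\<Sum>T''\<in>Th. if F \<in> faces_of Fs T'' then face_integral T'' F (A T'') (W T'') \<phi> else 0)"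
    proof (intro sum.cong refl)
      fix T'' assume "T'' \<in> Th"
      have fT: "finite (faces_of Fs T'')" using fin_s by (simp add: faces_of_def)
      show "(\<Sum>G\<in>faces_of Fs T''. face_integral T'' G (A T'') (W T'') \<phi>) = (if F \<in> faces_of Fs T'' then face_integral T'' F (A T'') (W T'') \<phi> else 0)"
      proof (cases "F \<in> faces_of Fs T''")
        case True
        have "(\<Sum>G\<in>faces_of Fs T'' - {F}. face_integral T'' G (A T'') (W T'') \<phi>) = 0"
          by (intro sum.neutral ballI z) (auto simp: faces_of_def)
        then show ?thesis using True fT by (simp add: sum.remove[of _ F])
      next
        case False
        then show ?thesis by (auto intro!: sum.neutral z simp: faces_of_def)
      qed
    qed
    also have "\<dots> = (\<Sum>T''\<in>{T, T'}. face_integral T'' F (A T'') (W T'') \<phi>)"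
    proof -
      have "{T'' \<in> Th. F \<in> faces_of Fs T''} = {T, T'}" using Th FT others by blast
      then show ?thesis using fin by (simp add: sum.If_cases Int_def)
    qed
    also have "\<dots> = face_integral T F (A T) (W T) \<phi> + face_integral T' F (A T') (W T') \<phi>"
      using cells(2) by simp
    also have "\<dots> = (LINT x|?M. ?q T x * \<phi> x) + (LINT x|?M. ?q T' x * \<phi> x)"
      by (simp add: face_integral_def hyp)
    also have "\<dots> = (LINT x|?M. ?q T x * \<phi> x + ?q T' x * \<phi> x)"
    proof (rule Bochner_Integration.integral_add[symmetric])
      obtain P where P: "P > 0" "\<And>x. \<bar>\<phi> x\<bar> \<le> P" using \<phi> by (rule test_function_bounded) blast
      have b: "\<phi> \<in> borel_measurable ?M" using borel_measurable_smooth[OF test_function_smooth[OF \<phi>]] by simp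
      show "integrable ?M (\<lambda>x. ?q T x * \<phi> x)" "integrable ?M (\<lambda>x. ?q T' x * \<phi> x)"
        by (rule integrable_mult_bounded[OF I(1) b P(2)] integrable_mult_bounded[OF I(2) b P(2)])+
    qed
    finally show ?thesis by (simp add: j_def algebra_simps)
  qed
  let ?U = "\<Union>x\<in>F - skeleton Fs. V x"
  \<comment> \<open>The fundamental lemma asks for all test functions supported in the union;
    localization reduces them to those supported in a single \<open>V x\<close>.\<close>
  have "AE x in ?M. x \<in> ?U \<longrightarrow> j x = 0"
  proof (rule AE_0_if_test_integrals_0[OF _ Ij])
    show "open ?U" using V(1) by blast
    fix \<phi> assume \<phi>: "test_function ?U \<phi>"
    show "(LINT x|?M. \<phi> x * j x) = 0"
    proof (rule test_function_localize[where L = "\<lambda>\<phi>. LINT x|?M. \<phi> x * j x", OF _ _ \<phi>])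
      fix \<phi> \<psi> :: "real^'n \<Rightarrow> real" assume t: "test_function UNIV \<phi>" "test_function UNIV \<psi>"
      have i: "integrable ?M (\<lambda>x. \<theta> x * j x)" if "test_function UNIV \<theta>" for \<theta>
      proof -
        obtain P where P: "P > 0" "\<And>x. \<bar>\<theta> x\<bar> \<le> P" using \<open>test_function UNIV \<theta>\<close> by (rule test_function_bounded) blast
        have b: "\<theta> \<in> borel_measurable ?M" using borel_measurable_smooth[OF test_function_smooth[OF that]] by simp
        show ?thesis using integrable_mult_bounded[OF Ij b P(2)] by (simp add: mult.commute)
      qed
      show "(LINT x|?M. (\<phi> x + \<psi> x) * j x) = (LINT x|?M. \<phi> x * j x) + (LINT x|?M. \<psi> x * j x)"
        using i[OF t(1)] i[OF t(2)] by (simp add: distrib_right)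
    next
      fix y assume "y \<in> ?U"
      then obtain x where x: "x \<in> F - skeleton Fs" "y \<in> V x" by blast
      then show "\<exists>V. open V \<and> y \<in> V \<and> (\<forall>\<psi>. test_function V \<psi> \<longrightarrow> (LINT x|?M. \<psi> x * j x) = 0)"
        using V(1)[OF x(1)] loc[OF x(1)] by blast
    qed
  qed simp
  moreover have "AE x in ?M. x \<in> F \<longrightarrow> x \<notin> skeleton Fs"
    by (rule AE_face_off_skeleton[OF fin_s fl F(1) face_like_nrm(1)[OF fl[OF F(1)]]]) (auto simp: hpl_def)
  ultimately have "AE x in ?M. j x = 0"
  proof eventually_elim
    fix x assume *: "x \<in> ?U \<longrightarrow> j x = 0" "x \<in> F \<longrightarrow> x \<notin> skeleton Fs"
    show "j x = 0"
    proof (cases "x \<in> F")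
      case True
      then have "x \<in> ?U" using * V(2)[of x] by blast
      then show ?thesis using * by blast
    qed (simp add: j_def)
  qed
  then have "(LINT x|?M. j x) = 0" by (rule integral_eq_zero_AE)
  then show ?thesis using I by (simp add: j_def[abs_def] face_integral_def hyp)
qed

section \<open>Boundary values of functions in H10\<close>

text \<open>A weighted Young inequality: a small weight \<open>\<eta>\<close> makes the fixed factor
  contribute little, and the vanishing norm of \<open>a k\<close> absorbs the inverse
  weight.\<close>

lemma integral_product_tendsto_0:
  fixes a :: "nat \<Rightarrow> 'a \<Rightarrow> real" and b :: "'a \<Rightarrow> real"
  assumes a: "\<And>k. a k \<in> borel_measurable M" "\<And>k. integrable M (\<lambda>x. (a k x)\<^sup>2)" "(\<lambda>k. LINT x|M. (a k x)\<^sup>2) \<longlonglongrightarrow> 0"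
    and b: "b \<in> borel_measurable M" "integrable M (\<lambda>x. (b x)\<^sup>2)"
  shows "(\<lambda>k. LINT x|M. a k x * b x) \<longlonglongrightarrow> 0"
proof (rule LIMSEQ_I)
  fix e :: real assume e: "e > 0"
  let ?b = "LINT x|M. (b x)\<^sup>2"
  have b0: "?b \<ge> 0" by (intro Bochner_Integration.integral_nonneg) auto
  define \<eta> where "\<eta> = e / (?b + 1)"
  have "e / (c + 1) > 0 \<and> e / (c + 1) * c < e" if "c \<ge> 0" for c
    using e that by (simp add: field_simps)
  from this[OF b0] have \<eta>: "\<eta> > 0" "\<eta> * ?b < e" by (auto simp: \<eta>_def)
  \<comment> \<open>With this threshold the two halves of the Young bound add up to exactly
    \<open>e\<close>.\<close>
  have "\<forall>\<^sub>F k in sequentially. (LINT x|M. (a k x)\<^sup>2) < \<eta> * (2 * e - \<eta> * ?b)"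
    using \<eta> e by (intro order_tendstoD(2)[OF a(3)] mult_pos_pos) auto
  then obtain N where N: "\<And>k. k \<ge> N \<Longrightarrow> (LINT x|M. (a k x)\<^sup>2) < \<eta> * (2 * e - \<eta> * ?b)"
    unfolding eventually_sequentially by blast
  show "\<exists>no. \<forall>k\<ge>no. norm ((LINT x|M. a k x * b x) - 0) < e"
  proof (intro exI[of _ N] allI impI)
    fix k assume k: "k \<ge> N"
    have pt: "\<bar>a k x * b x\<bar> \<le> (1 / (2 * \<eta>)) * (a k x)\<^sup>2 + (\<eta> / 2) * (b x)\<^sup>2" for x
    proof -
      have "0 \<le> (\<bar>a k x\<bar> - \<eta> * \<bar>b x\<bar>)\<^sup>2" by simp
      then have "2 * (\<bar>a k x\<bar> * \<bar>b x\<bar>) * \<eta> \<le> (a k x)\<^sup>2 + \<eta>\<^sup>2 * (b x)\<^sup>2"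
        by (simp add: power2_diff power_mult_distrib mult_ac)
      then show ?thesis using \<eta>(1) by (simp add: abs_mult field_simps power2_eq_square)
    qed
    have "\<bar>LINT x|M. a k x * b x\<bar> \<le> (LINT x|M. (1 / (2 * \<eta>)) * (a k x)\<^sup>2 + (\<eta> / 2) * (b x)\<^sup>2)"
      using pt a b by (intro integral_norm_le_AE Bochner_Integration.integrable_add integrable_mult_right borel_measurable_times) auto
    also have "\<dots> = (1 / (2 * \<eta>)) * (LINT x|M. (a k x)\<^sup>2) + (\<eta> / 2) * ?b"
      using a(2) b(2) by simp
    also have "\<dots> < (1 / (2 * \<eta>)) * (\<eta> * (2 * e - \<eta> * ?b)) + (\<eta> / 2) * ?b"
      using N[OF k] \<eta>(1) by (intro add_strict_right_mono mult_strict_left_mono) auto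
    also have "\<dots> = e" using \<eta>(1) by (simp add: field_simps)
    finally show "norm ((LINT x|M. a k x * b x) - 0) < e" by simp
  qed
qed

lemma L2_diff:
  assumes "open S" "bounded S" "L2 S f" "L2 S g"
  shows "L2 S (\<lambda>x. f x - g x)"
  unfolding L2_def
proof
  have "f \<in> borel_measurable (lebesgue_on S)" "g \<in> borel_measurable (lebesgue_on S)"
    and i: "integrable (lebesgue_on S) (\<lambda>x. (f x)\<^sup>2)" "integrable (lebesgue_on S) (\<lambda>x. (g x)\<^sup>2)"
    using assms by (auto simp: L2_def)
  then show d: "(\<lambda>x. f x - g x) \<in> borel_measurable (lebesgue_on S)" by simp
  show "integrable (lebesgue_on S) (\<lambda>x. (f x - g x)\<^sup>2)"
  proof (rule Bochner_Integration.integrable_bound)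
    show "integrable (lebesgue_on S) (\<lambda>x. 2 * (f x)\<^sup>2 + 2 * (g x)\<^sup>2)" using i by simp
    have "(f x - g x)\<^sup>2 \<le> 2 * (f x)\<^sup>2 + 2 * (g x)\<^sup>2" for x
      using zero_le_power2[of "f x + g x"] by (simp add: power2_eq_square algebra_simps)
    then show "AE x in lebesgue_on S. norm ((f x - g x)\<^sup>2) \<le> norm (2 * (f x)\<^sup>2 + 2 * (g x)\<^sup>2)"
      by (intro AE_I2) simp
  qed (use d in measurable)
qed

lemma L2_mult_integrable:
  assumes "L2 S f" "L2 S g"
  shows "integrable (lebesgue_on S) (\<lambda>x. f x * g x)"
proof (rule Bochner_Integration.integrable_bound)
  show "integrable (lebesgue_on S) (\<lambda>x. (f x)\<^sup>2 + (g x)\<^sup>2)" using assms by (simp add: L2_def)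
  have "\<bar>f x * g x\<bar> \<le> (f x)\<^sup>2 + (g x)\<^sup>2" for x
  proof -
    have "0 \<le> (\<bar>f x\<bar> - \<bar>g x\<bar>)\<^sup>2" by simp
    then have "2 * \<bar>f x * g x\<bar> \<le> (f x)\<^sup>2 + (g x)\<^sup>2" by (simp add: power2_diff abs_mult)
    then show ?thesis by simp
  qed
  then show "AE x in lebesgue_on S. norm (f x * g x) \<le> norm ((f x)\<^sup>2 + (g x)\<^sup>2)" by (intro AE_I2) simp
  show "(\<lambda>x. f x * g x) \<in> borel_measurable (lebesgue_on S)"
    using assms by (intro borel_measurable_times) (auto simp: L2_def)
qed

lemma weak_partial_diff:
  assumes "open S" "L2 S f" "L2 S g" "L2 S f'" "L2 S g'" "weak_partial S i f f'" "weak_partial S i g g'"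
  shows "weak_partial S i (\<lambda>x. f x - g x) (\<lambda>x. f' x - g' x)"
  unfolding weak_partial_def
proof (intro allI impI)
  fix \<phi> assume \<phi>: "test_function S \<phi>"
  have l: "L2 S \<phi>" "L2 S (partial_deriv i \<phi>)"
    using L2_test_function[OF assms(1) \<phi>] L2_test_function[OF assms(1) test_function_grad[OF \<phi>]] by auto
  have "(LINT x|lebesgue_on S. (f x - g x) * partial_deriv i \<phi> x) = (LINT x|lebesgue_on S. f x * partial_deriv i \<phi> x) - (LINT x|lebesgue_on S. g x * partial_deriv i \<phi> x)"
    using L2_mult_integrable[OF assms(2) l(2)] L2_mult_integrable[OF assms(3) l(2)] by (simp add: left_diff_distrib)
  moreover have "(LINT x|lebesgue_on S. (f' x - g' x) * \<phi> x) = (LINT x|lebesgue_on S. f' x * \<phi> x) - (LINT x|lebesgue_on S. g' x * \<phi> x)"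
    using L2_mult_integrable[OF assms(4) l(1)] L2_mult_integrable[OF assms(5) l(1)] by (simp add: left_diff_distrib)
  ultimately show "(LINT x|lebesgue_on S. (f x - g x) * partial_deriv i \<phi> x) = - (LINT x|lebesgue_on S. (f' x - g' x) * \<phi> x)"
    using assms(6,7) \<phi> by (simp add: weak_partial_def)
qed

text \<open>For the approximating test functions of \<open>\<Omega>\<close>, integration by parts
  holds against every \<open>\<psi>\<close>, also one that is nonzero on the boundary, and both
  sides pass to the limit in the H1 norm. So the zero extension of \<open>u\<close> acquires no
  singular derivative on the boundary.\<close>

lemma H10_extension:
  fixes \<Omega> :: "(real^'n) set"
  assumes \<Omega>: "open \<Omega>" "bounded \<Omega>" and u: "H10 \<Omega> u" and \<psi>: "test_function UNIV \<psi>"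
  shows "(LINT x|lebesgue_on \<Omega>. u x * partial_deriv i \<psi> x) = - (LINT x|lebesgue_on \<Omega>. wgrad \<Omega> u x $ i * \<psi> x)"
proof -
  let ?M = "lebesgue_on \<Omega>"
  have H1: "H1 \<Omega> u" using u by (simp add: H10_def)
  then have Lu: "L2 \<Omega> u" by (simp add: H1_def)
  note Lg = H1_wgrad[OF H1]
  obtain \<phi> where \<phi>: "\<And>k::nat. test_function \<Omega> (\<phi> k)" and lim: "(\<lambda>k. H1_norm \<Omega> (\<lambda>x. \<phi> k x - u x)) \<longlonglongrightarrow> 0"
    using u by (auto simp: H10_def)
  note L\<phi> = L2_test_function[OF \<Omega>(1) \<phi>] L2_test_function[OF \<Omega>(1) test_function_grad[OF \<phi>]]
  note L\<psi> = L2_test_function[OF \<Omega>(1) \<psi>] L2_test_function[OF \<Omega>(1) test_function_grad[OF \<psi>]]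
  have Ld: "L2 \<Omega> (\<lambda>x. \<phi> k x - u x)" "\<And>i. L2 \<Omega> (\<lambda>x. partial_deriv i (\<phi> k) x - wgrad \<Omega> u x $ i)" for k
    by (intro L2_diff \<Omega> L\<phi> Lu Lg)+
  \<comment> \<open>\<open>H1_norm\<close> refers to the gradient chosen for the difference, which
    is first identified with the difference of the gradients.\<close>
  have "AE x in lborel. x \<in> \<Omega> \<longrightarrow> wgrad \<Omega> (\<lambda>x. \<phi> k x - u x) x = (\<chi> i. partial_deriv i (\<phi> k) x - wgrad \<Omega> u x $ i)" for k
    using Ld by (intro wgrad_eq_AE[OF \<Omega>]) (auto intro!: weak_partial_diff \<Omega> L\<phi> Lu Lg weak_partial_test_function \<phi>)
  then have wg: "AE x in ?M. wgrad \<Omega> (\<lambda>x. \<phi> k x - u x) x = (\<chi> i. partial_deriv i (\<phi> k) x - wgrad \<Omega> u x $ i)" for k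
    using \<Omega>(1) by (intro AE_lebesgue_on) auto
  let ?a = "\<lambda>k x. \<phi> k x - u x" and ?b = "\<lambda>k x. partial_deriv i (\<phi> k) x - wgrad \<Omega> u x $ i"
  have gsum: "(norm (\<chi> i. partial_deriv i (\<phi> k) x - wgrad \<Omega> u x $ i))\<^sup>2 = (\<Sum>i\<in>UNIV. (partial_deriv i (\<phi> k) x - wgrad \<Omega> u x $ i)\<^sup>2)" for k x
    by (simp add: norm_vec_def L2_set_def sum_nonneg)
  have nm: "(H1_norm \<Omega> (?a k))\<^sup>2 = (LINT x|?M. (?a k x)\<^sup>2) + (LINT x|?M. (\<Sum>i\<in>UNIV. (partial_deriv i (\<phi> k) x - wgrad \<Omega> u x $ i)\<^sup>2))" for k
  proof -
    have "(LINT x|?M. (norm (wgrad \<Omega> (?a k) x))\<^sup>2) = (LINT x|?M. (\<Sum>i\<in>UNIV. (partial_deriv i (\<phi> k) x - wgrad \<Omega> u x $ i)\<^sup>2))"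
    proof (rule integral_cong_AE)
      show s: "(\<lambda>x. \<Sum>i\<in>UNIV. (partial_deriv i (\<phi> k) x - wgrad \<Omega> u x $ i)\<^sup>2) \<in> borel_measurable ?M"
        using Ld(2) by (intro borel_measurable_sum borel_measurable_power) (simp add: L2_def)
      show ae: "AE x in ?M. (norm (wgrad \<Omega> (?a k) x))\<^sup>2 = (\<Sum>i\<in>UNIV. (partial_deriv i (\<phi> k) x - wgrad \<Omega> u x $ i)\<^sup>2)"
        using wg[of k] by eventually_elim (simp only: gsum)
      show "(\<lambda>x. (norm (wgrad \<Omega> (?a k) x))\<^sup>2) \<in> borel_measurable ?M"
        by (rule borel_measurable_lebesgue_on_AE[OF _ s]) (use ae \<Omega>(1) in \<open>auto elim!: eventually_mono\<close>)
    qed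
    then show ?thesis
      unfolding H1_norm_def by (subst real_sqrt_pow2) (auto intro!: add_nonneg_nonneg Bochner_Integration.integral_nonneg sum_nonneg)
  qed
  have sq: "(\<lambda>k. (H1_norm \<Omega> (?a k))\<^sup>2) \<longlonglongrightarrow> 0" using tendsto_power[OF lim, of 2] by simp
  have i1: "integrable ?M (\<lambda>x. (?a k x)\<^sup>2)" and i2: "integrable ?M (\<lambda>x. (?b k x)\<^sup>2)" for k using Ld by (auto simp: L2_def)
  have a0: "(\<lambda>k. LINT x|?M. (?a k x)\<^sup>2) \<longlonglongrightarrow> 0"
    by (rule tendsto_sandwich[OF _ _ tendsto_const sq])
      (auto intro!: always_eventually Bochner_Integration.integral_nonneg sum_nonneg simp: nm)
  have b0: "(\<lambda>k. LINT x|?M. (?b k x)\<^sup>2) \<longlonglongrightarrow> 0"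
  proof (rule tendsto_sandwich[OF _ _ tendsto_const sq])
    have "(LINT x|?M. (?b k x)\<^sup>2) \<le> (H1_norm \<Omega> (?a k))\<^sup>2" for k
    proof -
      have "(LINT x|?M. (?b k x)\<^sup>2) \<le> (LINT x|?M. (\<Sum>i\<in>UNIV. (partial_deriv i (\<phi> k) x - wgrad \<Omega> u x $ i)\<^sup>2))"
      proof (rule integral_mono[OF i2])
        show "integrable ?M (\<lambda>x. \<Sum>i\<in>UNIV. (partial_deriv i (\<phi> k) x - wgrad \<Omega> u x $ i)\<^sup>2)"
          using Ld(2) by (intro Bochner_Integration.integrable_sum) (simp add: L2_def)
        show "(?b k x)\<^sup>2 \<le> (\<Sum>i\<in>UNIV. (partial_deriv i (\<phi> k) x - wgrad \<Omega> u x $ i)\<^sup>2)" for x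
          by (rule member_le_sum) auto
      qed
      also have "\<dots> \<le> (H1_norm \<Omega> (?a k))\<^sup>2"
        unfolding nm by (simp add: Bochner_Integration.integral_nonneg)
      finally show ?thesis .
    qed
    then show "\<forall>\<^sub>F k in sequentially. (LINT x|?M. (?b k x)\<^sup>2) \<le> (H1_norm \<Omega> (?a k))\<^sup>2" by (simp add: always_eventually)
  qed (auto intro!: always_eventually Bochner_Integration.integral_nonneg)
  have l1: "(\<lambda>k. LINT x|?M. ?a k x * partial_deriv i \<psi> x) \<longlonglongrightarrow> 0"
    using Ld L\<psi> by (intro integral_product_tendsto_0 a0 i1) (auto simp: L2_def)
  have l2: "(\<lambda>k. LINT x|?M. ?b k x * \<psi> x) \<longlonglongrightarrow> 0"
    using Ld L\<psi> by (intro integral_product_tendsto_0 b0 i2) (auto simp: L2_def)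
  have eq: "(LINT x|?M. \<phi> k x * partial_deriv i \<psi> x) = - (LINT x|?M. partial_deriv i (\<phi> k) x * \<psi> x)" for k
  proof -
    have sm: "smooth (\<phi> k)" "smooth \<psi>" using \<phi> \<psi> by (auto dest: test_function_smooth)
    have b: "\<phi> k \<in> borel_measurable borel" "\<psi> \<in> borel_measurable borel" "partial_deriv i \<psi> \<in> borel_measurable borel"
      "partial_deriv i (\<phi> k) \<in> borel_measurable borel"
      using sm by (auto intro: borel_measurable_smooth borel_measurable_partial_deriv)
    have "(LINT x|?M. \<phi> k x * partial_deriv i \<psi> x) = (LINT x|lborel. \<phi> k x * partial_deriv i \<psi> x)"
      using \<Omega>(1) b test_function_grad_0(1)[OF \<phi>[of k]]
      by (intro integral_lebesgue_on_representative borel_measurable_lebesgue_on_borel) auto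
    also have "\<dots> = - (LINT x|lborel. partial_deriv i (\<phi> k) x * \<psi> x)"
      using integral_by_parts_test_function[OF \<phi>[of k] sm(2), of "axis i 1"] by (simp add: inner_axis')
    also have "(LINT x|lborel. partial_deriv i (\<phi> k) x * \<psi> x) = (LINT x|?M. partial_deriv i (\<phi> k) x * \<psi> x)"
      using \<Omega>(1) b test_function_grad_0(1)[OF test_function_grad[OF \<phi>[of k]]]
      by (intro integral_lebesgue_on_representative[symmetric] borel_measurable_lebesgue_on_borel) auto
    finally show ?thesis .
  qed
  have e1: "(LINT x|?M. ?a k x * partial_deriv i \<psi> x) = (LINT x|?M. \<phi> k x * partial_deriv i \<psi> x) - (LINT x|?M. u x * partial_deriv i \<psi> x)" for k
    using L2_mult_integrable[OF L\<phi>(1) L\<psi>(2)] L2_mult_integrable[OF Lu L\<psi>(2)] by (simp add: left_diff_distrib)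
  have e2: "(LINT x|?M. ?b k x * \<psi> x) = (LINT x|?M. partial_deriv i (\<phi> k) x * \<psi> x) - (LINT x|?M. wgrad \<Omega> u x $ i * \<psi> x)" for k
    using L2_mult_integrable[OF L\<phi>(2) L\<psi>(1)] L2_mult_integrable[OF Lg(1) L\<psi>(1)] by (simp add: left_diff_distrib)
  have "(\<lambda>k. (LINT x|?M. ?a k x * partial_deriv i \<psi> x) + (LINT x|?M. ?b k x * \<psi> x)) \<longlonglongrightarrow> 0 + 0"
    by (intro tendsto_add l1 l2)
  moreover have "(LINT x|?M. ?a k x * partial_deriv i \<psi> x) + (LINT x|?M. ?b k x * \<psi> x)
      = - (LINT x|?M. u x * partial_deriv i \<psi> x) - (LINT x|?M. wgrad \<Omega> u x $ i * \<psi> x)" for k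
    unfolding e1 e2 eq by simp
  ultimately have "- (LINT x|?M. u x * partial_deriv i \<psi> x) - (LINT x|?M. wgrad \<Omega> u x $ i * \<psi> x) = 0 + 0"
    by (simp add: LIMSEQ_const_iff)
  then show ?thesis by simp
qed

lemma indefinite_integral_isCont:
  fixes g :: "real \<Rightarrow> real"
  assumes g: "integrable lborel g"
  shows "isCont (\<lambda>t. LINT r|lborel. indicator {0..t} r * g r) a"
proof (rule continuous_at_sequentiallyI)
  fix S :: "nat \<Rightarrow> real" assume S: "S \<longlonglongrightarrow> a"
  show "(\<lambda>k. LINT r|lborel. indicator {0..S k} r * g r) \<longlonglongrightarrow> (LINT r|lborel. indicator {0..a} r * g r)"
  proof (rule integral_dominated_convergence[where w = "\<lambda>r. \<bar>g r\<bar>"])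
    have "AE r in lborel. r \<noteq> a" by (rule AE_lborel_singleton)
    then show "AE r in lborel. (\<lambda>k. indicator {0..S k} r * g r) \<longlonglongrightarrow> indicator {0..a} r * g r"
    proof eventually_elim
      fix r :: real assume "r \<noteq> a"
      have "\<forall>\<^sub>F k in sequentially. indicator {0..S k} r * g r = indicator {0..a} r * g r"
      proof (cases "r < a")
        case True
        with S have "\<forall>\<^sub>F k in sequentially. r < S k" by (intro order_tendstoD(1)) auto
        then show ?thesis by eventually_elim (use True \<open>r \<noteq> a\<close> in \<open>auto simp: indicator_def\<close>)
      next
        case False
        with S \<open>r \<noteq> a\<close> have "\<forall>\<^sub>F k in sequentially. S k < r" by (intro order_tendstoD(2)) auto
        then show ?thesis by eventually_elim (use False \<open>r \<noteq> a\<close> in \<open>auto simp: indicator_def\<close>)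
      qed
      then show "(\<lambda>k. indicator {0..S k} r * g r) \<longlonglongrightarrow> indicator {0..a} r * g r"
        by (rule tendsto_eventually)
    qed
  qed (use g in \<open>auto simp: indicator_def\<close>)
qed

lemma AE_hyp_obtain:
  fixes n :: "real^'n"
  assumes "AE x in hyp n c. P x" "norm n = 1" "open U" "y \<in> U" "n \<bullet> y = c"
  obtains x where "x \<in> U" "n \<bullet> x = c" "P x"
proof (rule ccontr)
  assume "\<not> thesis"
  then have "\<And>x. P x \<Longrightarrow> x \<notin> U \<inter> {x. n \<bullet> x = c}" using that by blast
  then have "AE x in hyp n c. x \<notin> U \<inter> {x. n \<bullet> x = c}" using assms(1) by (auto elim!: eventually_mono)
  moreover have "U \<inter> {x. n \<bullet> x = c} \<in> sets (hyp n c)"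
    using assms(3) closed_hyperplane[of n c] by (auto intro!: sets.Int)
  ultimately have "emeasure (hyp n c) (U \<inter> {x. n \<bullet> x = c}) = 0"
    by (subst (asm) AE_iff_null_sets[symmetric]) auto
  then show False using emeasure_hyp_pos[OF assms(2-5)] by simp
qed

text \<open>By \<open>H10_extension\<close> the zero extension is weakly differentiable on the whole
  space, so the results on lines apply across the boundary.\<close>

lemma H10_weak_dd:
  fixes \<Omega> :: "(real^'n) set"
  assumes \<Omega>: "open \<Omega>" "bounded \<Omega>" and u: "H10 \<Omega> u"
  obtains u' g where "\<And>v. weak_dd UNIV v u' (g v)" "\<And>z. z \<notin> \<Omega> \<Longrightarrow> u' z = 0" "AE z in lborel. z \<in> \<Omega> \<longrightarrow> u z = u' z"
proof -
  have H1: "H1 \<Omega> u" using u by (simp add: H10_def)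
  then have Lu: "L2 \<Omega> u" by (simp add: H1_def)
  obtain u' where u': "u' \<in> borel_measurable borel" "integrable lborel u'" "\<And>x. x \<notin> \<Omega> \<Longrightarrow> u' x = 0" "AE x in lborel. x \<in> \<Omega> \<longrightarrow> u x = u' x"
    by (rule L2_representative[OF \<Omega> Lu]) blast
  define G where "G i = (SOME g'. g' \<in> borel_measurable borel \<and> integrable lborel g' \<and> (\<forall>x. x \<notin> \<Omega> \<longrightarrow> g' x = 0) \<and>
    (AE x in lborel. x \<in> \<Omega> \<longrightarrow> wgrad \<Omega> u x $ i = g' x))" for i
  have G: "G i \<in> borel_measurable borel" "integrable lborel (G i)" "\<And>x. x \<notin> \<Omega> \<Longrightarrow> G i x = 0"
    "AE x in lborel. x \<in> \<Omega> \<longrightarrow> wgrad \<Omega> u x $ i = G i x" for i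
  proof -
    obtain g' where "g' \<in> borel_measurable borel" "integrable lborel g'" "\<And>x. x \<notin> \<Omega> \<Longrightarrow> g' x = 0"
      "AE x in lborel. x \<in> \<Omega> \<longrightarrow> wgrad \<Omega> u x $ i = g' x"
      by (rule L2_representative[OF \<Omega> H1_wgrad(1)[OF H1, of i]]) blast
    then have "\<exists>g'. g' \<in> borel_measurable borel \<and> integrable lborel g' \<and> (\<forall>x. x \<notin> \<Omega> \<longrightarrow> g' x = 0) \<and>
      (AE x in lborel. x \<in> \<Omega> \<longrightarrow> wgrad \<Omega> u x $ i = g' x)" by blast
    from someI_ex[OF this] show "G i \<in> borel_measurable borel" "integrable lborel (G i)" "\<And>x. x \<notin> \<Omega> \<Longrightarrow> G i x = 0"
      "AE x in lborel. x \<in> \<Omega> \<longrightarrow> wgrad \<Omega> u x $ i = G i x"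
      unfolding G_def by blast+
  qed
  have "weak_dd UNIV (axis i 1) u' (G i)" for i
    unfolding weak_dd_def
  proof (intro conjI allI impI)
    fix \<psi> :: "real^'n \<Rightarrow> real" assume \<psi>: "test_function UNIV \<psi>"
    have sm: "smooth \<psi>" using \<psi> by (rule test_function_smooth)
    have b: "\<psi> \<in> borel_measurable borel" "partial_deriv i \<psi> \<in> borel_measurable borel"
      using sm by (auto intro: borel_measurable_smooth borel_measurable_partial_deriv)
    have ml: "u \<in> borel_measurable (lebesgue_on \<Omega>)" "(\<lambda>x. wgrad \<Omega> u x $ i) \<in> borel_measurable (lebesgue_on \<Omega>)"
      using Lu H1_wgrad(1)[OF H1, of i] by (auto simp: L2_def)
    note bl = b[THEN borel_measurable_lebesgue_on_borel, of \<Omega>]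
    have "(LINT x|lebesgue_on \<Omega>. u x * partial_deriv i \<psi> x) = (LINT x|lborel. u' x * partial_deriv i \<psi> x)"
      using \<Omega>(1) b bl u' ml by (intro integral_lebesgue_on_representative borel_measurable_times)
        (auto elim!: eventually_mono)
    moreover have "(LINT x|lebesgue_on \<Omega>. wgrad \<Omega> u x $ i * \<psi> x) = (LINT x|lborel. G i x * \<psi> x)"
      using \<Omega>(1) b bl G(1,2,4)[of i] G(3)[of _ i] ml by (intro integral_lebesgue_on_representative borel_measurable_times)
        (auto elim!: eventually_mono)
    ultimately show "(LINT x|lborel. u' x * (axis i 1 \<bullet> grad \<psi> x)) = - (LINT x|lborel. G i x * \<psi> x)"
      using H10_extension[OF \<Omega> u \<psi>, of i] by (simp add: inner_axis')
  qed (use u' G in auto)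
  then have "weak_dd UNIV v u' (\<lambda>x. \<Sum>j\<in>UNIV. v $ j * G j x)" for v by (rule weak_dd_sum)
  then show ?thesis using that[of u' "\<lambda>v x. \<Sum>j\<in>UNIV. v $ j * G j x"] u' by blast
qed

text \<open>Slightly outside of the domain the extension by zero vanishes; integrating its derivative
  along a normal line back into the domain gives the boundary value zero.\<close>

lemma H10_boundary_value:
  fixes \<Omega> :: "(real^'n) set"
  assumes \<Omega>: "open \<Omega>" "bounded \<Omega>" "interior (closure \<Omega>) = \<Omega>" and u: "H10 \<Omega> u" and cont: "continuous_on (closure \<Omega>) u"
    and fin: "finite Fs" and fl: "\<And>F. F \<in> Fs \<Longrightarrow> face_like F" and fr: "frontier \<Omega> \<subseteq> (\<Union>F\<in>Fs. closure F)"
    and F: "F \<in> Fs" "F \<subseteq> frontier \<Omega>" "x \<in> F"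
  shows "u x = 0"
proof (rule ccontr)
  assume ux: "u x \<noteq> 0"
  have xc: "x \<in> closure \<Omega>" using F by (auto simp: frontier_def)
  have "\<bar>u x\<bar> > 0" using ux by simp
  \<comment> \<open>Continuity keeps \<open>u\<close> away from zero near \<open>x\<close>, so
    \<open>x\<close> may be replaced by a nearby point of the face off the skeleton.\<close>
  then obtain r where r: "r > 0" "\<And>y. y \<in> closure \<Omega> \<Longrightarrow> dist y x < r \<Longrightarrow> dist (u y) (u x) < \<bar>u x\<bar>"
    using cont xc unfolding continuous_on_iff by blast
  then have nz: "u y \<noteq> 0" if "y \<in> closure \<Omega>" "dist y x < r" for y
    using that by (force simp: dist_real_def)
  note nF = face_like_nrm[OF fl[OF F(1)]]
  obtain O' where O': "open O'" "F = hpl F \<inter> O'" using nF(5) by (auto simp: openin_open)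
  have "AE x in hyp (nrm F) (off F). x \<in> F \<longrightarrow> x \<notin> skeleton Fs"
    by (rule AE_face_off_skeleton[OF fin fl F(1) nF(1)]) (auto simp: hpl_def)
  then obtain x2 where x2: "x2 \<in> O' \<inter> ball x r" "nrm F \<bullet> x2 = off F" "x2 \<in> F \<longrightarrow> x2 \<notin> skeleton Fs"
  proof (rule AE_hyp_obtain)
    show "open (O' \<inter> ball x r)" using O' by auto
    show "x \<in> O' \<inter> ball x r" "nrm F \<bullet> x = off F" using F(3) O'(2) r(1) nF(2) by (auto simp: hpl_def)
  qed (use nF(1) in blast)+
  then have x2F: "x2 \<in> F" "x2 \<notin> skeleton Fs" using O'(2) by (auto simp: hpl_def)
  have x2H: "x2 \<in> hpl F" using x2F nF(2) by blast
  obtain \<rho>1 where \<rho>1: "\<rho>1 > 0" "\<And>G. G \<in> Fs \<Longrightarrow> ball x2 \<rho>1 \<inter> hpl G \<noteq> {} \<Longrightarrow> hpl G = hpl F"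
    by (rule ball_off_skeleton[OF fin fl x2F(2) F(1) x2H]) blast+
  obtain \<rho>2 where \<rho>2: "\<rho>2 > 0" "ball x2 \<rho>2 \<subseteq> ball x r"
    using openE[OF open_ball, of x2 x r] x2(1) by blast
  define \<rho> where "\<rho> = min \<rho>1 \<rho>2"
  have \<rho>: "\<rho> > 0" "ball x2 \<rho> \<subseteq> ball x2 \<rho>1" "ball x2 \<rho> \<subseteq> ball x r"
    using \<rho>1 \<rho>2 by (auto simp: \<rho>_def)
  have frH: "frontier \<Omega> \<inter> ball x2 \<rho> \<subseteq> hpl F"
  proof
    fix z assume z: "z \<in> frontier \<Omega> \<inter> ball x2 \<rho>"
    then obtain G where G: "G \<in> Fs" "z \<in> closure G" using fr by blast
    then have "z \<in> hpl G" using face_like_nrm(4)[OF fl[OF G(1)]] by blast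
    then show "z \<in> hpl F" using \<rho>1(2)[OF G(1)] z \<rho>(2) by blast
  qed
  have "x2 \<in> frontier \<Omega>" using x2F F(2) by blast
  then have "(\<forall>z\<in>ball x2 \<rho>. z \<in> \<Omega> \<longleftrightarrow> nrm F \<bullet> z < off F) \<or> (\<forall>z\<in>ball x2 \<rho>. z \<in> \<Omega> \<longleftrightarrow> (- nrm F) \<bullet> z < - off F)"
    using frH by (intro half_ball[OF \<Omega>(1,3) _ nF(1) x2(2) \<rho>(1)]) (auto simp: hpl_def)
  then obtain n c where n: "norm n = 1" "n \<bullet> x2 = c" and V: "\<And>z. z \<in> ball x2 \<rho> \<Longrightarrow> z \<in> \<Omega> \<longleftrightarrow> n \<bullet> z < c"
  proof
    assume "\<forall>z\<in>ball x2 \<rho>. z \<in> \<Omega> \<longleftrightarrow> nrm F \<bullet> z < off F"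
    then show ?thesis using that[of "nrm F" "off F"] nF(1) x2(2) by auto
  next
    assume "\<forall>z\<in>ball x2 \<rho>. z \<in> \<Omega> \<longleftrightarrow> (- nrm F) \<bullet> z < - off F"
    then show ?thesis using that[of "- nrm F" "- off F"] nF(1) x2(2) by auto
  qed
  have nn: "n \<bullet> n = 1" using n(1) by (simp add: dot_square_norm)
  obtain u' g where wd: "\<And>v. weak_dd UNIV v u' (g v)" and u0: "\<And>z. z \<notin> \<Omega> \<Longrightarrow> u' z = 0"
    and ae: "AE z in lborel. z \<in> \<Omega> \<longrightarrow> u z = u' z"
    by (rule H10_weak_dd[OF \<Omega>(1,2) u]) blast
  \<comment> \<open>Lines start at height \<open>\<delta>\<close> outside and are followed for the
    length \<open>2 * \<delta>\<close>: they cross the boundary at \<open>t = \<delta>\<close> and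
    stay in the ball of radius \<open>\<rho>\<close>.\<close>
  define \<delta> where "\<delta> = \<rho> / 4"
  have \<delta>: "\<delta> > 0" using \<rho> by (simp add: \<delta>_def)
  have "AE y in hyp n (c + \<delta>). \<exists>\<tau>. normal_trace_at UNIV n u' (g n) y \<tau>"
    by (rule normal_trace_exists[OF open_UNIV n(1) wd])
  moreover have "AE y in hyp n (c + \<delta>). AE t in lborel. y + t *\<^sub>R n \<in> \<Omega> \<longrightarrow> u (y + t *\<^sub>R n) = u' (y + t *\<^sub>R n)"
    by (rule AE_hyp[OF n(1) ae])
  ultimately have "AE y in hyp n (c + \<delta>). (\<exists>\<tau>. normal_trace_at UNIV n u' (g n) y \<tau>) \<and>
      (AE t in lborel. y + t *\<^sub>R n \<in> \<Omega> \<longrightarrow> u (y + t *\<^sub>R n) = u' (y + t *\<^sub>R n))"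
    by (rule eventually_conj)
  then obtain y where y: "y \<in> ball (x2 + \<delta> *\<^sub>R n) \<delta>" "n \<bullet> y = c + \<delta>" "(\<exists>\<tau>. normal_trace_at UNIV n u' (g n) y \<tau>) \<and>
      (AE t in lborel. y + t *\<^sub>R n \<in> \<Omega> \<longrightarrow> u (y + t *\<^sub>R n) = u' (y + t *\<^sub>R n))"
    by (rule AE_hyp_obtain[where n = n and c = "c + \<delta>" and U = "ball (x2 + \<delta> *\<^sub>R n) \<delta>" and y = "x2 + \<delta> *\<^sub>R n", OF _ n(1)])
      (use n nn \<delta> in \<open>auto simp: inner_simps\<close>)
  then obtain \<tau> where \<tau>: "normal_trace_at UNIV n u' (g n) y \<tau>" by blast
  have "AE t in lborel. y + (0 + (-1) * t) *\<^sub>R n \<in> \<Omega> \<longrightarrow> u (y + (0 + (-1) * t) *\<^sub>R n) = u' (y + (0 + (-1) * t) *\<^sub>R n)"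
    using y(3) by (intro AE_lborel_affine) auto
  then have uu: "AE t in lborel. y - t *\<^sub>R n \<in> \<Omega> \<longrightarrow> u (y - t *\<^sub>R n) = u' (y - t *\<^sub>R n)" by simp
  define h where "h t = \<tau> - (LINT r|lborel. indicator {0..t} r * g n (y - r *\<^sub>R n))" for t
  have hh: "AE t in lborel. 0 < t \<and> t < 2 * \<delta> \<longrightarrow> u' (y - t *\<^sub>R n) = h t"
    using \<tau> \<delta> by (simp add: normal_trace_at_def h_def)
  have "isCont h \<delta>"
    unfolding h_def using \<tau> by (intro continuous_intros indefinite_integral_isCont) (simp add: normal_trace_at_def)
  have inb: "y - t *\<^sub>R n \<in> ball x2 \<rho>" if "0 < t" "t < 2 * \<delta>" for t
  proof -
    have "dist x2 (y - t *\<^sub>R n) = norm ((x2 + \<delta> *\<^sub>R n - y) + (t - \<delta>) *\<^sub>R n)" by (simp add: dist_norm algebra_simps)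
    also have "\<dots> \<le> norm (x2 + \<delta> *\<^sub>R n - y) + norm ((t - \<delta>) *\<^sub>R n)" by (rule norm_triangle_ineq)
    also have "\<dots> < \<delta> + \<delta>" using y(1) that n(1) by (intro add_less_le_mono) (auto simp: dist_norm)
    finally show ?thesis using \<delta> by (simp add: \<delta>_def)
  qed
  have side: "n \<bullet> (y - t *\<^sub>R n) = c + \<delta> - t" for t using y(2) by (simp add: inner_simps nn)
  have in\<Omega>: "y - t *\<^sub>R n \<in> \<Omega>" if "\<delta> < t" "t < 2 * \<delta>" for t
    using V[OF inb] side[of t] that \<delta> by simp
  have out\<Omega>: "y - t *\<^sub>R n \<notin> \<Omega>" if "0 < t" "t < \<delta>" for t
    using V[OF inb] side[of t] that \<delta> by simp
  let ?x = "y - \<delta> *\<^sub>R n"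
  have xb: "?x \<in> ball x2 \<rho>" using inb[of \<delta>] \<delta> by simp
  have tend: "((\<lambda>t. y - t *\<^sub>R n) \<longlongrightarrow> ?x) (at_right \<delta>)" by (intro tendsto_intros)
  have ev\<Omega>: "\<forall>\<^sub>F t in at_right \<delta>. y - t *\<^sub>R n \<in> closure \<Omega>"
    unfolding eventually_at_right_field using in\<Omega> closure_subset[of \<Omega>] \<delta>
    by (intro exI[of _ "2 * \<delta>"]) auto
  have xcl: "?x \<in> closure \<Omega>"
    by (rule Lim_in_closed_set[OF closed_closure ev\<Omega> _ tend]) simp
  have ulim: "((\<lambda>t. u (y - t *\<^sub>R n)) \<longlongrightarrow> u ?x) (at_right \<delta>)"
    by (rule continuous_on_tendsto_compose[OF cont tend xcl ev\<Omega>])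
  \<comment> \<open>Three comparisons with error below \<open>e\<close> will give
    \<open>\<bar>u ?x\<bar> < 3 * e\<close>, a contradiction.\<close>
  define e where "e = \<bar>u ?x\<bar> / 4"
  have e: "e > 0" using nz[OF xcl] xb \<rho>(3) by (auto simp: e_def dist_commute)
  have "\<forall>\<^sub>F t in at_right \<delta>. dist (u (y - t *\<^sub>R n)) (u ?x) < e" by (rule tendstoD[OF ulim e])
  then obtain b1 where b1: "b1 > \<delta>" "\<And>t. \<delta> < t \<Longrightarrow> t < b1 \<Longrightarrow> \<bar>u (y - t *\<^sub>R n) - u ?x\<bar> < e"
    unfolding eventually_at_right_field dist_real_def by blast
  obtain b2 where b2: "b2 > 0" "\<And>t. \<bar>t - \<delta>\<bar> < b2 \<Longrightarrow> \<bar>h t - h \<delta>\<bar> < e"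
    using \<open>isCont h \<delta>\<close> e unfolding continuous_at_eps_delta by (metis dist_real_def)
  \<comment> \<open>Small enough for both continuity estimates and for \<open>t1\<close> and
    \<open>t2\<close> to stay between 0 and \<open>2 * \<delta>\<close>.\<close>
  define m where "m = min (b1 - \<delta>) (min b2 \<delta>)"
  have m: "m > 0" "m \<le> b1 - \<delta>" "m \<le> b2" "m \<le> \<delta>" using b1 b2 \<delta> by (auto simp: m_def)
  obtain t1 where t1: "\<delta> - m < t1" "t1 < \<delta>" "0 < t1 \<and> t1 < 2 * \<delta> \<longrightarrow> u' (y - t1 *\<^sub>R n) = h t1"
    by (rule AE_lborel_obtain[OF hh, of "\<delta> - m" \<delta>]) (use m in auto)
  have "h t1 = 0" using t1 m out\<Omega>[of t1] u0 by simp
  then have 1: "\<bar>h \<delta>\<bar> < e" using b2(2)[of t1] t1 m by simp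
  obtain t2 where t2: "\<delta> < t2" "t2 < \<delta> + m" "(0 < t2 \<and> t2 < 2 * \<delta> \<longrightarrow> u' (y - t2 *\<^sub>R n) = h t2) \<and>
      (y - t2 *\<^sub>R n \<in> \<Omega> \<longrightarrow> u (y - t2 *\<^sub>R n) = u' (y - t2 *\<^sub>R n))"
    by (rule AE_lborel_obtain[OF eventually_conj[OF hh uu], of \<delta> "\<delta> + m"]) (use m in auto)
  have "u (y - t2 *\<^sub>R n) = h t2" using t2 m \<delta> in\<Omega>[of t2] by simp
  moreover have "\<bar>h t2 - h \<delta>\<bar> < e" using b2(2)[of t2] t2 m by simp
  moreover have "\<bar>u (y - t2 *\<^sub>R n) - u ?x\<bar> < e" using b1(2)[of t2] t2 m by simp
  ultimately have "\<bar>u ?x\<bar> < 3 * e" using 1 by linarith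
  then show False using e by (simp add: e_def)
qed


section \<open>Eigenvalues of symmetric matrices\<close>

lemma symmetric_inner:
  fixes A :: "real^'n^'n"
  assumes "transpose A = A"
  shows "(A *v x) \<bullet> y = x \<bullet> (A *v y)"
  using dot_lmul_matrix[of x A y] assms by (metis transpose_matrix_vector vector_transpose_matrix)

text \<open>The quadratic form attains its maximum \<open>l\<close> on the unit sphere, at
  \<open>v\<close>. If the residual \<open>z = A *v v - l *\<^sub>R v\<close> were nonzero, moving
  from \<open>v\<close> along \<open>z\<close> would raise the Rayleigh quotient to first
  order.\<close>

lemma symmetric_has_eigenvector:
  fixes A :: "real^'n^'n"
  assumes sym: "transpose A = A"
  shows "\<exists>l v. v \<noteq> 0 \<and> A *v v = l *\<^sub>R v"
proof -
  let ?q = "\<lambda>x. (A *v x) \<bullet> x"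
  have cont: "continuous_on (sphere 0 1) ?q"
    by (intro continuous_intros linear_continuous_on linear_conv_bounded_linear[THEN iffD1] matrix_vector_mul_linear)
  have "axis undefined 1 \<in> sphere (0 :: real^'n) 1" by (simp add: norm_axis_1)
  then have ne: "sphere (0 :: real^'n) 1 \<noteq> {}" by blast
  obtain v where v: "v \<in> sphere 0 1" "\<And>x. x \<in> sphere 0 1 \<Longrightarrow> ?q x \<le> ?q v"
    using continuous_attains_sup[OF compact_sphere ne cont] by blast
  define l where "l = ?q v"
  have hom: "?q x \<le> l * (x \<bullet> x)" for x
  proof (cases "x = 0")
    case False
    let ?x = "x /\<^sub>R norm x"
    have "?q ?x \<le> l" using v(2)[of ?x] False by (simp add: l_def)
    moreover have "?q ?x = ?q x / (norm x)\<^sup>2"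
      by (simp add: matrix_vector_mult_scaleR power2_eq_square divide_inverse mult_ac)
    ultimately have "?q x / (norm x)\<^sup>2 \<le> l" by (simp only:)
    then have "?q x \<le> l * (norm x)\<^sup>2" using False by (simp add: pos_divide_le_eq)
    then show ?thesis by (simp add: dot_square_norm)
  qed simp
  define z where "z = A *v v - l *\<^sub>R v"
  have "z = 0"
  proof (rule ccontr)
    assume z: "z \<noteq> 0"
    \<comment> \<open>\<open>C\<close> dominates the second-order coefficient, so for
      \<open>t = (z \<bullet> z) / C\<close> the first-order gain wins.\<close>
    define C where "C = \<bar>?q z - l * (z \<bullet> z)\<bar> + 1"
    define t where "t = (z \<bullet> z) / C"
    have C: "C > 0" by (simp add: C_def)
    have zz: "z \<bullet> z > 0" using z by simp
    have t: "t > 0" using C zz by (simp add: t_def)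
    have vv: "v \<bullet> v = 1" using v(1) by (simp add: dot_square_norm)
    have "?q (v + t *\<^sub>R z) = ?q v + 2 * t * ((A *v v) \<bullet> z) + t\<^sup>2 * ?q z"
      using symmetric_inner[OF sym, of z v]
      by (simp add: matrix_vector_right_distrib matrix_vector_mult_scaleR inner_add_left inner_add_right power2_eq_square inner_commute algebra_simps)
    moreover have "(v + t *\<^sub>R z) \<bullet> (v + t *\<^sub>R z) = 1 + 2 * t * (v \<bullet> z) + t\<^sup>2 * (z \<bullet> z)"
      using vv by (simp add: inner_add_left inner_add_right power2_eq_square inner_commute algebra_simps)
    ultimately have "l + 2 * t * ((A *v v) \<bullet> z) + t\<^sup>2 * ?q z \<le> l * (1 + 2 * t * (v \<bullet> z) + t\<^sup>2 * (z \<bullet> z))"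
      using hom[of "v + t *\<^sub>R z"] by (simp add: l_def)
    moreover have "(A *v v) \<bullet> z - l * (v \<bullet> z) = z \<bullet> z"
    proof -
      have "(A *v v) \<bullet> z - l * (v \<bullet> z) = (A *v v - l *\<^sub>R v) \<bullet> z" by (simp add: inner_diff_left)
      then show ?thesis by (simp only: z_def[symmetric])
    qed
    ultimately have "2 * t * (z \<bullet> z) + t\<^sup>2 * (?q z - l * (z \<bullet> z)) \<le> 0"
      by (simp add: algebra_simps)
    then have "2 * (z \<bullet> z) + t * (?q z - l * (z \<bullet> z)) \<le> 0"
      using t by (simp add: power2_eq_square mult.assoc distrib_left[symmetric] mult_le_0_iff)
        (smt (verit) mult_le_0_iff distrib_left mult.left_commute)
    moreover have "t * (?q z - l * (z \<bullet> z)) \<ge> - (t * C)"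
    proof -
      have "- C \<le> ?q z - l * (z \<bullet> z)" unfolding C_def by linarith
      from mult_left_mono[OF this, of t] t show ?thesis by simp
    qed
    moreover have "t * C = z \<bullet> z" using C by (simp add: t_def)
    ultimately show False using zz by linarith
  qed
  moreover have "v \<noteq> 0" using v(1) by auto
  ultimately show ?thesis by (auto simp: z_def)
qed

text \<open>Eigenvectors to distinct eigenvalues are orthogonal, hence independent. Finiteness gives
  \<open>Min\<close> in \<open>min_eigenvalue\<close> its meaning.\<close>

lemma finite_symmetric_eigenvalues:
  fixes A :: "real^'n^'n"
  assumes sym: "transpose A = A"
  shows "finite {l. \<exists>v. v \<noteq> 0 \<and> A *v v = l *\<^sub>R v}" 
proof -
  define S where "S = {l. \<exists>v. v \<noteq> 0 \<and> A *v v = l *\<^sub>R v}"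
  define e where "e l = (SOME v. v \<noteq> 0 \<and> A *v v = l *\<^sub>R v)" for l
  have e: "e l \<noteq> 0" "A *v e l = l *\<^sub>R e l" if "l \<in> S" for l
    using that someI_ex[of "\<lambda>v. v \<noteq> 0 \<and> A *v v = l *\<^sub>R v"] by (auto simp: e_def S_def)
  have orth: "e l \<bullet> e k = 0" if "l \<in> S" "k \<in> S" "l \<noteq> k" for l k
  proof -
    have "l * (e l \<bullet> e k) = k * (e l \<bullet> e k)"
      using symmetric_inner[OF sym, of "e l" "e k"] e[OF that(1)] e[OF that(2)] by simp
    then show ?thesis using that(3) by simp
  qed
  have inj: "inj_on e S"
  proof (rule inj_onI)
    fix l k assume lk: "l \<in> S" "k \<in> S" "e l = e k"
    then have "l *\<^sub>R e l = k *\<^sub>R e l" using e by metis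
    then show "l = k" using e(1)[OF lk(1)] by simp
  qed
  have "pairwise orthogonal (e ` S)"
    unfolding pairwise_def
  proof (intro ballI impI)
    fix x y assume "x \<in> e ` S" "y \<in> e ` S" "x \<noteq> y"
    then obtain l k where "l \<in> S" "k \<in> S" "x = e l" "y = e k" by blast
    then show "orthogonal x y" using orth[of l k] \<open>x \<noteq> y\<close> unfolding orthogonal_def by blast
  qed
  moreover have "0 \<notin> e ` S" using e(1) by (metis (no_types, lifting) imageE)
  ultimately have "independent (e ` S)" by (rule pairwise_orthogonal_independent)
  then have "finite (e ` S)" using independent_bound by blast
  then show ?thesis using inj finite_imageD unfolding S_def by blast
qed

lemma min_eigenvalue_pos:
  fixes A :: "real^'n^'n"
  assumes sym: "transpose A = A" and a: "a > 0" "\<And>\<xi>. a * (norm \<xi>)\<^sup>2 \<le> (A *v \<xi>) \<bullet> \<xi>"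
  shows "min_eigenvalue A > 0"
proof -
  let ?S = "{l. \<exists>v. v \<noteq> 0 \<and> A *v v = l *\<^sub>R v}"
  have "?S \<noteq> {}" using symmetric_has_eigenvector[OF sym] by blast
  then have "Min ?S \<in> ?S" using finite_symmetric_eigenvalues[OF sym] by (rule Min_in[rotated])
  then obtain v where v: "v \<noteq> 0" "A *v v = Min ?S *\<^sub>R v" by blast
  have "0 < a * (norm v)\<^sup>2" using a v by simp
  also have "\<dots> \<le> Min ?S * (norm v)\<^sup>2" using a(2)[of v] v(2) by (simp add: dot_square_norm)
  finally show ?thesis using v(1) by (simp add: min_eigenvalue_def zero_less_mult_iff)
qed

section \<open>The error estimate\<close>

text \<open>The integrand of \<open>exact_flux\<close> is known only through its almost everywhere
  equality with a Borel function; for a complete measure this suffices.\<close>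

lemma measurable_completion_AE:
  fixes f g :: "'a \<Rightarrow> real"
  assumes g: "g \<in> borel_measurable M" and ae: "AE x in M. f x = g x"
  shows "f \<in> borel_measurable (completion M)"
proof (rule measurableI)
  fix A :: "real set" assume A: "A \<in> sets borel"
  show "f -` A \<inter> space (completion M) \<in> sets (completion M)"
  proof (rule completion.in_sets_AE)
    show "g -` A \<inter> space M \<in> sets (completion M)"
      using measurable_sets[OF g A] by simp
    show "AE x in completion M. x \<in> g -` A \<inter> space M \<longleftrightarrow> x \<in> f -` A \<inter> space (completion M)"
      using AE_completion[OF ae] by eventually_elim auto
  qed simp
qed simp

lemma integral_completion_AE:
  fixes f g :: "'a \<Rightarrow> real"
  assumes g: "g \<in> borel_measurable M" and ae: "AE x in M. f x = g x"
  shows "integral\<^sup>L (completion M) f = integral\<^sup>L M g"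
proof -
  have "integral\<^sup>L (completion M) f = integral\<^sup>L (completion M) g"
    using measurable_completion_AE[OF assms] g AE_completion[OF ae]
    by (intro integral_cong_AE) (auto intro: measurable_completion)
  then show ?thesis using g by (simp add: integral_completion)
qed

lemma polytopal_convex_union:
  assumes "polytopal P"
  shows "convex_union P" "bounded P" "P \<noteq> {}"
proof -
  obtain S where S: "finite S" "\<And>C. C \<in> S \<Longrightarrow> polytope C" "P = interior (\<Union>S)" and "P \<noteq> {}"
    using assms by (auto simp: polytopal_def)
  then show "P \<noteq> {}" by simp
  show "convex_union P"
    unfolding convex_union_def using S by (intro exI[of _ S]) (auto intro: polytope_imp_convex polytope_imp_compact)
  have "bounded (\<Union>S)" using S by (intro bounded_Union) (auto intro: compact_imp_bounded polytope_imp_compact)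
  then show "bounded P" unfolding S(3) by (rule bounded_subset[OF _ interior_subset])
qed

lemma L2_subset:
  assumes "open S" "open T" "T \<subseteq> S" "L2 S f"
  shows "L2 T f"
proof -
  have "f \<in> borel_measurable (lebesgue_on T)"
    using assms by (auto simp: L2_def intro: measurable_restrict_mono)
  moreover have "integrable (lebesgue_on T) (\<lambda>x. (f x)\<^sup>2)"
    by (rule integrable_on_subset_lebesgue_on[of S]) (use assms in \<open>auto simp: L2_def\<close>)
  ultimately show ?thesis by (simp add: L2_def)
qed

text \<open>\<open>H2\<close> provides each first derivative as some \<open>gi\<close> in
  \<open>H1\<close>, not as the component of \<open>wgrad\<close>. The two agree almost everywhere,
  so a common representative inherits the second derivatives.\<close>

lemma H2_gradient_field:
  fixes T :: "(real^'n) set"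
  assumes T: "open T" "bounded T" and u: "H2 T u"
  obtains W G where "\<And>i v. weak_dd T v (\<lambda>z. W z $ i) (G i v)" "\<And>z. z \<notin> T \<Longrightarrow> W z = 0"
    "integrable lborel (\<lambda>z. (norm (W z))\<^sup>2)" "AE z in lborel. z \<in> T \<longrightarrow> wgrad T u z = W z"
proof -
  have H1: "H1 T u" using u by (auto simp: H2_def H1_def)
  then have Lu: "L2 T u" by (simp add: H1_def)
  define R where "R f f' \<longleftrightarrow> f' \<in> borel_measurable borel \<and> integrable lborel f' \<and> integrable lborel (\<lambda>x. (f' x)\<^sup>2) \<and>
    (\<forall>x. x \<notin> T \<longrightarrow> f' x = 0) \<and> (AE x in lborel. x \<in> T \<longrightarrow> f x = f' x)" for f f' :: "real^'n \<Rightarrow> real"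
  have rep: "\<exists>f'. R f f'" if "L2 T f" for f
    unfolding R_def by (rule L2_representative[OF T that]) blast
  have "\<exists>w. R (\<lambda>z. wgrad T u z $ i) w \<and> (\<exists>G. \<forall>j. weak_dd T (axis j 1) w (G j))" for i
  proof -
    obtain w where w: "R (\<lambda>z. wgrad T u z $ i) w" using rep[OF H1_wgrad(1)[OF H1]] by blast
    obtain gi where gi: "H1 T gi" "weak_partial T i u gi" using u by (auto simp: H2_def)
    have Lgi: "L2 T gi" using gi by (simp add: H1_def)
    have "AE x in lborel. x \<in> T \<longrightarrow> gi x = wgrad T u x $ i"
      by (rule weak_partial_unique[OF T Lu Lgi H1_wgrad(1)[OF H1] gi(2) H1_wgrad(2)[OF H1]])
    moreover have "AE x in lborel. x \<in> T \<longrightarrow> wgrad T u x $ i = w x" using w by (simp add: R_def)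
    ultimately have gw: "AE x in lborel. x \<in> T \<longrightarrow> gi x = w x" by eventually_elim auto
    have "\<exists>g. weak_dd T (axis j 1) w g" for j
    proof -
      obtain h where h: "L2 T h" "weak_partial T j gi h" using gi(1) by (auto simp: H1_def)
      obtain h' where h': "R h h'" using rep[OF h(1)] by blast
      have "\<forall>\<phi>. test_function T \<phi> \<longrightarrow> (LINT x|lborel. w x * (axis j 1 \<bullet> grad \<phi> x)) = - (LINT x|lborel. h' x * \<phi> x)"
        using h(2) w h' gw
        by (subst (asm) weak_partial_iff_representative[OF T(1) Lgi h(1), of w h']) (auto simp: R_def)
      then show ?thesis using w h' by (auto simp: weak_dd_def R_def)
    qed
    then show ?thesis using w by metis
  qed
  then obtain w G where w: "\<And>i. R (\<lambda>z. wgrad T u z $ i) (w i)" and G: "\<And>i j. weak_dd T (axis j 1) (w i) (G i j)"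
    by metis
  define W where "W z = (\<chi> i. w i z)" for z
  show ?thesis
  proof (rule that[of W "\<lambda>i v z. \<Sum>j\<in>UNIV. v $ j * G i j z"])
    show "weak_dd T v (\<lambda>z. W z $ i) (\<lambda>z. \<Sum>j\<in>UNIV. v $ j * G i j z)" for i v
      using weak_dd_sum[of T "w i" "G i" v] G by (simp add: W_def)
    show "W z = 0" if "z \<notin> T" for z using w that by (simp add: W_def vec_eq_iff R_def)
    have "(\<lambda>z. (norm (W z))\<^sup>2) = (\<lambda>z. \<Sum>i\<in>UNIV. (w i z)\<^sup>2)"
      by (simp add: W_def norm_vec_def L2_set_def sum_nonneg)
    moreover have "integrable lborel (\<lambda>z. \<Sum>i\<in>UNIV. (w i z)\<^sup>2)"
      using w by (intro Bochner_Integration.integrable_sum) (simp add: R_def)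
    ultimately show "integrable lborel (\<lambda>z. (norm (W z))\<^sup>2)" by simp
    have "AE z in lborel. \<forall>i. z \<in> T \<longrightarrow> wgrad T u z $ i = w i z"
      using w by (intro eventually_all_finite) (simp add: R_def)
    then show "AE z in lborel. z \<in> T \<longrightarrow> wgrad T u z = W z"
      by eventually_elim (simp add: W_def vec_eq_iff)
  qed
qed

text \<open>At almost every point of the face all components of the field have a normal trace, and
  \<open>face_trace\<close> and \<open>btrace\<close> are both equal to it.\<close>

lemma exact_flux_eq_face_integral:
  fixes T :: "(real^'n) set"
  assumes m: "mesh_cell Fs T" and d: "div_field T A W g f" and F: "F \<in> faces_of Fs T"
    and W: "AE z in lborel. z \<in> T \<longrightarrow> wgrad T u z = W z" and K: "cell_value K T = A"
  shows "exact_flux K u T F = face_integral T F A W (\<lambda>x. 1)"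
proof -
  let ?n = "outward_normal T F" and ?c = "face_offset T F"
  have "F \<in> Fs" using F by (simp add: faces_of_def)
  then have fl: "face_like F" and on: "is_outward_normal T F ?n" and cu: "convex_union T"
    using m F unfolding mesh_cell_def by blast+
  note props = outward_normal_props[OF fl on]
  note T = convex_union_regular[OF cu]
  have wd: "\<And>i v. weak_dd T v (\<lambda>z. W z $ i) (g i v)" using d by (simp add: div_field_def)
  have wm: "(\<lambda>z. W z $ i) \<in> borel_measurable borel" for i using wd[of 0 i] by (auto simp: weak_dd_def)
  have "AE x in hyp ?n ?c. \<forall>i. \<exists>\<tau>. normal_trace_at T ?n (\<lambda>z. W z $ i) (g i ?n) x \<tau>"
    using normal_trace_exists[OF T(1) props(1) wd] by (intro eventually_all_finite)
  moreover have "AE x in hyp ?n ?c. AE t in lborel. x + t *\<^sub>R ?n \<in> T \<longrightarrow> wgrad T u (x + t *\<^sub>R ?n) = W (x + t *\<^sub>R ?n)"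
    by (rule AE_hyp[OF props(1) W])
  ultimately have ae: "AE x in hyp ?n ?c. indicator F x *\<^sub>R ((A *v face_trace T F (wgrad T u) x) \<bullet> ?n) = indicator F x * flux_density A W ?n x * 1"
    using props(5)
  proof eventually_elim
    fix x
    assume tr: "\<forall>i. \<exists>\<tau>. normal_trace_at T ?n (\<lambda>z. W z $ i) (g i ?n) x \<tau>"
      and wg: "AE t in lborel. x + t *\<^sub>R ?n \<in> T \<longrightarrow> wgrad T u (x + t *\<^sub>R ?n) = W (x + t *\<^sub>R ?n)"
      and seg: "x \<in> F \<longrightarrow> (\<exists>\<epsilon>>0. \<forall>t. 0 < t \<and> t < \<epsilon> \<longrightarrow> x - t *\<^sub>R ?n \<in> T \<and> x + t *\<^sub>R ?n \<notin> T)"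
    show "indicator F x *\<^sub>R ((A *v face_trace T F (wgrad T u) x) \<bullet> ?n) = indicator F x * flux_density A W ?n x * 1"
    proof (cases "x \<in> F")
      case True
      then obtain \<epsilon> where e: "\<epsilon> > 0" "\<And>t. 0 < t \<Longrightarrow> t < \<epsilon> \<Longrightarrow> x - t *\<^sub>R ?n \<in> T" using seg by blast
      obtain \<tau> where \<tau>: "\<And>i. normal_trace_at T ?n (\<lambda>z. W z $ i) (g i ?n) x (\<tau> i)" using tr by metis
      have bt: "btrace ?n (\<lambda>z. W z $ i) x = \<tau> i" for i
        by (rule btrace_tendsto(1)[OF wm \<tau> e])
      have "AE t in lborel. x + (0 + (-1) * t) *\<^sub>R ?n \<in> T \<longrightarrow> wgrad T u (x + (0 + (-1) * t) *\<^sub>R ?n) = W (x + (0 + (-1) * t) *\<^sub>R ?n)"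
        using wg by (intro AE_lborel_affine) auto
      then have "AE t in lborel. x - t *\<^sub>R ?n \<in> T \<longrightarrow> wgrad T u (x - t *\<^sub>R ?n) = W (x - t *\<^sub>R ?n)" by simp
      then have "face_trace T F (wgrad T u) x = (\<chi> i. \<tau> i)"
        using \<tau> by (intro face_trace_eq[OF refl props(1) _ e, where W = W and g = "\<lambda>i. g i ?n"]) auto
      then show ?thesis using True by (simp add: flux_density_def bt)
    qed simp
  qed
  have "integrable (hyp ?n ?c) (\<lambda>x. indicator F x * flux_density A W ?n x * 1)"
    using flux_density_integrable[OF m d F] by simp
  then have mb: "(\<lambda>x. indicator F x * flux_density A W ?n x * 1) \<in> borel_measurable (hyp ?n ?c)" by (rule borel_measurable_integrable)
  show ?thesis
    unfolding exact_flux_def set_lebesgue_integral_def face_integral_def K props(4)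
    by (rule integral_completion_AE[OF mb ae])
qed

lemma matrix_field_integrable:
  assumes "\<And>i. integrable lborel (\<lambda>z. W z $ i)" "test_function S \<phi>"
  shows "integrable lborel (\<lambda>z. ((A :: real^'n^'n) *v W z) \<bullet> grad \<phi> z)"
proof -
  have "integrable lborel (\<lambda>z. W z $ j * partial_deriv i \<phi> z)" for i j
    using integrable_mult_test_function(2)[OF assms(1) assms(2), of j "axis i 1"] by (simp add: inner_axis')
  then have "integrable lborel (\<lambda>z. \<Sum>j\<in>UNIV. \<Sum>i\<in>UNIV. A $ i $ j * (W z $ j * partial_deriv i \<phi> z))"
    by (intro Bochner_Integration.integrable_sum integrable_mult_right)
  then show ?thesis by (simp add: matrix_inner_sum sum_distrib_right sum_distrib_left mult_ac)
qed

lemma integral_lebesgue_on_AE: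
  fixes F F' :: "'a::euclidean_space \<Rightarrow> real"
  assumes "S \<in> sets borel" "F' \<in> borel_measurable borel" "\<And>x. x \<notin> S \<Longrightarrow> F' x = 0" "AE x in lborel. x \<in> S \<longrightarrow> F x = F' x"
  shows "(LINT x|lebesgue_on S. F x) = (LINT x|lborel. F' x)"
proof (rule integral_lebesgue_on_representative[OF assms(1) _ assms(2-4)])
  show "F \<in> borel_measurable (lebesgue_on S)"
  proof (rule borel_measurable_lebesgue_on_AE[OF _ borel_measurable_lebesgue_on_borel[OF assms(2)]])
    show "AE x in lebesgue_on S. F' x = F x"
      by (rule AE_lebesgue_on[OF assms(1)]) (use assms(4) in \<open>eventually_elim, auto\<close>)
  qed (use assms(1) in simp)
qed

text \<open>A test function is admissible in the weak formulation, and both integrals split over the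
  cells, which cover \<open>\<Omega>\<close> up to a null set. For support in one cell this is the
  divergence equation of that cell; for support across a face it is the input of
  \<open>flux_conservation\<close>.\<close>

lemma weak_solution_cells:
  fixes \<Omega> :: "(real^'n) set"
  assumes \<Omega>: "open \<Omega>" "bounded \<Omega>" and sol: "weak_solution \<Omega> K f u"
    and Th: "finite Th" "\<And>T. T \<in> Th \<Longrightarrow> open T \<and> bounded T \<and> T \<subseteq> \<Omega>" "disjoint Th"
    and cover: "AE z in lborel. z \<in> \<Omega> \<longrightarrow> (\<exists>T\<in>Th. z \<in> T)"
    and A: "\<And>T z. T \<in> Th \<Longrightarrow> z \<in> T \<Longrightarrow> K z = A T"
    and W: "\<And>T i. T \<in> Th \<Longrightarrow> integrable lborel (\<lambda>z. W T z $ i)" "\<And>T z. T \<in> Th \<Longrightarrow> z \<notin> T \<Longrightarrow> W T z = 0"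
      "\<And>T. T \<in> Th \<Longrightarrow> AE z in lborel. z \<in> T \<longrightarrow> wgrad T u z = W T z"
    and f: "\<And>T. T \<in> Th \<Longrightarrow> integrable lborel (f' T)" "\<And>T z. T \<in> Th \<Longrightarrow> z \<notin> T \<Longrightarrow> f' T z = 0"
      "\<And>T. T \<in> Th \<Longrightarrow> AE z in lborel. z \<in> T \<longrightarrow> f z = f' T z"
    and \<phi>: "test_function \<Omega> \<phi>"
  shows "(\<Sum>T\<in>Th. (LINT z|lborel. (A T *v W T z) \<bullet> grad \<phi> z) - (LINT z|lborel. f' T z * \<phi> z)) = 0"
proof -
  have H1: "H1 \<Omega> u" using sol by (simp add: weak_solution_def H10_def)
  then have Lu: "L2 \<Omega> u" by (simp add: H1_def)
  have Omega_b: "\<Omega> \<in> sets borel" using \<Omega> by simp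
  have wT: "AE z in lborel. z \<in> T \<longrightarrow> wgrad \<Omega> u z = W T z" if T: "T \<in> Th" for T
  proof -
    have T': "open T" "bounded T" "T \<subseteq> \<Omega>" using Th(2)[OF T] by auto
    have "AE z in lborel. z \<in> T \<longrightarrow> wgrad T u z = wgrad \<Omega> u z"
      by (rule wgrad_eq_AE[OF T'(1,2)])
        (auto intro: L2_subset[OF \<Omega>(1) T'(1,3)] Lu H1_wgrad(1)[OF H1] weak_partial_subset(1)[OF \<Omega>(1) T'(1,3) Lu H1_wgrad[OF H1]])
    with W(3)[OF T] show ?thesis by eventually_elim auto
  qed
  have uniq: "T' = T" if "T \<in> Th" "T' \<in> Th" "z \<in> T" "z \<in> T'" for T T' z
    using Th(3) that by (auto simp: disjoint_def)
  have single: "(\<Sum>T'\<in>Th. q T') = q T" if "T \<in> Th" "\<And>T'. T' \<in> Th \<Longrightarrow> T' \<noteq> T \<Longrightarrow> q T' = 0" for q :: "_ \<Rightarrow> real" and T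
    using that Th(1) by (subst sum.remove[of _ T]) (auto intro!: sum.neutral)
  have Wi: "integrable lborel (\<lambda>z. (A T *v W T z) \<bullet> grad \<phi> z)" if "T \<in> Th" for T
    by (rule matrix_field_integrable[OF W(1)[OF that] \<phi>])
  have fi: "integrable lborel (\<lambda>z. f' T z * \<phi> z)" if "T \<in> Th" for T
    by (rule integrable_mult_test_function(1)[OF f(1)[OF that] \<phi>])
  have "(LINT x|lebesgue_on \<Omega>. (K x *v wgrad \<Omega> u x) \<bullet> wgrad \<Omega> \<phi> x) = (LINT z|lborel. (\<Sum>T\<in>Th. (A T *v W T z) \<bullet> grad \<phi> z))"
  proof (rule integral_lebesgue_on_AE[OF Omega_b])
    show "(\<lambda>z. \<Sum>T\<in>Th. (A T *v W T z) \<bullet> grad \<phi> z) \<in> borel_measurable borel"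
      using Wi by (intro borel_measurable_sum) auto
    show "(\<Sum>T\<in>Th. (A T *v W T z) \<bullet> grad \<phi> z) = 0" if "z \<notin> \<Omega>" for z
      using test_function_grad_0(2)[OF \<phi> that] by simp
    have "AE z in lborel. \<forall>T\<in>Th. z \<in> T \<longrightarrow> wgrad \<Omega> u z = W T z"
      using Th(1) wT by (intro AE_finite_allI) auto
    with cover wgrad_test_function[OF \<Omega> \<phi>]
    show "AE z in lborel. z \<in> \<Omega> \<longrightarrow> (K z *v wgrad \<Omega> u z) \<bullet> wgrad \<Omega> \<phi> z = (\<Sum>T\<in>Th. (A T *v W T z) \<bullet> grad \<phi> z)"
    proof (eventually_elim, intro impI)
      fix z assume z: "z \<in> \<Omega> \<longrightarrow> (\<exists>T\<in>Th. z \<in> T)" "z \<in> \<Omega> \<longrightarrow> wgrad \<Omega> \<phi> z = grad \<phi> z"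
        "\<forall>T\<in>Th. z \<in> T \<longrightarrow> wgrad \<Omega> u z = W T z" "z \<in> \<Omega>"
      then obtain T where T: "T \<in> Th" "z \<in> T" by blast
      have "(\<Sum>T'\<in>Th. (A T' *v W T' z) \<bullet> grad \<phi> z) = (A T *v W T z) \<bullet> grad \<phi> z"
      proof (rule single[OF T(1)])
        fix T' assume T': "T' \<in> Th" "T' \<noteq> T"
        then have "z \<notin> T'" using uniq[OF T(1) T'(1) T(2)] by blast
        then show "(A T' *v W T' z) \<bullet> grad \<phi> z = 0" using W(2)[OF T'(1)] by simp
      qed
      then show "(K z *v wgrad \<Omega> u z) \<bullet> wgrad \<Omega> \<phi> z = (\<Sum>T\<in>Th. (A T *v W T z) \<bullet> grad \<phi> z)"
        using z T A by simp
    qed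
  qed
  moreover have "(LINT x|lebesgue_on \<Omega>. f x * \<phi> x) = (LINT z|lborel. (\<Sum>T\<in>Th. f' T z * \<phi> z))"
  proof (rule integral_lebesgue_on_AE[OF Omega_b])
    show "(\<lambda>z. \<Sum>T\<in>Th. f' T z * \<phi> z) \<in> borel_measurable borel"
      using fi by (intro borel_measurable_sum) auto
    show "(\<Sum>T\<in>Th. f' T z * \<phi> z) = 0" if "z \<notin> \<Omega>" for z
      using test_function_grad_0(1)[OF \<phi> that] by simp
    have "AE z in lborel. \<forall>T\<in>Th. z \<in> T \<longrightarrow> f z = f' T z"
      using Th(1) f(3) by (intro AE_finite_allI) auto
    with cover show "AE z in lborel. z \<in> \<Omega> \<longrightarrow> f z * \<phi> z = (\<Sum>T\<in>Th. f' T z * \<phi> z)"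
    proof (eventually_elim, intro impI)
      fix z assume z: "z \<in> \<Omega> \<longrightarrow> (\<exists>T\<in>Th. z \<in> T)" "\<forall>T\<in>Th. z \<in> T \<longrightarrow> f z = f' T z" "z \<in> \<Omega>"
      then obtain T where T: "T \<in> Th" "z \<in> T" by blast
      have "(\<Sum>T'\<in>Th. f' T' z * \<phi> z) = f' T z * \<phi> z"
      proof (rule single[OF T(1)])
        fix T' assume T': "T' \<in> Th" "T' \<noteq> T"
        then have "z \<notin> T'" using uniq[OF T(1) T'(1) T(2)] by blast
        then show "f' T' z * \<phi> z = 0" using f(2)[OF T'(1)] by simp
      qed
      then show "f z * \<phi> z = (\<Sum>T\<in>Th. f' T z * \<phi> z)" using z T by simp
    qed
  qed
  moreover have "(LINT x|lebesgue_on \<Omega>. (K x *v wgrad \<Omega> u x) \<bullet> wgrad \<Omega> \<phi> x) = (LINT x|lebesgue_on \<Omega>. f x * \<phi> x)"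
    using sol H10_test_function[OF \<Omega> \<phi>] by (simp add: weak_solution_def)
  ultimately have "(\<Sum>T\<in>Th. LINT z|lborel. (A T *v W T z) \<bullet> grad \<phi> z) = (\<Sum>T\<in>Th. LINT z|lborel. f' T z * \<phi> z)"
    using Wi fi by (simp add: Bochner_Integration.integral_sum)
  then show ?thesis by (simp add: sum_subtractf)
qed

section \<open>Discrete summation by parts and the abstract error bound\<close>

text \<open>After exchanging the sums, each face value multiplies the sum of the fluxes at its face:
  inside, the sum vanishes by conservation; on the boundary, the face value does. The condition is a
  single product so that it covers both cases, for discrete and exact fluxes alike.\<close>

lemma flux_pairing:
  fixes E :: "(real^'n) set \<Rightarrow> (real^'n) set \<Rightarrow> real"
  assumes fin: "finite Th" "finite Fh"
    and cons: "\<And>F. F \<in> Fh \<Longrightarrow> vF F * (\<Sum>T\<in>cells_of Th F. E T F) = 0"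
    and bal: "\<And>T. T \<in> Th \<Longrightarrow> (\<Sum>F\<in>faces_of Fh T. E T F) = b T"
  shows "(\<Sum>T\<in>Th. \<Sum>F\<in>faces_of Fh T. E T F * (vT T - vF F)) = (\<Sum>T\<in>Th. vT T * b T)"
proof -
  have "(\<Sum>T\<in>Th. \<Sum>F\<in>faces_of Fh T. E T F * vF F) = (\<Sum>F\<in>Fh. \<Sum>T\<in>cells_of Th F. E T F * vF F)"
    unfolding faces_of_def cells_of_def by (rule sum.swap_restrict[OF fin])
  also have "\<dots> = (\<Sum>F\<in>Fh. 0)"
  proof (intro sum.cong refl)
    fix F assume "F \<in> Fh"
    from cons[OF this] show "(\<Sum>T\<in>cells_of Th F. E T F * vF F) = 0"
      by (subst sum_distrib_right[symmetric]) (simp only: mult.commute)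
  qed
  finally have "(\<Sum>T\<in>Th. \<Sum>F\<in>faces_of Fh T. E T F * vF F) = 0" by simp
  moreover have "(\<Sum>T\<in>Th. \<Sum>F\<in>faces_of Fh T. E T F * vT T) = (\<Sum>T\<in>Th. vT T * b T)"
  proof (intro sum.cong refl)
    fix T assume "T \<in> Th"
    from bal[OF this] show "(\<Sum>F\<in>faces_of Fh T. E T F * vT T) = vT T * b T"
      by (subst sum_distrib_right[symmetric]) simp
  qed
  ultimately show ?thesis
    by (simp add: right_diff_distrib sum_subtractf)
qed

text \<open>The weights in the norm and in the bound are reciprocal, so the Cauchy--Schwarz
  inequality over all pairs of a cell and one of its faces produces exactly these two factors; then
  one power of \<open>N\<close> cancels.\<close>

lemma coercive_error_bound:
  fixes l :: "'t \<Rightarrow> real" and ar :: "'f \<Rightarrow> real" and ds R :: "'t \<Rightarrow> 'f \<Rightarrow> real"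
  assumes fin: "finite Th" "\<And>T. T \<in> Th \<Longrightarrow> finite (Fc T)"
    and pos: "\<gamma> > 0" "\<And>T. T \<in> Th \<Longrightarrow> l T > 0" "\<And>T F. T \<in> Th \<Longrightarrow> F \<in> Fc T \<Longrightarrow> ar F > 0 \<and> ds T F > 0"
    and N: "N = sqrt (\<Sum>T\<in>Th. l T * (\<Sum>F\<in>Fc T. ar F * ds T F * ((vT T - vF F) / ds T F)\<^sup>2))"
    and coer: "\<gamma> * N\<^sup>2 \<le> (\<Sum>T\<in>Th. \<Sum>F\<in>Fc T. - R T F * (vT T - vF F))"
  shows "N \<le> inverse \<gamma> * sqrt (\<Sum>T\<in>Th. inverse (l T) * (\<Sum>F\<in>Fc T. ds T F / ar F * (R T F)\<^sup>2))"
proof -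
  let ?P = "SIGMA T:Th. Fc T"
  define x where "x p = (case p of (T, F) \<Rightarrow> sqrt (l T * ar F / ds T F) * (vT T - vF F))" for p
  define y where "y p = (case p of (T, F) \<Rightarrow> sqrt (inverse (l T) * (ds T F / ar F)) * R T F)" for p
  have Nx: "N = L2_set x ?P"
  proof -
    have "(\<Sum>T\<in>Th. l T * (\<Sum>F\<in>Fc T. ar F * ds T F * ((vT T - vF F) / ds T F)\<^sup>2)) = (\<Sum>T\<in>Th. \<Sum>F\<in>Fc T. (x (T, F))\<^sup>2)"
      unfolding sum_distrib_left
    proof (intro sum.cong refl)
      fix T F assume "T \<in> Th" "F \<in> Fc T"
      then have "l T > 0" "ar F > 0" "ds T F > 0" using pos by auto
      then show "l T * (ar F * ds T F * ((vT T - vF F) / ds T F)\<^sup>2) = (x (T, F))\<^sup>2"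
        by (simp add: x_def power_mult_distrib real_sqrt_pow2 power_divide power2_eq_square[of "ds T F"])
    qed
    also have "\<dots> = (\<Sum>p\<in>?P. (x p)\<^sup>2)" using fin by (simp add: sum.Sigma split_beta)
    finally show ?thesis by (simp add: N L2_set_def)
  qed
  have Sy: "sqrt (\<Sum>T\<in>Th. inverse (l T) * (\<Sum>F\<in>Fc T. ds T F / ar F * (R T F)\<^sup>2)) = L2_set y ?P"
  proof -
    have "(\<Sum>T\<in>Th. inverse (l T) * (\<Sum>F\<in>Fc T. ds T F / ar F * (R T F)\<^sup>2)) = (\<Sum>T\<in>Th. \<Sum>F\<in>Fc T. (y (T, F))\<^sup>2)"
      unfolding sum_distrib_left
    proof (intro sum.cong refl)
      fix T F assume "T \<in> Th" "F \<in> Fc T"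
      then have "l T > 0" "ar F > 0" "ds T F > 0" using pos by auto
      then have "0 \<le> inverse (l T) * (ds T F / ar F)" by simp
      then show "inverse (l T) * (ds T F / ar F * (R T F)\<^sup>2) = (y (T, F))\<^sup>2"
        by (simp only: y_def prod.case power_mult_distrib real_sqrt_pow2 mult.assoc)
    qed
    also have "\<dots> = (\<Sum>p\<in>?P. (y p)\<^sup>2)" using fin by (simp add: sum.Sigma split_beta)
    finally show ?thesis by (simp add: L2_set_def)
  qed
  have "\<gamma> * N\<^sup>2 \<le> (\<Sum>T\<in>Th. \<Sum>F\<in>Fc T. \<bar>x (T, F)\<bar> * \<bar>y (T, F)\<bar>)"
  proof (rule order_trans[OF coer], intro sum_mono)
    fix T F assume "T \<in> Th" "F \<in> Fc T"
    then have p: "l T > 0" "ar F > 0" "ds T F > 0" using pos by auto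
    have "sqrt (l T * ar F / ds T F) * sqrt (inverse (l T) * (ds T F / ar F)) = 1"
      using p by (simp add: real_sqrt_mult[symmetric] field_simps)
    then have "\<bar>x (T, F)\<bar> * \<bar>y (T, F)\<bar> = \<bar>vT T - vF F\<bar> * \<bar>R T F\<bar>"
      using p by (simp add: x_def y_def abs_mult mult.assoc[symmetric])
    moreover have "- R T F * (vT T - vF F) \<le> \<bar>vT T - vF F\<bar> * \<bar>R T F\<bar>"
      using abs_ge_self[of "- R T F * (vT T - vF F)"] by (simp add: abs_mult mult.commute)
    ultimately show "- R T F * (vT T - vF F) \<le> \<bar>x (T, F)\<bar> * \<bar>y (T, F)\<bar>" by simp
  qed
  also have "\<dots> = (\<Sum>p\<in>?P. \<bar>x p\<bar> * \<bar>y p\<bar>)" using fin by (simp add: sum.Sigma split_beta)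
  also have "\<dots> \<le> N * L2_set y ?P" unfolding Nx by (rule L2_set_mult_ineq)
  finally have le: "\<gamma> * N * N \<le> L2_set y ?P * N" by (simp add: power2_eq_square mult_ac)
  have "N \<ge> 0" unfolding Nx by simp
  have "\<gamma> * N \<le> L2_set y ?P"
  proof (cases "N = 0")
    case False
    then have "N > 0" using \<open>N \<ge> 0\<close> by simp
    with le show ?thesis by (rule mult_right_le_imp_le)
  qed simp
  then show ?thesis unfolding Sy using pos(1) by (simp add: field_simps)
qed

theorem theorem28:
  fixes \<Omega> :: "(real^'n) set"
    and K :: "real^'n \<Rightarrow> real^'n^'n"
    and f u :: "real^'n \<Rightarrow> real"
    and Ps Th Fh :: "(real^'n) set set"
    and xT xF :: "(real^'n) set \<Rightarrow> real^'n"
    and flux :: "(real^'n) set \<Rightarrow> (real^'n) set \<Rightarrow> 'n dofs \<Rightarrow> real"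
    and \<gamma> :: real
    and uh :: "'n dofs"
  assumes "polytopal \<Omega>" and "connected \<Omega>"
    and "L2 \<Omega> f"
    and "\<forall>x\<in>\<Omega>. transpose (K x) = K x"
    and "uniformly_elliptic \<Omega> K"
    and "polytopal_partition \<Omega> Ps" and "\<forall>P\<in>Ps. K constant_on P"
    and "polytopal_mesh \<Omega> Th Fh" and "\<forall>T\<in>Th. \<exists>P\<in>Ps. T \<subseteq> P"
    and "\<forall>T\<in>Th. xT T \<in> T" and "\<forall>F\<in>Fh. xF F \<in> F"
    and "\<forall>T\<in>Th. \<forall>F\<in>faces_of Fh T. orth_dist (xT T) F > 0"
    and "\<forall>T\<in>Th. \<forall>F\<in>faces_of Fh T. linear_on_dofs (Xh \<Omega> Th Fh) (flux T F)"
    and "\<gamma> > 0" and "coercive_fluxes \<Omega> Th Fh K xT flux \<gamma>"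
    and "weak_solution \<Omega> K f u"
    and "continuous_on (closure \<Omega>) u" and "broken_H2 \<Omega> Th u"
    and "fv_solution \<Omega> Th Fh f flux uh"
  shows "dofs_norm Th Fh K xT (uh - interpolate Th Fh xT xF u)
    \<le> inverse \<gamma> *
      sqrt (\<Sum>T\<in>Th. inverse (min_eigenvalue (cell_value K T)) *
        (\<Sum>F\<in>faces_of Fh T. orth_dist (xT T) F / area F *
          (exact_flux K u T F + flux T F (interpolate Th Fh xT xF u))\<^sup>2))"
proof -
  note A = assms
  note \<Omega>p = polytopal_convex_union[OF A(1)]
  note \<Omega> = convex_union_regular[OF \<Omega>p(1)]
  have part: "polytopal_partition \<Omega> Th" and fin: "finite Fh" "disjoint Fh"
    and faces: "\<forall>F\<in>Fh. F \<noteq> {} \<and> (\<exists>n c. norm n = 1 \<and> openin (top_of_set {x. n \<bullet> x = c}) F) \<and> closure F - F \<in> null_sets (surf F)"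
    and card: "\<forall>F\<in>Fh. F \<subseteq> \<Omega> \<and> card (cells_of Th F) = 2 \<or> F \<subseteq> frontier \<Omega> \<and> card (cells_of Th F) = 1"
    and fr: "\<forall>T\<in>Th. frontier T = (\<Union>F\<in>faces_of Fh T. closure F)"
    and on: "\<forall>T\<in>Th. \<forall>F\<in>faces_of Fh T. \<exists>n. is_outward_normal T F n"
    using A(8) unfolding polytopal_mesh_def by blast+
  have finT: "finite Th" "disjoint Th" and Tp: "\<And>T. T \<in> Th \<Longrightarrow> polytopal T" and cl: "closure \<Omega> = (\<Union>T\<in>Th. closure T)"
    using part by (auto simp: polytopal_partition_def)
  have fl: "face_like F" if "F \<in> Fh" for F using faces that by (auto simp: face_like_def)
  \<comment> \<open>A cell is open and lies in \<open>closure \<Omega>\<close>, whose interior is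
    \<open>\<Omega>\<close> again because polytopal sets are regular open.\<close>
  have Tsub: "T \<subseteq> \<Omega>" if "T \<in> Th" for T
  proof -
    have "T \<subseteq> closure \<Omega>" using that cl closure_subset by blast
    then have "T \<subseteq> interior (closure \<Omega>)"
      using convex_union_regular(1)[OF polytopal_convex_union(1)[OF Tp[OF that]]] by (rule interior_maximal)
    then show ?thesis using \<Omega>(2) by simp
  qed
  have T: "open T" "bounded T" "T \<noteq> {}" if "T \<in> Th" for T
    using convex_union_regular(1)[OF polytopal_convex_union(1)[OF Tp[OF that]]] polytopal_convex_union(2,3)[OF Tp[OF that]] by auto
  have cell: "mesh_cell Fh T" if "T \<in> Th" for T
    unfolding mesh_cell_def
  proof (intro conjI ballI)
    show "face_like F" "closure F - F \<in> null_sets (surf F)" if "F \<in> Fh" for F using fl faces that by blast+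
    show "is_outward_normal T F (outward_normal T F)" if F: "F \<in> faces_of Fh T" for F
    proof -
      obtain n where n: "is_outward_normal T F n" using on \<open>T \<in> Th\<close> F by blast
      have "F \<in> Fh" using F by (simp add: faces_of_def)
      then show ?thesis using outward_normal_eq[OF fl n] n by simp
    qed
  qed (use that fin fr polytopal_convex_union(1)[OF Tp[OF that]] in auto)
  let ?A = "cell_value K"
  have cv: "K z = ?A T" if Tz: "T \<in> Th" "z \<in> T" for T z
  proof -
    obtain P where P: "P \<in> Ps" "T \<subseteq> P" using bspec[OF A(9) Tz(1)] by blast
    obtain B where "\<And>x. x \<in> P \<Longrightarrow> K x = B" using bspec[OF A(7) P(1)] unfolding constant_on_def by blast
    then have B: "\<And>x. x \<in> T \<Longrightarrow> K x = B" using P(2) by blast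
    have "?A T = B"
      unfolding cell_value_def by (rule the_equality) (use B Tz in auto)
    then show ?thesis using B Tz by simp
  qed
  have lam: "min_eigenvalue (?A T) > 0" if "T \<in> Th" for T
  proof -
    obtain z where z: "z \<in> T" using T(3)[OF \<open>T \<in> Th\<close>] by blast
    then have z\<Omega>: "z \<in> \<Omega>" using Tsub[OF that] by blast
    obtain a b where a: "a > 0" "\<And>x \<xi>. x \<in> \<Omega> \<Longrightarrow> a * (norm \<xi>)\<^sup>2 \<le> (K x *v \<xi>) \<bullet> \<xi>"
      using A(5) unfolding uniformly_elliptic_def by blast
    show ?thesis
      using min_eigenvalue_pos[of "K z" a] A(4) a z\<Omega> cv[OF that z] by metis
  qed
  define Grad where "Grad T W G \<longleftrightarrow> (\<forall>i v. weak_dd T v (\<lambda>z. W z $ i) (G i v)) \<and> (\<forall>z. z \<notin> T \<longrightarrow> W z = 0) \<and>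
    integrable lborel (\<lambda>z. (norm (W z))\<^sup>2) \<and> (AE z in lborel. z \<in> T \<longrightarrow> wgrad T u z = W z)" for T W G
  have "\<exists>W G. Grad T W G" if "T \<in> Th" for T
  proof -
    have "H2 T u" using A(18) that by (simp add: broken_H2_def)
    then show ?thesis unfolding Grad_def by (rule H2_gradient_field[OF T(1,2)[OF that]]) blast
  qed
  then obtain W G where "\<And>T. T \<in> Th \<Longrightarrow> Grad T (W T) (G T)" by metis
  then have W: "\<And>T i v. T \<in> Th \<Longrightarrow> weak_dd T v (\<lambda>z. W T z $ i) (G T i v)" "\<And>T z. T \<in> Th \<Longrightarrow> z \<notin> T \<Longrightarrow> W T z = 0"
    "\<And>T. T \<in> Th \<Longrightarrow> integrable lborel (\<lambda>z. (norm (W T z))\<^sup>2)" "\<And>T. T \<in> Th \<Longrightarrow> AE z in lborel. z \<in> T \<longrightarrow> wgrad T u z = W T z"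
    by (auto simp: Grad_def)
  define Rep where "Rep T f' \<longleftrightarrow> integrable lborel f' \<and> (\<forall>z. z \<notin> T \<longrightarrow> f' z = 0) \<and> (AE z in lborel. z \<in> T \<longrightarrow> f z = f' z)" for T f'
  have "\<exists>f'. Rep T f'" if "T \<in> Th" for T
    unfolding Rep_def
    by (rule L2_representative[OF T(1,2)[OF that] L2_subset[OF \<Omega>(1) T(1)[OF that] Tsub[OF that] A(3)]]) blast
  then obtain f' where "\<And>T. T \<in> Th \<Longrightarrow> Rep T (f' T)" by metis
  then have f': "\<And>T. T \<in> Th \<Longrightarrow> integrable lborel (f' T)" "\<And>T z. T \<in> Th \<Longrightarrow> z \<notin> T \<Longrightarrow> f' T z = 0"
    "\<And>T. T \<in> Th \<Longrightarrow> AE z in lborel. z \<in> T \<longrightarrow> f z = f' T z"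
    by (auto simp: Rep_def)
  \<comment> \<open>Points of \<open>\<Omega>\<close> outside all cells lie on frontiers of cells,
    hence on finitely many face hyperplanes.\<close>
  have cover: "AE z in lborel. z \<in> \<Omega> \<longrightarrow> (\<exists>T\<in>Th. z \<in> T)"
  proof -
    have "AE z in lborel. \<forall>F\<in>Fh. z \<notin> hpl F"
    proof (rule AE_finite_allI[OF fin(1)])
      fix F assume "F \<in> Fh"
      then have "nrm F \<noteq> 0" using face_like_nrm(1)[OF fl] by force
      then show "AE z in lborel. z \<notin> hpl F" unfolding hpl_def by (intro negligible_AE negligible_hyperplane) auto
    qed
    then show ?thesis
    proof (eventually_elim, intro impI)
      fix z assume z: "\<forall>F\<in>Fh. z \<notin> hpl F" "z \<in> \<Omega>"
      then obtain T where T': "T \<in> Th" "z \<in> closure T" using cl closure_subset[of \<Omega>] by blast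
      have "z \<notin> frontier T"
      proof
        assume "z \<in> frontier T"
        then obtain F where F: "F \<in> faces_of Fh T" "z \<in> closure F" using fr T'(1) by blast
        then have "F \<in> Fh" by (simp add: faces_of_def)
        then show False using z(1) face_like_nrm(4)[OF fl] F(2) by blast
      qed
      then show "\<exists>T\<in>Th. z \<in> T" using T' T(1)[OF T'(1)] by (auto simp: frontier_def interior_open)
    qed
  qed
  have Wi: "integrable lborel (\<lambda>z. W T z $ i)" if "T \<in> Th" for T i using W(1)[OF that, of 0 i] by (simp add: weak_dd_def)
  have sum0: "(\<Sum>T\<in>Th. (LINT z|lborel. (?A T *v W T z) \<bullet> grad \<phi> z) - (LINT z|lborel. f' T z * \<phi> z)) = 0"
    if "test_function \<Omega> \<phi>" for \<phi>
    using T Tsub by (intro weak_solution_cells[OF \<Omega>(1) \<Omega>p(2) A(16) finT(1) _ finT(2) cover cv Wi W(2) W(4) f' that]) auto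
  \<comment> \<open>For a test function on one cell the terms of all other cells in
    \<open>sum0\<close> vanish.\<close>
  have div: "div_field T (?A T) (W T) (G T) (f' T)" if TT: "T \<in> Th" for T
    unfolding div_field_def
  proof (intro conjI allI impI)
    fix \<phi> assume \<phi>: "test_function T \<phi>"
    have z: "(LINT z|lborel. (?A T' *v W T' z) \<bullet> grad \<phi> z) - (LINT z|lborel. f' T' z * \<phi> z) = 0" if T': "T' \<in> Th - {T}" for T'
    proof -
      have dis: "z \<notin> T' \<or> z \<notin> T" for z using finT(2) TT T' by (auto simp: disjoint_def)
      have "(?A T' *v W T' z) \<bullet> grad \<phi> z = 0 \<and> f' T' z * \<phi> z = 0" for z
        using dis[of z] W(2)[of T' z] f'(2)[of T' z] test_function_grad_0[OF \<phi>, of z] T' by auto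
      then have "(\<lambda>z. (?A T' *v W T' z) \<bullet> grad \<phi> z) = (\<lambda>z. 0)" "(\<lambda>z. f' T' z * \<phi> z) = (\<lambda>z. 0)"
        by (auto simp: fun_eq_iff)
      then show ?thesis by simp
    qed
    have "(\<Sum>T'\<in>Th - {T}. (LINT z|lborel. (?A T' *v W T' z) \<bullet> grad \<phi> z) - (LINT z|lborel. f' T' z * \<phi> z)) = 0"
      by (intro sum.neutral ballI z)
    then show "(LINT z|lborel. (?A T *v W T z) \<bullet> grad \<phi> z) = (LINT z|lborel. f' T z * \<phi> z)"
      using sum0[OF test_function_mono[OF \<phi> Tsub[OF TT]]] sum.remove[OF finT(1) TT, of "\<lambda>T'. (LINT z|lborel. (?A T' *v W T' z) \<bullet> grad \<phi> z) - (LINT z|lborel. f' T' z * \<phi> z)"]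
      by simp
  qed (use W f' TT in auto)
  let ?E = "exact_flux K u"
  have E: "?E T F = face_integral T F (?A T) (W T) (\<lambda>x. 1)" if "T \<in> Th" "F \<in> faces_of Fh T" for T F
    by (rule exact_flux_eq_face_integral[OF cell[OF that(1)] div[OF that(1)] that(2) W(4)[OF that(1)] refl])
  have Ebal: "(\<Sum>F\<in>faces_of Fh T. - ?E T F) = (LINT x|lebesgue_on T. f x)" if "T \<in> Th" for T
  proof -
    have "(\<Sum>F\<in>faces_of Fh T. ?E T F) = - (LINT z|lborel. f' T z)"
      using flux_balance[OF cell[OF that] div[OF that] T(2)[OF that] W(3)[OF that]] E[OF that] by simp
    moreover have "(LINT x|lebesgue_on T. f x) = (LINT z|lborel. f' T z)"
      using T(1)[OF that] f'[OF that] by (intro integral_lebesgue_on_AE) auto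
    ultimately show ?thesis by (simp add: sum_negf)
  qed
  let ?I = "interpolate Th Fh xT xF u"
  define v where "v = uh - ?I"
  \<comment> \<open>A boundary point of \<open>\<Omega>\<close> is in the closure of some cell but
    in no cell, so it lies on the frontier of that cell.\<close>
  have frO: "frontier \<Omega> \<subseteq> (\<Union>F\<in>Fh. closure F)"
  proof
    fix x assume x: "x \<in> frontier \<Omega>"
    then have "x \<in> closure \<Omega>" "x \<notin> \<Omega>" using \<Omega>(1) by (auto simp: frontier_def interior_open)
    then obtain T' where T': "T' \<in> Th" "x \<in> closure T'" "x \<notin> T'" using cl Tsub by blast
    then have "x \<in> frontier T'" using T(1)[OF T'(1)] by (simp add: frontier_def interior_open)
    then have "x \<in> (\<Union>F\<in>faces_of Fh T'. closure F)" using bspec[OF fr T'(1)] by simp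
    then show "x \<in> (\<Union>F\<in>Fh. closure F)" unfolding faces_of_def by blast
  qed
  have H10u: "H10 \<Omega> u" using A(16) by (simp add: weak_solution_def)
  have u0: "u (xF F) = 0" if "F \<in> boundary_faces \<Omega> Fh" for F
    using that A(11)
    by (intro H10_boundary_value[OF \<Omega>(1) \<Omega>p(2) \<Omega>(2) H10u A(17) fin(1) fl frO, of F]) (auto simp: boundary_faces_def)
  have IX: "?I \<in> Xh \<Omega> Th Fh"
    using u0 by (auto simp: Xh_def interpolate_def boundary_faces_def)
  have uX: "uh \<in> Xh \<Omega> Th Fh" using A(19) by (simp add: fv_solution_def)
  \<comment> \<open>Linearity of the fluxes is stated for \<open>lincomb\<close>, which is matched
    here with the subtraction of pairs of functions.\<close>
  have lin: "lincomb 1 uh (-1) ?I = v"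
    by (simp add: lincomb_def v_def prod_eq_iff fun_eq_iff)
  have vX: "v \<in> Xh \<Omega> Th Fh"
    using IX uX by (auto simp: v_def Xh_def split_beta)
  have vflux: "flux T F v = flux T F uh - flux T F ?I" if "T \<in> Th" "F \<in> faces_of Fh T" for T F
  proof -
    have "flux T F (lincomb 1 uh (-1) ?I) = 1 * flux T F uh + (-1) * flux T F ?I"
      using A(13) that uX IX unfolding linear_on_dofs_def by blast
    then show ?thesis using lin by simp
  qed
  have bdry: "snd v F = 0" if "F \<in> Fh" "F \<subseteq> frontier \<Omega>" for F
    using vX that by (auto simp: Xh_def boundary_faces_def split_beta)
  have two: "\<exists>T T'. T \<noteq> T' \<and> cells_of Th F = {T, T'}" if "card (cells_of Th F) = 2" for F
    using that unfolding card_2_iff by blast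
  have fv: "\<forall>F\<in>internal_faces \<Omega> Fh. \<forall>T T'. T \<noteq> T' \<and> cells_of Th F = {T, T'} \<longrightarrow> flux T F uh + flux T' F uh = 0"
    and fvb: "\<And>T. T \<in> Th \<Longrightarrow> (\<Sum>F\<in>faces_of Fh T. flux T F uh) = (LINT x|lebesgue_on T. f x)"
    using A(19) by (simp_all add: fv_solution_def)
  have p1: "(\<Sum>T\<in>Th. \<Sum>F\<in>faces_of Fh T. flux T F uh * (fst v T - snd v F)) = (\<Sum>T\<in>Th. fst v T * (LINT x|lebesgue_on T. f x))"
  proof (rule flux_pairing[OF finT(1) fin(1)])
    fix F assume F: "F \<in> Fh"
    show "snd v F * (\<Sum>T\<in>cells_of Th F. flux T F uh) = 0"
    proof (cases "F \<subseteq> \<Omega> \<and> card (cells_of Th F) = 2")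
      case True
      from two[OF conjunct2[OF True]] obtain T1 T2 where T12: "T1 \<noteq> T2" "cells_of Th F = {T1, T2}"
        by (elim exE conjE)
      have "F \<in> internal_faces \<Omega> Fh" using F True by (simp add: internal_faces_def)
      from fv[rule_format, OF this conjI[OF T12]] have "flux T1 F uh + flux T2 F uh = 0" .
      then show ?thesis using T12 by simp
    qed (use card F bdry in auto)
  qed (rule fvb)
  \<comment> \<open>With the minus sign the exact fluxes have the same cell balance as the discrete
    ones, hence the same right-hand side as in \<open>p1\<close>.\<close>
  have p2: "(\<Sum>T\<in>Th. \<Sum>F\<in>faces_of Fh T. - ?E T F * (fst v T - snd v F)) = (\<Sum>T\<in>Th. fst v T * (LINT x|lebesgue_on T. f x))"
  proof (rule flux_pairing[OF finT(1) fin(1)])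
    fix F assume F: "F \<in> Fh"
    show "snd v F * (\<Sum>T\<in>cells_of Th F. - ?E T F) = 0"
    proof (cases "F \<subseteq> \<Omega> \<and> card (cells_of Th F) = 2")
      case True
      from two[OF conjunct2[OF True]] obtain T1 T2 where T12: "T1 \<noteq> T2" "cells_of Th F = {T1, T2}"
        by (elim exE conjE)
      then have "T1 \<in> cells_of Th F" "T2 \<in> cells_of Th F" by simp_all
      then have in12: "T1 \<in> Th" "T2 \<in> Th" "F \<in> faces_of Fh T1" "F \<in> faces_of Fh T2"
        using F by (simp_all add: cells_of_def faces_of_def)
      have "?E T1 F + ?E T2 F = 0"
        unfolding E[OF in12(1,3)] E[OF in12(2,4)]
        by (rule flux_conservation[OF finT(1) cell div \<Omega>(1) sum0 F _ T12(2,1)]) (use True in auto)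
      then have "- ?E T1 F + - ?E T2 F = 0" by linarith
      then have "(\<Sum>T\<in>cells_of Th F. - ?E T F) = 0" unfolding T12(2) using T12(1) by simp
      then show ?thesis by simp
    qed (use card F bdry in auto)
  qed (rule Ebal)
  have Nv: "dofs_norm Th Fh K xT v = sqrt (\<Sum>T\<in>Th. min_eigenvalue (?A T) *
      (\<Sum>F\<in>faces_of Fh T. area F * orth_dist (xT T) F * ((fst v T - snd v F) / orth_dist (xT T) F)\<^sup>2))"
  proof -
    have "(local_seminorm Fh xT T v)\<^sup>2 = (\<Sum>F\<in>faces_of Fh T. area F * orth_dist (xT T) F * ((fst v T - snd v F) / orth_dist (xT T) F)\<^sup>2)" if "T \<in> Th" for T
      unfolding local_seminorm_def
    proof (rule real_sqrt_pow2, intro sum_nonneg mult_nonneg_nonneg)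
      show "0 \<le> area F" for F by (simp add: area_def)
      show "0 \<le> orth_dist (xT T) F" for F by (simp add: orth_dist_def infdist_nonneg)
    qed auto
    then show ?thesis by (simp add: dofs_norm_def)
  qed
  \<comment> \<open>Linearity writes the fluxes of \<open>v\<close> as those of \<open>uh\<close>
    minus those of the interpolate; \<open>p1\<close> and \<open>p2\<close> then exchange the fluxes
    of \<open>uh\<close> for the exact ones.\<close>
  have coer: "\<gamma> * (dofs_norm Th Fh K xT v)\<^sup>2 \<le> (\<Sum>T\<in>Th. \<Sum>F\<in>faces_of Fh T. - (?E T F + flux T F ?I) * (fst v T - snd v F))"
  proof -
    have "\<gamma> * (dofs_norm Th Fh K xT v)\<^sup>2 \<le> (\<Sum>T\<in>Th. \<Sum>F\<in>faces_of Fh T. flux T F v * (fst v T - snd v F))"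
      using A(15) vX by (simp add: coercive_fluxes_def)
    also have "\<dots> = (\<Sum>T\<in>Th. \<Sum>F\<in>faces_of Fh T. flux T F uh * (fst v T - snd v F)) - (\<Sum>T\<in>Th. \<Sum>F\<in>faces_of Fh T. flux T F ?I * (fst v T - snd v F))"
      using vflux by (simp add: left_diff_distrib sum_subtractf)
    also have "\<dots> = (\<Sum>T\<in>Th. \<Sum>F\<in>faces_of Fh T. - ?E T F * (fst v T - snd v F)) - (\<Sum>T\<in>Th. \<Sum>F\<in>faces_of Fh T. flux T F ?I * (fst v T - snd v F))"
      by (simp only: p1 p2)
    also have "\<dots> = (\<Sum>T\<in>Th. \<Sum>F\<in>faces_of Fh T. - (?E T F + flux T F ?I) * (fst v T - snd v F))"
      unfolding sum_subtractf[symmetric] by (intro sum.cong refl) (simp add: algebra_simps)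
    finally show ?thesis .
  qed
  show ?thesis
    unfolding v_def[symmetric]
  proof (rule coercive_error_bound[OF finT(1) _ A(14) lam _ Nv coer])
    show "finite (faces_of Fh T)" for T using fin(1) by (simp add: faces_of_def)
    fix T F assume TF: "T \<in> Th" "F \<in> faces_of Fh T"
    then have F: "F \<in> Fh" "F \<subseteq> frontier T" by (auto simp: faces_of_def)
    have "bounded F" by (rule bounded_subset[OF bounded_closure[OF T(2)[OF TF(1)]]]) (use F(2) in \<open>auto simp: frontier_def\<close>)
    then have "area F > 0"
      using area_pos[OF fl[OF F(1)] face_like_nrm(1)[OF fl[OF F(1)]]] face_like_nrm(2)[OF fl[OF F(1)]] by (simp add: hpl_def)
    then show "0 < area F \<and> 0 < orth_dist (xT T) F" using A(12) TF by blast
  qed auto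
qed

end
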